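(* Let $\mathrm{H} := \text{E-HA}^{\omega*}_{\mathrm{st}\lor} + \mathsf{OS}^*_\lor + \mathsf{US}^*_\lor + \mathsf{NU} + \mathsf{AC}^{\mathrm{st}} + \mathsf{IP}_{\forall \, \lor}^{\mathrm{st}}$, and let $\Phi$ be a formula in the language of $\text{E-HA}^{\omega*}_{\mathrm{st}\lor}$. (a) $\mathrm{H} \vdash \Phi \leftrightarrow \Phi^U$. (b) If for all formulae $\Psi$ of that language, with $\Psi^U = \exists^{\mathrm{st}} \underline{x} \, \forall^{\mathrm{st}} \underline{y} \, \psi(\underline{x}, \underline{y})$, $\mathrm{H} + \Phi \vdash \Psi$ implies that there exist closed terms $\underline{t}$ such that $\text{E-HA}^{\omega*}_\lor \vdash \forall \underline{y} \, \psi(\underline{t},\underline{y})$, then $\mathrm{H} \vdash \Phi$.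
   Context: $\text{E-HA}^{\omega*}$ is extensional Heyting arithmetic in all finite types over the types generated by $0$, $\sigma\to\tau$ and $\sigma^*$ (finite sequences), with constants for the empty sequence, prepending, a list recursor, and the axiom that every sequence is empty or a prepend; $a\in s :\equiv \exists i<|s|\,(a=s_i)$. $\text{E-HA}^{\omega*}_{\mathrm{st}}$ adds predicates $\mathrm{st}_\sigma$ and external quantifiers $\forall^{\mathrm{st}}x\,\Phi :\leftrightarrow \forall x(\mathrm{st}(x)\to\Phi)$, $\exists^{\mathrm{st}}x\,\Phi :\leftrightarrow \exists x(\mathrm{st}(x)\land\Phi)$; internal formulae (lowercase Greek) are those not containing $\mathrm{st}$. Axioms: those of $\text{E-HA}^{\omega*}$, $\mathrm{st}(x)\land x=y\to\mathrm{st}(y)$, $\mathrm{st}(a)$ for closed terms $a$, $\mathrm{st}(f)\land\mathrm{st}(x)\to\mathrm{st}(fx)$, and external induction for all formulae. $\text{E-HA}^{\omega*}_\lor$, $\text{E-HA}^{\omega*}_{\mathrm{st}\lor}$: the same with internal induction restricted to internal $\lor$-free formulae. $\mathrm{hyper}(s):=\forall^{\mathrm{st}}x\,(x\in s)$. Principles (all types; $\varphi$ internal $\lor$-free; $\Phi,\Psi$ arbitrary): $\mathsf{OS}^*_\lor$: $\forall^{\mathrm{st}}s:\sigma^*\,\varphi(s)\to\exists s(\mathrm{hyper}(s)\land\varphi(s))$; $\mathsf{US}^*_\lor$: $\forall s(\mathrm{hyper}(s)\to\varphi(s))\to\exists^{\mathrm{st}}s\,\varphi(s)$; $\mathsf{NU}$: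 $\forall y\,\exists^{\mathrm{st}}x\,\Phi(x,y)\to\exists^{\mathrm{st}}x\,\forall y\,\Phi(x,y)$; $\mathsf{AC}^{\mathrm{st}}$: $\forall^{\mathrm{st}}x\,\exists^{\mathrm{st}}y\,\Phi(x,y)\to\exists^{\mathrm{st}}f\,\forall^{\mathrm{st}}x\,\Phi(x,fx)$; $\mathsf{IP}^{\mathrm{st}}_{\forall\lor}$: $(\forall^{\mathrm{st}}x\,\varphi(x)\to\exists^{\mathrm{st}}y\,\Psi(y))\to\exists^{\mathrm{st}}y(\forall^{\mathrm{st}}x\,\varphi(x)\to\Psi(y))$. The translation $\Phi^U=\exists^{\mathrm{st}}\underline{x}\,\forall^{\mathrm{st}}\underline{y}\,\varphi_U$ ($\varphi_U$ internal $\lor$-free) is defined by: $\varphi^U:=\varphi$ for internal atomic $\varphi$; $\mathrm{st}(x)^U:=\exists^{\mathrm{st}}y(y=x)$; with $\Phi^U=\exists^{\mathrm{st}}\underline{x}\forall^{\mathrm{st}}\underline{y}\,\varphi_U(\underline{x},\underline{y},\underline{a})$, $\Psi^U=\exists^{\mathrm{st}}\underline{u}\forall^{\mathrm{st}}\underline{v}\,\psi_U(\underline{u},\underline{v},\underline{b})$: $(\Phi\land\Psi)^U:=\exists^{\mathrm{st}}\underline{x},\underline{u}\forall^{\mathrm{st}}\underline{y},\underline{v}(\varphi_U\land\psi_U)$; $(\Phi\lor\Psi)^U:=\exists^{\mathrm{st}}z{:}0,\underline{x},\underline{u}\forall^{\mathrm{st}}\underline{y},\underline{v}((z=0\to\varphi_U)\land(\neg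 z=0\to\psi_U))$; $(\Phi\to\Psi)^U:=\exists^{\mathrm{st}}\underline{U},\underline{Y}\forall^{\mathrm{st}}\underline{x},\underline{v}(\forall\underline{y}\in\underline{Y}\underline{x}\underline{v}\,\varphi_U(\underline{x},\underline{y},\underline{a})\to\psi_U(\underline{U}\underline{x},\underline{v},\underline{b}))$; $(\exists z\Phi)^U:=\exists^{\mathrm{st}}\underline{x}\forall^{\mathrm{st}}\underline{y}\,\exists z\,\forall\underline{y}'\in\underline{y}\,\varphi_U(\underline{x},\underline{y}',z,\underline{a})$; $(\forall z\Phi)^U:=\exists^{\mathrm{st}}\underline{x}\forall^{\mathrm{st}}\underline{y}\forall z\,\varphi_U$; $(\exists^{\mathrm{st}}z\Phi)^U:=\exists^{\mathrm{st}}z,\underline{x}\forall^{\mathrm{st}}\underline{y}\,\varphi_U$; $(\forall^{\mathrm{st}}z\Phi)^U:=\exists^{\mathrm{st}}\underline{X}\forall^{\mathrm{st}}\underline{y},z\,\varphi_U(\underline{X}z,\underline{y},z,\underline{a})$.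
   Formalization: The axiom "every sequence is empty or a prepend" is taken as ∃z((z=0→A)∧(¬z=0→B)) instead of with primitive ∨; with primitive ∨, NU would give one z for all sequences and make H inconsistent. *)

theory Defs
  imports Main
begin

datatype ty = N | Fun ty ty (infixr "\<rightarrow>" 60) | Seq ty

text \<open>The recursion constants satisfy
  \<open>R 0 y z = y\<close>, \<open>R (S x) y z = z (R x y z) x\<close>,
  \<open>L \<langle>\<rangle> y z = y\<close>, \<open>L (C a x) y z = z (L x y z) a\<close>.\<close>

datatype con =
    Zero | Succ
  | K ty ty | S ty ty ty
  | R ty
  | Emp ty | Prep ty
  | L ty ty

primrec con_ty :: "con \<Rightarrow> ty" where
  "con_ty Zero = N"
| "con_ty Succ = N \<rightarrow> N"
| "con_ty (K \<sigma> \<tau>) = \<sigma> \<rightarrow> \<tau> \<rightarrow> \<sigma>"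
| "con_ty (S \<rho> \<sigma> \<tau>) = (\<rho> \<rightarrow> \<sigma> \<rightarrow> \<tau>) \<rightarrow> (\<rho> \<rightarrow> \<sigma>) \<rightarrow> \<rho> \<rightarrow> \<tau>"
| "con_ty (R \<sigma>) = N \<rightarrow> \<sigma> \<rightarrow> (\<sigma> \<rightarrow> N \<rightarrow> \<sigma>) \<rightarrow> \<sigma>"
| "con_ty (Emp \<sigma>) = Seq \<sigma>"
| "con_ty (Prep \<sigma>) = \<sigma> \<rightarrow> Seq \<sigma> \<rightarrow> Seq \<sigma>"
| "con_ty (L \<sigma> \<rho>) = Seq \<sigma> \<rightarrow> \<rho> \<rightarrow> (\<rho> \<rightarrow> \<sigma> \<rightarrow> \<rho>) \<rightarrow> \<rho>"

text \<open>Variables are de Bruijn indices; a context is the list of the types of the variables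
  \<open>0, 1, 2, \<dots>\<close>.\<close>

datatype tm = Var nat | Con con | App tm tm (infixl "\<cdot>" 75)

fun ty_of :: "ty list \<Rightarrow> tm \<Rightarrow> ty option" where
  "ty_of \<Gamma> (Var i) = (if i < length \<Gamma> then Some (\<Gamma> ! i) else None)"
| "ty_of \<Gamma> (Con c) = Some (con_ty c)"
| "ty_of \<Gamma> (t \<cdot> u) =
     (case ty_of \<Gamma> t of
        Some (\<sigma> \<rightarrow> \<tau>) \<Rightarrow> if ty_of \<Gamma> u = Some \<sigma> then Some \<tau> else None
      | _ \<Rightarrow> None)"

abbreviation has_ty :: "ty list \<Rightarrow> tm \<Rightarrow> ty \<Rightarrow> bool" where
  "has_ty \<Gamma> t \<sigma> \<equiv> ty_of \<Gamma> t = Some \<sigma>"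

abbreviation closed_tm :: "tm \<Rightarrow> ty \<Rightarrow> bool" where
  "closed_tm t \<sigma> \<equiv> has_ty [] t \<sigma>"

primrec tsub :: "(nat \<Rightarrow> tm) \<Rightarrow> tm \<Rightarrow> tm" where
  "tsub s (Var i) = s i"
| "tsub s (Con c) = Con c"
| "tsub s (t \<cdot> u) = tsub s t \<cdot> tsub s u"

definition shift :: "nat \<Rightarrow> tm \<Rightarrow> tm" where
  "shift n = tsub (\<lambda>i. Var (i + n))"

definition up :: "(nat \<Rightarrow> tm) \<Rightarrow> nat \<Rightarrow> tm" where
  "up s = case_nat (Var 0) (\<lambda>i. shift 1 (s i))"

text \<open>Bracket abstraction: for \<open>t\<close> in context \<open>\<sigma> # \<Gamma>\<close>, \<open>lam \<Gamma> \<sigma> t\<close> is the term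
  \<open>\<lambda>x:\<sigma>. t\<close> in context \<open>\<Gamma>\<close>, where \<open>x\<close> is variable \<open>0\<close> of \<open>t\<close>.\<close>

fun lam :: "ty list \<Rightarrow> ty \<Rightarrow> tm \<Rightarrow> tm" where
  "lam \<Gamma> \<sigma> (Var 0) = Con (S \<sigma> (\<sigma> \<rightarrow> \<sigma>) \<sigma>) \<cdot> Con (K \<sigma> (\<sigma> \<rightarrow> \<sigma>)) \<cdot> Con (K \<sigma> \<sigma>)"
| "lam \<Gamma> \<sigma> (Var (Suc i)) = Con (K (\<Gamma> ! i) \<sigma>) \<cdot> Var i"
| "lam \<Gamma> \<sigma> (Con c) = Con (K (con_ty c) \<sigma>) \<cdot> Con c"
| "lam \<Gamma> \<sigma> (t \<cdot> u) =
     Con (S \<sigma> (the (ty_of (\<sigma> # \<Gamma>) u)) (the (ty_of (\<sigma> # \<Gamma>) (t \<cdot> u)))) \<cdot> lam \<Gamma> \<sigma> t \<cdot> lam \<Gamma> \<sigma> u"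

abbreviation zero :: tm where "zero \<equiv> Con Zero"

abbreviation suc :: "tm \<Rightarrow> tm" where "suc t \<equiv> Con Succ \<cdot> t"

primrec default_tm :: "ty \<Rightarrow> tm" where
  "default_tm N = zero"
| "default_tm (\<sigma> \<rightarrow> \<tau>) = Con (K \<tau> \<sigma>) \<cdot> default_tm \<tau>"
| "default_tm (Seq \<sigma>) = Con (Emp \<sigma>)"

definition plus_tm :: "tm \<Rightarrow> tm \<Rightarrow> tm" where
  "plus_tm t u = Con (R N) \<cdot> u \<cdot> t \<cdot> lam [] N (lam [N] N (suc (Var 1)))"

definition len :: "ty \<Rightarrow> tm \<Rightarrow> tm" where
  "len \<sigma> s = Con (L \<sigma> N) \<cdot> s \<cdot> zero \<cdot> lam [] N (lam [N] \<sigma> (suc (Var 1)))"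

text \<open>\<open>s\<^sub>i\<close>, defined from \<open>\<langle>\<rangle>\<^sub>i = 0\<^sub>\<sigma>\<close>, \<open>(C a x)\<^sub>0 = a\<close>, \<open>(C a x)\<^sub>i\<^sub>+\<^sub>1 = x\<^sub>i\<close>; the step function is
  \<open>\<lambda>r a i. R i a (\<lambda>_. r)\<close>.\<close>

definition nth_tm :: "ty \<Rightarrow> tm \<Rightarrow> tm \<Rightarrow> tm" where
  "nth_tm \<sigma> s i =
     Con (L \<sigma> (N \<rightarrow> \<sigma>)) \<cdot> s \<cdot> default_tm (N \<rightarrow> \<sigma>) \<cdot>
       lam [] (N \<rightarrow> \<sigma>) (lam [N \<rightarrow> \<sigma>] \<sigma> (lam [\<sigma>, N \<rightarrow> \<sigma>] N
         (Con (R \<sigma>) \<cdot> Var 0 \<cdot> Var 1 \<cdot> (Con (K (N \<rightarrow> \<sigma>) \<sigma>) \<cdot> Var 2)))) \<cdot> i"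

text \<open>Equality is primitive at every type, disjunction is primitive, and the external quantifiers
  are primitive (governed by their defining axioms below), so that the translation has its own
  clauses for them.\<close>

datatype fm =
    Fls
  | Eq ty tm tm
  | St ty tm
  | And fm fm (infixr "\<^bold>\<and>" 35)
  | Or fm fm (infixr "\<^bold>\<or>" 30)
  | Imp fm fm (infixr "\<^bold>\<longrightarrow>" 25)
  | All ty fm
  | Ex ty fm
  | AllSt ty fm
  | ExSt ty fm

abbreviation Neg :: "fm \<Rightarrow> fm" ("\<^bold>\<not> _" [40] 40) where
  "\<^bold>\<not> \<phi> \<equiv> \<phi> \<^bold>\<longrightarrow> Fls"

abbreviation Iff :: "fm \<Rightarrow> fm \<Rightarrow> fm" (infixr "\<^bold>\<longleftrightarrow>" 25) where
  "\<phi> \<^bold>\<longleftrightarrow> \<psi> \<equiv> (\<phi> \<^bold>\<longrightarrow> \<psi>) \<^bold>\<and> (\<psi> \<^bold>\<longrightarrow> \<phi>)"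

primrec wff :: "fm \<Rightarrow> ty list \<Rightarrow> bool" where
  "wff Fls \<Gamma> = True"
| "wff (Eq \<sigma> t u) \<Gamma> = (has_ty \<Gamma> t \<sigma> \<and> has_ty \<Gamma> u \<sigma>)"
| "wff (St \<sigma> t) \<Gamma> = has_ty \<Gamma> t \<sigma>"
| "wff (\<phi> \<^bold>\<and> \<psi>) \<Gamma> = (wff \<phi> \<Gamma> \<and> wff \<psi> \<Gamma>)"
| "wff (\<phi> \<^bold>\<or> \<psi>) \<Gamma> = (wff \<phi> \<Gamma> \<and> wff \<psi> \<Gamma>)"
| "wff (\<phi> \<^bold>\<longrightarrow> \<psi>) \<Gamma> = (wff \<phi> \<Gamma> \<and> wff \<psi> \<Gamma>)"
| "wff (All \<sigma> \<phi>) \<Gamma> = wff \<phi> (\<sigma> # \<Gamma>)"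
| "wff (Ex \<sigma> \<phi>) \<Gamma> = wff \<phi> (\<sigma> # \<Gamma>)"
| "wff (AllSt \<sigma> \<phi>) \<Gamma> = wff \<phi> (\<sigma> # \<Gamma>)"
| "wff (ExSt \<sigma> \<phi>) \<Gamma> = wff \<phi> (\<sigma> # \<Gamma>)"

primrec internal :: "fm \<Rightarrow> bool" where
  "internal Fls = True"
| "internal (Eq \<sigma> t u) = True"
| "internal (St \<sigma> t) = False"
| "internal (\<phi> \<^bold>\<and> \<psi>) = (internal \<phi> \<and> internal \<psi>)"
| "internal (\<phi> \<^bold>\<or> \<psi>) = (internal \<phi> \<and> internal \<psi>)"
| "internal (\<phi> \<^bold>\<longrightarrow> \<psi>) = (internal \<phi> \<and> internal \<psi>)"
| "internal (All \<sigma> \<phi>) = internal \<phi>"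
| "internal (Ex \<sigma> \<phi>) = internal \<phi>"
| "internal (AllSt \<sigma> \<phi>) = False"
| "internal (ExSt \<sigma> \<phi>) = False"

primrec or_free :: "fm \<Rightarrow> bool" where
  "or_free Fls = True"
| "or_free (Eq \<sigma> t u) = True"
| "or_free (St \<sigma> t) = True"
| "or_free (\<phi> \<^bold>\<and> \<psi>) = (or_free \<phi> \<and> or_free \<psi>)"
| "or_free (\<phi> \<^bold>\<or> \<psi>) = False"
| "or_free (\<phi> \<^bold>\<longrightarrow> \<psi>) = (or_free \<phi> \<and> or_free \<psi>)"
| "or_free (All \<sigma> \<phi>) = or_free \<phi>"
| "or_free (Ex \<sigma> \<phi>) = or_free \<phi>"
| "or_free (AllSt \<sigma> \<phi>) = or_free \<phi>"
| "or_free (ExSt \<sigma> \<phi>) = or_free \<phi>"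

primrec fsub :: "fm \<Rightarrow> (nat \<Rightarrow> tm) \<Rightarrow> fm" where
  "fsub Fls s = Fls"
| "fsub (Eq \<sigma> t u) s = Eq \<sigma> (tsub s t) (tsub s u)"
| "fsub (St \<sigma> t) s = St \<sigma> (tsub s t)"
| "fsub (\<phi> \<^bold>\<and> \<psi>) s = (fsub \<phi> s \<^bold>\<and> fsub \<psi> s)"
| "fsub (\<phi> \<^bold>\<or> \<psi>) s = (fsub \<phi> s \<^bold>\<or> fsub \<psi> s)"
| "fsub (\<phi> \<^bold>\<longrightarrow> \<psi>) s = (fsub \<phi> s \<^bold>\<longrightarrow> fsub \<psi> s)"
| "fsub (All \<sigma> \<phi>) s = All \<sigma> (fsub \<phi> (up s))"
| "fsub (Ex \<sigma> \<phi>) s = Ex \<sigma> (fsub \<phi> (up s))"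
| "fsub (AllSt \<sigma> \<phi>) s = AllSt \<sigma> (fsub \<phi> (up s))"
| "fsub (ExSt \<sigma> \<phi>) s = ExSt \<sigma> (fsub \<phi> (up s))"

definition lift :: "fm \<Rightarrow> fm" where
  "lift \<phi> = fsub \<phi> (\<lambda>i. Var (Suc i))"

definition inst :: "tm \<Rightarrow> fm \<Rightarrow> fm" where
  "inst t \<phi> = fsub \<phi> (case_nat t Var)"

text \<open>\<open>\<phi>(S n)\<close> for \<open>\<phi>(n)\<close> with \<open>n\<close> the variable \<open>0\<close>, in the same context.\<close>

definition at_suc :: "fm \<Rightarrow> fm" where
  "at_suc \<phi> = fsub \<phi> (case_nat (suc (Var 0)) (\<lambda>i. Var (Suc i)))"

text \<open>Universal closure; the innermost quantifier binds variable \<open>0\<close>.\<close>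

definition closure :: "ty list \<Rightarrow> fm \<Rightarrow> fm" where
  "closure \<Gamma> \<phi> = fold All \<Gamma> \<phi>"

definition less_fm :: "tm \<Rightarrow> tm \<Rightarrow> fm" where
  "less_fm t u = Ex N (Eq N (plus_tm (shift 1 t) (suc (Var 0))) (shift 1 u))"

definition mem :: "ty \<Rightarrow> tm \<Rightarrow> tm \<Rightarrow> fm" where
  "mem \<sigma> a s =
     Ex N (less_fm (Var 0) (len \<sigma> (shift 1 s)) \<^bold>\<and> Eq \<sigma> (shift 1 a) (nth_tm \<sigma> (shift 1 s) (Var 0)))"

definition hyper :: "ty \<Rightarrow> tm \<Rightarrow> fm" where
  "hyper \<sigma> s = AllSt \<sigma> (mem \<sigma> (Var 0) (shift 1 s))"

text \<open>Intuitionistic natural deduction. \<open>prv \<L> T \<Gamma> \<Delta> \<phi>\<close>: in the language \<open>\<L>\<close> (the set of formulae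
  that may occur in the derivation), \<open>\<phi>\<close> with free variables in \<open>\<Gamma>\<close> follows from the sentences
  in \<open>T\<close> and the hypotheses \<open>\<Delta>\<close>. Variables of \<open>\<Gamma>\<close> are held fixed in \<open>\<Delta>\<close>.\<close>

inductive prv :: "fm set \<Rightarrow> fm set \<Rightarrow> ty list \<Rightarrow> fm set \<Rightarrow> fm \<Rightarrow> bool"
  for \<L> :: "fm set" and T :: "fm set" where
  ax: "\<phi> \<in> T \<Longrightarrow> prv \<L> T \<Gamma> \<Delta> \<phi>"
| hyp: "\<phi> \<in> \<Delta> \<Longrightarrow> prv \<L> T \<Gamma> \<Delta> \<phi>"
| fls_elim: "prv \<L> T \<Gamma> \<Delta> Fls \<Longrightarrow> wff \<phi> \<Gamma> \<Longrightarrow> \<phi> \<in> \<L> \<Longrightarrow> prv \<L> T \<Gamma> \<Delta> \<phi>"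
| and_intro: "prv \<L> T \<Gamma> \<Delta> \<phi> \<Longrightarrow> prv \<L> T \<Gamma> \<Delta> \<psi> \<Longrightarrow> prv \<L> T \<Gamma> \<Delta> (\<phi> \<^bold>\<and> \<psi>)"
| and_elim1: "prv \<L> T \<Gamma> \<Delta> (\<phi> \<^bold>\<and> \<psi>) \<Longrightarrow> prv \<L> T \<Gamma> \<Delta> \<phi>"
| and_elim2: "prv \<L> T \<Gamma> \<Delta> (\<phi> \<^bold>\<and> \<psi>) \<Longrightarrow> prv \<L> T \<Gamma> \<Delta> \<psi>"
| or_intro1: "prv \<L> T \<Gamma> \<Delta> \<phi> \<Longrightarrow> wff \<psi> \<Gamma> \<Longrightarrow> \<psi> \<in> \<L> \<Longrightarrow> prv \<L> T \<Gamma> \<Delta> (\<phi> \<^bold>\<or> \<psi>)"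
| or_intro2: "prv \<L> T \<Gamma> \<Delta> \<psi> \<Longrightarrow> wff \<phi> \<Gamma> \<Longrightarrow> \<phi> \<in> \<L> \<Longrightarrow> prv \<L> T \<Gamma> \<Delta> (\<phi> \<^bold>\<or> \<psi>)"
| or_elim: "prv \<L> T \<Gamma> \<Delta> (\<phi> \<^bold>\<or> \<psi>) \<Longrightarrow> prv \<L> T \<Gamma> (insert \<phi> \<Delta>) \<chi> \<Longrightarrow> prv \<L> T \<Gamma> (insert \<psi> \<Delta>) \<chi>
    \<Longrightarrow> prv \<L> T \<Gamma> \<Delta> \<chi>"
| imp_intro: "prv \<L> T \<Gamma> (insert \<phi> \<Delta>) \<psi> \<Longrightarrow> wff \<phi> \<Gamma> \<Longrightarrow> \<phi> \<in> \<L> \<Longrightarrow> prv \<L> T \<Gamma> \<Delta> (\<phi> \<^bold>\<longrightarrow> \<psi>)"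
| imp_elim: "prv \<L> T \<Gamma> \<Delta> (\<phi> \<^bold>\<longrightarrow> \<psi>) \<Longrightarrow> prv \<L> T \<Gamma> \<Delta> \<phi> \<Longrightarrow> prv \<L> T \<Gamma> \<Delta> \<psi>"
| all_intro: "prv \<L> T (\<sigma> # \<Gamma>) (lift ` \<Delta>) \<phi> \<Longrightarrow> prv \<L> T \<Gamma> \<Delta> (All \<sigma> \<phi>)"
| all_elim: "prv \<L> T \<Gamma> \<Delta> (All \<sigma> \<phi>) \<Longrightarrow> has_ty \<Gamma> t \<sigma> \<Longrightarrow> prv \<L> T \<Gamma> \<Delta> (inst t \<phi>)"
| ex_intro: "prv \<L> T \<Gamma> \<Delta> (inst t \<phi>) \<Longrightarrow> has_ty \<Gamma> t \<sigma> \<Longrightarrow> wff \<phi> (\<sigma> # \<Gamma>) \<Longrightarrow> \<phi> \<in> \<L>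
    \<Longrightarrow> prv \<L> T \<Gamma> \<Delta> (Ex \<sigma> \<phi>)"
| ex_elim: "prv \<L> T \<Gamma> \<Delta> (Ex \<sigma> \<phi>) \<Longrightarrow> prv \<L> T (\<sigma> # \<Gamma>) (insert \<phi> (lift ` \<Delta>)) (lift \<chi>)
    \<Longrightarrow> prv \<L> T \<Gamma> \<Delta> \<chi>"

text \<open>\<open>eha_ax \<Gamma> \<phi>\<close>: \<open>\<phi>\<close>, with free variables in \<open>\<Gamma>\<close>, is an axiom of the system with induction
  restricted to internal disjunction-free formulae.

  In \<open>seq_cases\<close> the statement that a sequence is empty or a prepend is expressed by the usual
  arithmetical rendering \<open>\<exists>z ((z = 0 \<rightarrow> A) \<and> (\<not> z = 0 \<rightarrow> B))\<close> of a disjunction of internal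
  formulae, which is equivalent to \<open>A \<or> B\<close> given full induction. In the restricted systems
  primitive disjunction is stronger: by NU, \<open>\<forall>s (A(s) \<or> B(s))\<close> entails
  \<open>\<forall>s A(s) \<or> \<forall>s B(s)\<close>, so the axiom with primitive disjunction would be contradictory there.\<close>

inductive eha_ax :: "ty list \<Rightarrow> fm \<Rightarrow> bool" where
  eq_refl: "has_ty \<Gamma> t \<sigma> \<Longrightarrow> eha_ax \<Gamma> (Eq \<sigma> t t)"
| eq_sym: "has_ty \<Gamma> t \<sigma> \<Longrightarrow> has_ty \<Gamma> u \<sigma> \<Longrightarrow> eha_ax \<Gamma> (Eq \<sigma> t u \<^bold>\<longrightarrow> Eq \<sigma> u t)"
| eq_trans: "has_ty \<Gamma> t \<sigma> \<Longrightarrow> has_ty \<Gamma> u \<sigma> \<Longrightarrow> has_ty \<Gamma> v \<sigma>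
    \<Longrightarrow> eha_ax \<Gamma> (Eq \<sigma> t u \<^bold>\<and> Eq \<sigma> u v \<^bold>\<longrightarrow> Eq \<sigma> t v)"
| eq_app: "has_ty \<Gamma> f (\<sigma> \<rightarrow> \<tau>) \<Longrightarrow> has_ty \<Gamma> g (\<sigma> \<rightarrow> \<tau>) \<Longrightarrow> has_ty \<Gamma> t \<sigma> \<Longrightarrow> has_ty \<Gamma> u \<sigma>
    \<Longrightarrow> eha_ax \<Gamma> (Eq (\<sigma> \<rightarrow> \<tau>) f g \<^bold>\<and> Eq \<sigma> t u \<^bold>\<longrightarrow> Eq \<tau> (f \<cdot> t) (g \<cdot> u))"
| extensionality: "has_ty \<Gamma> f (\<sigma> \<rightarrow> \<tau>) \<Longrightarrow> has_ty \<Gamma> g (\<sigma> \<rightarrow> \<tau>)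
    \<Longrightarrow> eha_ax \<Gamma> (All \<sigma> (Eq \<tau> (shift 1 f \<cdot> Var 0) (shift 1 g \<cdot> Var 0)) \<^bold>\<longrightarrow> Eq (\<sigma> \<rightarrow> \<tau>) f g)"
| suc_not_zero: "has_ty \<Gamma> t N \<Longrightarrow> eha_ax \<Gamma> (\<^bold>\<not> Eq N (suc t) zero)"
| suc_inj: "has_ty \<Gamma> t N \<Longrightarrow> has_ty \<Gamma> u N \<Longrightarrow> eha_ax \<Gamma> (Eq N (suc t) (suc u) \<^bold>\<longrightarrow> Eq N t u)"
| induction: "wff \<phi> (N # \<Gamma>) \<Longrightarrow> internal \<phi> \<Longrightarrow> or_free \<phi>
    \<Longrightarrow> eha_ax \<Gamma> (inst zero \<phi> \<^bold>\<and> All N (\<phi> \<^bold>\<longrightarrow> at_suc \<phi>) \<^bold>\<longrightarrow> All N \<phi>)"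
| K: "has_ty \<Gamma> t \<sigma> \<Longrightarrow> has_ty \<Gamma> u \<tau> \<Longrightarrow> eha_ax \<Gamma> (Eq \<sigma> (Con (K \<sigma> \<tau>) \<cdot> t \<cdot> u) t)"
| S: "has_ty \<Gamma> t (\<rho> \<rightarrow> \<sigma> \<rightarrow> \<tau>) \<Longrightarrow> has_ty \<Gamma> u (\<rho> \<rightarrow> \<sigma>) \<Longrightarrow> has_ty \<Gamma> v \<rho>
    \<Longrightarrow> eha_ax \<Gamma> (Eq \<tau> (Con (S \<rho> \<sigma> \<tau>) \<cdot> t \<cdot> u \<cdot> v) (t \<cdot> v \<cdot> (u \<cdot> v)))"
| R_zero: "has_ty \<Gamma> u \<sigma> \<Longrightarrow> has_ty \<Gamma> v (\<sigma> \<rightarrow> N \<rightarrow> \<sigma>)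
    \<Longrightarrow> eha_ax \<Gamma> (Eq \<sigma> (Con (R \<sigma>) \<cdot> zero \<cdot> u \<cdot> v) u)"
| R_suc: "has_ty \<Gamma> t N \<Longrightarrow> has_ty \<Gamma> u \<sigma> \<Longrightarrow> has_ty \<Gamma> v (\<sigma> \<rightarrow> N \<rightarrow> \<sigma>)
    \<Longrightarrow> eha_ax \<Gamma> (Eq \<sigma> (Con (R \<sigma>) \<cdot> suc t \<cdot> u \<cdot> v) (v \<cdot> (Con (R \<sigma>) \<cdot> t \<cdot> u \<cdot> v) \<cdot> t))"
| L_nil: "has_ty \<Gamma> u \<rho> \<Longrightarrow> has_ty \<Gamma> v (\<rho> \<rightarrow> \<sigma> \<rightarrow> \<rho>)
    \<Longrightarrow> eha_ax \<Gamma> (Eq \<rho> (Con (L \<sigma> \<rho>) \<cdot> Con (Emp \<sigma>) \<cdot> u \<cdot> v) u)"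
| L_cons: "has_ty \<Gamma> a \<sigma> \<Longrightarrow> has_ty \<Gamma> t (Seq \<sigma>) \<Longrightarrow> has_ty \<Gamma> u \<rho> \<Longrightarrow> has_ty \<Gamma> v (\<rho> \<rightarrow> \<sigma> \<rightarrow> \<rho>)
    \<Longrightarrow> eha_ax \<Gamma> (Eq \<rho> (Con (L \<sigma> \<rho>) \<cdot> (Con (Prep \<sigma>) \<cdot> a \<cdot> t) \<cdot> u \<cdot> v)
                     (v \<cdot> (Con (L \<sigma> \<rho>) \<cdot> t \<cdot> u \<cdot> v) \<cdot> a))"
| seq_cases: "has_ty \<Gamma> s (Seq \<sigma>)
    \<Longrightarrow> eha_ax \<Gamma> (Ex N (
          (Eq N (Var 0) zero \<^bold>\<longrightarrow> Eq (Seq \<sigma>) (shift 1 s) (Con (Emp \<sigma>))) \<^bold>\<and>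
          ((\<^bold>\<not> Eq N (Var 0) zero) \<^bold>\<longrightarrow>
            Ex \<sigma> (Ex (Seq \<sigma>) (Eq (Seq \<sigma>) (shift 3 s) (Con (Prep \<sigma>) \<cdot> Var 1 \<cdot> Var 0))))))"

inductive st_ax :: "ty list \<Rightarrow> fm \<Rightarrow> bool" where
  all_st: "wff \<phi> (\<sigma> # \<Gamma>) \<Longrightarrow> st_ax \<Gamma> (AllSt \<sigma> \<phi> \<^bold>\<longleftrightarrow> All \<sigma> (St \<sigma> (Var 0) \<^bold>\<longrightarrow> \<phi>))"
| ex_st: "wff \<phi> (\<sigma> # \<Gamma>) \<Longrightarrow> st_ax \<Gamma> (ExSt \<sigma> \<phi> \<^bold>\<longleftrightarrow> Ex \<sigma> (St \<sigma> (Var 0) \<^bold>\<and> \<phi>))"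
| st_eq: "has_ty \<Gamma> t \<sigma> \<Longrightarrow> has_ty \<Gamma> u \<sigma> \<Longrightarrow> st_ax \<Gamma> (St \<sigma> t \<^bold>\<and> Eq \<sigma> t u \<^bold>\<longrightarrow> St \<sigma> u)"
| st_closed: "closed_tm t \<sigma> \<Longrightarrow> st_ax \<Gamma> (St \<sigma> t)"
| st_app: "has_ty \<Gamma> f (\<sigma> \<rightarrow> \<tau>) \<Longrightarrow> has_ty \<Gamma> t \<sigma>
    \<Longrightarrow> st_ax \<Gamma> (St (\<sigma> \<rightarrow> \<tau>) f \<^bold>\<and> St \<sigma> t \<^bold>\<longrightarrow> St \<tau> (f \<cdot> t))"
| external_induction: "wff \<phi> (N # \<Gamma>)
    \<Longrightarrow> st_ax \<Gamma> (inst zero \<phi> \<^bold>\<and> AllSt N (\<phi> \<^bold>\<longrightarrow> at_suc \<phi>) \<^bold>\<longrightarrow> AllSt N \<phi>)"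

text \<open>In each scheme the formulae may contain further free variables (parameters) from \<open>\<Gamma>\<close>. In \<open>NU\<close> the
  variables \<open>x, y\<close> of \<open>\<Phi>\<close> are \<open>0, 1\<close>; in \<open>AC\<close> the variables \<open>y, x\<close> of \<open>\<Phi>\<close> are \<open>0, 1\<close>, and
  after the substitution \<open>x, f\<close> are \<open>0, 1\<close>.\<close>

inductive OS :: "ty list \<Rightarrow> fm \<Rightarrow> bool" where
  "wff \<phi> (Seq \<sigma> # \<Gamma>) \<Longrightarrow> internal \<phi> \<Longrightarrow> or_free \<phi>
    \<Longrightarrow> OS \<Gamma> (AllSt (Seq \<sigma>) \<phi> \<^bold>\<longrightarrow> Ex (Seq \<sigma>) (hyper \<sigma> (Var 0) \<^bold>\<and> \<phi>))"

inductive US :: "ty list \<Rightarrow> fm \<Rightarrow> bool" where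
  "wff \<phi> (Seq \<sigma> # \<Gamma>) \<Longrightarrow> internal \<phi> \<Longrightarrow> or_free \<phi>
    \<Longrightarrow> US \<Gamma> (All (Seq \<sigma>) (hyper \<sigma> (Var 0) \<^bold>\<longrightarrow> \<phi>) \<^bold>\<longrightarrow> ExSt (Seq \<sigma>) \<phi>)"

inductive NU :: "ty list \<Rightarrow> fm \<Rightarrow> bool" where
  "wff \<Phi> (\<sigma> # \<tau> # \<Gamma>)
    \<Longrightarrow> NU \<Gamma> (All \<tau> (ExSt \<sigma> \<Phi>) \<^bold>\<longrightarrow>
              ExSt \<sigma> (All \<tau> (fsub \<Phi> (Var(0 := Var 1, 1 := Var 0)))))"

inductive AC :: "ty list \<Rightarrow> fm \<Rightarrow> bool" where
  "wff \<Phi> (\<tau> # \<sigma> # \<Gamma>)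
    \<Longrightarrow> AC \<Gamma> (AllSt \<sigma> (ExSt \<tau> \<Phi>) \<^bold>\<longrightarrow>
              ExSt (\<sigma> \<rightarrow> \<tau>) (AllSt \<sigma> (fsub \<Phi> (Var(0 := Var 1 \<cdot> Var 0, 1 := Var 0)))))"

inductive IP :: "ty list \<Rightarrow> fm \<Rightarrow> bool" where
  "wff \<phi> (\<sigma> # \<Gamma>) \<Longrightarrow> internal \<phi> \<Longrightarrow> or_free \<phi> \<Longrightarrow> wff \<Psi> (\<tau> # \<Gamma>)
    \<Longrightarrow> IP \<Gamma> ((AllSt \<sigma> \<phi> \<^bold>\<longrightarrow> ExSt \<tau> \<Psi>) \<^bold>\<longrightarrow> ExSt \<tau> (lift (AllSt \<sigma> \<phi>) \<^bold>\<longrightarrow> \<Psi>))"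

definition closures :: "(ty list \<Rightarrow> fm \<Rightarrow> bool) \<Rightarrow> fm set" where
  "closures A = {closure \<Gamma> \<phi> | \<Gamma> \<phi>. A \<Gamma> \<phi>}"

definition EHA_or :: "fm set" where
  "EHA_or = closures eha_ax"

definition EHA_st_or :: "fm set" where
  "EHA_st_or = EHA_or \<union> closures st_ax"

definition H :: "fm set" where
  "H = EHA_st_or \<union> closures OS \<union> closures US \<union> closures NU \<union> closures AC \<union> closures IP"

definition prv_int :: "fm set \<Rightarrow> ty list \<Rightarrow> fm \<Rightarrow> bool" where
  "prv_int T \<Gamma> \<phi> \<longleftrightarrow> prv (Collect internal) T \<Gamma> {} \<phi>"

definition prv_st :: "fm set \<Rightarrow> ty list \<Rightarrow> fm \<Rightarrow> bool" where
  "prv_st T \<Gamma> \<phi> \<longleftrightarrow> prv UNIV T \<Gamma> {} \<phi>"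

abbreviation funs :: "ty list \<Rightarrow> ty \<Rightarrow> ty" where
  "funs \<sigma>s \<tau> \<equiv> foldr Fun \<sigma>s \<tau>"

abbreviation apps :: "tm \<Rightarrow> tm list \<Rightarrow> tm" where
  "apps t us \<equiv> foldl App t us"

text \<open>\<open>Ux \<Phi>\<close> and \<open>Uy \<Phi>\<close> are the types of the tuples \<open>x\<close> and \<open>y\<close> in
  \<open>\<Phi>\<^sup>U = \<exists>\<^sup>s\<^sup>t x \<forall>\<^sup>s\<^sup>t y \<phi>\<^sub>U\<close>.\<close>

fun Ux :: "fm \<Rightarrow> ty list" and Uy :: "fm \<Rightarrow> ty list" where
  "Ux Fls = []"
| "Ux (Eq \<sigma> t u) = []"
| "Ux (St \<sigma> t) = [\<sigma>]"
| "Ux (\<Phi> \<^bold>\<and> \<Psi>) = Ux \<Phi> @ Ux \<Psi>"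
| "Ux (\<Phi> \<^bold>\<or> \<Psi>) = N # Ux \<Phi> @ Ux \<Psi>"
| "Ux (\<Phi> \<^bold>\<longrightarrow> \<Psi>) =
     map (funs (Ux \<Phi>)) (Ux \<Psi>) @ map (\<lambda>\<sigma>. funs (Ux \<Phi> @ Uy \<Psi>) (Seq \<sigma>)) (Uy \<Phi>)"
| "Ux (Ex \<sigma> \<Phi>) = Ux \<Phi>"
| "Ux (All \<sigma> \<Phi>) = Ux \<Phi>"
| "Ux (ExSt \<sigma> \<Phi>) = \<sigma> # Ux \<Phi>"
| "Ux (AllSt \<sigma> \<Phi>) = map (Fun \<sigma>) (Ux \<Phi>)"
| "Uy Fls = []"
| "Uy (Eq \<sigma> t u) = []"
| "Uy (St \<sigma> t) = []"
| "Uy (\<Phi> \<^bold>\<and> \<Psi>) = Uy \<Phi> @ Uy \<Psi>"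
| "Uy (\<Phi> \<^bold>\<or> \<Psi>) = Uy \<Phi> @ Uy \<Psi>"
| "Uy (\<Phi> \<^bold>\<longrightarrow> \<Psi>) = Ux \<Phi> @ Uy \<Psi>"
| "Uy (Ex \<sigma> \<Phi>) = map Seq (Uy \<Phi>)"
| "Uy (All \<sigma> \<Phi>) = Uy \<Phi>"
| "Uy (ExSt \<sigma> \<Phi>) = Uy \<Phi>"
| "Uy (AllSt \<sigma> \<Phi>) = Uy \<Phi> @ [\<sigma>]"

text \<open>\<open>vars n\<close> is the tuple bound by a block of \<open>n\<close> quantifiers, outermost first.\<close>

definition vars :: "nat \<Rightarrow> tm list" where
  "vars n = rev (map Var [0..<n])"

text \<open>\<open>\<forall>y\<^sub>1 \<in> s\<^sub>1 \<dots> \<forall>y\<^sub>n \<in> s\<^sub>n. \<phi>\<close>, with the terms \<open>s\<^sub>i : \<sigma>\<^sub>i*\<close> given in the context outside the whole block.\<close>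

fun ball :: "ty list \<Rightarrow> tm list \<Rightarrow> fm \<Rightarrow> fm" where
  "ball (\<sigma> # \<sigma>s) (s # ss) \<phi> =
     All \<sigma> (mem \<sigma> (Var 0) (shift 1 s) \<^bold>\<longrightarrow> ball \<sigma>s (map (shift 1) ss) \<phi>)"
| "ball _ _ \<phi> = \<phi>"

text \<open>\<open>Um \<Phi> a xs ys\<close> is the formula \<open>\<phi>\<^sub>U(xs, ys, a)\<close> for tuples of terms \<open>xs : Ux \<Phi>\<close> and \<open>ys : Uy \<Phi>\<close>, where
  \<open>a i\<close> is the term taking the place of the free variable \<open>i\<close> of \<open>\<Phi>\<close>.\<close>

primrec Um :: "fm \<Rightarrow> (nat \<Rightarrow> tm) \<Rightarrow> tm list \<Rightarrow> tm list \<Rightarrow> fm" where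
  "Um Fls a xs ys = Fls"
| "Um (Eq \<sigma> t u) a xs ys = Eq \<sigma> (tsub a t) (tsub a u)"
| "Um (St \<sigma> t) a xs ys = Eq \<sigma> (hd xs) (tsub a t)"
| "Um (\<Phi> \<^bold>\<and> \<Psi>) a xs ys =
     (let n = length (Ux \<Phi>); m = length (Uy \<Phi>)
      in Um \<Phi> a (take n xs) (take m ys) \<^bold>\<and> Um \<Psi> a (drop n xs) (drop m ys))"
| "Um (\<Phi> \<^bold>\<or> \<Psi>) a zxs ys =
     (let n = length (Ux \<Phi>); m = length (Uy \<Phi>); z = hd zxs; xs = tl zxs
      in (Eq N z zero \<^bold>\<longrightarrow> Um \<Phi> a (take n xs) (take m ys)) \<^bold>\<and>
         ((\<^bold>\<not> Eq N z zero) \<^bold>\<longrightarrow> Um \<Psi> a (drop n xs) (drop m ys)))"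
| "Um (\<Phi> \<^bold>\<longrightarrow> \<Psi>) a UYs xvs =
     (let Us = take (length (Ux \<Psi>)) UYs; Ys = drop (length (Ux \<Psi>)) UYs;
          xs = take (length (Ux \<Phi>)) xvs; vs = drop (length (Ux \<Phi>)) xvs;
          m = length (Uy \<Phi>)
      in ball (Uy \<Phi>) (map (\<lambda>Y. apps Y (xs @ vs)) Ys)
           (Um \<Phi> (\<lambda>i. shift m (a i)) (map (shift m) xs) (vars m)) \<^bold>\<longrightarrow>
         Um \<Psi> a (map (\<lambda>U. apps U xs) Us) vs)"
| "Um (Ex \<sigma> \<Phi>) a xs ys =
     (let m = length (Uy \<Phi>)
      in Ex \<sigma> (ball (Uy \<Phi>) (map (shift 1) ys)
           (Um \<Phi> (\<lambda>i. shift m (up a i)) (map (shift (m + 1)) xs) (vars m))))"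
| "Um (All \<sigma> \<Phi>) a xs ys = All \<sigma> (Um \<Phi> (up a) (map (shift 1) xs) (map (shift 1) ys))"
| "Um (ExSt \<sigma> \<Phi>) a zxs ys = Um \<Phi> (case_nat (hd zxs) a) (tl zxs) ys"
| "Um (AllSt \<sigma> \<Phi>) a Xs yzs =
     (let z = last yzs; ys = butlast yzs
      in Um \<Phi> (case_nat z a) (map (\<lambda>X. X \<cdot> z) Xs) ys)"

definition U :: "fm \<Rightarrow> fm" where
  "U \<Phi> =
     (let n = length (Ux \<Phi>); m = length (Uy \<Phi>)
      in foldr ExSt (Ux \<Phi>) (foldr AllSt (Uy \<Phi>)
           (Um \<Phi> (\<lambda>i. Var (i + n + m)) (map (shift m) (vars n)) (vars m))))"

text \<open>\<open>\<forall>y \<phi>\<^sub>U(ts, y)\<close> with internal quantifiers, where \<open>ts\<close> and the free variables of \<open>\<Phi>\<close> live in the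
  outer context.\<close>

definition U_at :: "fm \<Rightarrow> tm list \<Rightarrow> fm" where
  "U_at \<Phi> ts =
     (let m = length (Uy \<Phi>)
      in foldr All (Uy \<Phi>) (Um \<Phi> (\<lambda>i. Var (i + m)) (map (shift m) ts) (vars m)))"

end

theory Submission
  imports Defs "HOL-Library.Countable"
begin

text \<open>Provability in \<open>H\<close> is organised as a forcing relation. Types are assigned once and for all to
  infinitely many variables, each type infinitely often, and \<open>w \<tturnstile> \<phi>\<close> means that \<open>H\<close> derives \<open>\<phi>\<close> from
  \<open>w\<close> over finitely many of them. Then \<open>\<phi> \<^bold>\<longrightarrow> \<psi>\<close> is forced iff every later set forcing \<open>\<phi>\<close> forces
  \<open>\<psi>\<close>, and quantifiers range over typed terms, without any renaming of variables.

  For (a), \<open>\<Phi> \<^bold>\<longleftrightarrow> U \<Phi>\<close> is shown by induction on \<open>\<Phi>\<close>. Disjunction uses that standard numbers are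
  decidably zero (external induction), \<open>All\<close> uses \<open>NU\<close>, \<open>AllSt\<close> uses \<open>AC\<close>, \<open>Ex\<close> uses \<open>OS\<close>, and an
  implication is treated by \<open>IP\<close>, \<open>AC\<close>, \<open>US\<close>, \<open>AC\<close> in this order. The principles speak about single
  variables whereas the translation needs them for tuples; for \<open>IP\<close>, \<open>US\<close> and \<open>OS\<close>, whose hypotheses
  contain one standard universal quantifier in front of an internal formula, tuples are coded
  in a single type by definable pairing functions.

  For (b), the assumption for \<open>\<Psi> = \<Phi>\<close> yields closed terms witnessing \<open>U \<Phi>\<close>, so (a) gives \<open>\<Phi>\<close>.\<close>

section \<open>Substitution and derivations\<close>

text \<open>\<open>AC\<close> and \<open>NU\<close> admit arbitrary formulae, so a block of external
  quantifiers is treated one variable at a time, the rest of the block being part of the formula. In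
  \<open>IP\<close>, \<open>US\<close> and \<open>OS\<close> the matrix must be internal, and
  peeling one quantifier off a block would leave an external matrix. Coding removes the block, but
  at a price: \<open>US\<close> and \<open>OS\<close> then speak of one sequence of codes, whereas
  the translation has a separate sequence for each component, and the entries of a standard sequence
  of codes cannot be assumed standard. That their projections lie in given sequences is however an
  internal statement, so \<open>US\<close> supplies standard component sequences.

  The other obstacle is disjunction. \<open>NU\<close> refutes the decidability of
  \<open>z = 0\<close> for arbitrary \<open>z\<close>, so a case distinction on a possibly
  nonstandard object is available only for internal disjunction-free goals. The translation is built
  to stay among these: \<open>St\<close> becomes an equation and a disjunction becomes a flag, which
  is standard and hence decidable.\<close>

lemma tsub_tsub: "tsub s (tsub r t) = tsub (\<lambda>i. tsub s (r i)) t"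
  by (induction t) auto

lemma tsub_Var [simp]: "tsub Var t = t"
  by (induction t) auto

lemma shift_simps [simp]:
  "shift n (Var i) = Var (i + n)" "shift n (Con c) = Con c" "shift n (t \<cdot> u) = shift n t \<cdot> shift n u"
  by (simp_all add: shift_def)

lemma shift_0 [simp]: "shift 0 t = t"
  by (simp add: shift_def)

lemma shift_shift [simp]: "shift m (shift n t) = shift (m + n) t"
  by (simp add: shift_def tsub_tsub add.commute add.left_commute)

lemma up_simps [simp]: "up s 0 = Var 0" "up s (Suc i) = shift 1 (s i)"
  by (simp_all add: up_def)

lemma tsub_up_shift [simp]: "tsub (up s) (shift (Suc n) t) = shift 1 (tsub s (shift n t))"
  by (simp add: shift_def tsub_tsub)

lemma tsub_case_shift [simp]: "tsub (case_nat t e) (shift (Suc n) u) = tsub e (shift n u)"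
  by (simp add: shift_def tsub_tsub)

lemma up_Var [simp]: "up Var = Var"
proof
  show "up Var i = Var i" for i by (cases i) auto
qed

lemma up_comp: "(\<lambda>i. tsub (up s) (up r i)) = up (\<lambda>i. tsub s (r i))"
proof
  show "tsub (up s) (up r i) = up (\<lambda>i. tsub s (r i)) i" for i by (cases i) auto
qed

lemma case_up_comp: "(\<lambda>i. tsub (case_nat t e) (up r i)) = case_nat t (\<lambda>i. tsub e (r i))"
proof
  show "tsub (case_nat t e) (up r i) = case_nat t (\<lambda>i. tsub e (r i)) i" for i by (cases i) auto
qed

lemma fsub_fsub: "fsub (fsub \<phi> r) s = fsub \<phi> (\<lambda>i. tsub s (r i))"
  by (induction \<phi> arbitrary: r s) (auto simp: tsub_tsub up_comp)

lemma fsub_Var [simp]: "fsub \<phi> Var = \<phi>"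
  by (induction \<phi>) auto

lemma fsub_lift_up: "fsub (lift \<phi>) (up s) = lift (fsub \<phi> s)"
  by (simp add: lift_def fsub_fsub shift_def)

lemma tsub_case_nat: "tsub s (case_nat t e i) = case_nat (tsub s t) (\<lambda>i. tsub s (e i)) i"
  by (cases i) auto

lemma fsub_inst: "fsub (inst t \<phi>) s = fsub \<phi> (case_nat (tsub s t) s)"
  by (simp add: inst_def fsub_fsub tsub_case_nat cong: nat.case_cong)

lemma inst_up: "inst t (fsub \<phi> (up e)) = fsub \<phi> (case_nat t e)"
  by (simp add: inst_def fsub_fsub case_up_comp)

lemma internal_fsub [simp]: "internal (fsub \<phi> s) = internal \<phi>"
  by (induction \<phi> arbitrary: s) auto

lemma or_free_fsub [simp]: "or_free (fsub \<phi> s) = or_free \<phi>"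
  by (induction \<phi> arbitrary: s) auto

section \<open>Typing and well-formedness under substitution\<close>

lemma has_ty_App: "has_ty \<Gamma> (t \<cdot> u) \<tau> \<longleftrightarrow> (\<exists>\<sigma>. has_ty \<Gamma> t (\<sigma> \<rightarrow> \<tau>) \<and> has_ty \<Gamma> u \<sigma>)"
  by (auto split: option.splits ty.splits)

lemma has_ty_Var [simp]: "has_ty \<Gamma> (Var i) \<sigma> \<longleftrightarrow> i < length \<Gamma> \<and> \<Gamma> ! i = \<sigma>"
  by auto

declare ty_of.simps(1,3) [simp del]

lemma has_ty_AppI: "has_ty \<Gamma> t (\<sigma> \<rightarrow> \<tau>) \<Longrightarrow> has_ty \<Gamma> u \<sigma> \<Longrightarrow> has_ty \<Gamma> (t \<cdot> u) \<tau>"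
  by (auto simp: has_ty_App)

lemma has_ty_tsub:
  "has_ty \<Gamma> t \<sigma> \<Longrightarrow> (\<And>i. i < length \<Gamma> \<Longrightarrow> has_ty \<Gamma>' (s i) (\<Gamma> ! i)) \<Longrightarrow> has_ty \<Gamma>' (tsub s t) \<sigma>"
proof (induction t arbitrary: \<sigma>)
  case (Var x)
  then show ?case by (auto split: if_splits)
next
  case (App t1 t2)
  then show ?case by (simp add: has_ty_App) blast
qed auto

text \<open>A term has at most one type, so it suffices that the type of the image of a variable, if
  there is one, is the type of the variable. This converse of \<open>has_ty_tsub\<close> is needed
  because forcing an instance of \<open>\<phi>\<close> only guarantees that the instance is well
  formed; \<open>wff_instD\<close> recovers the body from it.\<close>

lemma has_ty_tsub_inv:
  "has_ty \<Gamma>' (tsub s t) \<sigma> \<Longrightarrow> (\<And>i \<tau>. has_ty \<Gamma>' (s i) \<tau> \<Longrightarrow> has_ty \<Gamma> (Var i) \<tau>) \<Longrightarrow> has_ty \<Gamma> t \<sigma>"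
proof (induction t arbitrary: \<sigma>)
  case (App t1 t2)
  from App.prems(1) obtain \<rho> where "has_ty \<Gamma>' (tsub s t1) (\<rho> \<rightarrow> \<sigma>)" "has_ty \<Gamma>' (tsub s t2) \<rho>"
    by (auto simp: has_ty_App)
  then have "has_ty \<Gamma> t1 (\<rho> \<rightarrow> \<sigma>)" "has_ty \<Gamma> t2 \<rho>"
    using App.IH App.prems(2) by blast+
  then show ?case by (rule has_ty_AppI)
qed auto

lemma tsub_cong:
  "has_ty \<Gamma> t \<sigma> \<Longrightarrow> (\<And>i. i < length \<Gamma> \<Longrightarrow> s i = s' i) \<Longrightarrow> tsub s t = tsub s' t"
proof (induction t arbitrary: \<sigma>)
  case (Var x)
  then show ?case by (auto split: if_splits)
next
  case (App t1 t2)
  then show ?case by (simp add: has_ty_App) blast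
qed auto

lemma tsub_closed: "closed_tm t \<sigma> \<Longrightarrow> tsub s t = t"
  using tsub_cong[of "[]" t \<sigma> s Var] by simp

lemma has_ty_closed: "closed_tm t \<sigma> \<Longrightarrow> has_ty \<Gamma> t \<sigma>"
  using has_ty_tsub[of "[]" t \<sigma> \<Gamma> Var] by simp

lemma has_ty_shift: "has_ty \<Gamma> t \<sigma> \<Longrightarrow> length \<Theta> = n \<Longrightarrow> has_ty (\<Theta> @ \<Gamma>) (shift n t) \<sigma>"
  unfolding shift_def by (rule has_ty_tsub) (auto simp: nth_append)

lemma has_ty_shift1: "has_ty \<Gamma> t \<sigma> \<Longrightarrow> has_ty (\<tau> # \<Gamma>) (shift (Suc 0) t) \<sigma>"
  using has_ty_shift[of \<Gamma> t \<sigma> "[\<tau>]"] by simp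

lemma up_typed:
  "(\<And>i. i < length \<Gamma> \<Longrightarrow> has_ty \<Gamma>' (s i) (\<Gamma> ! i)) \<Longrightarrow> i < length (\<sigma> # \<Gamma>)
    \<Longrightarrow> has_ty (\<sigma> # \<Gamma>') (up s i) ((\<sigma> # \<Gamma>) ! i)"
  by (cases i) (auto intro: has_ty_shift1)

lemma wff_fsub:
  "wff \<phi> \<Gamma> \<Longrightarrow> (\<And>i. i < length \<Gamma> \<Longrightarrow> has_ty \<Gamma>' (s i) (\<Gamma> ! i)) \<Longrightarrow> wff (fsub \<phi> s) \<Gamma>'"
proof (induction \<phi> arbitrary: \<Gamma> \<Gamma>' s)
  case (All \<sigma> \<phi>)
  show ?case using All.IH[of "\<sigma> # \<Gamma>" "\<sigma> # \<Gamma>'" "up s"] All.prems up_typed by auto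
next
  case (Ex \<sigma> \<phi>)
  show ?case using Ex.IH[of "\<sigma> # \<Gamma>" "\<sigma> # \<Gamma>'" "up s"] Ex.prems up_typed by auto
next
  case (AllSt \<sigma> \<phi>)
  show ?case using AllSt.IH[of "\<sigma> # \<Gamma>" "\<sigma> # \<Gamma>'" "up s"] AllSt.prems up_typed by auto
next
  case (ExSt \<sigma> \<phi>)
  show ?case using ExSt.IH[of "\<sigma> # \<Gamma>" "\<sigma> # \<Gamma>'" "up s"] ExSt.prems up_typed by auto
qed (auto intro: has_ty_tsub)

lemma up_typed_inv:
  assumes "\<And>i \<tau>. has_ty \<Gamma>' (s i) \<tau> \<Longrightarrow> has_ty \<Gamma> (Var i) \<tau>" and "has_ty (\<sigma> # \<Gamma>') (up s i) \<tau>"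
  shows "has_ty (\<sigma> # \<Gamma>) (Var i) \<tau>"
proof (cases i)
  case (Suc j)
  then have "has_ty (\<sigma> # \<Gamma>') (shift 1 (s j)) \<tau>" using assms(2) by simp
  then have "has_ty \<Gamma>' (s j) \<tau>" unfolding shift_def
    by (rule has_ty_tsub_inv) (auto split: if_splits)
  then show ?thesis using assms(1)[of j \<tau>] Suc by simp
qed (use assms(2) in auto)

lemma wff_fsub_inv:
  "wff (fsub \<phi> s) \<Gamma>' \<Longrightarrow> (\<And>i \<tau>. has_ty \<Gamma>' (s i) \<tau> \<Longrightarrow> has_ty \<Gamma> (Var i) \<tau>) \<Longrightarrow> wff \<phi> \<Gamma>"
proof (induction \<phi> arbitrary: \<Gamma> \<Gamma>' s)
  case (All \<sigma> \<phi>)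
  from All.prems(1) have "wff (fsub \<phi> (up s)) (\<sigma> # \<Gamma>')" by simp
  from All.IH[OF this up_typed_inv[OF All.prems(2)]] show ?case by simp
next
  case (Ex \<sigma> \<phi>)
  from Ex.prems(1) have "wff (fsub \<phi> (up s)) (\<sigma> # \<Gamma>')" by simp
  from Ex.IH[OF this up_typed_inv[OF Ex.prems(2)]] show ?case by simp
next
  case (AllSt \<sigma> \<phi>)
  from AllSt.prems(1) have "wff (fsub \<phi> (up s)) (\<sigma> # \<Gamma>')" by simp
  from AllSt.IH[OF this up_typed_inv[OF AllSt.prems(2)]] show ?case by simp
next
  case (ExSt \<sigma> \<phi>)
  from ExSt.prems(1) have "wff (fsub \<phi> (up s)) (\<sigma> # \<Gamma>')" by simp
  from ExSt.IH[OF this up_typed_inv[OF ExSt.prems(2)]] show ?case by simp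
next
  case (Eq \<sigma> t u)
  then have "has_ty \<Gamma>' (tsub s t) \<sigma>" "has_ty \<Gamma>' (tsub s u) \<sigma>" by simp_all
  from this(1)[THEN has_ty_tsub_inv, OF Eq.prems(2)] this(2)[THEN has_ty_tsub_inv, OF Eq.prems(2)]
  show ?case by simp
next
  case (St \<sigma> t)
  then have "has_ty \<Gamma>' (tsub s t) \<sigma>" by simp
  from has_ty_tsub_inv[OF this St.prems(2)] show ?case by simp
qed (auto)

lemma wff_instD:
  assumes "wff (inst t \<phi>) \<Gamma>" "has_ty \<Gamma> t \<sigma>"
  shows "wff \<phi> (\<sigma> # \<Gamma>)"
proof (rule wff_fsub_inv[OF assms(1)[unfolded inst_def]])
  show "has_ty (\<sigma> # \<Gamma>) (Var i) \<tau>" if "has_ty \<Gamma> (case_nat t Var i) \<tau>" for i \<tau>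
    using that assms(2) by (cases i) auto
qed

lemma wff_instI:
  assumes "wff \<phi> (\<sigma> # \<Gamma>)" "has_ty \<Gamma> t \<sigma>"
  shows "wff (inst t \<phi>) \<Gamma>"
  unfolding inst_def
proof (rule wff_fsub[OF assms(1)])
  show "has_ty \<Gamma> (case_nat t Var i) ((\<sigma> # \<Gamma>) ! i)" if "i < length (\<sigma> # \<Gamma>)" for i
    using that assms(2) by (cases i) auto
qed

lemma up_cong: "(\<And>i. i < n \<Longrightarrow> s i = s' i) \<Longrightarrow> i < Suc n \<Longrightarrow> up s i = up s' i"
  by (cases i) auto

lemma fsub_cong: "wff \<phi> \<Gamma> \<Longrightarrow> (\<And>i. i < length \<Gamma> \<Longrightarrow> s i = s' i) \<Longrightarrow> fsub \<phi> s = fsub \<phi> s'"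
proof (induction \<phi> arbitrary: \<Gamma> s s')
  case (All \<sigma> \<phi>)
  from All.prems(1) have "wff \<phi> (\<sigma> # \<Gamma>)" by simp
  then have "fsub \<phi> (up s) = fsub \<phi> (up s')"
    by (rule All.IH) (rule up_cong[OF All.prems(2)], simp_all)
  then show ?case by simp
next
  case (Ex \<sigma> \<phi>)
  from Ex.prems(1) have "wff \<phi> (\<sigma> # \<Gamma>)" by simp
  then have "fsub \<phi> (up s) = fsub \<phi> (up s')"
    by (rule Ex.IH) (rule up_cong[OF Ex.prems(2)], simp_all)
  then show ?case by simp
next
  case (AllSt \<sigma> \<phi>)
  from AllSt.prems(1) have "wff \<phi> (\<sigma> # \<Gamma>)" by simp
  then have "fsub \<phi> (up s) = fsub \<phi> (up s')"
    by (rule AllSt.IH) (rule up_cong[OF AllSt.prems(2)], simp_all)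
  then show ?case by simp
next
  case (ExSt \<sigma> \<phi>)
  from ExSt.prems(1) have "wff \<phi> (\<sigma> # \<Gamma>)" by simp
  then have "fsub \<phi> (up s) = fsub \<phi> (up s')"
    by (rule ExSt.IH) (rule up_cong[OF ExSt.prems(2)], simp_all)
  then show ?case by simp
next
  case (Eq \<sigma> t u)
  then show ?case using tsub_cong[of \<Gamma> _ \<sigma> s s'] by simp
next
  case (St \<sigma> t)
  then show ?case using tsub_cong[of \<Gamma> _ \<sigma> s s'] by simp
next
  case (And \<phi> \<psi>)
  then show ?case using And.IH[of \<Gamma> s s'] by simp
next
  case (Or \<phi> \<psi>)
  then show ?case using Or.IH[of \<Gamma> s s'] by simp
next
  case (Imp \<phi> \<psi>)
  then show ?case using Imp.IH[of \<Gamma> s s'] by simp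
qed simp

lemma fsub_closed: "wff \<phi> [] \<Longrightarrow> fsub \<phi> s = \<phi>"
  using fsub_cong[of \<phi> "[]" s Var] by simp

section \<open>Structural properties of derivations\<close>

lemma prv_mono:
  "prv \<L> T \<Gamma> \<Delta> \<phi> \<Longrightarrow> \<L> \<subseteq> \<L>' \<Longrightarrow> T \<subseteq> T' \<Longrightarrow> \<Delta> \<subseteq> \<Delta>' \<Longrightarrow> prv \<L>' T' \<Gamma> \<Delta>' \<phi>"
proof (induction arbitrary: \<Delta>' rule: prv.induct)
  case (or_elim \<Gamma> \<Delta> \<phi> \<psi> \<chi>)
  then show ?case by (meson insert_mono prv.or_elim)
next
  case (imp_intro \<Gamma> \<phi> \<Delta> \<psi>)
  then show ?case by (meson insert_mono prv.imp_intro subsetD)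
next
  case (all_intro \<sigma> \<Gamma> \<Delta> \<phi>)
  then show ?case by (meson image_mono prv.all_intro)
next
  case (ex_elim \<Gamma> \<Delta> \<sigma> \<phi> \<chi>)
  then show ?case by (meson image_mono insert_mono prv.ex_elim)
next
  case (ex_intro \<Gamma> \<Delta> t \<phi> \<sigma>)
  then show ?case by (meson prv.ex_intro subsetD)
next
  case (all_elim \<Gamma> \<Delta> \<sigma> \<phi> t)
  then show ?case by (meson prv.all_elim)
next
  case (imp_elim \<Gamma> \<Delta> \<phi> \<psi>)
  then show ?case by (meson prv.imp_elim)
next
  case (and_elim1 \<Gamma> \<Delta> \<phi> \<psi>)
  then show ?case by (meson prv.and_elim1)
next
  case (and_elim2 \<Gamma> \<Delta> \<phi> \<psi>)
  then show ?case by (meson prv.and_elim2)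
qed (auto intro: prv.ax prv.hyp prv.fls_elim prv.and_intro prv.or_intro1 prv.or_intro2)

text \<open>The sentences of \<open>T\<close> are fixed by substitution, and every rule commutes
  with it. Depending on \<open>s\<close> this yields weakening of the context, the renaming of a
  fresh variable into a bound one, and the return from pool variables to an arbitrary
  context.\<close>

lemma prv_fsub:
  assumes "prv UNIV T \<Gamma> \<Delta> \<phi>" and T: "\<And>\<phi>. \<phi> \<in> T \<Longrightarrow> wff \<phi> []"
    and "\<And>i. i < length \<Gamma> \<Longrightarrow> has_ty \<Gamma>' (s i) (\<Gamma> ! i)"
  shows "prv UNIV T \<Gamma>' ((\<lambda>\<delta>. fsub \<delta> s) ` \<Delta>) (fsub \<phi> s)"
  using assms(1,3)
proof (induction arbitrary: \<Gamma>' s rule: prv.induct)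
  case (ax \<phi> \<Gamma> \<Delta>)
  then show ?case using T by (simp add: fsub_closed prv.ax)
next
  case (fls_elim \<Gamma> \<Delta> \<phi>)
  show ?case using fls_elim.IH[OF fls_elim.prems] wff_fsub[OF fls_elim.hyps(2) fls_elim.prems]
    by (simp add: prv.fls_elim)
next
  case (or_intro1 \<Gamma> \<Delta> \<phi> \<psi>)
  show ?case using or_intro1.IH[OF or_intro1.prems] wff_fsub[OF or_intro1.hyps(2) or_intro1.prems]
    by (simp add: prv.or_intro1)
next
  case (or_intro2 \<Gamma> \<Delta> \<psi> \<phi>)
  show ?case using or_intro2.IH[OF or_intro2.prems] wff_fsub[OF or_intro2.hyps(2) or_intro2.prems]
    by (simp add: prv.or_intro2)
next
  case (or_elim \<Gamma> \<Delta> \<phi> \<psi> \<chi>)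
  show ?case using or_elim.IH[OF or_elim.prems] by simp (rule prv.or_elim)
next
  case (imp_intro \<Gamma> \<phi> \<Delta> \<psi>)
  show ?case using imp_intro.IH[OF imp_intro.prems] wff_fsub[OF imp_intro.hyps(2) imp_intro.prems]
    by (simp add: prv.imp_intro)
next
  case (imp_elim \<Gamma> \<Delta> \<phi> \<psi>)
  show ?case using imp_elim.IH[OF imp_elim.prems] by simp (rule prv.imp_elim)
next
  case (all_intro \<sigma> \<Gamma> \<Delta> \<phi>)
  have "prv UNIV T (\<sigma> # \<Gamma>') ((\<lambda>\<delta>. fsub \<delta> (up s)) ` lift ` \<Delta>) (fsub \<phi> (up s))"
    by (rule all_intro.IH, rule up_typed) (use all_intro.prems in auto)
  then show ?case by (simp add: image_image fsub_lift_up prv.all_intro)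
next
  case (all_elim \<Gamma> \<Delta> \<sigma> \<phi> t)
  have "prv UNIV T \<Gamma>' ((\<lambda>\<delta>. fsub \<delta> s) ` \<Delta>) (All \<sigma> (fsub \<phi> (up s)))"
    using all_elim.IH[OF all_elim.prems] by simp
  then show ?case
    using prv.all_elim has_ty_tsub[OF all_elim.hyps(2) all_elim.prems] by (metis fsub_inst inst_up)
next
  case (ex_intro \<Gamma> \<Delta> t \<phi> \<sigma>)
  have "prv UNIV T \<Gamma>' ((\<lambda>\<delta>. fsub \<delta> s) ` \<Delta>) (inst (tsub s t) (fsub \<phi> (up s)))"
    using ex_intro.IH[OF ex_intro.prems] by (simp add: fsub_inst inst_up)
  then show ?case
    using has_ty_tsub[OF ex_intro.hyps(2) ex_intro.prems]
      wff_fsub[OF ex_intro.hyps(3) up_typed[OF ex_intro.prems]]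
    by (simp add: prv.ex_intro)
next
  case (ex_elim \<Gamma> \<Delta> \<sigma> \<phi> \<chi>)
  have "prv UNIV T (\<sigma> # \<Gamma>') ((\<lambda>\<delta>. fsub \<delta> (up s)) ` insert \<phi> (lift ` \<Delta>)) (fsub (lift \<chi>) (up s))"
    by (rule ex_elim.IH(2), rule up_typed) (use ex_elim.prems in auto)
  then show ?case
    using ex_elim.IH(1)[OF ex_elim.prems]
    by (simp add: image_image fsub_lift_up)
      (rule prv.ex_elim, assumption, simp add: image_image)
next
  case (and_elim1 \<Gamma> \<Delta> \<phi> \<psi>)
  show ?case using and_elim1.IH[OF and_elim1.prems] by simp (rule prv.and_elim1)
next
  case (and_elim2 \<Gamma> \<Delta> \<phi> \<psi>)
  show ?case using and_elim2.IH[OF and_elim2.prems] by simp (rule prv.and_elim2)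
next
  case (and_intro \<Gamma> \<Delta> \<phi> \<psi>)
  show ?case using and_intro.IH[OF and_intro.prems] by (simp add: prv.and_intro)
qed (simp add: prv.hyp)

text \<open>The innermost quantifier of the closure binds variable 0, so the induction strips the
  outer quantifiers first, using the tail of \<open>e\<close>, and instantiates variable 0
  last.\<close>

lemma prv_closure:
  "prv \<L> T \<Gamma>' \<Delta> (closure \<Gamma> \<phi>) \<Longrightarrow> (\<And>i. i < length \<Gamma> \<Longrightarrow> has_ty \<Gamma>' (e i) (\<Gamma> ! i))
    \<Longrightarrow> wff (closure \<Gamma> \<phi>) [] \<Longrightarrow> prv \<L> T \<Gamma>' \<Delta> (fsub \<phi> e)"
proof (induction \<Gamma> arbitrary: \<phi> e)
  case Nil
  then show ?case by (simp add: closure_def fsub_closed)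
next
  case (Cons \<sigma> \<Gamma>)
  have "prv \<L> T \<Gamma>' \<Delta> (fsub (All \<sigma> \<phi>) (\<lambda>i. e (Suc i)))"
    by (rule Cons.IH) (use Cons.prems in \<open>auto simp: closure_def\<close>)
  then have "prv \<L> T \<Gamma>' \<Delta> (inst (e 0) (fsub \<phi> (up (\<lambda>i. e (Suc i)))))"
    using Cons.prems(2)[of 0] by (auto intro: prv.all_elim)
  moreover have "case_nat (e 0) (\<lambda>i. e (Suc i)) = e"
    by (rule ext) (simp split: nat.split)
  ultimately show ?case by (simp add: inst_up)
qed

lemma wff_closure [simp]: "wff (closure \<Gamma> \<phi>) [] = wff \<phi> \<Gamma>"
proof -
  have "wff (fold All \<Gamma> \<phi>) \<Gamma>' = wff \<phi> (\<Gamma> @ \<Gamma>')" for \<Gamma>'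
    by (induction \<Gamma> arbitrary: \<phi>) auto
  then show ?thesis by (simp add: closure_def)
qed

section \<open>Typing of the defined terms and of the axioms\<close>

lemma has_ty_lam: "has_ty (\<sigma> # \<Gamma>) t \<tau> \<Longrightarrow> has_ty \<Gamma> (lam \<Gamma> \<sigma> t) (\<sigma> \<rightarrow> \<tau>)"
proof (induction \<Gamma> \<sigma> t arbitrary: \<tau> rule: lam.induct)
  case (4 \<Gamma> \<sigma> t u)
  then obtain \<rho> where "has_ty (\<sigma> # \<Gamma>) t (\<rho> \<rightarrow> \<tau>)" "has_ty (\<sigma> # \<Gamma>) u \<rho>"
    by (auto simp: has_ty_App)
  then have "the (ty_of (\<sigma> # \<Gamma>) (t \<cdot> u)) = \<tau>" "the (ty_of (\<sigma> # \<Gamma>) u) = \<rho>"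
    and "has_ty \<Gamma> (lam \<Gamma> \<sigma> t) (\<sigma> \<rightarrow> \<rho> \<rightarrow> \<tau>)" "has_ty \<Gamma> (lam \<Gamma> \<sigma> u) (\<sigma> \<rightarrow> \<rho>)"
    using has_ty_AppI[of "\<sigma> # \<Gamma>" t \<rho> \<tau> u] 4 by simp_all
  then show ?case by (simp add: has_ty_App)
qed (auto simp: has_ty_App split: if_splits)

declare lam.simps [simp del]

lemma closed_default [simp]: "closed_tm (default_tm \<sigma>) \<sigma>"
  by (induction \<sigma>) (auto simp: has_ty_App)

lemma has_ty_plus: "has_ty \<Gamma> t N \<Longrightarrow> has_ty \<Gamma> u N \<Longrightarrow> has_ty \<Gamma> (plus_tm t u) N"
  unfolding plus_tm_def
  by (auto simp: has_ty_App intro!: has_ty_closed[OF has_ty_lam] has_ty_lam)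

lemma has_ty_len: "has_ty \<Gamma> s (Seq \<sigma>) \<Longrightarrow> has_ty \<Gamma> (len \<sigma> s) N"
  unfolding len_def
  by (auto simp: has_ty_App intro!: has_ty_closed[OF has_ty_lam] has_ty_lam)

text \<open>A name for the step function inside \<open>nth_tm\<close>: being closed, it is untouched
  by substitution and keeps its type in every context.\<close>

definition nth_step :: "ty \<Rightarrow> tm" where
  "nth_step \<sigma> = lam [] (N \<rightarrow> \<sigma>) (lam [N \<rightarrow> \<sigma>] \<sigma> (lam [\<sigma>, N \<rightarrow> \<sigma>] N
         (Con (R \<sigma>) \<cdot> Var 0 \<cdot> Var 1 \<cdot> (Con (K (N \<rightarrow> \<sigma>) \<sigma>) \<cdot> Var 2))))"

lemma closed_nth_step: "closed_tm (nth_step \<sigma>) ((N \<rightarrow> \<sigma>) \<rightarrow> \<sigma> \<rightarrow> N \<rightarrow> \<sigma>)"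
  unfolding nth_step_def by (intro has_ty_lam) (auto simp: has_ty_App)

lemma nth_tm_eq:
  "nth_tm \<sigma> s i = Con (L \<sigma> (N \<rightarrow> \<sigma>)) \<cdot> s \<cdot> default_tm (N \<rightarrow> \<sigma>) \<cdot> nth_step \<sigma> \<cdot> i"
  by (simp add: nth_tm_def nth_step_def)

lemma has_ty_nth: "has_ty \<Gamma> s (Seq \<sigma>) \<Longrightarrow> has_ty \<Gamma> i N \<Longrightarrow> has_ty \<Gamma> (nth_tm \<sigma> s i) \<sigma>"
  unfolding nth_tm_eq
  by (auto simp: has_ty_App intro!: has_ty_closed[OF closed_nth_step] has_ty_closed[OF closed_default])

text \<open>The step function of \<open>len\<close> and, for \<open>\<sigma> = N\<close>, that of
  \<open>plus_tm\<close>. The index is written \<open>Suc 0\<close> because the simplifier rewrites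
  \<open>1\<close> to that form.\<close>

lemma tsub_lam2 [simp]: "tsub e (lam [] N (lam [N] \<sigma> (suc (Var (Suc 0))))) = lam [] N (lam [N] \<sigma> (suc (Var (Suc 0))))"
  by (rule tsub_closed[of _ "N \<rightarrow> \<sigma> \<rightarrow> N"], intro has_ty_lam) (auto simp: has_ty_App)

lemma tsub_plus [simp]: "tsub e (plus_tm t u) = plus_tm (tsub e t) (tsub e u)"
  by (simp add: plus_tm_def)

lemma tsub_len [simp]: "tsub e (len \<sigma> s) = len \<sigma> (tsub e s)"
  by (simp add: len_def)

lemma tsub_default [simp]: "tsub e (default_tm \<sigma>) = default_tm \<sigma>"
  by (rule tsub_closed[OF closed_default])

lemma tsub_nth [simp]: "tsub e (nth_tm \<sigma> s i) = nth_tm \<sigma> (tsub e s) (tsub e i)"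
  by (simp add: nth_tm_eq tsub_closed[OF closed_nth_step])

lemma shift_len [simp]: "shift n (len \<sigma> s) = len \<sigma> (shift n s)"
  by (simp add: shift_def)

lemma fsub_less [simp]: "fsub (less_fm t u) e = less_fm (tsub e t) (tsub e u)"
  by (simp add: less_fm_def)

lemma fsub_mem [simp]: "fsub (mem \<sigma> a s) e = mem \<sigma> (tsub e a) (tsub e s)"
  by (simp add: mem_def)

lemma fsub_hyper [simp]: "fsub (hyper \<sigma> s) e = hyper \<sigma> (tsub e s)"
  by (simp add: hyper_def)

lemma wff_less: "has_ty \<Gamma> t N \<Longrightarrow> has_ty \<Gamma> u N \<Longrightarrow> wff (less_fm t u) \<Gamma>"
  by (auto simp: less_fm_def has_ty_App intro!: has_ty_plus has_ty_shift1)

lemma wff_mem: "has_ty \<Gamma> a \<sigma> \<Longrightarrow> has_ty \<Gamma> s (Seq \<sigma>) \<Longrightarrow> wff (mem \<sigma> a s) \<Gamma>"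
  by (auto simp: mem_def intro!: wff_less has_ty_len has_ty_nth has_ty_shift1)

lemma wff_hyper: "has_ty \<Gamma> s (Seq \<sigma>) \<Longrightarrow> wff (hyper \<sigma> s) \<Gamma>"
  by (auto simp: hyper_def intro!: wff_mem has_ty_shift1)

lemma internal_mem [simp]: "internal (mem \<sigma> a s)" "or_free (mem \<sigma> a s)"
  and internal_less [simp]: "internal (less_fm t u)" "or_free (less_fm t u)"
  by (simp_all add: mem_def less_fm_def)

lemma wff_at_suc: "wff \<phi> (N # \<Gamma>) \<Longrightarrow> wff (at_suc \<phi>) (N # \<Gamma>)"
  unfolding at_suc_def
proof (rule wff_fsub, assumption)
  show "has_ty (N # \<Gamma>) (case_nat (suc (Var 0)) (\<lambda>i. Var (Suc i)) i) ((N # \<Gamma>) ! i)"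
    if "i < length (N # \<Gamma>)" for i
    using that by (cases i) (auto simp: has_ty_App)
qed

lemma wff_eha_ax: "eha_ax \<Gamma> \<phi> \<Longrightarrow> wff \<phi> \<Gamma>"
proof (induction rule: eha_ax.induct)
  case (seq_cases \<Gamma> s \<sigma>)
  then show ?case
    using has_ty_shift[of \<Gamma> s "Seq \<sigma>" "[Seq \<sigma>, \<sigma>, N]" 3] has_ty_shift1[of \<Gamma> s "Seq \<sigma>" N]
    by (auto simp: has_ty_App)
qed (auto simp: has_ty_App intro!: has_ty_shift1 wff_instI wff_at_suc)

lemma wff_st_ax: "st_ax \<Gamma> \<phi> \<Longrightarrow> wff \<phi> \<Gamma>"
proof (induction rule: st_ax.induct)
  case (st_closed t \<sigma> \<Gamma>)
  then show ?case using has_ty_closed[of t \<sigma> \<Gamma>] by simp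
qed (auto simp: has_ty_App intro!: wff_instI wff_at_suc)

lemma wff_H: "\<phi> \<in> H \<Longrightarrow> wff \<phi> []"
proof -
  have 1: "wff (fsub \<Phi> (Var(0 := Var (Suc 0), Suc 0 := Var 0))) (\<tau> # \<sigma> # \<Gamma>)"
    if "wff \<Phi> (\<sigma> # \<tau> # \<Gamma>)" for \<Phi> \<sigma> \<tau> \<Gamma>
    using that by (rule wff_fsub) (auto simp: nth_Cons split: nat.splits)
  have 2: "wff (fsub \<Phi> (Var(0 := Var (Suc 0) \<cdot> Var 0, Suc 0 := Var 0))) (\<sigma> # (\<sigma> \<rightarrow> \<tau>) # \<Gamma>)"
    if "wff \<Phi> (\<tau> # \<sigma> # \<Gamma>)" for \<Phi> \<sigma> \<tau> \<Gamma>
    using that by (rule wff_fsub) (auto simp: nth_Cons has_ty_App split: nat.splits)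
  have 3: "wff (fsub \<phi> (up (\<lambda>i. Var (Suc i)))) (\<sigma> # \<tau> # \<Gamma>)" if "wff \<phi> (\<sigma> # \<Gamma>)" for \<phi> \<sigma> \<tau> \<Gamma>
    using that by (rule wff_fsub) (auto simp: nth_Cons split: nat.splits)
  show "\<phi> \<in> H \<Longrightarrow> wff \<phi> []"
    by (auto simp: H_def EHA_st_or_def EHA_or_def closures_def wff_eha_ax wff_st_ax lift_def
        OS.simps US.simps NU.simps AC.simps IP.simps 1 2 3 intro!: wff_hyper)
qed

section \<open>Forcing\<close>

instance ty :: countable
  by countable_datatype

text \<open>The first component of the decoded index is the code of a type; the second is a mere
  serial number, which provides infinitely many variables of each type.\<close>

definition pty :: "nat \<Rightarrow> ty" where
  "pty k = from_nat (fst (prod_decode k))"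

lemma pty_encode [simp]: "pty (prod_encode (to_nat \<sigma>, n)) = \<sigma>"
  by (simp add: pty_def)

lemma pty_infinitely_often: "\<exists>k\<ge>n. pty k = \<sigma>"
  by (rule exI[of _ "prod_encode (to_nat \<sigma>, n)"]) (simp add: le_prod_encode_2)

text \<open>Larger contexts extend smaller ones at the end, so an index keeps its meaning and
  weakening is substitution of \<open>Var\<close>.\<close>

definition Ctx :: "nat \<Rightarrow> ty list" where
  "Ctx n = map pty [0..<n]"

lemma length_Ctx [simp]: "length (Ctx n) = n" and nth_Ctx [simp]: "i < n \<Longrightarrow> Ctx n ! i = pty i"
  by (simp_all add: Ctx_def)

lemma has_ty_Ctx_mono: "has_ty (Ctx n) t \<sigma> \<Longrightarrow> n \<le> m \<Longrightarrow> has_ty (Ctx m) t \<sigma>"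
  using has_ty_tsub[of "Ctx n" t \<sigma> "Ctx m" Var] by simp

lemma wff_Ctx_mono: "wff \<phi> (Ctx n) \<Longrightarrow> n \<le> m \<Longrightarrow> wff \<phi> (Ctx m)"
  using wff_fsub[of \<phi> "Ctx n" "Ctx m" Var] by simp

lemma prv_Ctx_mono: "prv UNIV H (Ctx n) w \<phi> \<Longrightarrow> n \<le> m \<Longrightarrow> prv UNIV H (Ctx m) w \<phi>"
  using prv_fsub[of H "Ctx n" w \<phi> "Ctx m" Var] wff_H by simp

definition typed :: "tm \<Rightarrow> ty \<Rightarrow> bool" where
  "typed t \<sigma> \<longleftrightarrow> (\<exists>n. has_ty (Ctx n) t \<sigma>)"

definition env :: "(nat \<Rightarrow> tm) \<Rightarrow> ty list \<Rightarrow> bool" where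
  "env e \<Gamma> \<longleftrightarrow> (\<forall>i<length \<Gamma>. typed (e i) (\<Gamma> ! i))"

definition wfm :: "fm \<Rightarrow> bool" where
  "wfm \<phi> \<longleftrightarrow> (\<exists>n. wff \<phi> (Ctx n))"

definition world :: "fm set \<Rightarrow> bool" where
  "world w \<longleftrightarrow> (\<exists>n. \<forall>\<delta>\<in>w. wff \<delta> (Ctx n))"

text \<open>Formula and hypotheses have to fit into one finite context, which leaves infinitely many
  fresh variables of each type. By \<open>forcesD\<close> every larger context serves as well, so
  two forced formulae are combined at the sum of their bounds.\<close>

definition forces :: "fm set \<Rightarrow> fm \<Rightarrow> bool" (infix "\<tturnstile>" 50) where
  "w \<tturnstile> \<phi> \<longleftrightarrow> (\<exists>n. wff \<phi> (Ctx n) \<and> (\<forall>\<delta>\<in>w. wff \<delta> (Ctx n)) \<and> prv UNIV H (Ctx n) w \<phi>)"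

definition later :: "fm set \<Rightarrow> fm set \<Rightarrow> bool" (infix "\<sqsubseteq>" 50) where
  "w \<sqsubseteq> w' \<longleftrightarrow> w \<subseteq> w' \<and> world w'"

lemma typed_Var_pty: "pty k = \<sigma> \<Longrightarrow> typed (Var k) \<sigma>"
  unfolding typed_def by (rule exI[of _ "Suc k"]) simp

lemma typed_closed: "closed_tm t \<sigma> \<Longrightarrow> typed t \<sigma>"
  unfolding typed_def by (rule exI[of _ 0]) (rule has_ty_closed)

lemma typed_Con [simp]: "typed (Con c) \<sigma> \<longleftrightarrow> \<sigma> = con_ty c"
  by (auto simp: typed_def)

lemma typed_default [simp]: "typed (default_tm \<sigma>) \<sigma>"
  by (rule typed_closed) simp

lemma typed_App: "typed f (\<sigma> \<rightarrow> \<tau>) \<Longrightarrow> typed t \<sigma> \<Longrightarrow> typed (f \<cdot> t) \<tau>"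
  unfolding typed_def by (meson has_ty_AppI has_ty_Ctx_mono nat_le_linear)

lemma env_Nil [simp]: "env e []"
  by (simp add: env_def)

lemma env_Cons [simp]: "env (case_nat t e) (\<sigma> # \<Gamma>) \<longleftrightarrow> typed t \<sigma> \<and> env e \<Gamma>"
  by (auto simp: env_def nth_Cons split: nat.splits)

lemma env_Ctx: "env Var (Ctx n)"
  by (auto simp: env_def intro: typed_Var_pty)

lemma env_has_ty: "env e \<Gamma> \<Longrightarrow> \<exists>n. \<forall>m\<ge>n. \<forall>i<length \<Gamma>. has_ty (Ctx m) (e i) (\<Gamma> ! i)"
proof -
  assume "env e \<Gamma>"
  then obtain f where f: "\<And>i. i < length \<Gamma> \<Longrightarrow> has_ty (Ctx (f i)) (e i) (\<Gamma> ! i)"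
    unfolding env_def typed_def by metis
  \<comment> \<open>The sum over the finitely many variables is a common bound for the contexts of
    their images.\<close>
  have "f i \<le> (\<Sum>i<length \<Gamma>. f i)" if "i < length \<Gamma>" for i
    using that by (simp add: member_le_sum)
  then show ?thesis
    by (intro exI[of _ "\<Sum>i<length \<Gamma>. f i"]) (meson f has_ty_Ctx_mono order_trans)
qed

lemma typed_tsub: "has_ty \<Gamma> t \<sigma> \<Longrightarrow> env e \<Gamma> \<Longrightarrow> typed (tsub e t) \<sigma>"
  using env_has_ty[of e \<Gamma>] has_ty_tsub[of \<Gamma> t \<sigma>] unfolding typed_def by blast

lemma wfm_fsub: "wff \<phi> \<Gamma> \<Longrightarrow> env e \<Gamma> \<Longrightarrow> wfm (fsub \<phi> e)"
  using env_has_ty[of e \<Gamma>] wff_fsub[of \<phi> \<Gamma>] unfolding wfm_def by blast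

lemma wfm_simps [simp]:
  "wfm Fls" "wfm (\<phi> \<^bold>\<and> \<psi>) \<longleftrightarrow> wfm \<phi> \<and> wfm \<psi>" "wfm (\<phi> \<^bold>\<or> \<psi>) \<longleftrightarrow> wfm \<phi> \<and> wfm \<psi>"
  "wfm (\<phi> \<^bold>\<longrightarrow> \<psi>) \<longleftrightarrow> wfm \<phi> \<and> wfm \<psi>" "wfm (St \<sigma> t) \<longleftrightarrow> typed t \<sigma>"
  unfolding wfm_def typed_def by (auto, (meson wff_Ctx_mono nat_le_linear)+)

lemma wfm_Eq [simp]: "wfm (Eq \<sigma> t u) \<longleftrightarrow> typed t \<sigma> \<and> typed u \<sigma>"
  unfolding wfm_def typed_def by (auto, meson has_ty_Ctx_mono nat_le_linear)

lemma forcesD: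
  assumes "w \<tturnstile> \<phi>"
  shows "\<exists>n. \<forall>m\<ge>n. wff \<phi> (Ctx m) \<and> (\<forall>\<delta>\<in>w. wff \<delta> (Ctx m)) \<and> prv UNIV H (Ctx m) w \<phi>"
  using assms unfolding forces_def by (meson prv_Ctx_mono wff_Ctx_mono)

lemma worldD: "world w \<Longrightarrow> \<exists>n. \<forall>m\<ge>n. \<forall>\<delta>\<in>w. wff \<delta> (Ctx m)"
  unfolding world_def by (meson wff_Ctx_mono)

lemma wfmD: "wfm \<phi> \<Longrightarrow> \<exists>n. \<forall>m\<ge>n. wff \<phi> (Ctx m)"
  unfolding wfm_def by (meson wff_Ctx_mono)

lemma typedD: "typed t \<sigma> \<Longrightarrow> \<exists>n. \<forall>m\<ge>n. has_ty (Ctx m) t \<sigma>"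
  unfolding typed_def by (meson has_ty_Ctx_mono)

lemma forces_world: "w \<tturnstile> \<phi> \<Longrightarrow> world w"
  and forces_wfm: "w \<tturnstile> \<phi> \<Longrightarrow> wfm \<phi>"
  unfolding forces_def world_def wfm_def by blast+

lemma world_insert: "world w \<Longrightarrow> wfm \<phi> \<Longrightarrow> world (insert \<phi> w)"
proof -
  assume "world w" "wfm \<phi>"
  then obtain n n' where "\<And>m. m \<ge> n \<Longrightarrow> \<forall>\<delta>\<in>w. wff \<delta> (Ctx m)" "\<And>m. m \<ge> n' \<Longrightarrow> wff \<phi> (Ctx m)"
    using worldD wfmD by metis
  from this(1)[of "n + n'"] this(2)[of "n + n'"] show ?thesis
    unfolding world_def by (intro exI[of _ "n + n'"]) simp
qed

lemma later_refl: "world w \<Longrightarrow> w \<sqsubseteq> w"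
  and later_trans: "w \<sqsubseteq> w' \<Longrightarrow> w' \<sqsubseteq> w'' \<Longrightarrow> w \<sqsubseteq> w''"
  and later_world: "w \<sqsubseteq> w' \<Longrightarrow> world w'"
  by (auto simp: later_def)

lemma forces_mono: "w \<tturnstile> \<phi> \<Longrightarrow> w \<sqsubseteq> w' \<Longrightarrow> w' \<tturnstile> \<phi>"
proof -
  assume a: "w \<tturnstile> \<phi>" and b: "w \<sqsubseteq> w'"
  obtain n where n: "\<And>m. m \<ge> n \<Longrightarrow> wff \<phi> (Ctx m) \<and> prv UNIV H (Ctx m) w \<phi>"
    using forcesD[OF a] by blast
  obtain n' where "\<And>m. m \<ge> n' \<Longrightarrow> \<forall>\<delta>\<in>w'. wff \<delta> (Ctx m)"
    using worldD[OF later_world[OF b]] by blast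
  then show ?thesis
    using n[of "max n n'"] b unfolding forces_def later_def
    by (intro exI[of _ "max n n'"]) (auto intro: prv_mono)
qed

lemma forces_hyp: "world w \<Longrightarrow> \<phi> \<in> w \<Longrightarrow> w \<tturnstile> \<phi>"
  unfolding world_def forces_def by (auto intro: prv.hyp)

text \<open>An axiom is taken over a short context that lists just its parameters, and
  \<open>e\<close> then supplies arbitrary typed terms for them. In this way the axioms can be used
  without looking for a particular \<open>Ctx n\<close>.\<close>

lemma forces_axiom:
  assumes "A \<Gamma> \<phi>" "closures A \<subseteq> H" "env e \<Gamma>" "world w"
  shows "w \<tturnstile> fsub \<phi> e"
proof -
  have c: "closure \<Gamma> \<phi> \<in> H" using assms(1,2) by (auto simp: closures_def)
  obtain n1 where 1: "\<And>m. m \<ge> n1 \<Longrightarrow> \<forall>i<length \<Gamma>. has_ty (Ctx m) (e i) (\<Gamma> ! i)"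
    using env_has_ty[OF assms(3)] by blast
  obtain n2 where 2: "\<And>m. m \<ge> n2 \<Longrightarrow> \<forall>\<delta>\<in>w. wff \<delta> (Ctx m)"
    using worldD[OF assms(4)] by blast
  let ?m = "n1 + n2"
  have "prv UNIV H (Ctx ?m) w (fsub \<phi> e)"
    by (rule prv_closure[OF prv.ax[OF c]]) (use 1[of ?m] wff_H[OF c] in auto)
  moreover have "wff (fsub \<phi> e) (Ctx ?m)"
    by (rule wff_fsub[of _ \<Gamma>]) (use 1[of ?m] wff_H[OF c] in auto)
  ultimately show ?thesis unfolding forces_def using 2[of ?m] by (auto intro!: exI[of _ ?m])
qed

lemma closures_H [simp]: "closures eha_ax \<subseteq> H" "closures st_ax \<subseteq> H" "closures OS \<subseteq> H"
  "closures US \<subseteq> H" "closures NU \<subseteq> H" "closures AC \<subseteq> H" "closures IP \<subseteq> H"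
  by (auto simp: H_def EHA_st_or_def EHA_or_def)

lemmas forces_eha = forces_axiom[of eha_ax, OF _ closures_H(1)]
lemmas forces_st_ax = forces_axiom[of st_ax, OF _ closures_H(2)]

lemma forces_axiom_Ctx: "A (Ctx n) \<phi> \<Longrightarrow> closures A \<subseteq> H \<Longrightarrow> world w \<Longrightarrow> w \<tturnstile> \<phi>"
  using forces_axiom[of A "Ctx n" \<phi> Var w] by (simp add: env_Ctx)

section \<open>Forcing clauses for connectives and internal quantifiers\<close>

lemma forces_mp:
  assumes "w \<tturnstile> (\<phi> \<^bold>\<longrightarrow> \<psi>)" "w \<tturnstile> \<phi>"
  shows "w \<tturnstile> \<psi>"
proof -
  obtain n1 where 1: "\<And>m. m \<ge> n1 \<Longrightarrow> wff (\<phi> \<^bold>\<longrightarrow> \<psi>) (Ctx m) \<and> prv UNIV H (Ctx m) w (\<phi> \<^bold>\<longrightarrow> \<psi>)"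
    using forcesD[OF assms(1)] by blast
  obtain n2 where 2: "\<And>m. m \<ge> n2 \<Longrightarrow> (\<forall>\<delta>\<in>w. wff \<delta> (Ctx m)) \<and> prv UNIV H (Ctx m) w \<phi>"
    using forcesD[OF assms(2)] by blast
  show ?thesis unfolding forces_def
    using 1[of "n1 + n2"] 2[of "n1 + n2"]
    by (intro exI[of _ "n1 + n2"]) (auto intro: prv.imp_elim)
qed

lemma forces_andI:
  assumes "w \<tturnstile> \<phi>" "w \<tturnstile> \<psi>"
  shows "w \<tturnstile> (\<phi> \<^bold>\<and> \<psi>)"
proof -
  obtain n1 where 1: "\<And>m. m \<ge> n1 \<Longrightarrow> wff \<phi> (Ctx m) \<and> prv UNIV H (Ctx m) w \<phi>"
    using forcesD[OF assms(1)] by blast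
  obtain n2 where 2: "\<And>m. m \<ge> n2 \<Longrightarrow> wff \<psi> (Ctx m) \<and> (\<forall>\<delta>\<in>w. wff \<delta> (Ctx m)) \<and> prv UNIV H (Ctx m) w \<psi>"
    using forcesD[OF assms(2)] by blast
  show ?thesis unfolding forces_def
    using 1[of "n1 + n2"] 2[of "n1 + n2"]
    by (intro exI[of _ "n1 + n2"]) (auto intro: prv.and_intro)
qed

lemma forces_andD: "w \<tturnstile> (\<phi> \<^bold>\<and> \<psi>) \<Longrightarrow> w \<tturnstile> \<phi>" "w \<tturnstile> (\<phi> \<^bold>\<and> \<psi>) \<Longrightarrow> w \<tturnstile> \<psi>"
  unfolding forces_def by (auto intro: prv.and_elim1 prv.and_elim2)

lemma forces_and [simp]: "w \<tturnstile> (\<phi> \<^bold>\<and> \<psi>) \<longleftrightarrow> w \<tturnstile> \<phi> \<and> w \<tturnstile> \<psi>"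
  by (meson forces_andI forces_andD)

lemma forces_flsE:
  assumes "w \<tturnstile> Fls" "wfm \<phi>"
  shows "w \<tturnstile> \<phi>"
proof -
  obtain n1 where 1: "\<And>m. m \<ge> n1 \<Longrightarrow> wff \<phi> (Ctx m)" using wfmD[OF assms(2)] by blast
  obtain n2 where 2: "\<And>m. m \<ge> n2 \<Longrightarrow> (\<forall>\<delta>\<in>w. wff \<delta> (Ctx m)) \<and> prv UNIV H (Ctx m) w Fls"
    using forcesD[OF assms(1)] by blast
  show ?thesis unfolding forces_def
    using 1[of "n1 + n2"] 2[of "n1 + n2"]
    by (intro exI[of _ "n1 + n2"]) (auto intro: prv.fls_elim)
qed

lemma forces_orI:
  assumes "w \<tturnstile> \<phi> \<or> w \<tturnstile> \<psi>" "wfm \<phi>" "wfm \<psi>"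
  shows "w \<tturnstile> (\<phi> \<^bold>\<or> \<psi>)"
proof -
  obtain n1 where 1: "\<And>m. m \<ge> n1 \<Longrightarrow> wff \<phi> (Ctx m)" using wfmD[OF assms(2)] by blast
  obtain n2 where 2: "\<And>m. m \<ge> n2 \<Longrightarrow> wff \<psi> (Ctx m)" using wfmD[OF assms(3)] by blast
  obtain n3 where 3: "\<And>m. m \<ge> n3 \<Longrightarrow> (\<forall>\<delta>\<in>w. wff \<delta> (Ctx m)) \<and>
      (prv UNIV H (Ctx m) w \<phi> \<or> prv UNIV H (Ctx m) w \<psi>)"
    using assms(1) forcesD by metis
  let ?m = "n1 + n2 + n3"
  show ?thesis unfolding forces_def
    using 1[of ?m] 2[of ?m] 3[of ?m]
    by (intro exI[of _ ?m]) (auto intro: prv.or_intro1 prv.or_intro2)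
qed

lemma forces_orE:
  assumes or: "w \<tturnstile> (\<phi> \<^bold>\<or> \<psi>)"
    and "\<And>w'. w \<sqsubseteq> w' \<Longrightarrow> w' \<tturnstile> \<phi> \<Longrightarrow> w' \<tturnstile> \<chi>"
    and "\<And>w'. w \<sqsubseteq> w' \<Longrightarrow> w' \<tturnstile> \<psi> \<Longrightarrow> w' \<tturnstile> \<chi>"
  shows "w \<tturnstile> \<chi>"
proof -
  have w: "world (insert \<phi> w)" "world (insert \<psi> w)"
    using forces_world[OF or] forces_wfm[OF or] by (auto intro: world_insert)
  then have *: "insert \<phi> w \<tturnstile> \<chi>" "insert \<psi> w \<tturnstile> \<chi>"
    using assms(2)[of "insert \<phi> w"] assms(3)[of "insert \<psi> w"]
    by (auto simp: later_def forces_hyp)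
  obtain n1 where 1: "\<And>m. m \<ge> n1 \<Longrightarrow> (\<forall>\<delta>\<in>w. wff \<delta> (Ctx m)) \<and> prv UNIV H (Ctx m) w (\<phi> \<^bold>\<or> \<psi>)"
    using forcesD[OF or] by blast
  obtain n2 where 2: "\<And>m. m \<ge> n2 \<Longrightarrow> wff \<chi> (Ctx m) \<and> prv UNIV H (Ctx m) (insert \<phi> w) \<chi>"
    using forcesD[OF *(1)] by blast
  obtain n3 where 3: "\<And>m. m \<ge> n3 \<Longrightarrow> prv UNIV H (Ctx m) (insert \<psi> w) \<chi>"
    using forcesD[OF *(2)] by blast
  let ?m = "n1 + n2 + n3"
  show ?thesis unfolding forces_def
    using 1[of ?m] 2[of ?m] 3[of ?m] by (intro exI[of _ ?m]) (auto intro: prv.or_elim)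
qed

text \<open>The later world \<open>insert \<phi> w\<close> is generic: what it forces is derivable
  from \<open>w\<close> with the additional hypothesis \<open>\<phi>\<close>, which is then
  discharged.\<close>

lemma forces_impI:
  assumes "wfm \<phi>" "world w" "\<And>w'. w \<sqsubseteq> w' \<Longrightarrow> w' \<tturnstile> \<phi> \<Longrightarrow> w' \<tturnstile> \<psi>"
  shows "w \<tturnstile> (\<phi> \<^bold>\<longrightarrow> \<psi>)"
proof -
  have "world (insert \<phi> w)" using assms(1,2) by (simp add: world_insert)
  then have "insert \<phi> w \<tturnstile> \<psi>" by (intro assms(3)) (auto simp: later_def forces_hyp)
  then show ?thesis unfolding forces_def by (auto intro: prv.imp_intro)
qed

text \<open>Turns the pool variable \<open>k\<close> into variable 0 of a new quantifier and lifts
  all others. On formulae over a context of length at most \<open>k\<close> it agrees with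
  \<open>lift\<close>.\<close>

definition fresh_sub :: "nat \<Rightarrow> nat \<Rightarrow> tm" where
  "fresh_sub k i = (if i = k then Var 0 else Var (Suc i))"

lemma fsub_fresh: "wff \<phi> (Ctx n) \<Longrightarrow> n \<le> k \<Longrightarrow> fsub \<phi> (fresh_sub k) = lift \<phi>"
  unfolding lift_def by (rule fsub_cong) (auto simp: fresh_sub_def)

lemma fsub_fresh_inst:
  assumes "wff \<phi> (\<sigma> # Ctx n)" "n \<le> k"
  shows "fsub (inst (Var k) \<phi>) (fresh_sub k) = \<phi>"
proof -
  have "fsub \<phi> (case_nat (Var 0) (fresh_sub k)) = fsub \<phi> Var"
    by (rule fsub_cong[OF assms(1)]) (use assms(2) in \<open>auto simp: fresh_sub_def split: nat.split\<close>)
  then show ?thesis by (simp add: fsub_inst fresh_sub_def)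
qed

lemma prv_fresh:
  assumes "prv UNIV H (Ctx m) w \<chi>" "pty k = \<sigma>" "k < m"
  shows "prv UNIV H (\<sigma> # Ctx m) ((\<lambda>\<delta>. fsub \<delta> (fresh_sub k)) ` w) (fsub \<chi> (fresh_sub k))"
  by (rule prv_fsub[OF assms(1) wff_H]) (use assms(2,3) in \<open>auto simp: fresh_sub_def\<close>)

text \<open>In contrast to implication, the premise concerns only the world \<open>w\<close> itself:
  a variable that is fresh for \<open>w\<close> and \<open>\<phi>\<close> is already a generic
  element.\<close>

lemma forces_allI:
  assumes "\<And>t. typed t \<sigma> \<Longrightarrow> w \<tturnstile> inst t \<phi>"
  shows "w \<tturnstile> All \<sigma> \<phi>"
proof -
  \<comment> \<open>This first instance only bounds the free variables of \<open>\<phi>\<close>;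
    without such a bound no variable could be called fresh.\<close>
  obtain k0 where k0: "pty k0 = \<sigma>" using pty_infinitely_often by blast
  obtain n where n: "\<And>m. m \<ge> n \<Longrightarrow> wff (inst (Var k0) \<phi>) (Ctx m) \<and> (\<forall>\<delta>\<in>w. wff \<delta> (Ctx m))"
    using forcesD[OF assms[OF typed_Var_pty[OF k0]]] by blast
  let ?n = "n + Suc k0"
  have wf: "wff \<phi> (\<sigma> # Ctx m)" if "m \<ge> ?n" for m
    by (rule wff_instD[of "Var k0"]) (use n[of m] that k0 in auto)
  \<comment> \<open>The instance at a variable beyond the bound is the one that is
    generalised.\<close>
  obtain k where k: "k \<ge> ?n" "pty k = \<sigma>" using pty_infinitely_often by blast
  obtain n' where n': "\<And>m. m \<ge> n' \<Longrightarrow> prv UNIV H (Ctx m) w (inst (Var k) \<phi>)"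
    using forcesD[OF assms[OF typed_Var_pty[OF k(2)]]] by blast
  let ?m = "n' + Suc k"
  have "prv UNIV H (\<sigma> # Ctx ?m) ((\<lambda>\<delta>. fsub \<delta> (fresh_sub k)) ` w) \<phi>"
    using prv_fresh[OF n'[of ?m] k(2)] fsub_fresh_inst[OF wf[of ?n] k(1)] by simp
  \<comment> \<open>The formulae of \<open>w\<close> do not contain \<open>k\<close>, so the
    renaming acts on them as the \<open>lift\<close> that \<open>all_intro\<close> requires.\<close>
  moreover have "(\<lambda>\<delta>. fsub \<delta> (fresh_sub k)) ` w = lift ` w"
    by (rule image_cong[OF refl], rule fsub_fresh[of _ ?n]) (use n[of ?n] k(1) in auto)
  ultimately have "prv UNIV H (Ctx ?m) w (All \<sigma> \<phi>)" by (auto intro: prv.all_intro)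
  then show ?thesis unfolding forces_def
    using n[of ?m] wf[of ?m] k(1) by (intro exI[of _ ?m]) auto
qed

lemma forces_allE:
  assumes "w \<tturnstile> All \<sigma> \<phi>" "typed t \<sigma>"
  shows "w \<tturnstile> inst t \<phi>"
proof -
  obtain n1 where 1: "\<And>m. m \<ge> n1 \<Longrightarrow> wff \<phi> (\<sigma> # Ctx m) \<and> (\<forall>\<delta>\<in>w. wff \<delta> (Ctx m)) \<and>
      prv UNIV H (Ctx m) w (All \<sigma> \<phi>)"
    using forcesD[OF assms(1)] by auto
  obtain n2 where 2: "\<And>m. m \<ge> n2 \<Longrightarrow> has_ty (Ctx m) t \<sigma>" using typedD[OF assms(2)] by blast
  show ?thesis unfolding forces_def
    using 1[of "n1 + n2"] 2[of "n1 + n2"]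
    by (intro exI[of _ "n1 + n2"]) (auto intro: prv.all_elim wff_instI)
qed

lemma forces_exI:
  assumes "w \<tturnstile> inst t \<phi>" "typed t \<sigma>"
  shows "w \<tturnstile> Ex \<sigma> \<phi>"
proof -
  obtain n1 where 1: "\<And>m. m \<ge> n1 \<Longrightarrow> wff (inst t \<phi>) (Ctx m) \<and> (\<forall>\<delta>\<in>w. wff \<delta> (Ctx m)) \<and>
      prv UNIV H (Ctx m) w (inst t \<phi>)"
    using forcesD[OF assms(1)] by auto
  obtain n2 where 2: "\<And>m. m \<ge> n2 \<Longrightarrow> has_ty (Ctx m) t \<sigma>" using typedD[OF assms(2)] by blast
  let ?m = "n1 + n2"
  have "wff \<phi> (\<sigma> # Ctx ?m)" using 1[of ?m] 2[of ?m] by (auto intro: wff_instD)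
  then show ?thesis unfolding forces_def
    using 1[of ?m] 2[of ?m] by (intro exI[of _ ?m]) (auto intro: prv.ex_intro)
qed

text \<open>The witness is again a fresh variable, and the later world is \<open>w\<close> together
  with the instance at it. As \<open>\<chi>\<close> does not contain that variable, renaming it into
  a bound one gives the second premise of \<open>ex_elim\<close>.\<close>

lemma forces_exE:
  assumes ex: "w \<tturnstile> Ex \<sigma> \<phi>"
    and elim: "\<And>t w'. w \<sqsubseteq> w' \<Longrightarrow> typed t \<sigma> \<Longrightarrow> w' \<tturnstile> inst t \<phi> \<Longrightarrow> w' \<tturnstile> \<chi>"
  shows "w \<tturnstile> \<chi>"
proof -
  obtain n where n: "\<And>m. m \<ge> n \<Longrightarrow> wff \<phi> (\<sigma> # Ctx m) \<and> (\<forall>\<delta>\<in>w. wff \<delta> (Ctx m)) \<and>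
      prv UNIV H (Ctx m) w (Ex \<sigma> \<phi>)"
    using forcesD[OF ex] by auto
  have elim': "insert (inst (Var k) \<phi>) w \<tturnstile> \<chi>" if "pty k = \<sigma>" for k
  proof (rule elim[of _ "Var k"])
    have "wff (inst (Var k) \<phi>) (Ctx (n + Suc k))"
      using n[of "n + Suc k"] that by (auto intro!: wff_instI)
    then have "world (insert (inst (Var k) \<phi>) w)"
      using forces_world[OF ex] by (auto intro!: world_insert simp: wfm_def)
    then show "w \<sqsubseteq> insert (inst (Var k) \<phi>) w" "insert (inst (Var k) \<phi>) w \<tturnstile> inst (Var k) \<phi>"
      by (auto simp: later_def forces_hyp)
  qed (rule typed_Var_pty[OF that])
  \<comment> \<open>A preliminary use at an arbitrary variable shows in which context
    \<open>\<chi>\<close> lives; only then can a fresh variable be picked.\<close>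
  obtain k0 where "pty k0 = \<sigma>" using pty_infinitely_often by blast
  then obtain n1 where n1: "\<And>m. m \<ge> n1 \<Longrightarrow> wff \<chi> (Ctx m)"
    using wfmD[OF forces_wfm[OF elim']] by blast
  let ?n = "n + n1"
  obtain k where k: "k \<ge> ?n" "pty k = \<sigma>" using pty_infinitely_often by blast
  obtain n' where n': "\<And>m. m \<ge> n' \<Longrightarrow> prv UNIV H (Ctx m) (insert (inst (Var k) \<phi>) w) \<chi>"
    using forcesD[OF elim'[OF k(2)]] by blast
  let ?m = "n' + Suc k"
  have "(\<lambda>\<delta>. fsub \<delta> (fresh_sub k)) ` w = lift ` w"
    by (rule image_cong[OF refl], rule fsub_fresh[of _ ?n]) (use n[of ?n] k(1) in auto)
  moreover have "fsub \<chi> (fresh_sub k) = lift \<chi>"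
    by (rule fsub_fresh[of _ ?n]) (use n1[of ?n] k(1) in auto)
  moreover have "fsub (inst (Var k) \<phi>) (fresh_sub k) = \<phi>"
    by (rule fsub_fresh_inst[of _ _ ?n]) (use n[of ?n] k(1) in auto)
  ultimately have *: "prv UNIV H (\<sigma> # Ctx ?m) (insert \<phi> (lift ` w)) (lift \<chi>)"
    using prv_fresh[OF n'[of ?m] k(2)] by simp
  have "prv UNIV H (Ctx ?m) w (Ex \<sigma> \<phi>)" using n[of ?m] k(1) by simp
  from prv.ex_elim[OF this *] have "prv UNIV H (Ctx ?m) w \<chi>" .
  then show ?thesis unfolding forces_def
    using n[of ?m] n1[of ?m] k(1) by (intro exI[of _ ?m]) auto
qed

section \<open>Standard terms and external quantifiers, single and in blocks\<close>

definition st :: "fm set \<Rightarrow> tm \<Rightarrow> ty \<Rightarrow> bool" where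
  "st w t \<sigma> \<longleftrightarrow> w \<tturnstile> St \<sigma> t"

lemma st_typed: "st w t \<sigma> \<Longrightarrow> typed t \<sigma>"
  using forces_wfm[of w "St \<sigma> t"] by (simp add: st_def)

lemma st_world: "st w t \<sigma> \<Longrightarrow> world w"
  by (simp add: st_def forces_world)

lemma st_mono: "st w t \<sigma> \<Longrightarrow> w \<sqsubseteq> w' \<Longrightarrow> st w' t \<sigma>"
  by (simp add: st_def forces_mono)

lemma st_App: "st w f (\<sigma> \<rightarrow> \<tau>) \<Longrightarrow> st w t \<sigma> \<Longrightarrow> st w (f \<cdot> t) \<tau>"
  using forces_st_ax[OF st_ax.st_app[of "[\<sigma>, \<sigma> \<rightarrow> \<tau>]" "Var 1" \<sigma> \<tau> "Var 0"],
      of "case_nat t (case_nat f Var)" w] st_typed[of w f] st_typed[of w t] forces_world[of w]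
  by (auto simp: st_def dest: forces_mp)

lemma st_closed: "closed_tm t \<sigma> \<Longrightarrow> world w \<Longrightarrow> st w t \<sigma>"
  using forces_st_ax[OF st_ax.st_closed[of t \<sigma> "[]"], of Var w] by (simp add: st_def)

text \<open>The unfolded quantifier contains an implication from \<open>St\<close>, so later worlds
  enter the premise although \<open>forces_allI\<close> does without them.\<close>

lemma forces_AllStI:
  assumes w: "world w" and "\<And>w' t. w \<sqsubseteq> w' \<Longrightarrow> st w' t \<sigma> \<Longrightarrow> w' \<tturnstile> inst t \<phi>"
  shows "w \<tturnstile> AllSt \<sigma> \<phi>"
proof -
  have *: "w \<tturnstile> All \<sigma> (St \<sigma> (Var 0) \<^bold>\<longrightarrow> \<phi>)"
  proof (rule forces_allI)
    fix t assume t: "typed t \<sigma>"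
    have "w \<tturnstile> (St \<sigma> t \<^bold>\<longrightarrow> inst t \<phi>)"
      by (rule forces_impI) (use t w assms(2) in \<open>auto simp: st_def\<close>)
    then show "w \<tturnstile> inst t (St \<sigma> (Var 0) \<^bold>\<longrightarrow> \<phi>)" by (simp add: inst_def)
  qed
  \<comment> \<open>Whatever is forced is well formed, so the side condition of the defining axiom
    is read off the unfolded formula and need not be assumed.\<close>
  then obtain n where "wff \<phi> (\<sigma> # Ctx n)" using forces_wfm by (fastforce simp: wfm_def)
  from forces_axiom_Ctx[of st_ax, OF st_ax.all_st[OF this] _ w] * show ?thesis
    using forces_mp by auto
qed

lemma forces_AllStE:
  assumes a: "w \<tturnstile> AllSt \<sigma> \<phi>" and t: "st w t \<sigma>"
  shows "w \<tturnstile> inst t \<phi>"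
proof -
  obtain n where "wff \<phi> (\<sigma> # Ctx n)" using forces_wfm[OF a] by (fastforce simp: wfm_def)
  from forces_axiom_Ctx[of st_ax, OF st_ax.all_st[OF this] _ forces_world[OF a]]
  have "w \<tturnstile> All \<sigma> (St \<sigma> (Var 0) \<^bold>\<longrightarrow> \<phi>)" using forces_mp a by auto
  from forces_allE[OF this st_typed[OF t]] t show ?thesis
    using forces_mp by (auto simp: inst_def st_def)
qed

lemma forces_ExStI:
  assumes t: "st w t \<sigma>" and a: "w \<tturnstile> inst t \<phi>"
  shows "w \<tturnstile> ExSt \<sigma> \<phi>"
proof -
  have *: "w \<tturnstile> Ex \<sigma> (St \<sigma> (Var 0) \<^bold>\<and> \<phi>)"
    by (rule forces_exI[OF _ st_typed[OF t]]) (use t a in \<open>simp add: inst_def st_def\<close>)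
  then obtain n where "wff \<phi> (\<sigma> # Ctx n)" using forces_wfm by (fastforce simp: wfm_def)
  from forces_axiom_Ctx[of st_ax, OF st_ax.ex_st[OF this] _ forces_world[OF a]] * show ?thesis
    using forces_mp by auto
qed

lemma forces_ExStE:
  assumes a: "w \<tturnstile> ExSt \<sigma> \<phi>"
    and elim: "\<And>t w'. w \<sqsubseteq> w' \<Longrightarrow> st w' t \<sigma> \<Longrightarrow> w' \<tturnstile> inst t \<phi> \<Longrightarrow> w' \<tturnstile> \<chi>"
  shows "w \<tturnstile> \<chi>"
proof -
  obtain n where "wff \<phi> (\<sigma> # Ctx n)" using forces_wfm[OF a] by (fastforce simp: wfm_def)
  from forces_axiom_Ctx[of st_ax, OF st_ax.ex_st[OF this] _ forces_world[OF a]]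
  have "w \<tturnstile> Ex \<sigma> (St \<sigma> (Var 0) \<^bold>\<and> \<phi>)" using forces_mp a by auto
  then show ?thesis
    by (rule forces_exE) (auto simp: inst_def st_def intro: elim[unfolded inst_def st_def])
qed

text \<open>The last entry of the tuple gets index 0, in agreement with the innermost quantifier of
  a \<open>foldr\<close> block and with \<open>vars\<close>.\<close>

abbreviation push :: "(nat \<Rightarrow> tm) \<Rightarrow> tm list \<Rightarrow> nat \<Rightarrow> tm" where
  "push e ts \<equiv> fold case_nat ts e"

abbreviation sts :: "fm set \<Rightarrow> tm list \<Rightarrow> ty list \<Rightarrow> bool" where
  "sts w \<equiv> list_all2 (st w)"

lemma sts_mono: "sts w ts \<sigma>s \<Longrightarrow> w \<sqsubseteq> w' \<Longrightarrow> sts w' ts \<sigma>s"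
  using list_all2_mono[of "st w" ts \<sigma>s "st w'"] st_mono by blast

lemma forces_AllStsI:
  assumes "world w"
    and "\<And>w' ts. w \<sqsubseteq> w' \<Longrightarrow> sts w' ts \<sigma>s \<Longrightarrow> w' \<tturnstile> fsub \<phi> (push e ts)"
  shows "w \<tturnstile> fsub (foldr AllSt \<sigma>s \<phi>) e"
  using assms
proof (induction \<sigma>s arbitrary: w e)
  case Nil
  then show ?case by (simp add: later_refl)
next
  case (Cons \<sigma> \<sigma>s)
  have "w \<tturnstile> AllSt \<sigma> (fsub (foldr AllSt \<sigma>s \<phi>) (up e))"
  proof (rule forces_AllStI[OF Cons.prems(1)])
    fix w' t assume *: "w \<sqsubseteq> w'" "st w' t \<sigma>"
    show "w' \<tturnstile> inst t (fsub (foldr AllSt \<sigma>s \<phi>) (up e))"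
      unfolding inst_up
    proof (rule Cons.IH[OF st_world[OF *(2)]])
      fix w'' ts assume **: "w' \<sqsubseteq> w''" "sts w'' ts \<sigma>s"
      show "w'' \<tturnstile> fsub \<phi> (push (case_nat t e) ts)"
        using Cons.prems(2)[OF later_trans[OF *(1) **(1)], of "t # ts"] ** st_mono[OF *(2) **(1)]
        by simp
    qed
  qed
  then show ?case by simp
qed

lemma forces_AllStsE:
  "w \<tturnstile> fsub (foldr AllSt \<sigma>s \<phi>) e \<Longrightarrow> sts w ts \<sigma>s \<Longrightarrow> w \<tturnstile> fsub \<phi> (push e ts)"
proof (induction \<sigma>s arbitrary: ts e)
  case (Cons \<sigma> \<sigma>s)
  then obtain t ts' where t: "ts = t # ts'" "st w t \<sigma>" "sts w ts' \<sigma>s"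
    by (auto simp: list_all2_Cons2)
  have "w \<tturnstile> AllSt \<sigma> (fsub (foldr AllSt \<sigma>s \<phi>) (up e))" using Cons.prems(1) by simp
  from forces_AllStE[OF this t(2)] have "w \<tturnstile> fsub (foldr AllSt \<sigma>s \<phi>) (case_nat t e)"
    by (simp add: inst_up)
  from Cons.IH[OF this t(3)] show ?case by (simp add: t(1))
qed simp

lemma forces_ExStsI:
  "sts w ts \<sigma>s \<Longrightarrow> w \<tturnstile> fsub \<phi> (push e ts) \<Longrightarrow> w \<tturnstile> fsub (foldr ExSt \<sigma>s \<phi>) e"
proof (induction \<sigma>s arbitrary: ts e)
  case (Cons \<sigma> \<sigma>s)
  then obtain t ts' where t: "ts = t # ts'" "st w t \<sigma>" "sts w ts' \<sigma>s"
    by (auto simp: list_all2_Cons2)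
  have "w \<tturnstile> fsub (foldr ExSt \<sigma>s \<phi>) (case_nat t e)"
    by (rule Cons.IH[OF t(3)]) (use Cons.prems(2) t(1) in simp)
  then show ?case using forces_ExStI[OF t(2), of "fsub (foldr ExSt \<sigma>s \<phi>) (up e)"]
    by (simp add: inst_up)
qed simp

lemma forces_ExStsE:
  assumes "w \<tturnstile> fsub (foldr ExSt \<sigma>s \<phi>) e"
    and "\<And>w' ts. w \<sqsubseteq> w' \<Longrightarrow> sts w' ts \<sigma>s \<Longrightarrow> w' \<tturnstile> fsub \<phi> (push e ts) \<Longrightarrow> w' \<tturnstile> \<chi>"
  shows "w \<tturnstile> \<chi>"
  using assms
proof (induction \<sigma>s arbitrary: w e)
  case Nil
  then show ?case using later_refl[OF forces_world[OF Nil(1)]] by simp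
next
  case (Cons \<sigma> \<sigma>s)
  have "w \<tturnstile> ExSt \<sigma> (fsub (foldr ExSt \<sigma>s \<phi>) (up e))" using Cons.prems(1) by simp
  then show ?case
  proof (rule forces_ExStE)
    fix t w' assume *: "w \<sqsubseteq> w'" "st w' t \<sigma>" "w' \<tturnstile> inst t (fsub (foldr ExSt \<sigma>s \<phi>) (up e))"
    show "w' \<tturnstile> \<chi>"
    proof (rule Cons.IH[OF *(3)[unfolded inst_up]])
      fix w'' ts
      assume **: "w' \<sqsubseteq> w''" "sts w'' ts \<sigma>s" "w'' \<tturnstile> fsub \<phi> (push (case_nat t e) ts)"
      show "w'' \<tturnstile> \<chi>"
        using Cons.prems(2)[OF later_trans[OF *(1) **(1)], of "t # ts"] ** st_mono[OF *(2) **(1)]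
        by simp
    qed
  qed
qed

section \<open>Equality and induction\<close>

lemma eq_typed: "w \<tturnstile> Eq \<sigma> t u \<Longrightarrow> typed t \<sigma>" "w \<tturnstile> Eq \<sigma> t u \<Longrightarrow> typed u \<sigma>"
  using forces_wfm[of w "Eq \<sigma> t u"] by simp_all

lemma eq_refl: "typed t \<sigma> \<Longrightarrow> world w \<Longrightarrow> w \<tturnstile> Eq \<sigma> t t"
  using forces_eha[OF eha_ax.eq_refl[of "[\<sigma>]" "Var 0" \<sigma>], of "case_nat t Var" w] by simp

lemma eq_sym: "w \<tturnstile> Eq \<sigma> t u \<Longrightarrow> w \<tturnstile> Eq \<sigma> u t"
  using forces_eha[OF eha_ax.eq_sym[of "[\<sigma>, \<sigma>]" "Var 0" \<sigma> "Var (Suc 0)"],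
      of "case_nat t (case_nat u Var)" w] eq_typed[of w \<sigma> t u] forces_world[of w]
  by (auto dest: forces_mp)

lemma eq_trans [trans]: "w \<tturnstile> Eq \<sigma> t u \<Longrightarrow> w \<tturnstile> Eq \<sigma> u v \<Longrightarrow> w \<tturnstile> Eq \<sigma> t v"
  using forces_eha[OF eha_ax.eq_trans[of "[\<sigma>, \<sigma>, \<sigma>]" "Var 0" \<sigma> "Var (Suc 0)" "Var (Suc (Suc 0))"],
      of "case_nat t (case_nat u (case_nat v Var))" w]
    eq_typed[of w \<sigma> t u] eq_typed[of w \<sigma> u v] forces_world[of w]
  by (auto dest: forces_mp)

lemma eq_App: "w \<tturnstile> Eq (\<sigma> \<rightarrow> \<tau>) f g \<Longrightarrow> w \<tturnstile> Eq \<sigma> t u \<Longrightarrow> w \<tturnstile> Eq \<tau> (f \<cdot> t) (g \<cdot> u)"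
  using forces_eha[OF eha_ax.eq_app[of "[\<sigma>, \<sigma>, \<sigma> \<rightarrow> \<tau>, \<sigma> \<rightarrow> \<tau>]" "Var (Suc (Suc 0))" \<sigma> \<tau>
        "Var (Suc (Suc (Suc 0)))" "Var 0" "Var (Suc 0)"],
      of "case_nat t (case_nat u (case_nat f (case_nat g Var)))" w]
    eq_typed[of w \<sigma> t u] eq_typed[of w "\<sigma> \<rightarrow> \<tau>" f g] forces_world[of w]
  by (auto dest: forces_mp)

lemma eq_arg: "typed f (\<sigma> \<rightarrow> \<tau>) \<Longrightarrow> w \<tturnstile> Eq \<sigma> t u \<Longrightarrow> w \<tturnstile> Eq \<tau> (f \<cdot> t) (f \<cdot> u)"
  by (meson eq_App eq_refl forces_world)

lemma eq_fun: "w \<tturnstile> Eq (\<sigma> \<rightarrow> \<tau>) f g \<Longrightarrow> typed t \<sigma> \<Longrightarrow> w \<tturnstile> Eq \<tau> (f \<cdot> t) (g \<cdot> t)"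
  by (meson eq_App eq_refl forces_world)

lemma eq_extI:
  assumes "typed f (\<sigma> \<rightarrow> \<tau>)" "typed g (\<sigma> \<rightarrow> \<tau>)" "world w"
    and "\<And>t. typed t \<sigma> \<Longrightarrow> w \<tturnstile> Eq \<tau> (f \<cdot> t) (g \<cdot> t)"
  shows "w \<tturnstile> Eq (\<sigma> \<rightarrow> \<tau>) f g"
proof -
  have "w \<tturnstile> All \<sigma> (Eq \<tau> (shift 1 f \<cdot> Var 0) (shift 1 g \<cdot> Var 0))"
    by (rule forces_allI) (use assms(4) in \<open>simp add: inst_def\<close>)
  then show ?thesis
    using forces_eha[OF eha_ax.extensionality[of "[\<sigma> \<rightarrow> \<tau>, \<sigma> \<rightarrow> \<tau>]" "Var 0" \<sigma> \<tau> "Var (Suc 0)"],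
      of "case_nat f (case_nat g Var)" w] assms(1-3)
    by (auto dest: forces_mp)
qed

lemma st_eq: "w \<tturnstile> Eq \<sigma> t u \<Longrightarrow> st w t \<sigma> \<Longrightarrow> st w u \<sigma>"
  using forces_st_ax[OF st_ax.st_eq[of "[\<sigma>, \<sigma>]" "Var 0" \<sigma> "Var (Suc 0)"],
      of "case_nat t (case_nat u Var)" w] eq_typed[of w \<sigma> t u] forces_world[of w]
  by (auto simp: st_def dest: forces_mp)

lemma typed_consts:
  "typed zero N" "typed (Con Succ) (N \<rightarrow> N)" "typed (Con (K \<sigma> \<tau>)) (\<sigma> \<rightarrow> \<tau> \<rightarrow> \<sigma>)"
  "typed (Con (S \<rho> \<sigma> \<tau>)) ((\<rho> \<rightarrow> \<sigma> \<rightarrow> \<tau>) \<rightarrow> (\<rho> \<rightarrow> \<sigma>) \<rightarrow> \<rho> \<rightarrow> \<tau>)"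
  "typed (Con (R \<sigma>)) (N \<rightarrow> \<sigma> \<rightarrow> (\<sigma> \<rightarrow> N \<rightarrow> \<sigma>) \<rightarrow> \<sigma>)"
  "typed (Con (Emp \<sigma>)) (Seq \<sigma>)" "typed (Con (Prep \<sigma>)) (\<sigma> \<rightarrow> Seq \<sigma> \<rightarrow> Seq \<sigma>)"
  "typed (Con (L \<sigma> \<rho>)) (Seq \<sigma> \<rightarrow> \<rho> \<rightarrow> (\<rho> \<rightarrow> \<sigma> \<rightarrow> \<rho>) \<rightarrow> \<rho>)"
  by simp_all

lemmas typed_intros = typed_App typed_consts typed_default

lemma eq_K: "typed t \<sigma> \<Longrightarrow> typed u \<tau> \<Longrightarrow> world w \<Longrightarrow> w \<tturnstile> Eq \<sigma> (Con (K \<sigma> \<tau>) \<cdot> t \<cdot> u) t"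
  using forces_eha[OF eha_ax.K[of "[\<sigma>, \<tau>]" "Var 0" \<sigma> "Var (Suc 0)" \<tau>],
      of "case_nat t (case_nat u Var)" w] by simp

lemma eq_S:
  "typed t (\<rho> \<rightarrow> \<sigma> \<rightarrow> \<tau>) \<Longrightarrow> typed u (\<rho> \<rightarrow> \<sigma>) \<Longrightarrow> typed v \<rho> \<Longrightarrow> world w
    \<Longrightarrow> w \<tturnstile> Eq \<tau> (Con (S \<rho> \<sigma> \<tau>) \<cdot> t \<cdot> u \<cdot> v) (t \<cdot> v \<cdot> (u \<cdot> v))"
  using forces_eha[OF eha_ax.S[of "[\<rho> \<rightarrow> \<sigma> \<rightarrow> \<tau>, \<rho> \<rightarrow> \<sigma>, \<rho>]" "Var 0" \<rho> \<sigma> \<tau> "Var (Suc 0)" "Var (Suc (Suc 0))"],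
      of "case_nat t (case_nat u (case_nat v Var))" w] by simp

lemma eq_R_zero:
  "typed u \<sigma> \<Longrightarrow> typed v (\<sigma> \<rightarrow> N \<rightarrow> \<sigma>) \<Longrightarrow> world w \<Longrightarrow> w \<tturnstile> Eq \<sigma> (Con (R \<sigma>) \<cdot> zero \<cdot> u \<cdot> v) u"
  using forces_eha[OF eha_ax.R_zero[of "[\<sigma>, \<sigma> \<rightarrow> N \<rightarrow> \<sigma>]" "Var 0" \<sigma> "Var (Suc 0)"],
      of "case_nat u (case_nat v Var)" w] by simp

lemma eq_R_suc:
  "typed t N \<Longrightarrow> typed u \<sigma> \<Longrightarrow> typed v (\<sigma> \<rightarrow> N \<rightarrow> \<sigma>) \<Longrightarrow> world w
    \<Longrightarrow> w \<tturnstile> Eq \<sigma> (Con (R \<sigma>) \<cdot> suc t \<cdot> u \<cdot> v) (v \<cdot> (Con (R \<sigma>) \<cdot> t \<cdot> u \<cdot> v) \<cdot> t)"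
  using forces_eha[OF eha_ax.R_suc[of "[N, \<sigma>, \<sigma> \<rightarrow> N \<rightarrow> \<sigma>]" "Var 0" "Var (Suc 0)" \<sigma> "Var (Suc (Suc 0))"],
      of "case_nat t (case_nat u (case_nat v Var))" w] by simp

lemma eq_L_nil:
  "typed u \<rho> \<Longrightarrow> typed v (\<rho> \<rightarrow> \<sigma> \<rightarrow> \<rho>) \<Longrightarrow> world w
    \<Longrightarrow> w \<tturnstile> Eq \<rho> (Con (L \<sigma> \<rho>) \<cdot> Con (Emp \<sigma>) \<cdot> u \<cdot> v) u"
  using forces_eha[OF eha_ax.L_nil[of "[\<rho>, \<rho> \<rightarrow> \<sigma> \<rightarrow> \<rho>]" "Var 0" \<rho> "Var (Suc 0)" \<sigma>],
      of "case_nat u (case_nat v Var)" w] by simp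

lemma eq_L_cons:
  "typed a \<sigma> \<Longrightarrow> typed t (Seq \<sigma>) \<Longrightarrow> typed u \<rho> \<Longrightarrow> typed v (\<rho> \<rightarrow> \<sigma> \<rightarrow> \<rho>) \<Longrightarrow> world w
    \<Longrightarrow> w \<tturnstile> Eq \<rho> (Con (L \<sigma> \<rho>) \<cdot> (Con (Prep \<sigma>) \<cdot> a \<cdot> t) \<cdot> u \<cdot> v)
                     (v \<cdot> (Con (L \<sigma> \<rho>) \<cdot> t \<cdot> u \<cdot> v) \<cdot> a)"
  using forces_eha[OF eha_ax.L_cons[of "[\<sigma>, Seq \<sigma>, \<rho>, \<rho> \<rightarrow> \<sigma> \<rightarrow> \<rho>]" "Var 0" \<sigma> "Var (Suc 0)"
        "Var (Suc (Suc 0))" \<rho> "Var (Suc (Suc (Suc 0)))"],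
      of "case_nat a (case_nat t (case_nat u (case_nat v Var)))" w] by simp

lemma suc_not_zero: "w \<tturnstile> Eq N (suc t) zero \<Longrightarrow> typed t N \<Longrightarrow> w \<tturnstile> Fls"
  using forces_eha[OF eha_ax.suc_not_zero[of "[N]" "Var 0"], of "case_nat t Var" w]
    forces_world[of w] by (auto dest: forces_mp)

lemma suc_inj: "w \<tturnstile> Eq N (suc t) (suc u) \<Longrightarrow> typed t N \<Longrightarrow> typed u N \<Longrightarrow> w \<tturnstile> Eq N t u"
  using forces_eha[OF eha_ax.suc_inj[of "[N, N]" "Var 0" "Var (Suc 0)"],
      of "case_nat t (case_nat u Var)" w]
    forces_world[of w] by (auto dest: forces_mp)

text \<open>Follows the clauses of bracket abstraction: the variable itself gives the identity
  \<open>S K K\<close>, other variables and constants a \<open>K\<close>, an application an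
  \<open>S\<close>. The environment \<open>e\<close> instantiates the free variables of the
  abstraction, so that nested abstractions can be fed one argument after another.\<close>

lemma eq_beta:
  "has_ty (\<sigma> # \<Gamma>) t \<tau> \<Longrightarrow> env e \<Gamma> \<Longrightarrow> typed u \<sigma> \<Longrightarrow> world w
    \<Longrightarrow> w \<tturnstile> Eq \<tau> (tsub e (lam \<Gamma> \<sigma> t) \<cdot> u) (tsub (case_nat u e) t)"
proof (induction \<Gamma> \<sigma> t arbitrary: \<tau> rule: lam.induct)
  case (1 \<Gamma> \<sigma>)
  then have \<tau>: "\<tau> = \<sigma>" by simp
  have "w \<tturnstile> Eq \<sigma> (Con (S \<sigma> (\<sigma> \<rightarrow> \<sigma>) \<sigma>) \<cdot> Con (K \<sigma> (\<sigma> \<rightarrow> \<sigma>)) \<cdot> Con (K \<sigma> \<sigma>) \<cdot> u)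
      (Con (K \<sigma> (\<sigma> \<rightarrow> \<sigma>)) \<cdot> u \<cdot> (Con (K \<sigma> \<sigma>) \<cdot> u))"
    by (rule eq_S) (use 1 in simp_all)
  also have "w \<tturnstile> Eq \<sigma> (Con (K \<sigma> (\<sigma> \<rightarrow> \<sigma>)) \<cdot> u \<cdot> (Con (K \<sigma> \<sigma>) \<cdot> u)) u"
    by (rule eq_K) (use 1 in \<open>auto intro: typed_App typed_consts\<close>)
  finally show ?case by (simp add: lam.simps \<tau>)
next
  case (2 \<Gamma> \<sigma> i)
  then have "typed (e i) (\<Gamma> ! i)" "\<tau> = \<Gamma> ! i" by (auto simp: env_def)
  then show ?case using 2 by (simp add: lam.simps eq_K)
next
  case (3 \<Gamma> \<sigma> c)
  then show ?case by (auto simp: lam.simps eq_K)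
next
  case (4 \<Gamma> \<sigma> t1 t2)
  from 4(3) obtain \<rho> where ty: "has_ty (\<sigma> # \<Gamma>) t1 (\<rho> \<rightarrow> \<tau>)" "has_ty (\<sigma> # \<Gamma>) t2 \<rho>"
    by (auto simp: has_ty_App)
  note h = typed_tsub[OF has_ty_lam[OF ty(1)] 4(4)] typed_tsub[OF has_ty_lam[OF ty(2)] 4(4)]
  have "w \<tturnstile> Eq \<tau> (Con (S \<sigma> \<rho> \<tau>) \<cdot> tsub e (lam \<Gamma> \<sigma> t1) \<cdot> tsub e (lam \<Gamma> \<sigma> t2) \<cdot> u)
      (tsub e (lam \<Gamma> \<sigma> t1) \<cdot> u \<cdot> (tsub e (lam \<Gamma> \<sigma> t2) \<cdot> u))"
    by (rule eq_S[OF h 4(5,6)])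
  also have "w \<tturnstile> Eq \<tau> (tsub e (lam \<Gamma> \<sigma> t1) \<cdot> u \<cdot> (tsub e (lam \<Gamma> \<sigma> t2) \<cdot> u))
      (tsub (case_nat u e) t1 \<cdot> tsub (case_nat u e) t2)"
    by (rule eq_App[OF 4(1)[OF ty(1) 4(4-6)] 4(2)[OF ty(2) 4(4-6)]])
  finally show ?case
    using has_ty_AppI[OF ty] ty by (simp add: lam.simps del: has_ty_App)
qed

lemma eq_beta1:
  "has_ty [\<sigma>] t \<tau> \<Longrightarrow> typed u \<sigma> \<Longrightarrow> world w \<Longrightarrow> w \<tturnstile> Eq \<tau> (lam [] \<sigma> t \<cdot> u) (tsub (case_nat u Var) t)"
  using eq_beta[of \<sigma> "[]" t \<tau> Var] by simp

lemma eq_beta2: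
  assumes t: "has_ty [\<sigma>2, \<sigma>1] t \<tau>" and u: "typed u1 \<sigma>1" "typed u2 \<sigma>2" and w: "world w"
  shows "w \<tturnstile> Eq \<tau> (lam [] \<sigma>1 (lam [\<sigma>1] \<sigma>2 t) \<cdot> u1 \<cdot> u2) (tsub (case_nat u2 (case_nat u1 Var)) t)"
proof -
  have "w \<tturnstile> Eq \<tau> (lam [] \<sigma>1 (lam [\<sigma>1] \<sigma>2 t) \<cdot> u1 \<cdot> u2) (tsub (case_nat u1 Var) (lam [\<sigma>1] \<sigma>2 t) \<cdot> u2)"
    by (rule eq_fun[OF eq_beta1 u(2)]) (use assms in \<open>auto intro: has_ty_lam\<close>)
  also have "w \<tturnstile> Eq \<tau> (tsub (case_nat u1 Var) (lam [\<sigma>1] \<sigma>2 t) \<cdot> u2) (tsub (case_nat u2 (case_nat u1 Var)) t)"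
    by (rule eq_beta) (use assms in auto)
  finally show ?thesis .
qed

lemma eq_beta3:
  assumes t: "has_ty [\<sigma>3, \<sigma>2, \<sigma>1] t \<tau>" and u: "typed u1 \<sigma>1" "typed u2 \<sigma>2" "typed u3 \<sigma>3" and w: "world w"
  shows "w \<tturnstile> Eq \<tau> (lam [] \<sigma>1 (lam [\<sigma>1] \<sigma>2 (lam [\<sigma>2, \<sigma>1] \<sigma>3 t)) \<cdot> u1 \<cdot> u2 \<cdot> u3)
    (tsub (case_nat u3 (case_nat u2 (case_nat u1 Var))) t)"
proof -
  have "w \<tturnstile> Eq \<tau> (lam [] \<sigma>1 (lam [\<sigma>1] \<sigma>2 (lam [\<sigma>2, \<sigma>1] \<sigma>3 t)) \<cdot> u1 \<cdot> u2 \<cdot> u3)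
      (tsub (case_nat u2 (case_nat u1 Var)) (lam [\<sigma>2, \<sigma>1] \<sigma>3 t) \<cdot> u3)"
    by (rule eq_fun[OF eq_beta2 u(3)]) (use assms in \<open>auto intro: has_ty_lam\<close>)
  also have "w \<tturnstile> Eq \<tau> (tsub (case_nat u2 (case_nat u1 Var)) (lam [\<sigma>2, \<sigma>1] \<sigma>3 t) \<cdot> u3)
      (tsub (case_nat u3 (case_nat u2 (case_nat u1 Var))) t)"
    by (rule eq_beta) (use assms in auto)
  finally show ?thesis .
qed

lemma eq_tsub:
  "has_ty \<Gamma> t \<sigma> \<Longrightarrow> world w \<Longrightarrow> (\<And>i. i < length \<Gamma> \<Longrightarrow> w \<tturnstile> Eq (\<Gamma> ! i) (e i) (e' i))
    \<Longrightarrow> w \<tturnstile> Eq \<sigma> (tsub e t) (tsub e' t)"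
proof (induction t arbitrary: \<sigma>)
  case (Con c)
  then show ?case by (auto intro: eq_refl)
next
  case (App t1 t2)
  from App.prems(1) obtain \<rho> where "has_ty \<Gamma> t1 (\<rho> \<rightarrow> \<sigma>)" "has_ty \<Gamma> t2 \<rho>"
    by (auto simp: has_ty_App)
  with App.IH App.prems(2,3) show ?case by (simp add: eq_App)
qed auto

text \<open>Replacement of equals is not an axiom. For equations it reduces to congruence of
  application and for \<open>St\<close> to \<open>st_eq\<close>; compound formulae follow by
  induction, the premise of an implication requiring the symmetric equations.\<close>

lemma forces_fsub_cong:
  "wff \<phi> \<Gamma> \<Longrightarrow> env e \<Gamma> \<Longrightarrow> env e' \<Gamma> \<Longrightarrow> (\<And>i. i < length \<Gamma> \<Longrightarrow> w \<tturnstile> Eq (\<Gamma> ! i) (e i) (e' i))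
    \<Longrightarrow> w \<tturnstile> fsub \<phi> e \<Longrightarrow> w \<tturnstile> fsub \<phi> e'"
proof (induction \<phi> arbitrary: \<Gamma> e e' w)
  case (Eq \<sigma> t u)
  then have ty: "has_ty \<Gamma> t \<sigma>" "has_ty \<Gamma> u \<sigma>" and w: "world w" by (auto dest: forces_world)
  have "w \<tturnstile> Eq \<sigma> (tsub e' t) (tsub e t)"
    by (rule eq_sym, rule eq_tsub[OF ty(1) w Eq.prems(4)])
  also have "w \<tturnstile> Eq \<sigma> (tsub e t) (tsub e u)" using Eq.prems(5) by simp
  also have "w \<tturnstile> Eq \<sigma> (tsub e u) (tsub e' u)" by (rule eq_tsub[OF ty(2) w Eq.prems(4)])
  finally show ?case by simp
next
  case (St \<sigma> t)
  then have "has_ty \<Gamma> t \<sigma>" "world w" by (auto dest: forces_world)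
  from st_eq[OF eq_tsub[OF this St.prems(4)]] St.prems(5) show ?case by (simp add: st_def)
next
  case (And \<phi> \<psi>)
  then have "wff \<phi> \<Gamma>" "wff \<psi> \<Gamma>" "w \<tturnstile> fsub \<phi> e" "w \<tturnstile> fsub \<psi> e" by simp_all
  with And.IH(1)[OF _ And.prems(2-4)] And.IH(2)[OF _ And.prems(2-4)] show ?case by simp
next
  case (Or \<phi> \<psi>)
  then have wf: "wff \<phi> \<Gamma>" "wff \<psi> \<Gamma>" and or: "w \<tturnstile> (fsub \<phi> e \<^bold>\<or> fsub \<psi> e)" by simp_all
  from or have "w \<tturnstile> (fsub \<phi> e' \<^bold>\<or> fsub \<psi> e')"
  proof (rule forces_orE)
    fix w' assume *: "w \<sqsubseteq> w'" "w' \<tturnstile> fsub \<phi> e"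
    have "w' \<tturnstile> fsub \<phi> e'"
      by (rule Or.IH(1)[OF wf(1) Or.prems(2,3) forces_mono[OF Or.prems(4) *(1)] *(2)])
    then show "w' \<tturnstile> (fsub \<phi> e' \<^bold>\<or> fsub \<psi> e')"
      using wf Or.prems(3) by (auto intro!: forces_orI wfm_fsub)
  next
    fix w' assume *: "w \<sqsubseteq> w'" "w' \<tturnstile> fsub \<psi> e"
    have "w' \<tturnstile> fsub \<psi> e'"
      by (rule Or.IH(2)[OF wf(2) Or.prems(2,3) forces_mono[OF Or.prems(4) *(1)] *(2)])
    then show "w' \<tturnstile> (fsub \<phi> e' \<^bold>\<or> fsub \<psi> e')"
      using wf Or.prems(3) by (auto intro!: forces_orI wfm_fsub)
  qed
  then show ?case by simp
next
  case (Imp \<phi> \<psi>)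
  then have wf: "wff \<phi> \<Gamma>" "wff \<psi> \<Gamma>" and imp: "w \<tturnstile> (fsub \<phi> e \<^bold>\<longrightarrow> fsub \<psi> e)" by simp_all
  have "w \<tturnstile> (fsub \<phi> e' \<^bold>\<longrightarrow> fsub \<psi> e')"
  proof (rule forces_impI[OF wfm_fsub[OF wf(1) Imp.prems(3)] forces_world[OF imp]])
    fix w' assume *: "w \<sqsubseteq> w'" "w' \<tturnstile> fsub \<phi> e'"
    have "w' \<tturnstile> fsub \<phi> e"
      by (rule Imp.IH(1)[OF wf(1) Imp.prems(3,2) eq_sym[OF forces_mono[OF Imp.prems(4) *(1)]] *(2)])
    note psi = forces_mp[OF forces_mono[OF imp *(1)] this]
    show "w' \<tturnstile> fsub \<psi> e'"
      by (rule Imp.IH(2)[OF wf(2) Imp.prems(2,3) forces_mono[OF Imp.prems(4) *(1)] psi])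
  qed
  then show ?case by simp
next
  case (All \<sigma> \<phi>)
  have "w \<tturnstile> All \<sigma> (fsub \<phi> (up e'))"
  proof (rule forces_allI)
    fix t assume t: "typed t \<sigma>"
    have "w \<tturnstile> fsub \<phi> (case_nat t e)"
      using forces_allE[OF _ t, of w "fsub \<phi> (up e)"] All.prems(5) by (simp add: inst_up)
    moreover have "w \<tturnstile> Eq ((\<sigma> # \<Gamma>) ! i) (case_nat t e i) (case_nat t e' i)" if "i < length (\<sigma> # \<Gamma>)" for i
      using that All.prems(4) eq_refl[OF t forces_world[OF All.prems(5)]] by (cases i) auto
    ultimately show "w \<tturnstile> inst t (fsub \<phi> (up e'))" unfolding inst_up
      using All.IH[of "\<sigma> # \<Gamma>" "case_nat t e" "case_nat t e'" w] All.prems(1-3) t by simp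
  qed
  then show ?case by simp
next
  case (Ex \<sigma> \<phi>)
  have "w \<tturnstile> Ex \<sigma> (fsub \<phi> (up e))" using Ex.prems(5) by simp
  then have "w \<tturnstile> Ex \<sigma> (fsub \<phi> (up e'))"
  proof (rule forces_exE)
    fix t w' assume t: "w \<sqsubseteq> w'" "typed t \<sigma>" "w' \<tturnstile> inst t (fsub \<phi> (up e))"
    have "w' \<tturnstile> Eq ((\<sigma> # \<Gamma>) ! i) (case_nat t e i) (case_nat t e' i)" if "i < length (\<sigma> # \<Gamma>)" for i
      using that forces_mono[OF Ex.prems(4) t(1)] eq_refl[OF t(2) forces_world[OF t(3)]]
      by (cases i) auto
    then show "w' \<tturnstile> Ex \<sigma> (fsub \<phi> (up e'))" using t
      Ex.IH[of "\<sigma> # \<Gamma>" "case_nat t e" "case_nat t e'" w'] Ex.prems(1-3)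
      by (intro forces_exI[of _ t]) (auto simp: inst_up)
  qed
  then show ?case by simp
next
  case (AllSt \<sigma> \<phi>)
  have a: "w \<tturnstile> AllSt \<sigma> (fsub \<phi> (up e))" using AllSt.prems(5) by simp
  have "w \<tturnstile> AllSt \<sigma> (fsub \<phi> (up e'))"
  proof (rule forces_AllStI[OF forces_world[OF a]])
    fix t w' assume t: "w \<sqsubseteq> w'" "st w' t \<sigma>"
    have "w' \<tturnstile> fsub \<phi> (case_nat t e)"
      using forces_AllStE[OF forces_mono[OF a t(1)] t(2)] by (simp add: inst_up)
    moreover have "w' \<tturnstile> Eq ((\<sigma> # \<Gamma>) ! i) (case_nat t e i) (case_nat t e' i)" if "i < length (\<sigma> # \<Gamma>)" for i
      using that forces_mono[OF AllSt.prems(4) t(1)] eq_refl[OF st_typed[OF t(2)] st_world[OF t(2)]]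
      by (cases i) auto
    ultimately show "w' \<tturnstile> inst t (fsub \<phi> (up e'))" unfolding inst_up
      using AllSt.IH[of "\<sigma> # \<Gamma>" "case_nat t e" "case_nat t e'" w'] AllSt.prems(1-3) st_typed[OF t(2)]
      by simp
  qed
  then show ?case by simp
next
  case (ExSt \<sigma> \<phi>)
  have "w \<tturnstile> ExSt \<sigma> (fsub \<phi> (up e))" using ExSt.prems(5) by simp
  then have "w \<tturnstile> ExSt \<sigma> (fsub \<phi> (up e'))"
  proof (rule forces_ExStE)
    fix t w' assume t: "w \<sqsubseteq> w'" "st w' t \<sigma>" "w' \<tturnstile> inst t (fsub \<phi> (up e))"
    have "w' \<tturnstile> Eq ((\<sigma> # \<Gamma>) ! i) (case_nat t e i) (case_nat t e' i)" if "i < length (\<sigma> # \<Gamma>)" for i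
      using that forces_mono[OF ExSt.prems(4) t(1)] eq_refl[OF st_typed[OF t(2)] st_world[OF t(2)]]
      by (cases i) auto
    then show "w' \<tturnstile> ExSt \<sigma> (fsub \<phi> (up e'))" using t st_typed[OF t(2)]
      ExSt.IH[of "\<sigma> # \<Gamma>" "case_nat t e" "case_nat t e'" w'] ExSt.prems(1-3)
      by (intro forces_ExStI[of _ t]) (auto simp: inst_up)
  qed
  then show ?case by simp
qed simp

lemma forces_eq_subst:
  assumes "wff \<phi> (\<sigma> # \<Gamma>)" "env e \<Gamma>" and eq: "w \<tturnstile> Eq \<sigma> t u" and "w \<tturnstile> fsub \<phi> (case_nat t e)"
  shows "w \<tturnstile> fsub \<phi> (case_nat u e)"
proof (rule forces_fsub_cong[OF assms(1) _ _ _ assms(4)])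
  show "w \<tturnstile> Eq ((\<sigma> # \<Gamma>) ! i) (case_nat t e i) (case_nat u e i)" if "i < length (\<sigma> # \<Gamma>)" for i
    using that assms(2) eq eq_refl[OF _ forces_world[OF eq]] by (cases i) (auto simp: env_def)
qed (use assms(2) eq_typed[OF eq] in simp_all)

lemma fsub_fsub_eq: "(\<And>i. tsub e' (r i) = e i) \<Longrightarrow> fsub (fsub \<phi> r) e' = fsub \<phi> e"
  by (simp add: fsub_fsub)

lemma fsub_at_suc: "fsub (at_suc \<phi>) (case_nat t e) = fsub \<phi> (case_nat (suc t) e)"
  unfolding at_suc_def by (rule fsub_fsub_eq) (simp split: nat.split)

lemma fsub_lift_case [simp]: "fsub (lift \<phi>) (case_nat t e) = fsub \<phi> e"
  by (simp add: lift_def fsub_fsub)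

lemma internal_lift [simp]: "internal (lift \<phi>) = internal \<phi>" "or_free (lift \<phi>) = or_free \<phi>"
  by (simp_all add: lift_def)

lemma wff_lift: "wff \<phi> \<Gamma> \<Longrightarrow> wff (lift \<phi>) (\<sigma> # \<Gamma>)"
  unfolding lift_def by (rule wff_fsub) auto

lemma forces_allI':
  "(\<And>t. typed t \<sigma> \<Longrightarrow> w \<tturnstile> fsub \<phi> (case_nat t e)) \<Longrightarrow> w \<tturnstile> fsub (All \<sigma> \<phi>) e"
  using forces_allI[of \<sigma> w "fsub \<phi> (up e)"] by (simp add: inst_up)

lemma forces_allE':
  "w \<tturnstile> fsub (All \<sigma> \<phi>) e \<Longrightarrow> typed t \<sigma> \<Longrightarrow> w \<tturnstile> fsub \<phi> (case_nat t e)"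
  using forces_allE[of w \<sigma> "fsub \<phi> (up e)"] by (simp add: inst_up)

lemma forces_AllStI':
  "world w \<Longrightarrow> (\<And>w' t. w \<sqsubseteq> w' \<Longrightarrow> st w' t \<sigma> \<Longrightarrow> w' \<tturnstile> fsub \<phi> (case_nat t e))
    \<Longrightarrow> w \<tturnstile> fsub (AllSt \<sigma> \<phi>) e"
  using forces_AllStI[of w \<sigma> "fsub \<phi> (up e)"] by (simp add: inst_up)

lemma forces_AllStE':
  "w \<tturnstile> fsub (AllSt \<sigma> \<phi>) e \<Longrightarrow> st w t \<sigma> \<Longrightarrow> w \<tturnstile> fsub \<phi> (case_nat t e)"
  using forces_AllStE[of w \<sigma> "fsub \<phi> (up e)"] by (simp add: inst_up)

section \<open>Induction and case distinction\<close>

lemma forces_nat_induct: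
  assumes wf: "wff \<phi> (N # \<Gamma>)" "internal \<phi>" "or_free \<phi>" and e: "env e \<Gamma>" and w: "world w"
    and base: "w \<tturnstile> fsub \<phi> (case_nat zero e)"
    and step: "\<And>w' t. w \<sqsubseteq> w' \<Longrightarrow> typed t N \<Longrightarrow> w' \<tturnstile> fsub \<phi> (case_nat t e)
      \<Longrightarrow> w' \<tturnstile> fsub \<phi> (case_nat (suc t) e)"
    and t: "typed t N"
  shows "w \<tturnstile> fsub \<phi> (case_nat t e)"
proof -
  have "w \<tturnstile> fsub (All N (\<phi> \<^bold>\<longrightarrow> at_suc \<phi>)) e"
  proof (rule forces_allI')
    fix t assume t: "typed t N"
    have "w \<tturnstile> (fsub \<phi> (case_nat t e) \<^bold>\<longrightarrow> fsub \<phi> (case_nat (suc t) e))"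
      by (rule forces_impI) (use wf e t w step in \<open>auto intro: wfm_fsub\<close>)
    then show "w \<tturnstile> fsub (\<phi> \<^bold>\<longrightarrow> at_suc \<phi>) (case_nat t e)" by (simp add: fsub_at_suc)
  qed
  then have "w \<tturnstile> fsub (All N \<phi>) e"
    using forces_eha[OF eha_ax.induction[OF wf] e w] base by (auto simp: fsub_inst dest: forces_mp)
  then show ?thesis using t by (rule forces_allE')
qed

text \<open>External induction imposes no restriction on the formula, which is what makes a
  primitive disjunction provable in \<open>forces_st_zero_dec\<close>. The price is that the
  argument must be standard.\<close>

lemma forces_st_induct:
  assumes wf: "wff \<phi> (N # \<Gamma>)" and e: "env e \<Gamma>"
    and base: "w \<tturnstile> fsub \<phi> (case_nat zero e)"
    and step: "\<And>w' t. w \<sqsubseteq> w' \<Longrightarrow> st w' t N \<Longrightarrow> w' \<tturnstile> fsub \<phi> (case_nat t e)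
      \<Longrightarrow> w' \<tturnstile> fsub \<phi> (case_nat (suc t) e)"
    and t: "st w t N"
  shows "w \<tturnstile> fsub \<phi> (case_nat t e)"
proof -
  have "w \<tturnstile> fsub (AllSt N (\<phi> \<^bold>\<longrightarrow> at_suc \<phi>)) e"
  proof (rule forces_AllStI'[OF st_world[OF t]])
    fix w' t assume t: "w \<sqsubseteq> w'" "st w' t N"
    have "w' \<tturnstile> (fsub \<phi> (case_nat t e) \<^bold>\<longrightarrow> fsub \<phi> (case_nat (suc t) e))"
    proof (rule forces_impI[OF wfm_fsub[OF wf] st_world[OF t(2)]])
      fix w'' assume *: "w' \<sqsubseteq> w''" "w'' \<tturnstile> fsub \<phi> (case_nat t e)"
      show "w'' \<tturnstile> fsub \<phi> (case_nat (suc t) e)"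
        by (rule step[OF later_trans[OF t(1) *(1)] st_mono[OF t(2) *(1)] *(2)])
    qed (use e st_typed[OF t(2)] in simp)
    then show "w' \<tturnstile> fsub (\<phi> \<^bold>\<longrightarrow> at_suc \<phi>) (case_nat t e)" by (simp add: fsub_at_suc)
  qed
  then have "w \<tturnstile> fsub (AllSt N \<phi>) e"
    using forces_st_ax[OF st_ax.external_induction[OF wf] e st_world[OF t]] base
    by (auto simp: fsub_inst dest: forces_mp)
  then show ?thesis using t by (rule forces_AllStE')
qed

lemma typed_suc: "typed t N \<Longrightarrow> typed (suc t) N"
  by (rule typed_App) simp_all

text \<open>For nonstandard \<open>z\<close> the case distinction is confined to internal disjunction-free goals;
  with primitive disjunction it would be refuted by \<open>NU\<close>.\<close>

lemma forces_zero_cases: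
  assumes \<chi>: "internal \<chi>" "or_free \<chi>" and z: "typed z N"
    and 1: "w \<tturnstile> (Eq N z zero \<^bold>\<longrightarrow> \<chi>)" and 2: "w \<tturnstile> ((\<^bold>\<not> Eq N z zero) \<^bold>\<longrightarrow> \<chi>)"
  shows "w \<tturnstile> \<chi>"
proof -
  \<comment> \<open>The goal is kept inside the induction formula, which is internal and
    disjunction-free because \<open>\<chi>\<close> is; \<open>lift\<close> protects
    \<open>\<chi>\<close> from the induction variable.\<close>
  let ?\<phi> = "(Eq N (Var 0) zero \<^bold>\<longrightarrow> lift \<chi>) \<^bold>\<longrightarrow> ((\<^bold>\<not> Eq N (Var 0) zero) \<^bold>\<longrightarrow> lift \<chi>) \<^bold>\<longrightarrow> lift \<chi>"
  have w: "world w" and wf: "wfm \<chi>" using forces_world[OF 1] forces_wfm[OF 1] by auto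
  obtain n where n: "wff \<chi> (Ctx n)" using wf by (auto simp: wfm_def)
  have "w \<tturnstile> fsub ?\<phi> (case_nat z Var)"
  proof (rule forces_nat_induct[of ?\<phi> "Ctx n"])
    have "w \<tturnstile> ((Eq N zero zero \<^bold>\<longrightarrow> \<chi>) \<^bold>\<longrightarrow> ((\<^bold>\<not> Eq N zero zero) \<^bold>\<longrightarrow> \<chi>) \<^bold>\<longrightarrow> \<chi>)"
    proof (intro forces_impI)
      fix w' w'' assume "w' \<sqsubseteq> w''" "w' \<tturnstile> (Eq N zero zero \<^bold>\<longrightarrow> \<chi>)"
      then show "w'' \<tturnstile> \<chi>"
        using forces_mp forces_mono eq_refl[of zero N] later_world by (metis typed_consts(1))
    qed (use wf w in \<open>auto dest: later_world\<close>)
    then show "w \<tturnstile> fsub ?\<phi> (case_nat zero Var)" by simp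
    fix w1 t assume t: "w \<sqsubseteq> w1" "typed t N"
    have "w1 \<tturnstile> ((Eq N (suc t) zero \<^bold>\<longrightarrow> \<chi>) \<^bold>\<longrightarrow> ((\<^bold>\<not> Eq N (suc t) zero) \<^bold>\<longrightarrow> \<chi>) \<^bold>\<longrightarrow> \<chi>)"
    proof (intro forces_impI)
      fix w' w'' assume "w' \<sqsubseteq> w''" and *: "w'' \<tturnstile> ((\<^bold>\<not> Eq N (suc t) zero) \<^bold>\<longrightarrow> \<chi>)"
      have "w'' \<tturnstile> (\<^bold>\<not> Eq N (suc t) zero)"
        by (rule forces_impI) (use forces_world[OF *] t(2) in \<open>auto simp: typed_suc intro: suc_not_zero\<close>)
      with * show "w'' \<tturnstile> \<chi>" by (rule forces_mp)
    qed (use wf t in \<open>auto simp: typed_suc dest: later_world\<close>)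
    then show "w1 \<tturnstile> fsub ?\<phi> (case_nat (suc t) Var)" by simp
  qed (use \<chi> w z n in \<open>auto simp: env_Ctx intro: wff_lift\<close>)
  then have "w \<tturnstile> ((Eq N z zero \<^bold>\<longrightarrow> \<chi>) \<^bold>\<longrightarrow> ((\<^bold>\<not> Eq N z zero) \<^bold>\<longrightarrow> \<chi>) \<^bold>\<longrightarrow> \<chi>)" by simp
  with 1 2 show ?thesis by (blast intro: forces_mp)
qed

text \<open>The axiom delivers a number \<open>z\<close> whose being zero tells the empty sequence
  from a prepend. Nothing makes that number standard, so it is evaluated by
  \<open>forces_zero_cases\<close>, whence the restriction on \<open>\<chi>\<close>.\<close>

lemma forces_list_cases:
  assumes s: "typed s (Seq \<sigma>)" and \<chi>: "wfm \<chi>" "internal \<chi>" "or_free \<chi>" and w: "world w"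
    and nil: "\<And>w'. w \<sqsubseteq> w' \<Longrightarrow> w' \<tturnstile> Eq (Seq \<sigma>) s (Con (Emp \<sigma>)) \<Longrightarrow> w' \<tturnstile> \<chi>"
    and cons: "\<And>w' a r. w \<sqsubseteq> w' \<Longrightarrow> typed a \<sigma> \<Longrightarrow> typed r (Seq \<sigma>)
      \<Longrightarrow> w' \<tturnstile> Eq (Seq \<sigma>) s (Con (Prep \<sigma>) \<cdot> a \<cdot> r) \<Longrightarrow> w' \<tturnstile> \<chi>"
  shows "w \<tturnstile> \<chi>"
proof -
  let ?B = "Ex \<sigma> (Ex (Seq \<sigma>) (Eq (Seq \<sigma>) (shift 2 s) (Con (Prep \<sigma>) \<cdot> Var 1 \<cdot> Var 0)))"
  have "w \<tturnstile> fsub (Ex N (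
          (Eq N (Var 0) zero \<^bold>\<longrightarrow> Eq (Seq \<sigma>) (shift 1 (Var 0)) (Con (Emp \<sigma>))) \<^bold>\<and>
          ((\<^bold>\<not> Eq N (Var 0) zero) \<^bold>\<longrightarrow>
            Ex \<sigma> (Ex (Seq \<sigma>) (Eq (Seq \<sigma>) (shift 3 (Var 0)) (Con (Prep \<sigma>) \<cdot> Var 1 \<cdot> Var 0)))))) (case_nat s Var)"
    by (rule forces_eha[of "[Seq \<sigma>]", OF eha_ax.seq_cases]) (use s w in simp_all)
  then have "w \<tturnstile> Ex N (
          (Eq N (Var 0) zero \<^bold>\<longrightarrow> Eq (Seq \<sigma>) (shift (Suc 0) s) (Con (Emp \<sigma>))) \<^bold>\<and>
          ((\<^bold>\<not> Eq N (Var 0) zero) \<^bold>\<longrightarrow>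
            Ex \<sigma> (Ex (Seq \<sigma>) (Eq (Seq \<sigma>) (shift (Suc (Suc (Suc 0))) s) (Con (Prep \<sigma>) \<cdot> Var (Suc 0) \<cdot> Var 0)))))"
    by (simp add: eval_nat_numeral)
  then show ?thesis
  proof (rule forces_exE)
    fix z w1
    assume 1: "w \<sqsubseteq> w1" "typed z N"
     and "w1 \<tturnstile> inst z (
          (Eq N (Var 0) zero \<^bold>\<longrightarrow> Eq (Seq \<sigma>) (shift (Suc 0) s) (Con (Emp \<sigma>))) \<^bold>\<and>
          ((\<^bold>\<not> Eq N (Var 0) zero) \<^bold>\<longrightarrow>
            Ex \<sigma> (Ex (Seq \<sigma>) (Eq (Seq \<sigma>) (shift (Suc (Suc (Suc 0))) s) (Con (Prep \<sigma>) \<cdot> Var (Suc 0) \<cdot> Var 0)))))"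
    then have 2: "w1 \<tturnstile> (Eq N z zero \<^bold>\<longrightarrow> Eq (Seq \<sigma>) s (Con (Emp \<sigma>)))"
      and 3: "w1 \<tturnstile> ((\<^bold>\<not> Eq N z zero) \<^bold>\<longrightarrow> ?B)"
      by (simp_all add: inst_def eval_nat_numeral)
    show "w1 \<tturnstile> \<chi>"
    proof (rule forces_zero_cases[OF \<chi>(2,3) 1(2)])
      show "w1 \<tturnstile> (Eq N z zero \<^bold>\<longrightarrow> \<chi>)"
      proof (rule forces_impI)
        fix w2 assume 4: "w1 \<sqsubseteq> w2" "w2 \<tturnstile> Eq N z zero"
        show "w2 \<tturnstile> \<chi>"
          by (rule nil[OF later_trans[OF 1(1) 4(1)] forces_mp[OF forces_mono[OF 2 4(1)] 4(2)]])
      qed (use 1 forces_world[OF 2] in auto)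
      show "w1 \<tturnstile> ((\<^bold>\<not> Eq N z zero) \<^bold>\<longrightarrow> \<chi>)"
      proof (rule forces_impI)
        fix w2 assume 4: "w1 \<sqsubseteq> w2" "w2 \<tturnstile> (\<^bold>\<not> Eq N z zero)"
        have "w2 \<tturnstile> ?B" by (rule forces_mp[OF forces_mono[OF 3 4(1)] 4(2)])
        then show "w2 \<tturnstile> \<chi>"
        proof (rule forces_exE)
          fix a w3
          assume 5: "w2 \<sqsubseteq> w3" "typed a \<sigma>"
            and "w3 \<tturnstile> inst a (Ex (Seq \<sigma>) (Eq (Seq \<sigma>) (shift 2 s) (Con (Prep \<sigma>) \<cdot> Var 1 \<cdot> Var 0)))"
          then have "w3 \<tturnstile> Ex (Seq \<sigma>) (Eq (Seq \<sigma>) (shift 1 s) (Con (Prep \<sigma>) \<cdot> shift 1 a \<cdot> Var 0))"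
            by (simp add: inst_def eval_nat_numeral)
          then show "w3 \<tturnstile> \<chi>"
          proof (rule forces_exE)
            fix r w4
            assume 6: "w3 \<sqsubseteq> w4" "typed r (Seq \<sigma>)"
              and "w4 \<tturnstile> inst r (Eq (Seq \<sigma>) (shift 1 s) (Con (Prep \<sigma>) \<cdot> shift 1 a \<cdot> Var 0))"
            then have "w4 \<tturnstile> Eq (Seq \<sigma>) s (Con (Prep \<sigma>) \<cdot> a \<cdot> r)" by (simp add: inst_def)
            then show "w4 \<tturnstile> \<chi>"
              by (rule cons[OF _ 5(2) 6(2), rotated]) (meson 1(1) 4(1) 5(1) 6(1) later_trans)
          qed
        qed
      qed (use 1 forces_world[OF 2] in auto)
    qed
  qed
qed

lemma typed_len: "typed s (Seq \<sigma>) \<Longrightarrow> typed (len \<sigma> s) N"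
  using typed_tsub[of "[Seq \<sigma>]" "len \<sigma> (Var 0)" N "case_nat s Var"] by (simp add: has_ty_len)

lemma eq_len_cons:
  assumes "world w" "typed a \<sigma>" "typed s (Seq \<sigma>)"
  shows "w \<tturnstile> Eq N (len \<sigma> (Con (Prep \<sigma>) \<cdot> a \<cdot> s)) (suc (len \<sigma> s))"
proof -
  let ?v = "lam [] N (lam [N] \<sigma> (suc (Var (Suc 0))))"
  have "closed_tm ?v (N \<rightarrow> \<sigma> \<rightarrow> N)" by (intro has_ty_lam) (simp add: has_ty_App)
  then have "w \<tturnstile> Eq N (len \<sigma> (Con (Prep \<sigma>) \<cdot> a \<cdot> s)) (?v \<cdot> len \<sigma> s \<cdot> a)"
    unfolding len_def One_nat_def using assms by (intro eq_L_cons) (auto intro: typed_closed)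
  also have "w \<tturnstile> Eq N (?v \<cdot> len \<sigma> s \<cdot> a) (tsub (case_nat a (case_nat (len \<sigma> s) Var)) (suc (Var (Suc 0))))"
    by (rule eq_beta2) (use assms in \<open>auto simp: has_ty_App intro: typed_len\<close>)
  finally show ?thesis by simp
qed

text \<open>There is no induction axiom for sequences. Ordinary induction on \<open>n\<close> proves
  the claim for all sequences of length \<open>n\<close>, and the result is read off at the length
  of \<open>s\<close>.\<close>

lemma forces_list_induct:
  assumes wf: "wff \<phi> (Seq \<sigma> # \<Gamma>)" "internal \<phi>" "or_free \<phi>" and e: "env e \<Gamma>" and w: "world w"
    and base: "w \<tturnstile> fsub \<phi> (case_nat (Con (Emp \<sigma>)) e)"
    and step: "\<And>w' a s. w \<sqsubseteq> w' \<Longrightarrow> typed a \<sigma> \<Longrightarrow> typed s (Seq \<sigma>) \<Longrightarrow> w' \<tturnstile> fsub \<phi> (case_nat s e)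
      \<Longrightarrow> w' \<tturnstile> fsub \<phi> (case_nat (Con (Prep \<sigma>) \<cdot> a \<cdot> s) e)"
    and s: "typed s (Seq \<sigma>)"
  shows "w \<tturnstile> fsub \<phi> (case_nat s e)"
proof -
  \<comment> \<open>Variable 1 is going to be the length, so the parameters of \<open>\<phi>\<close>
    move up by one.\<close>
  let ?\<phi> = "fsub \<phi> (case_nat (Var 0) (\<lambda>i. Var (Suc (Suc i))))"
  let ?\<psi> = "All (Seq \<sigma>) (Eq N (len \<sigma> (Var 0)) (Var (Suc 0)) \<^bold>\<longrightarrow> ?\<phi>)"
  have \<phi>: "fsub ?\<phi> (case_nat s (case_nat n e)) = fsub \<phi> (case_nat s e)" for s n
    by (rule fsub_fsub_eq) (simp split: nat.split)
  have wf': "wff ?\<phi> (Seq \<sigma> # N # \<Gamma>)"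
    by (rule wff_fsub[OF wf(1)]) (simp add: nth_Cons split: nat.split)
  have wfm: "wfm (fsub \<phi> (case_nat s e))" if "typed s (Seq \<sigma>)" for s
    by (rule wfm_fsub[OF wf(1)]) (use that e in simp)
  have "w \<tturnstile> fsub ?\<psi> (case_nat (len \<sigma> s) e)"
  proof (rule forces_nat_induct[of ?\<psi> \<Gamma>])
    show "w \<tturnstile> fsub ?\<psi> (case_nat zero e)"
    proof (rule forces_allI')
      fix s assume s: "typed s (Seq \<sigma>)"
      have "w \<tturnstile> (Eq N (len \<sigma> s) zero \<^bold>\<longrightarrow> fsub \<phi> (case_nat s e))"
      proof (rule forces_impI)
        fix w1 assume 1: "w \<sqsubseteq> w1" "w1 \<tturnstile> Eq N (len \<sigma> s) zero"
        show "w1 \<tturnstile> fsub \<phi> (case_nat s e)"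
        proof (rule forces_list_cases[OF s wfm[OF s]])
          fix w2 assume 2: "w1 \<sqsubseteq> w2" "w2 \<tturnstile> Eq (Seq \<sigma>) s (Con (Emp \<sigma>))"
          show "w2 \<tturnstile> fsub \<phi> (case_nat s e)"
            by (rule forces_eq_subst[OF wf(1) e eq_sym[OF 2(2)]
                  forces_mono[OF base later_trans[OF 1(1) 2(1)]]])
        next
          fix w2 a r
          assume 2: "w1 \<sqsubseteq> w2" "typed a \<sigma>" "typed r (Seq \<sigma>)" "w2 \<tturnstile> Eq (Seq \<sigma>) s (Con (Prep \<sigma>) \<cdot> a \<cdot> r)"
          have "w2 \<tturnstile> Eq N (suc (len \<sigma> r)) (len \<sigma> (Con (Prep \<sigma>) \<cdot> a \<cdot> r))"
            by (rule eq_sym[OF eq_len_cons[OF forces_world[OF 2(4)] 2(2,3)]])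
          also have "w2 \<tturnstile> Eq N (len \<sigma> (Con (Prep \<sigma>) \<cdot> a \<cdot> r)) (len \<sigma> s)"
            using eq_tsub[of "[Seq \<sigma>]" "len \<sigma> (Var 0)" N w2 "case_nat (Con (Prep \<sigma>) \<cdot> a \<cdot> r) Var" "case_nat s Var"]
              eq_sym[OF 2(4)] forces_world[OF 2(4)] by (simp add: has_ty_len)
          also note forces_mono[OF 1(2) 2(1)]
          \<comment> \<open>A prepend has successor length, so at length zero only the empty
            sequence remains.\<close>
          finally have "w2 \<tturnstile> Fls" by (rule suc_not_zero) (rule typed_len[OF 2(3)])
          then show "w2 \<tturnstile> fsub \<phi> (case_nat s e)" by (rule forces_flsE[OF _ wfm[OF s]])
        qed (use wf forces_world[OF 1(2)] in auto)
      qed (use w s in \<open>auto intro: typed_len\<close>)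
      then show "w \<tturnstile> fsub (Eq N (len \<sigma> (Var 0)) (Var (Suc 0)) \<^bold>\<longrightarrow> ?\<phi>) (case_nat s (case_nat zero e))"
        by (simp add: \<phi>)
    qed
  next
    fix w0 n assume n: "w \<sqsubseteq> w0" "typed n N" "w0 \<tturnstile> fsub ?\<psi> (case_nat n e)"
    show "w0 \<tturnstile> fsub ?\<psi> (case_nat (suc n) e)"
    proof (rule forces_allI')
      fix s assume s: "typed s (Seq \<sigma>)"
      have "w0 \<tturnstile> (Eq N (len \<sigma> s) (suc n) \<^bold>\<longrightarrow> fsub \<phi> (case_nat s e))"
      proof (rule forces_impI)
        fix w1 assume 1: "w0 \<sqsubseteq> w1" "w1 \<tturnstile> Eq N (len \<sigma> s) (suc n)"
        show "w1 \<tturnstile> fsub \<phi> (case_nat s e)"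
        proof (rule forces_list_cases[OF s wfm[OF s]])
          fix w2 assume 2: "w1 \<sqsubseteq> w2" "w2 \<tturnstile> Eq (Seq \<sigma>) s (Con (Emp \<sigma>))"
          show "w2 \<tturnstile> fsub \<phi> (case_nat s e)"
            by (rule forces_eq_subst[OF wf(1) e eq_sym[OF 2(2)]
                  forces_mono[OF base later_trans[OF n(1) later_trans[OF 1(1) 2(1)]]]])
        next
          fix w2 a r
          assume 2: "w1 \<sqsubseteq> w2" "typed a \<sigma>" "typed r (Seq \<sigma>)" "w2 \<tturnstile> Eq (Seq \<sigma>) s (Con (Prep \<sigma>) \<cdot> a \<cdot> r)"
          have "w2 \<tturnstile> Eq N (suc (len \<sigma> r)) (len \<sigma> (Con (Prep \<sigma>) \<cdot> a \<cdot> r))"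
            by (rule eq_sym[OF eq_len_cons[OF forces_world[OF 2(4)] 2(2,3)]])
          also have "w2 \<tturnstile> Eq N (len \<sigma> (Con (Prep \<sigma>) \<cdot> a \<cdot> r)) (len \<sigma> s)"
            using eq_tsub[of "[Seq \<sigma>]" "len \<sigma> (Var 0)" N w2 "case_nat (Con (Prep \<sigma>) \<cdot> a \<cdot> r) Var" "case_nat s Var"]
              eq_sym[OF 2(4)] forces_world[OF 2(4)] by (simp add: has_ty_len)
          also note forces_mono[OF 1(2) 2(1)]
          finally have eq: "w2 \<tturnstile> Eq N (len \<sigma> r) n"
            by (rule suc_inj) (use 2(3) n(2) in \<open>auto intro: typed_len\<close>)
          have "w2 \<tturnstile> fsub ?\<psi> (case_nat n e)" by (rule forces_mono[OF n(3) later_trans[OF 1(1) 2(1)]])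
          from forces_allE'[OF this 2(3)]
          have "w2 \<tturnstile> (Eq N (len \<sigma> r) n \<^bold>\<longrightarrow> fsub \<phi> (case_nat r e))" by (simp add: \<phi>)
          from step[OF later_trans[OF n(1) later_trans[OF 1(1) 2(1)]] 2(2,3) forces_mp[OF this eq]]
          show "w2 \<tturnstile> fsub \<phi> (case_nat s e)"
            by (rule forces_eq_subst[OF wf(1) e eq_sym[OF 2(4)]])
        qed (use wf forces_world[OF 1(2)] in auto)
      qed (use n s in \<open>auto intro: typed_len typed_suc later_world\<close>)
      then show "w0 \<tturnstile> fsub (Eq N (len \<sigma> (Var 0)) (Var (Suc 0)) \<^bold>\<longrightarrow> ?\<phi>) (case_nat s (case_nat (suc n) e))"
        by (simp add: \<phi>)
    qed
  qed (use wf wf' e w s in \<open>auto intro: typed_len has_ty_len\<close>)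
  from forces_allE'[OF this s]
  have "w \<tturnstile> (Eq N (len \<sigma> s) (len \<sigma> s) \<^bold>\<longrightarrow> fsub \<phi> (case_nat s e))" by (simp add: \<phi>)
  then show ?thesis by (rule forces_mp) (rule eq_refl[OF typed_len[OF s] w])
qed

section \<open>Standard sequences and coding of tuples\<close>

text \<open>Terms are built from closed constants by application, and both preserve standardness.
  The length of a standard sequence and its entries at standard indices are special cases.\<close>

lemma st_tsub:
  "has_ty \<Gamma> t \<sigma> \<Longrightarrow> world w \<Longrightarrow> (\<And>i. i < length \<Gamma> \<Longrightarrow> st w (e i) (\<Gamma> ! i)) \<Longrightarrow> st w (tsub e t) \<sigma>"
proof (induction t arbitrary: \<sigma>)
  case (Con c)
  then show ?case by (simp add: st_closed)
next
  case (App t1 t2)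
  from App.prems(1) obtain \<rho> where "has_ty \<Gamma> t1 (\<rho> \<rightarrow> \<sigma>)" "has_ty \<Gamma> t2 \<rho>"
    by (auto simp: has_ty_App)
  with App.IH App.prems(2,3) show ?case by (simp add: st_App)
qed auto

lemma st_len: "st w s (Seq \<sigma>) \<Longrightarrow> st w (len \<sigma> s) N"
  using st_tsub[of "[Seq \<sigma>]" "len \<sigma> (Var 0)" N w "case_nat s Var"]
  by (simp add: has_ty_len st_world)

lemma st_nth: "st w s (Seq \<sigma>) \<Longrightarrow> st w i N \<Longrightarrow> st w (nth_tm \<sigma> s i) \<sigma>"
proof -
  assume "st w s (Seq \<sigma>)" "st w i N"
  then have "st w (tsub (case_nat s (case_nat i Var)) (nth_tm \<sigma> (Var 0) (Var (Suc 0)))) \<sigma>"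
    by (intro st_tsub[of "[Seq \<sigma>, N]"]) (auto simp: has_ty_nth less_Suc_eq intro: st_world)
  then show ?thesis by simp
qed

lemma typed_plus: "typed t N \<Longrightarrow> typed u N \<Longrightarrow> typed (plus_tm t u) N"
  using typed_tsub[of "[N, N]" "plus_tm (Var 0) (Var (Suc 0))" N "case_nat t (case_nat u Var)"]
  by (simp add: has_ty_plus)

lemma wfm_less: "typed t N \<Longrightarrow> typed u N \<Longrightarrow> wfm (less_fm t u)"
  using wfm_fsub[of "less_fm (Var 0) (Var (Suc 0))" "[N, N]" "case_nat t (case_nat u Var)"]
  by (simp add: wff_less)

lemma wfm_mem: "typed a \<sigma> \<Longrightarrow> typed s (Seq \<sigma>) \<Longrightarrow> wfm (mem \<sigma> a s)"
  using wfm_fsub[of "mem \<sigma> (Var 0) (Var (Suc 0))" "[\<sigma>, Seq \<sigma>]" "case_nat a (case_nat s Var)"]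
  by (simp add: wff_mem)

lemma closed_suc_step: "closed_tm (lam [] N (lam [N] \<sigma> (suc (Var (Suc 0))))) (N \<rightarrow> \<sigma> \<rightarrow> N)"
  by (intro has_ty_lam) (simp add: has_ty_App)

lemma eq_plus_zero: "typed t N \<Longrightarrow> world w \<Longrightarrow> w \<tturnstile> Eq N (plus_tm t zero) t"
  unfolding plus_tm_def One_nat_def by (rule eq_R_zero) (simp_all add: typed_closed[OF closed_suc_step])

lemma eq_plus_suc:
  assumes "typed t N" "typed u N" "world w"
  shows "w \<tturnstile> Eq N (plus_tm t (suc u)) (suc (plus_tm t u))"
proof -
  let ?v = "lam [] N (lam [N] N (suc (Var (Suc 0))))"
  have "w \<tturnstile> Eq N (plus_tm t (suc u)) (?v \<cdot> plus_tm t u \<cdot> u)"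
    unfolding plus_tm_def One_nat_def
    by (rule eq_R_suc) (use assms in \<open>simp_all add: typed_closed[OF closed_suc_step]\<close>)
  also have "w \<tturnstile> Eq N (?v \<cdot> plus_tm t u \<cdot> u) (tsub (case_nat u (case_nat (plus_tm t u) Var)) (suc (Var (Suc 0))))"
    by (rule eq_beta2) (use assms in \<open>auto simp: has_ty_App intro: typed_plus\<close>)
  finally show ?thesis by simp
qed

lemma forces_lessI:
  "w \<tturnstile> Eq N (plus_tm t (suc k)) u \<Longrightarrow> typed k N \<Longrightarrow> w \<tturnstile> less_fm t u"
  unfolding less_fm_def by (rule forces_exI[of _ k]) (simp_all add: inst_def)

lemma forces_lessE:
  assumes "w \<tturnstile> less_fm t u"
    and "\<And>w' k. w \<sqsubseteq> w' \<Longrightarrow> typed k N \<Longrightarrow> w' \<tturnstile> Eq N (plus_tm t (suc k)) u \<Longrightarrow> w' \<tturnstile> \<chi>"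
  shows "w \<tturnstile> \<chi>"
  using assms(1)[unfolded less_fm_def]
  by (rule forces_exE) (use assms(2) in \<open>simp add: inst_def\<close>)

lemma forces_memE:
  assumes "w \<tturnstile> mem \<sigma> a s"
    and "\<And>w' i. w \<sqsubseteq> w' \<Longrightarrow> typed i N \<Longrightarrow> w' \<tturnstile> less_fm i (len \<sigma> s)
      \<Longrightarrow> w' \<tturnstile> Eq \<sigma> a (nth_tm \<sigma> s i) \<Longrightarrow> w' \<tturnstile> \<chi>"
  shows "w \<tturnstile> \<chi>"
  using assms(1)[unfolded mem_def]
  by (rule forces_exE) (use assms(2) in \<open>simp add: inst_def\<close>)

text \<open>The assumption yields \<open>k\<close> with \<open>i + k = n\<close>. If
  \<open>k\<close> is zero then \<open>i\<close> equals \<open>n\<close>, and if it is a successor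
  then \<open>i < n\<close>. The distinction has to be an induction with the goal inside the
  formula, since \<open>k\<close> may be nonstandard.\<close>

lemma forces_less_suc_cases:
  assumes wf: "wff \<phi> (N # \<Gamma>)" "internal \<phi>" "or_free \<phi>" and e: "env e \<Gamma>"
    and i: "typed i N" and n: "typed n N" and less: "w \<tturnstile> less_fm i (suc n)"
    and eq: "w \<tturnstile> fsub \<phi> (case_nat n e)"
    and lt: "\<And>w'. w \<sqsubseteq> w' \<Longrightarrow> w' \<tturnstile> less_fm i n \<Longrightarrow> w' \<tturnstile> fsub \<phi> (case_nat i e)"
  shows "w \<tturnstile> fsub \<phi> (case_nat i e)"
  using less
proof (rule forces_lessE)
  fix w1 k assume 1: "w \<sqsubseteq> w1" "typed k N" "w1 \<tturnstile> Eq N (plus_tm i (suc k)) (suc n)"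
  let ?\<phi> = "fsub \<phi> (case_nat (Var (Suc 0)) (\<lambda>i. Var (Suc (Suc (Suc i)))))"
  let ?\<theta> = "Eq N (plus_tm (Var (Suc 0)) (Var 0)) (Var (Suc (Suc 0))) \<^bold>\<longrightarrow> ?\<phi>"
  let ?e = "case_nat i (case_nat n e)"
  have \<phi>: "fsub ?\<phi> (case_nat k ?e) = fsub \<phi> (case_nat i e)" for k
    by (rule fsub_fsub_eq) (simp split: nat.split)
  have w: "world w1" by (rule forces_world[OF 1(3)])
  have "w1 \<tturnstile> fsub ?\<theta> (case_nat k ?e)"
  proof (rule forces_nat_induct[of _ "N # N # \<Gamma>"])
    have "w1 \<tturnstile> (Eq N (plus_tm i zero) n \<^bold>\<longrightarrow> fsub \<phi> (case_nat i e))"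
    proof (rule forces_impI)
      fix w2 assume 2: "w1 \<sqsubseteq> w2" "w2 \<tturnstile> Eq N (plus_tm i zero) n"
      have "w2 \<tturnstile> Eq N n i"
        by (rule eq_trans[OF eq_sym[OF 2(2)] eq_plus_zero[OF i forces_world[OF 2(2)]]])
      then show "w2 \<tturnstile> fsub \<phi> (case_nat i e)"
        by (rule forces_eq_subst[OF wf(1) e _ forces_mono[OF eq later_trans[OF 1(1) 2(1)]]])
    qed (use i n w in \<open>auto intro: typed_plus\<close>)
    then show "w1 \<tturnstile> fsub ?\<theta> (case_nat zero ?e)" by (simp add: \<phi>)
  next
    fix w2 k assume 2: "w1 \<sqsubseteq> w2" "typed k N"
    have "w2 \<tturnstile> (Eq N (plus_tm i (suc k)) n \<^bold>\<longrightarrow> fsub \<phi> (case_nat i e))"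
    proof (rule forces_impI)
      fix w3 assume 3: "w2 \<sqsubseteq> w3" "w3 \<tturnstile> Eq N (plus_tm i (suc k)) n"
      show "w3 \<tturnstile> fsub \<phi> (case_nat i e)"
        by (rule lt[OF later_trans[OF 1(1) later_trans[OF 2(1) 3(1)]] forces_lessI[OF 3(2) 2(2)]])
    qed (use i n 2 in \<open>auto intro: typed_plus typed_suc later_world\<close>)
    then show "w2 \<tturnstile> fsub ?\<theta> (case_nat (suc k) ?e)" by (simp add: \<phi>)
  next
    have "wff ?\<phi> (N # N # N # \<Gamma>)"
      by (rule wff_fsub[OF wf(1)]) (simp add: nth_Cons split: nat.split)
    then show "wff ?\<theta> (N # N # N # \<Gamma>)" by (simp add: has_ty_plus)
  qed (use wf e i n 1 w in auto)
  then have imp: "w1 \<tturnstile> (Eq N (plus_tm i k) n \<^bold>\<longrightarrow> fsub \<phi> (case_nat i e))" by (simp add: \<phi>)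
  have "w1 \<tturnstile> Eq N (plus_tm i k) n"
    by (rule suc_inj[OF eq_trans[OF eq_sym[OF eq_plus_suc[OF i 1(2) w]] 1(3)]])
      (use i n 1 in \<open>auto intro: typed_plus\<close>)
  with imp show "w1 \<tturnstile> fsub \<phi> (case_nat i e)" by (rule forces_mp)
qed

text \<open>The elements of a standard sequence cannot be shown to be standard: by \<open>IP\<close> and \<open>NU\<close> this
  would make all elements of a standard sequence equal. What survives is the following transfer of
  internal disjunction-free formulae, where the last element can be split off by induction.\<close>

lemma forces_st_ball:
  assumes wf: "wff \<phi> (\<sigma> # \<Gamma>)" "internal \<phi>" "or_free \<phi>" and e: "env e \<Gamma>"
    and s: "st w s (Seq \<sigma>)" and all: "w \<tturnstile> fsub (AllSt \<sigma> \<phi>) e"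
    and mem: "w \<tturnstile> mem \<sigma> a s"
  shows "w \<tturnstile> fsub \<phi> (case_nat a e)"
proof -
  let ?\<phi> = "fsub \<phi> (case_nat (nth_tm \<sigma> (Var (Suc 0)) (Var 0)) (\<lambda>i. Var (Suc (Suc i))))"
  let ?\<phi>' = "fsub ?\<phi> (case_nat (Var 0) (\<lambda>i. Var (Suc (Suc i))))"
  \<comment> \<open>The bound \<open>n\<close> is the variable of an external induction and hence
    standard. The index below it ranges over all numbers, because membership does not provide a
    standard index.\<close>
  let ?\<chi> = "All N (less_fm (Var 0) (Var (Suc 0)) \<^bold>\<longrightarrow> ?\<phi>')"
  let ?e = "case_nat s e"
  have ts: "typed s (Seq \<sigma>)" by (rule st_typed[OF s])
  have \<phi>: "fsub ?\<phi> (case_nat i ?e) = fsub \<phi> (case_nat (nth_tm \<sigma> s i) e)" for i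
    by (rule fsub_fsub_eq) (simp split: nat.split)
  have \<phi>': "fsub ?\<phi>' (case_nat i (case_nat n ?e)) = fsub ?\<phi> (case_nat i ?e)" for i n
    by (rule fsub_fsub_eq) (simp split: nat.split)
  have wf': "wff ?\<phi> (N # Seq \<sigma> # \<Gamma>)"
    by (rule wff_fsub[OF wf(1)]) (simp add: nth_Cons has_ty_nth split: nat.split)
  have "wff ?\<phi>' (N # N # Seq \<sigma> # \<Gamma>)"
    by (rule wff_fsub[OF wf']) (simp add: nth_Cons split: nat.split)
  then have wf\<chi>: "wff ?\<chi> (N # Seq \<sigma> # \<Gamma>)" by (simp add: wff_less)
  have wfm: "wfm (fsub ?\<phi> (case_nat i ?e))" if "typed i N" for i
    by (rule wfm_fsub[OF wf']) (use that ts e in simp)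
  have bounded: "w \<tturnstile> fsub ?\<chi> (case_nat (len \<sigma> s) ?e)"
  proof (rule forces_st_induct[OF wf\<chi>])
    show "w \<tturnstile> fsub ?\<chi> (case_nat zero ?e)"
    proof (rule forces_allI')
      fix i assume i: "typed i N"
      have "w \<tturnstile> (less_fm i zero \<^bold>\<longrightarrow> fsub ?\<phi> (case_nat i ?e))"
      proof (rule forces_impI)
        fix w1 assume "w1 \<tturnstile> less_fm i zero"
        then show "w1 \<tturnstile> fsub ?\<phi> (case_nat i ?e)"
        proof (rule forces_lessE)
          fix w2 k assume 2: "typed k N" "w2 \<tturnstile> Eq N (plus_tm i (suc k)) zero"
          have "w2 \<tturnstile> Fls"
            by (rule suc_not_zero[OF eq_trans[OF eq_sym[OF eq_plus_suc[OF i 2(1) forces_world[OF 2(2)]]] 2(2)]])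
              (rule typed_plus[OF i 2(1)])
          then show "w2 \<tturnstile> fsub ?\<phi> (case_nat i ?e)" by (rule forces_flsE[OF _ wfm[OF i]])
        qed
      qed (use i st_world[OF s] in \<open>auto intro: wfm_less\<close>)
      then show "w \<tturnstile> fsub (less_fm (Var 0) (Var (Suc 0)) \<^bold>\<longrightarrow> ?\<phi>') (case_nat i (case_nat zero ?e))"
        by (simp add: \<phi>')
    qed
  next
    fix w1 n assume 1: "w \<sqsubseteq> w1" "st w1 n N" "w1 \<tturnstile> fsub ?\<chi> (case_nat n ?e)"
    show "w1 \<tturnstile> fsub ?\<chi> (case_nat (suc n) ?e)"
    proof (rule forces_allI')
      fix i assume i: "typed i N"
      have "w1 \<tturnstile> (less_fm i (suc n) \<^bold>\<longrightarrow> fsub ?\<phi> (case_nat i ?e))"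
      proof (rule forces_impI)
        fix w2 assume 2: "w1 \<sqsubseteq> w2" "w2 \<tturnstile> less_fm i (suc n)"
        have 12: "w \<sqsubseteq> w2" by (rule later_trans[OF 1(1) 2(1)])
        show "w2 \<tturnstile> fsub ?\<phi> (case_nat i ?e)"
        proof (rule forces_less_suc_cases[OF wf' _ _ _ i st_typed[OF 1(2)] 2(2)])
          \<comment> \<open>The last index \<open>n\<close> is standard, therefore so is the entry
            at \<open>n\<close>, and \<open>all\<close> applies to it.\<close>
          show "w2 \<tturnstile> fsub ?\<phi> (case_nat n ?e)" unfolding \<phi>
            by (rule forces_AllStE'[OF forces_mono[OF all 12]
                  st_nth[OF st_mono[OF s 12] st_mono[OF 1(2) 2(1)]]])
          fix w3 assume 3: "w2 \<sqsubseteq> w3" "w3 \<tturnstile> less_fm i n"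
          have "w3 \<tturnstile> (less_fm i n \<^bold>\<longrightarrow> fsub ?\<phi> (case_nat i ?e))"
            using forces_allE'[OF forces_mono[OF 1(3) later_trans[OF 2(1) 3(1)]] i] by (simp add: \<phi>')
          then show "w3 \<tturnstile> fsub ?\<phi> (case_nat i ?e)" using 3(2) by (rule forces_mp)
        qed (use wf e ts in auto)
      qed (use i st_world[OF 1(2)] st_typed[OF 1(2)] in \<open>auto intro: wfm_less typed_suc\<close>)
      then show "w1 \<tturnstile> fsub (less_fm (Var 0) (Var (Suc 0)) \<^bold>\<longrightarrow> ?\<phi>') (case_nat i (case_nat (suc n) ?e))"
        by (simp add: \<phi>')
    qed
  qed (use e ts st_len[OF s] in auto)
  from mem show ?thesis
  proof (rule forces_memE)
    fix w1 i
    assume 1: "w \<sqsubseteq> w1" "typed i N" "w1 \<tturnstile> less_fm i (len \<sigma> s)" "w1 \<tturnstile> Eq \<sigma> a (nth_tm \<sigma> s i)"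
    have "w1 \<tturnstile> (less_fm i (len \<sigma> s) \<^bold>\<longrightarrow> fsub \<phi> (case_nat (nth_tm \<sigma> s i) e))"
      using forces_allE'[OF forces_mono[OF bounded 1(1)] 1(2)] by (simp add: \<phi>' \<phi>)
    from forces_mp[OF this 1(3)] show "w1 \<tturnstile> fsub \<phi> (case_nat a e)"
      by (rule forces_eq_subst[OF wf(1) e eq_sym[OF 1(4)]])
  qed
qed

text \<open>There are no product types, so the type of codes is allowed to depend on both
  components. Only the projection equations are required; a code need not be a pair. That
  \<open>p\<close>, \<open>l\<close> and \<open>r\<close> are closed ensures that pairing and
  projecting preserve standardness.\<close>

definition pairable :: "ty \<Rightarrow> ty \<Rightarrow> bool" where
  "pairable \<sigma> \<tau> \<longleftrightarrow> (\<exists>\<rho> p l r. closed_tm p (\<sigma> \<rightarrow> \<tau> \<rightarrow> \<rho>) \<and> closed_tm l (\<rho> \<rightarrow> \<sigma>) \<and> closed_tm r (\<rho> \<rightarrow> \<tau>) \<and>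
    (\<forall>w x y. world w \<longrightarrow> typed x \<sigma> \<longrightarrow> typed y \<tau> \<longrightarrow>
      w \<tturnstile> Eq \<sigma> (l \<cdot> (p \<cdot> x \<cdot> y)) x \<and> w \<tturnstile> Eq \<tau> (r \<cdot> (p \<cdot> x \<cdot> y)) y))"

text \<open>Exchange the arguments of \<open>p\<close> and the roles of \<open>l\<close> and
  \<open>r\<close>. Thus each closure property has to be established for the first component
  only.\<close>

lemma pairable_sym:
  assumes "pairable \<sigma> \<tau>"
  shows "pairable \<tau> \<sigma>"
proof -
  obtain \<rho> p l r where c: "closed_tm p (\<sigma> \<rightarrow> \<tau> \<rightarrow> \<rho>)" "closed_tm l (\<rho> \<rightarrow> \<sigma>)" "closed_tm r (\<rho> \<rightarrow> \<tau>)"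
    and eq: "\<And>w x y. world w \<Longrightarrow> typed x \<sigma> \<Longrightarrow> typed y \<tau> \<Longrightarrow>
      w \<tturnstile> Eq \<sigma> (l \<cdot> (p \<cdot> x \<cdot> y)) x \<and> w \<tturnstile> Eq \<tau> (r \<cdot> (p \<cdot> x \<cdot> y)) y"
    using assms unfolding pairable_def by blast
  let ?b = "p \<cdot> Var 0 \<cdot> Var (Suc 0)"
  let ?p = "lam [] \<tau> (lam [\<tau>] \<sigma> ?b)"
  have b: "has_ty [\<sigma>, \<tau>] ?b \<rho>" using has_ty_closed[OF c(1)] by (simp add: has_ty_App)
  have beta: "w \<tturnstile> Eq \<rho> (?p \<cdot> y \<cdot> x) (p \<cdot> x \<cdot> y)" if "world w" "typed x \<sigma>" "typed y \<tau>" for w x y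
    using eq_beta2[OF b that(3,2,1)] by (simp add: tsub_closed[OF c(1)])
  show ?thesis unfolding pairable_def
  proof (intro exI conjI allI impI)
    show "closed_tm ?p (\<tau> \<rightarrow> \<sigma> \<rightarrow> \<rho>)" by (intro has_ty_lam b)
    show "closed_tm r (\<rho> \<rightarrow> \<tau>)" "closed_tm l (\<rho> \<rightarrow> \<sigma>)" by fact+
    fix w y x assume h: "world w" "typed y \<tau>" "typed x \<sigma>"
    note beta = beta[OF h(1,3,2)]
    show "w \<tturnstile> Eq \<tau> (r \<cdot> (?p \<cdot> y \<cdot> x)) y"
      using eq_trans[OF eq_arg[OF typed_closed[OF c(3)] beta]] eq[OF h(1,3,2)] by blast
    show "w \<tturnstile> Eq \<sigma> (l \<cdot> (?p \<cdot> y \<cdot> x)) x"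
      using eq_trans[OF eq_arg[OF typed_closed[OF c(2)] beta]] eq[OF h(1,3,2)] by blast
  qed
qed

text \<open>The pair of \<open>f\<close> and \<open>y\<close> is the function that sends
  \<open>a\<close> to \<open>p (f a) y\<close>. The first component is recovered pointwise, by
  extensionality, and the second by evaluation at a default argument.\<close>

lemma pairable_fun:
  assumes "pairable \<beta> \<tau>"
  shows "pairable (\<alpha> \<rightarrow> \<beta>) \<tau>"
proof -
  obtain \<rho> p l r where c: "closed_tm p (\<beta> \<rightarrow> \<tau> \<rightarrow> \<rho>)" "closed_tm l (\<rho> \<rightarrow> \<beta>)" "closed_tm r (\<rho> \<rightarrow> \<tau>)"
    and eq: "\<And>w x y. world w \<Longrightarrow> typed x \<beta> \<Longrightarrow> typed y \<tau> \<Longrightarrow>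
      w \<tturnstile> Eq \<beta> (l \<cdot> (p \<cdot> x \<cdot> y)) x \<and> w \<tturnstile> Eq \<tau> (r \<cdot> (p \<cdot> x \<cdot> y)) y"
    using assms unfolding pairable_def by blast
  let ?b = "p \<cdot> (Var (Suc (Suc 0)) \<cdot> Var 0) \<cdot> Var (Suc 0)"
  let ?p = "lam [] (\<alpha> \<rightarrow> \<beta>) (lam [\<alpha> \<rightarrow> \<beta>] \<tau> (lam [\<tau>, \<alpha> \<rightarrow> \<beta>] \<alpha> ?b))"
  let ?bl = "l \<cdot> (Var (Suc 0) \<cdot> Var 0)"
  let ?l = "lam [] (\<alpha> \<rightarrow> \<rho>) (lam [\<alpha> \<rightarrow> \<rho>] \<alpha> ?bl)"
  let ?br = "r \<cdot> (Var 0 \<cdot> default_tm \<alpha>)"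
  let ?r = "lam [] (\<alpha> \<rightarrow> \<rho>) ?br"
  have b: "has_ty [\<alpha>, \<tau>, \<alpha> \<rightarrow> \<beta>] ?b \<rho>" using has_ty_closed[OF c(1)] by (simp add: has_ty_App)
  have bl: "has_ty [\<alpha>, \<alpha> \<rightarrow> \<rho>] ?bl \<beta>" using has_ty_closed[OF c(2)] by (simp add: has_ty_App)
  have br: "has_ty [\<alpha> \<rightarrow> \<rho>] ?br \<tau>"
    using has_ty_closed[OF c(3)] has_ty_closed[OF closed_default[of \<alpha>]] by (simp add: has_ty_App)
  have cp: "closed_tm ?p ((\<alpha> \<rightarrow> \<beta>) \<rightarrow> \<tau> \<rightarrow> \<alpha> \<rightarrow> \<rho>)" by (intro has_ty_lam b)
  have cl: "closed_tm ?l ((\<alpha> \<rightarrow> \<rho>) \<rightarrow> \<alpha> \<rightarrow> \<beta>)" by (intro has_ty_lam bl)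
  have cr: "closed_tm ?r ((\<alpha> \<rightarrow> \<rho>) \<rightarrow> \<tau>)" by (intro has_ty_lam br)
  show ?thesis unfolding pairable_def
  proof (intro exI conjI allI impI)
    show "closed_tm ?p ((\<alpha> \<rightarrow> \<beta>) \<rightarrow> \<tau> \<rightarrow> \<alpha> \<rightarrow> \<rho>)" "closed_tm ?l ((\<alpha> \<rightarrow> \<rho>) \<rightarrow> \<alpha> \<rightarrow> \<beta>)"
      "closed_tm ?r ((\<alpha> \<rightarrow> \<rho>) \<rightarrow> \<tau>)" by fact+
    fix w f y assume h: "world w" "typed f (\<alpha> \<rightarrow> \<beta>)" "typed y \<tau>"
    have tp: "typed (?p \<cdot> f \<cdot> y) (\<alpha> \<rightarrow> \<rho>)"
      by (rule typed_App[OF typed_App[OF typed_closed[OF cp] h(2)] h(3)])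
    have beta: "w \<tturnstile> Eq \<rho> (?p \<cdot> f \<cdot> y \<cdot> a) (p \<cdot> (f \<cdot> a) \<cdot> y)" if "typed a \<alpha>" for a
      using eq_beta3[OF b h(2,3) that h(1)] by (simp add: tsub_closed[OF c(1)])
    show "w \<tturnstile> Eq (\<alpha> \<rightarrow> \<beta>) (?l \<cdot> (?p \<cdot> f \<cdot> y)) f"
    proof (rule eq_extI[OF typed_App[OF typed_closed[OF cl] tp] h(2,1)])
      fix a assume a: "typed a \<alpha>"
      have "w \<tturnstile> Eq \<beta> (?l \<cdot> (?p \<cdot> f \<cdot> y) \<cdot> a) (l \<cdot> (?p \<cdot> f \<cdot> y \<cdot> a))"
        using eq_beta2[OF bl tp a h(1)] by (simp add: tsub_closed[OF c(2)])
      also have "w \<tturnstile> Eq \<beta> (l \<cdot> (?p \<cdot> f \<cdot> y \<cdot> a)) (l \<cdot> (p \<cdot> (f \<cdot> a) \<cdot> y))"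
        by (rule eq_arg[OF typed_closed[OF c(2)] beta[OF a]])
      also have "w \<tturnstile> Eq \<beta> (l \<cdot> (p \<cdot> (f \<cdot> a) \<cdot> y)) (f \<cdot> a)"
        using eq[OF h(1) typed_App[OF h(2) a] h(3)] by blast
      finally show "w \<tturnstile> Eq \<beta> (?l \<cdot> (?p \<cdot> f \<cdot> y) \<cdot> a) (f \<cdot> a)" .
    qed
    have "w \<tturnstile> Eq \<tau> (?r \<cdot> (?p \<cdot> f \<cdot> y)) (r \<cdot> (?p \<cdot> f \<cdot> y \<cdot> default_tm \<alpha>))"
      using eq_beta1[OF br tp h(1)] by (simp add: tsub_closed[OF c(3)])
    also have "w \<tturnstile> Eq \<tau> (r \<cdot> (?p \<cdot> f \<cdot> y \<cdot> default_tm \<alpha>)) (r \<cdot> (p \<cdot> (f \<cdot> default_tm \<alpha>) \<cdot> y))"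
      by (rule eq_arg[OF typed_closed[OF c(3)] beta[OF typed_default]])
    also have "w \<tturnstile> Eq \<tau> (r \<cdot> (p \<cdot> (f \<cdot> default_tm \<alpha>) \<cdot> y)) y"
      using eq[OF h(1) typed_App[OF h(2) typed_default] h(3)] by blast
    finally show "w \<tturnstile> Eq \<tau> (?r \<cdot> (?p \<cdot> f \<cdot> y)) y" .
  qed
qed

text \<open>The recursor as a case distinction: its step function is constantly \<open>y\<close>, so
  the value is \<open>x\<close> at zero and \<open>y\<close> at successors.\<close>

definition select_tm :: "ty \<Rightarrow> tm \<Rightarrow> tm \<Rightarrow> tm \<Rightarrow> tm" where
  "select_tm \<sigma> i x y = Con (R \<sigma>) \<cdot> i \<cdot> x \<cdot> (Con (K (N \<rightarrow> \<sigma>) \<sigma>) \<cdot> (Con (K \<sigma> N) \<cdot> y))"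

lemma tsub_select [simp]: "tsub e (select_tm \<sigma> i x y) = select_tm \<sigma> (tsub e i) (tsub e x) (tsub e y)"
  by (simp add: select_tm_def)

lemma has_ty_select:
  "has_ty \<Gamma> i N \<Longrightarrow> has_ty \<Gamma> x \<sigma> \<Longrightarrow> has_ty \<Gamma> y \<sigma> \<Longrightarrow> has_ty \<Gamma> (select_tm \<sigma> i x y) \<sigma>"
  by (simp add: select_tm_def has_ty_App)

lemma eq_select_zero: "typed x \<sigma> \<Longrightarrow> typed y \<sigma> \<Longrightarrow> world w \<Longrightarrow> w \<tturnstile> Eq \<sigma> (select_tm \<sigma> zero x y) x"
  unfolding select_tm_def by (rule eq_R_zero) (auto intro: typed_intros)

lemma eq_select_one:
  assumes "typed x \<sigma>" "typed y \<sigma>" "world w"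
  shows "w \<tturnstile> Eq \<sigma> (select_tm \<sigma> (suc zero) x y) y"
proof -
  let ?k = "Con (K \<sigma> N) \<cdot> y" and ?z = "Con (R \<sigma>) \<cdot> zero \<cdot> x \<cdot> (Con (K (N \<rightarrow> \<sigma>) \<sigma>) \<cdot> (Con (K \<sigma> N) \<cdot> y))"
  have k: "typed ?k (N \<rightarrow> \<sigma>)" and k': "typed (Con (K (N \<rightarrow> \<sigma>) \<sigma>) \<cdot> ?k) (\<sigma> \<rightarrow> N \<rightarrow> \<sigma>)"
    and z: "typed ?z \<sigma>"
    by (rule typed_intros assms)+
  have "w \<tturnstile> Eq \<sigma> (select_tm \<sigma> (suc zero) x y) (Con (K (N \<rightarrow> \<sigma>) \<sigma>) \<cdot> ?k \<cdot> ?z \<cdot> zero)"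
    unfolding select_tm_def by (rule eq_R_suc[OF typed_consts(1) assms(1) k' assms(3)])
  also have "w \<tturnstile> Eq \<sigma> (Con (K (N \<rightarrow> \<sigma>) \<sigma>) \<cdot> ?k \<cdot> ?z \<cdot> zero) (?k \<cdot> zero)"
    by (rule eq_fun[OF eq_K[OF k z assms(3)] typed_consts(1)])
  also have "w \<tturnstile> Eq \<sigma> (?k \<cdot> zero) y" by (rule eq_K[OF assms(2) typed_consts(1) assms(3)])
  finally show ?thesis .
qed

text \<open>The pair is the function with value \<open>x\<close> at 0 and \<open>y\<close> at 1.
  Passing to type \<open>N \<rightarrow> N\<close> avoids an arithmetical pairing function.\<close>

lemma pairable_N: "pairable N N"
proof -
  let ?b = "select_tm N (Var 0) (Var (Suc (Suc 0))) (Var (Suc 0))"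
  let ?p = "lam [] N (lam [N] N (lam [N, N] N ?b))"
  let ?l = "lam [] (N \<rightarrow> N) (Var 0 \<cdot> zero)"
  let ?r = "lam [] (N \<rightarrow> N) (Var 0 \<cdot> suc zero)"
  have b: "has_ty [N, N, N] ?b N" by (rule has_ty_select) simp_all
  have l: "has_ty [N \<rightarrow> N] (Var 0 \<cdot> zero) N" and r: "has_ty [N \<rightarrow> N] (Var 0 \<cdot> suc zero) N"
    by (simp_all add: has_ty_App)
  have cp: "closed_tm ?p (N \<rightarrow> N \<rightarrow> N \<rightarrow> N)" by (intro has_ty_lam b)
  show ?thesis unfolding pairable_def
  proof (intro exI conjI allI impI)
    show "closed_tm ?p (N \<rightarrow> N \<rightarrow> N \<rightarrow> N)" by fact
    show "closed_tm ?l ((N \<rightarrow> N) \<rightarrow> N)" "closed_tm ?r ((N \<rightarrow> N) \<rightarrow> N)" by (intro has_ty_lam l r)+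
    fix w x y assume h: "world w" "typed x N" "typed y N"
    have tp: "typed (?p \<cdot> x \<cdot> y) (N \<rightarrow> N)"
      by (rule typed_App[OF typed_App[OF typed_closed[OF cp] h(2)] h(3)])
    have beta: "w \<tturnstile> Eq N (?p \<cdot> x \<cdot> y \<cdot> i) (select_tm N i x y)" if "typed i N" for i
      using eq_beta3[OF b h(2,3) that h(1)] by simp
    have "w \<tturnstile> Eq N (?l \<cdot> (?p \<cdot> x \<cdot> y)) (?p \<cdot> x \<cdot> y \<cdot> zero)" using eq_beta1[OF l tp h(1)] by simp
    also note beta[OF typed_consts(1)]
    also note eq_select_zero[OF h(2,3,1)]
    finally show "w \<tturnstile> Eq N (?l \<cdot> (?p \<cdot> x \<cdot> y)) x" .
    have "w \<tturnstile> Eq N (?r \<cdot> (?p \<cdot> x \<cdot> y)) (?p \<cdot> x \<cdot> y \<cdot> suc zero)" using eq_beta1[OF r tp h(1)] by simp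
    also note beta[OF typed_suc[OF typed_consts(1)]]
    also note eq_select_one[OF h(2,3,1)]
    finally show "w \<tturnstile> Eq N (?r \<cdot> (?p \<cdot> x \<cdot> y)) y" .
  qed
qed

definition map_step :: "ty \<Rightarrow> ty \<Rightarrow> tm \<Rightarrow> tm" where
  "map_step \<alpha> \<beta> g = lam [] (Seq \<beta>) (lam [Seq \<beta>] \<alpha> (Con (Prep \<beta>) \<cdot> (g \<cdot> Var 0) \<cdot> Var (Suc 0)))"

definition map_tm :: "ty \<Rightarrow> ty \<Rightarrow> tm \<Rightarrow> tm" where
  "map_tm \<alpha> \<beta> g = lam [] (Seq \<alpha>) (Con (L \<alpha> (Seq \<beta>)) \<cdot> Var 0 \<cdot> Con (Emp \<beta>) \<cdot> map_step \<alpha> \<beta> g)"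

context
  fixes \<alpha> \<beta> :: ty and g :: tm
  assumes g: "closed_tm g (\<alpha> \<rightarrow> \<beta>)"
begin

lemma map_step_body: "has_ty [\<alpha>, Seq \<beta>] (Con (Prep \<beta>) \<cdot> (g \<cdot> Var 0) \<cdot> Var (Suc 0)) (Seq \<beta>)"
  using has_ty_closed[OF g] by (simp add: has_ty_App)

lemma closed_map_step: "closed_tm (map_step \<alpha> \<beta> g) (Seq \<beta> \<rightarrow> \<alpha> \<rightarrow> Seq \<beta>)"
  unfolding map_step_def by (intro has_ty_lam map_step_body)

lemma map_body: "has_ty [Seq \<alpha>] (Con (L \<alpha> (Seq \<beta>)) \<cdot> Var 0 \<cdot> Con (Emp \<beta>) \<cdot> map_step \<alpha> \<beta> g) (Seq \<beta>)"
  using has_ty_closed[OF closed_map_step] by (simp add: has_ty_App)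

lemma closed_map: "closed_tm (map_tm \<alpha> \<beta> g) (Seq \<alpha> \<rightarrow> Seq \<beta>)"
  unfolding map_tm_def by (intro has_ty_lam map_body)

lemma eq_map:
  "typed s (Seq \<alpha>) \<Longrightarrow> world w
    \<Longrightarrow> w \<tturnstile> Eq (Seq \<beta>) (map_tm \<alpha> \<beta> g \<cdot> s) (Con (L \<alpha> (Seq \<beta>)) \<cdot> s \<cdot> Con (Emp \<beta>) \<cdot> map_step \<alpha> \<beta> g)"
  using eq_beta1[OF map_body] by (simp add: map_tm_def tsub_closed[OF closed_map_step])

lemma eq_map_nil: "world w \<Longrightarrow> w \<tturnstile> Eq (Seq \<beta>) (map_tm \<alpha> \<beta> g \<cdot> Con (Emp \<alpha>)) (Con (Emp \<beta>))"
  by (rule eq_trans[OF eq_map eq_L_nil]) (simp_all add: typed_closed[OF closed_map_step])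

lemma eq_map_cons:
  assumes "typed a \<alpha>" "typed s (Seq \<alpha>)" "world w"
  shows "w \<tturnstile> Eq (Seq \<beta>) (map_tm \<alpha> \<beta> g \<cdot> (Con (Prep \<alpha>) \<cdot> a \<cdot> s)) (Con (Prep \<beta>) \<cdot> (g \<cdot> a) \<cdot> (map_tm \<alpha> \<beta> g \<cdot> s))"
proof -
  let ?r = "\<lambda>s. Con (L \<alpha> (Seq \<beta>)) \<cdot> s \<cdot> Con (Emp \<beta>) \<cdot> map_step \<alpha> \<beta> g"
  have r: "typed (?r s) (Seq \<beta>)" and c: "typed (Con (Prep \<alpha>) \<cdot> a \<cdot> s) (Seq \<alpha>)" and ga: "typed (Con (Prep \<beta>) \<cdot> (g \<cdot> a)) (Seq \<beta> \<rightarrow> Seq \<beta>)"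
    by (rule typed_intros typed_closed[OF closed_map_step] typed_closed[OF g] assms)+
  have "w \<tturnstile> Eq (Seq \<beta>) (map_tm \<alpha> \<beta> g \<cdot> (Con (Prep \<alpha>) \<cdot> a \<cdot> s)) (?r (Con (Prep \<alpha>) \<cdot> a \<cdot> s))"
    by (rule eq_map[OF c assms(3)])
  also have "w \<tturnstile> Eq (Seq \<beta>) (?r (Con (Prep \<alpha>) \<cdot> a \<cdot> s)) (map_step \<alpha> \<beta> g \<cdot> ?r s \<cdot> a)"
    by (rule eq_L_cons[OF assms(1,2) _ _ assms(3)]) (simp_all add: typed_closed[OF closed_map_step])
  also have "w \<tturnstile> Eq (Seq \<beta>) (map_step \<alpha> \<beta> g \<cdot> ?r s \<cdot> a) (Con (Prep \<beta>) \<cdot> (g \<cdot> a) \<cdot> ?r s)"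
    using eq_beta2[OF map_step_body r assms(1,3)]
    by (simp add: map_step_def[symmetric] tsub_closed[OF g])
  also have "w \<tturnstile> Eq (Seq \<beta>) (Con (Prep \<beta>) \<cdot> (g \<cdot> a) \<cdot> ?r s) (Con (Prep \<beta>) \<cdot> (g \<cdot> a) \<cdot> (map_tm \<alpha> \<beta> g \<cdot> s))"
    by (rule eq_arg[OF ga eq_sym[OF eq_map[OF assms(2,3)]]])
  finally show ?thesis .
qed

end

text \<open>A left inverse acts entry by entry. As the claim is an equation, induction along a
  possibly nonstandard sequence is available.\<close>

lemma eq_map_map_id:
  assumes f: "closed_tm f (\<alpha> \<rightarrow> \<beta>)" and g: "closed_tm g (\<beta> \<rightarrow> \<alpha>)"
    and id: "\<And>w a. world w \<Longrightarrow> typed a \<alpha> \<Longrightarrow> w \<tturnstile> Eq \<alpha> (g \<cdot> (f \<cdot> a)) a"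
    and s: "typed s (Seq \<alpha>)" and w: "world w"
  shows "w \<tturnstile> Eq (Seq \<alpha>) (map_tm \<beta> \<alpha> g \<cdot> (map_tm \<alpha> \<beta> f \<cdot> s)) s"
proof -
  let ?f = "map_tm \<alpha> \<beta> f" and ?g = "map_tm \<beta> \<alpha> g"
  let ?\<phi> = "Eq (Seq \<alpha>) (?g \<cdot> (?f \<cdot> Var 0)) (Var 0)"
  note cf = closed_map[OF f] and cg = closed_map[OF g]
  note tf = typed_closed[OF cf] and tg = typed_closed[OF cg]
  have \<phi>: "fsub ?\<phi> (case_nat s Var) = Eq (Seq \<alpha>) (?g \<cdot> (?f \<cdot> s)) s" for s
    by (simp add: tsub_closed[OF cf] tsub_closed[OF cg])
  have "w \<tturnstile> fsub ?\<phi> (case_nat s Var)"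
  proof (rule forces_list_induct[of _ _ "[]"])
    show "wff ?\<phi> [Seq \<alpha>]" using has_ty_closed[OF cf] has_ty_closed[OF cg] by (simp add: has_ty_App)
    have "w \<tturnstile> Eq (Seq \<alpha>) (?g \<cdot> (?f \<cdot> Con (Emp \<alpha>))) (?g \<cdot> Con (Emp \<beta>))"
      by (rule eq_arg[OF tg eq_map_nil[OF f w]])
    also note eq_map_nil[OF g w]
    finally show "w \<tturnstile> fsub ?\<phi> (case_nat (Con (Emp \<alpha>)) Var)" unfolding \<phi> .
    fix w1 a r assume 1: "w \<sqsubseteq> w1" "typed a \<alpha>" "typed r (Seq \<alpha>)" "w1 \<tturnstile> fsub ?\<phi> (case_nat r Var)"
    have w1: "world w1" by (rule forces_world[OF 1(4)])
    have fa: "typed (f \<cdot> a) \<beta>" by (rule typed_App[OF typed_closed[OF f] 1(2)])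
    have fr: "typed (?f \<cdot> r) (Seq \<beta>)" by (rule typed_App[OF tf 1(3)])
    have "w1 \<tturnstile> Eq (Seq \<alpha>) (?g \<cdot> (?f \<cdot> (Con (Prep \<alpha>) \<cdot> a \<cdot> r))) (?g \<cdot> (Con (Prep \<beta>) \<cdot> (f \<cdot> a) \<cdot> (?f \<cdot> r)))"
      by (rule eq_arg[OF tg eq_map_cons[OF f 1(2,3) w1]])
    also note eq_map_cons[OF g fa fr w1]
    also have "w1 \<tturnstile> Eq (Seq \<alpha>) (Con (Prep \<alpha>) \<cdot> (g \<cdot> (f \<cdot> a)) \<cdot> (?g \<cdot> (?f \<cdot> r))) (Con (Prep \<alpha>) \<cdot> a \<cdot> r)"
      by (rule eq_App[OF eq_arg[OF typed_consts(7) id[OF w1 1(2)]] 1(4)[unfolded \<phi>]])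
    finally show "w1 \<tturnstile> fsub ?\<phi> (case_nat (Con (Prep \<alpha>) \<cdot> a \<cdot> r) Var)" unfolding \<phi> .
  qed (use w s in simp_all)
  then show ?thesis unfolding \<phi> .
qed

text \<open>The step function returns the current entry and forgets the value computed for the
  rest.\<close>

definition head_tm :: "ty \<Rightarrow> tm \<Rightarrow> tm" where
  "head_tm \<sigma> s = Con (L \<sigma> \<sigma>) \<cdot> s \<cdot> default_tm \<sigma> \<cdot> lam [] \<sigma> (lam [\<sigma>] \<sigma> (Var 0))"

lemma closed_head_step: "closed_tm (lam [] \<sigma> (lam [\<sigma>] \<sigma> (Var 0))) (\<sigma> \<rightarrow> \<sigma> \<rightarrow> \<sigma>)"
  by (intro has_ty_lam) simp

lemma tsub_head [simp]: "tsub e (head_tm \<sigma> s) = head_tm \<sigma> (tsub e s)"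
  by (simp add: head_tm_def tsub_closed[OF closed_head_step])

lemma has_ty_head: "has_ty \<Gamma> s (Seq \<sigma>) \<Longrightarrow> has_ty \<Gamma> (head_tm \<sigma> s) \<sigma>"
  using has_ty_closed[OF closed_head_step] has_ty_closed[OF closed_default]
  by (simp add: head_tm_def has_ty_App)

lemma eq_head_cons:
  assumes "typed a \<sigma>" "typed s (Seq \<sigma>)" "world w"
  shows "w \<tturnstile> Eq \<sigma> (head_tm \<sigma> (Con (Prep \<sigma>) \<cdot> a \<cdot> s)) a"
proof -
  let ?v = "lam [] \<sigma> (lam [\<sigma>] \<sigma> (Var 0))"
  let ?r = "Con (L \<sigma> \<sigma>) \<cdot> s \<cdot> default_tm \<sigma> \<cdot> ?v"
  have r: "typed ?r \<sigma>" by (rule typed_intros typed_closed[OF closed_head_step] assms)+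
  have "w \<tturnstile> Eq \<sigma> (head_tm \<sigma> (Con (Prep \<sigma>) \<cdot> a \<cdot> s)) (?v \<cdot> ?r \<cdot> a)" unfolding head_tm_def
    by (rule eq_L_cons[OF assms(1,2) typed_default typed_closed[OF closed_head_step] assms(3)])
  also have "w \<tturnstile> Eq \<sigma> (?v \<cdot> ?r \<cdot> a) a" using eq_beta2[OF _ r assms(1,3), of "Var 0" \<sigma>] by simp
  finally show ?thesis .
qed

text \<open>The pair of \<open>s\<close> and \<open>y\<close> is the function with value \<open>map (\<lambda>a. p a 0) s\<close> at \<open>0\<close> and \<open>\<langle>p 0 y\<rangle>\<close> at
  \<open>1\<close>.\<close>

lemma pairable_Seq:
  assumes "pairable \<alpha> \<tau>"
  shows "pairable (Seq \<alpha>) \<tau>"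
proof -
  obtain \<rho> p l r where c: "closed_tm p (\<alpha> \<rightarrow> \<tau> \<rightarrow> \<rho>)" "closed_tm l (\<rho> \<rightarrow> \<alpha>)" "closed_tm r (\<rho> \<rightarrow> \<tau>)"
    and eq: "\<And>w x y. world w \<Longrightarrow> typed x \<alpha> \<Longrightarrow> typed y \<tau> \<Longrightarrow>
      w \<tturnstile> Eq \<alpha> (l \<cdot> (p \<cdot> x \<cdot> y)) x \<and> w \<tturnstile> Eq \<tau> (r \<cdot> (p \<cdot> x \<cdot> y)) y"
    using assms unfolding pairable_def by blast
  note d = has_ty_closed[OF closed_default]
  let ?bi = "p \<cdot> Var 0 \<cdot> default_tm \<tau>"
  let ?i = "lam [] \<alpha> ?bi"
  have bi: "has_ty [\<alpha>] ?bi \<rho>" using has_ty_closed[OF c(1)] d by (simp add: has_ty_App)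
  have ci: "closed_tm ?i (\<alpha> \<rightarrow> \<rho>)" by (intro has_ty_lam bi)
  let ?m = "map_tm \<alpha> \<rho> ?i" and ?ml = "map_tm \<rho> \<alpha> l"
  note cm = closed_map[OF ci] and cml = closed_map[OF c(2)]
  \<comment> \<open>The sequence \<open>s\<close> may be empty and then has no entry that could
    carry \<open>y\<close>, so \<open>y\<close> gets a singleton of its own.\<close>
  let ?w = "\<lambda>y. Con (Prep \<rho>) \<cdot> (p \<cdot> default_tm \<alpha> \<cdot> y) \<cdot> Con (Emp \<rho>)"
  let ?b = "select_tm (Seq \<rho>) (Var 0) (?m \<cdot> Var (Suc (Suc 0))) (?w (Var (Suc 0)))"
  let ?p = "lam [] (Seq \<alpha>) (lam [Seq \<alpha>] \<tau> (lam [\<tau>, Seq \<alpha>] N ?b))"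
  let ?bl = "?ml \<cdot> (Var 0 \<cdot> zero)"
  let ?br = "r \<cdot> head_tm \<rho> (Var 0 \<cdot> suc zero)"
  let ?l = "lam [] (N \<rightarrow> Seq \<rho>) ?bl"
  let ?r = "lam [] (N \<rightarrow> Seq \<rho>) ?br"
  have b: "has_ty [N, \<tau>, Seq \<alpha>] ?b (Seq \<rho>)"
    by (rule has_ty_select) (use has_ty_closed[OF c(1)] has_ty_closed[OF cm] d in \<open>simp_all add: has_ty_App\<close>)
  have bl: "has_ty [N \<rightarrow> Seq \<rho>] ?bl (Seq \<alpha>)" using has_ty_closed[OF cml] by (simp add: has_ty_App)
  have br: "has_ty [N \<rightarrow> Seq \<rho>] ?br \<tau>"
    by (rule has_ty_AppI[OF has_ty_closed[OF c(3)] has_ty_head]) (simp add: has_ty_App)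
  have cp: "closed_tm ?p (Seq \<alpha> \<rightarrow> \<tau> \<rightarrow> N \<rightarrow> Seq \<rho>)" by (intro has_ty_lam b)
  have cl: "closed_tm ?l ((N \<rightarrow> Seq \<rho>) \<rightarrow> Seq \<alpha>)" by (intro has_ty_lam bl)
  have cr: "closed_tm ?r ((N \<rightarrow> Seq \<rho>) \<rightarrow> \<tau>)" by (intro has_ty_lam br)
  \<comment> \<open>Filling up with a default embeds \<open>\<alpha>\<close> into
    \<open>\<rho>\<close>, and \<open>l\<close> is a left inverse of this embedding;
    \<open>eq_map_map_id\<close> transports the inverse to sequences.\<close>
  have li: "w \<tturnstile> Eq \<alpha> (l \<cdot> (?i \<cdot> a)) a" if "world w" "typed a \<alpha>" for w a
  proof -
    have "w \<tturnstile> Eq \<rho> (?i \<cdot> a) (p \<cdot> a \<cdot> default_tm \<tau>)"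
      using eq_beta1[OF bi that(2,1)] by (simp add: tsub_closed[OF c(1)])
    from eq_trans[OF eq_arg[OF typed_closed[OF c(2)] this]] eq[OF that typed_default] show ?thesis by blast
  qed
  show ?thesis unfolding pairable_def
  proof (intro exI conjI allI impI)
    show "closed_tm ?p (Seq \<alpha> \<rightarrow> \<tau> \<rightarrow> N \<rightarrow> Seq \<rho>)" "closed_tm ?l ((N \<rightarrow> Seq \<rho>) \<rightarrow> Seq \<alpha>)"
      "closed_tm ?r ((N \<rightarrow> Seq \<rho>) \<rightarrow> \<tau>)" by fact+
    fix w s y assume h: "world w" "typed s (Seq \<alpha>)" "typed y \<tau>"
    have tp: "typed (?p \<cdot> s \<cdot> y) (N \<rightarrow> Seq \<rho>)"
      by (rule typed_App[OF typed_App[OF typed_closed[OF cp] h(2)] h(3)])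
    have tm: "typed (?m \<cdot> s) (Seq \<rho>)" by (rule typed_App[OF typed_closed[OF cm] h(2)])
    have tpy: "typed (p \<cdot> default_tm \<alpha> \<cdot> y) \<rho>"
      by (rule typed_App[OF typed_App[OF typed_closed[OF c(1)] typed_default] h(3)])
    have tw: "typed (?w y) (Seq \<rho>)" by (rule typed_intros tpy)+
    have beta: "w \<tturnstile> Eq (Seq \<rho>) (?p \<cdot> s \<cdot> y \<cdot> i) (select_tm (Seq \<rho>) i (?m \<cdot> s) (?w y))" if "typed i N" for i
      using eq_beta3[OF b h(2,3) that h(1)] by (simp add: tsub_closed[OF c(1)] tsub_closed[OF cm])
    have "w \<tturnstile> Eq (Seq \<alpha>) (?l \<cdot> (?p \<cdot> s \<cdot> y)) (?ml \<cdot> (?p \<cdot> s \<cdot> y \<cdot> zero))"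
      using eq_beta1[OF bl tp h(1)] by (simp add: tsub_closed[OF cml])
    also have "w \<tturnstile> Eq (Seq \<alpha>) (?ml \<cdot> (?p \<cdot> s \<cdot> y \<cdot> zero)) (?ml \<cdot> (?m \<cdot> s))"
      by (rule eq_arg[OF typed_closed[OF cml] eq_trans[OF beta[OF typed_consts(1)] eq_select_zero[OF tm tw h(1)]]])
    also have "w \<tturnstile> Eq (Seq \<alpha>) (?ml \<cdot> (?m \<cdot> s)) s" by (rule eq_map_map_id[OF ci c(2) li h(2,1)])
    finally show "w \<tturnstile> Eq (Seq \<alpha>) (?l \<cdot> (?p \<cdot> s \<cdot> y)) s" .
    have head: "w \<tturnstile> Eq \<rho> (head_tm \<rho> t) (head_tm \<rho> u)" if "w \<tturnstile> Eq (Seq \<rho>) t u" for t u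
      using eq_tsub[of "[Seq \<rho>]" "head_tm \<rho> (Var 0)" \<rho> w "case_nat t Var" "case_nat u Var"] that h(1)
      by (simp add: has_ty_head)
    have "w \<tturnstile> Eq \<tau> (?r \<cdot> (?p \<cdot> s \<cdot> y)) (r \<cdot> head_tm \<rho> (?p \<cdot> s \<cdot> y \<cdot> suc zero))"
      using eq_beta1[OF br tp h(1)] by (simp add: tsub_closed[OF c(3)])
    also have "w \<tturnstile> Eq \<tau> (r \<cdot> head_tm \<rho> (?p \<cdot> s \<cdot> y \<cdot> suc zero)) (r \<cdot> (p \<cdot> default_tm \<alpha> \<cdot> y))"
      by (rule eq_arg[OF typed_closed[OF c(3)] eq_trans[OF head[OF eq_trans[OF
                beta[OF typed_suc[OF typed_consts(1)]] eq_select_one[OF tm tw h(1)]]]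
              eq_head_cons[OF tpy typed_consts(6) h(1)]]])
    also have "w \<tturnstile> Eq \<tau> (r \<cdot> (p \<cdot> default_tm \<alpha> \<cdot> y)) y" using eq[OF h(1) typed_default h(3)] by blast
    finally show "w \<tturnstile> Eq \<tau> (?r \<cdot> (?p \<cdot> s \<cdot> y)) y" .
  qed
qed

text \<open>A function type reduces to its codomain and a sequence type to its entry type. Once the
  first component is \<open>N\<close>, symmetry permits the same reduction in the second, down to
  \<open>pairable_N\<close>.\<close>

lemma pairable: "pairable \<sigma> \<tau>"
proof (induction \<sigma>)
  case N
  show ?case
    by (induction \<tau>) (auto intro: pairable_N pairable_sym[OF pairable_fun[OF pairable_sym]]
        pairable_sym[OF pairable_Seq[OF pairable_sym]])
qed (auto intro: pairable_fun pairable_Seq)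

section \<open>Codes for tuples\<close>

fun eqs :: "fm set \<Rightarrow> ty list \<Rightarrow> tm list \<Rightarrow> tm list \<Rightarrow> bool" where
  "eqs w [] [] [] = True"
| "eqs w (\<sigma> # \<sigma>s) (t # ts) (u # us) = (w \<tturnstile> Eq \<sigma> t u \<and> eqs w \<sigma>s ts us)"
| "eqs w _ _ _ = False"

text \<open>Iterated pairing: the code of a tuple pairs its head with the code of its tail. Since
  pairing is a closed term, a tuple of standard objects has a standard code.\<close>

lemma tuple_coding:
  "\<exists>\<tau> \<pi>s. list_all2 (\<lambda>\<pi> \<rho>. closed_tm \<pi> (\<tau> \<rightarrow> \<rho>)) \<pi>s \<rho>s \<and>
    (\<forall>w ys. world w \<longrightarrow> sts w ys \<rho>s \<longrightarrow>
      (\<exists>q. st w q \<tau> \<and> eqs w \<rho>s (map (\<lambda>\<pi>. \<pi> \<cdot> q) \<pi>s) ys))"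
proof (induction \<rho>s)
  case Nil
  \<comment> \<open>The empty tuple has no projections, so its code can be any standard object;
    \<open>zero\<close> is the choice made here.\<close>
  show ?case by (rule exI[of _ N], rule exI[of _ "[]"]) (auto intro!: exI[of _ zero] st_closed)
next
  case (Cons \<sigma> \<rho>s)
  then obtain \<tau> \<pi>s where \<pi>s: "list_all2 (\<lambda>\<pi> \<rho>. closed_tm \<pi> (\<tau> \<rightarrow> \<rho>)) \<pi>s \<rho>s"
    and code: "\<And>w ys. world w \<Longrightarrow> sts w ys \<rho>s \<Longrightarrow>
      \<exists>q. st w q \<tau> \<and> eqs w \<rho>s (map (\<lambda>\<pi>. \<pi> \<cdot> q) \<pi>s) ys"
    by blast
  obtain \<rho> p l r where c: "closed_tm p (\<sigma> \<rightarrow> \<tau> \<rightarrow> \<rho>)" "closed_tm l (\<rho> \<rightarrow> \<sigma>)" "closed_tm r (\<rho> \<rightarrow> \<tau>)"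
    and eq: "\<And>w x y. world w \<Longrightarrow> typed x \<sigma> \<Longrightarrow> typed y \<tau> \<Longrightarrow>
      w \<tturnstile> Eq \<sigma> (l \<cdot> (p \<cdot> x \<cdot> y)) x \<and> w \<tturnstile> Eq \<tau> (r \<cdot> (p \<cdot> x \<cdot> y)) y"
    using pairable[of \<sigma> \<tau>] unfolding pairable_def by blast
  let ?b = "\<lambda>\<pi>. \<pi> \<cdot> (r \<cdot> Var 0)"
  \<comment> \<open>Projections of the tail are preceded by \<open>r\<close>, which extracts the
    code of the tail.\<close>
  let ?\<pi> = "\<lambda>\<pi>. lam [] \<rho> (?b \<pi>)"
  have b: "has_ty [\<rho>] (?b \<pi>) \<rho>'" if "closed_tm \<pi> (\<tau> \<rightarrow> \<rho>')" for \<pi> \<rho>'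
    using has_ty_closed[OF that] has_ty_closed[OF c(3)] by (simp add: has_ty_App)
  show ?case
  proof (rule exI[of _ \<rho>], rule exI[of _ "l # map ?\<pi> \<pi>s"], intro conjI allI impI)
    show "list_all2 (\<lambda>\<pi> \<rho>'. closed_tm \<pi> (\<rho> \<rightarrow> \<rho>')) (l # map ?\<pi> \<pi>s) (\<sigma> # \<rho>s)"
      using c(2) \<pi>s by (auto simp: list_all2_map1 intro!: has_ty_lam b elim!: list_all2_mono)
    fix w ys assume w: "world w" and "sts w ys (\<sigma> # \<rho>s)"
    then obtain y ys' where ys: "ys = y # ys'" "st w y \<sigma>" "sts w ys' \<rho>s"
      by (auto simp: list_all2_Cons2)
    obtain q where q: "st w q \<tau>" "eqs w \<rho>s (map (\<lambda>\<pi>. \<pi> \<cdot> q) \<pi>s) ys'" using code[OF w ys(3)] by blast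
    let ?q = "p \<cdot> y \<cdot> q"
    have q': "st w ?q \<rho>" by (rule st_App[OF st_App[OF st_closed[OF c(1) w] ys(2)] q(1)])
    then have tq: "typed ?q \<rho>" by (rule st_typed)
    have eq': "w \<tturnstile> Eq \<sigma> (l \<cdot> ?q) y" "w \<tturnstile> Eq \<tau> (r \<cdot> ?q) q"
      using eq[OF w st_typed[OF ys(2)] st_typed[OF q(1)]] by auto
    have "eqs w \<rho>s (map (\<lambda>\<pi>. \<pi> \<cdot> ?q) (map ?\<pi> \<pi>s)) ys'" using \<pi>s q(2)
    proof (induction \<pi>s \<rho>s arbitrary: ys' rule: list_all2_induct)
      case (Cons \<pi> \<pi>s \<rho>' \<rho>s)
      then obtain y' ys'' where y': "ys' = y' # ys''" by (cases ys') auto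
      have "w \<tturnstile> Eq \<rho>' (?\<pi> \<pi> \<cdot> ?q) (\<pi> \<cdot> (r \<cdot> ?q))"
        using eq_beta1[OF b[OF Cons(1)] tq w] by (simp add: tsub_closed[OF Cons(1)] tsub_closed[OF c(3)])
      also have "w \<tturnstile> Eq \<rho>' (\<pi> \<cdot> (r \<cdot> ?q)) (\<pi> \<cdot> q)"
        by (rule eq_arg[OF typed_closed[OF Cons(1)] eq'(2)])
      also have "w \<tturnstile> Eq \<rho>' (\<pi> \<cdot> q) y'" using Cons.prems y' by simp
      finally show ?case using Cons.IH[of ys''] Cons.prems y' by simp
    qed simp
    then show "\<exists>q. st w q \<rho> \<and> eqs w (\<sigma> # \<rho>s) (map (\<lambda>\<pi>. \<pi> \<cdot> q) (l # map ?\<pi> \<pi>s)) ys"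
      using eq'(1) ys(1) q' by (intro exI[of _ ?q]) simp
  qed
qed

section \<open>The principles for tuples\<close>

lemma push_add [simp]: "push e ts (i + length ts) = e i"
proof (induction ts arbitrary: e i)
  case (Cons t ts)
  show ?case using Cons[of "case_nat t e" "Suc i"] by simp
qed simp

lemma push_less: "i < length ts \<Longrightarrow> push e ts i = rev ts ! i"
proof (induction ts arbitrary: e)
  case (Cons t ts)
  show ?case
  proof (cases "i < length ts")
    case False
    then have "i = 0 + length ts" using Cons.prems by simp
    then show ?thesis using push_add[of ts "case_nat t e" 0] by (simp add: nth_append)
  qed (simp add: Cons nth_append)
qed simp

lemma push_cases: "push e ts i = (if i < length ts then rev ts ! i else e (i - length ts))"
proof (cases "i < length ts")
  case False
  then have "i = (i - length ts) + length ts" by simp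
  then have "push e ts i = e (i - length ts)" by (metis push_add)
  with False show ?thesis by simp
qed (simp add: push_less)

lemma tsub_push_shift [simp]: "length ts = n \<Longrightarrow> tsub (push e ts) (shift n u) = tsub e u"
  by (auto simp: shift_def tsub_tsub)

lemma map_tsub_vars [simp]: "length ts = n \<Longrightarrow> map (tsub (push e ts)) (vars n) = ts"
  by (rule nth_equalityI) (auto simp: vars_def push_less rev_nth)

lemma length_vars [simp]: "length (vars n) = n"
  by (simp add: vars_def)

lemma tsub_push: "tsub s (push e ts i) = push (\<lambda>i. tsub s (e i)) (map (tsub s) ts) i"
  by (auto simp: push_cases rev_map)

lemma up_funpow: "(up ^^ n) s i = (if i < n then Var i else shift n (s (i - n)))"
proof (induction n arbitrary: i)
  case (Suc n)
  then show ?case by (cases i) auto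
qed simp

lemma tsub_push_up: "length ts = n \<Longrightarrow> tsub (push e ts) ((up ^^ n) s i) = push (\<lambda>i. tsub e (s i)) ts i"
  by (auto simp: up_funpow push_cases)

lemma fsub_push_up:
  "length ts = n \<Longrightarrow> fsub (fsub \<phi> ((up ^^ n) s)) (push e ts) = fsub \<phi> (push (\<lambda>i. tsub e (s i)) ts)"
  by (rule fsub_fsub_eq) (rule tsub_push_up)

lemma fsub_foldr:
  "fsub (foldr AllSt \<sigma>s \<phi>) s = foldr AllSt \<sigma>s (fsub \<phi> ((up ^^ length \<sigma>s) s))"
  "fsub (foldr ExSt \<sigma>s \<phi>) s = foldr ExSt \<sigma>s (fsub \<phi> ((up ^^ length \<sigma>s) s))"
  "fsub (foldr All \<sigma>s \<phi>) s = foldr All \<sigma>s (fsub \<phi> ((up ^^ length \<sigma>s) s))"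
  by (induction \<sigma>s arbitrary: s) (simp_all add: funpow_swap1)

lemma wff_foldr [simp]:
  "wff (foldr AllSt \<sigma>s \<phi>) \<Gamma> = wff \<phi> (rev \<sigma>s @ \<Gamma>)" "wff (foldr ExSt \<sigma>s \<phi>) \<Gamma> = wff \<phi> (rev \<sigma>s @ \<Gamma>)"
  "wff (foldr All \<sigma>s \<phi>) \<Gamma> = wff \<phi> (rev \<sigma>s @ \<Gamma>)"
  by (induction \<sigma>s arbitrary: \<Gamma>) auto

lemma tsub_apps [simp]: "tsub e (apps t us) = apps (tsub e t) (map (tsub e) us)"
  by (induction us arbitrary: t) auto

lemma st_apps: "st w f (funs \<sigma>s \<tau>) \<Longrightarrow> sts w ts \<sigma>s \<Longrightarrow> st w (apps f ts) \<tau>"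
proof (induction \<sigma>s arbitrary: f ts)
  case (Cons \<sigma> \<sigma>s)
  then obtain t ts' where ts: "ts = t # ts'" "st w t \<sigma>" "sts w ts' \<sigma>s"
    by (auto simp: list_all2_Cons2)
  with Cons.IH[OF st_App[OF _ ts(2)] ts(3)] Cons.prems(1) show ?case by simp
qed simp

lemma sts_typed: "sts w ts \<sigma>s \<Longrightarrow> list_all2 typed ts \<sigma>s"
  by (erule list_all2_mono) (rule st_typed)

lemma env_push: "list_all2 typed ts \<sigma>s \<Longrightarrow> env e \<Gamma> \<Longrightarrow> env (push e ts) (rev \<sigma>s @ \<Gamma>)"
  by (induction ts \<sigma>s arbitrary: e \<Gamma> rule: list_all2_induct) simp_all

lemma forces_ExStI':
  "st w t \<sigma> \<Longrightarrow> w \<tturnstile> fsub \<phi> (case_nat t e) \<Longrightarrow> w \<tturnstile> fsub (ExSt \<sigma> \<phi>) e"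
  using forces_ExStI[of w t \<sigma> "fsub \<phi> (up e)"] by (simp add: inst_up)

lemma fsub_up_case: "fsub (fsub \<phi> (up e)) (case_nat t Var) = fsub \<phi> (case_nat t e)"
  by (simp add: fsub_fsub case_up_comp)

lemma fsub_up_up_case: "fsub (fsub \<phi> (up (up e))) (case_nat t (case_nat u Var)) = fsub \<phi> (case_nat t (case_nat u e))"
  by (simp add: fsub_fsub case_up_comp)

text \<open>Cast as an elimination rule, with the permutation of variables in the axiom absorbed by
  the environment, so that the inductions on tuples below only meet \<open>case_nat\<close>.\<close>

lemma forces_AC:
  assumes a: "w \<tturnstile> fsub (AllSt \<sigma> (ExSt \<tau> \<phi>)) e"
    and elim: "\<And>w' f. w \<sqsubseteq> w' \<Longrightarrow> st w' f (\<sigma> \<rightarrow> \<tau>)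
      \<Longrightarrow> (\<And>w'' t. w' \<sqsubseteq> w'' \<Longrightarrow> st w'' t \<sigma> \<Longrightarrow> w'' \<tturnstile> fsub \<phi> (case_nat (f \<cdot> t) (case_nat t e)))
      \<Longrightarrow> w' \<tturnstile> \<chi>"
  shows "w \<tturnstile> \<chi>"
proof -
  let ?\<phi> = "fsub \<phi> (up (up e))" and ?r = "Var(0 := Var 1 \<cdot> Var 0, 1 := Var 0)"
  have a': "w \<tturnstile> AllSt \<sigma> (ExSt \<tau> ?\<phi>)" using a by simp
  then obtain n where "wff ?\<phi> (\<tau> # \<sigma> # Ctx n)" using forces_wfm by (fastforce simp: wfm_def)
  from forces_axiom_Ctx[of AC, OF AC.intros[OF this] _ forces_world[OF a']]
  have "w \<tturnstile> ExSt (\<sigma> \<rightarrow> \<tau>) (AllSt \<sigma> (fsub ?\<phi> ?r))" using a' forces_mp by (simp del: One_nat_def)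
  then show ?thesis
  proof (rule forces_ExStE)
    fix f w' assume f: "w \<sqsubseteq> w'" "st w' f (\<sigma> \<rightarrow> \<tau>)" "w' \<tturnstile> inst f (AllSt \<sigma> (fsub ?\<phi> ?r))"
    show "w' \<tturnstile> \<chi>"
    proof (rule elim[OF f(1,2)])
      fix w'' t assume t: "w' \<sqsubseteq> w''" "st w'' t \<sigma>"
      have "fsub (fsub ?\<phi> ?r) (case_nat t (case_nat f Var)) = fsub ?\<phi> (case_nat (f \<cdot> t) (case_nat t Var))"
        by (rule fsub_fsub_eq) (simp split: nat.split)
      then show "w'' \<tturnstile> fsub \<phi> (case_nat (f \<cdot> t) (case_nat t e))"
        using forces_AllStE'[OF forces_mono[OF f(3)[unfolded inst_def] t(1)] t(2)]
        by (simp only: fsub_up_up_case)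
    qed
  qed
qed

text \<open>Replaces the value, variable 0, by a function applied to \<open>n\<close> arguments.
  Afterwards the arguments are the variables below \<open>n\<close>, the function is variable
  \<open>n\<close>, and the parameters follow it.\<close>

definition app_sub :: "nat \<Rightarrow> nat \<Rightarrow> tm" where
  "app_sub n = case_nat (apps (Var n) (vars n)) (\<lambda>i. if i < n then Var i else Var (Suc i))"

lemma tsub_app_sub:
  assumes "length ts = n"
  shows "tsub (push (case_nat F e) ts) (app_sub n i) = case_nat (apps F ts) (push e ts) i"
proof (cases i)
  case 0
  then show ?thesis using assms push_add[of ts "case_nat F e" 0] by (simp add: app_sub_def)
next
  case (Suc j)
  then show ?thesis using assms by (auto simp: app_sub_def push_cases Suc_diff_le)
qed

lemma fsub_app_sub:
  "length ts = n \<Longrightarrow> fsub (fsub \<phi> (app_sub n)) (push (case_nat F e) ts) = fsub \<phi> (case_nat (apps F ts) (push e ts))"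
  by (rule fsub_fsub_eq) (rule tsub_app_sub)

text \<open>Currying: for a fixed first argument the induction hypothesis provides a function of the
  remaining ones, and \<open>AC\<close> makes that function depend on the first argument.\<close>

lemma forces_AC_args:
  assumes "world w" and "\<And>w' ts. w \<sqsubseteq> w' \<Longrightarrow> sts w' ts \<sigma>s \<Longrightarrow> w' \<tturnstile> fsub (ExSt \<tau> \<phi>) (push e ts)"
    and "\<And>w' F. w \<sqsubseteq> w' \<Longrightarrow> st w' F (funs \<sigma>s \<tau>)
      \<Longrightarrow> (\<And>w'' ts. w' \<sqsubseteq> w'' \<Longrightarrow> sts w'' ts \<sigma>s \<Longrightarrow> w'' \<tturnstile> fsub \<phi> (case_nat (apps F ts) (push e ts)))
      \<Longrightarrow> w' \<tturnstile> \<chi>"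
  shows "w \<tturnstile> \<chi>"
  using assms
proof (induction \<sigma>s arbitrary: w e \<chi>)
  case Nil
  have "w \<tturnstile> ExSt \<tau> (fsub \<phi> (up e))" using Nil(2)[OF later_refl[OF Nil(1)], of "[]"] by simp
  then show ?case
  proof (rule forces_ExStE)
    fix F w' assume F: "w \<sqsubseteq> w'" "st w' F \<tau>" "w' \<tturnstile> inst F (fsub \<phi> (up e))"
    show "w' \<tturnstile> \<chi>" by (rule Nil(3)[OF F(1)]) (use F forces_mono in \<open>auto simp: inst_up\<close>)
  qed
next
  case (Cons \<sigma> \<sigma>s)
  let ?\<phi> = "fsub \<phi> (app_sub (length \<sigma>s))"
  let ?\<psi> = "foldr AllSt \<sigma>s ?\<phi>"
  have "w \<tturnstile> fsub (AllSt \<sigma> (ExSt (funs \<sigma>s \<tau>) ?\<psi>)) e"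
  proof (rule forces_AllStI'[OF Cons.prems(1)])
    fix w1 t assume 1: "w \<sqsubseteq> w1" "st w1 t \<sigma>"
    show "w1 \<tturnstile> fsub (ExSt (funs \<sigma>s \<tau>) ?\<psi>) (case_nat t e)"
    proof (rule Cons.IH[OF st_world[OF 1(2)], of "case_nat t e"])
      fix w2 ts assume 2: "w1 \<sqsubseteq> w2" "sts w2 ts \<sigma>s"
      show "w2 \<tturnstile> fsub (ExSt \<tau> \<phi>) (push (case_nat t e) ts)"
        using Cons.prems(2)[OF later_trans[OF 1(1) 2(1)], of "t # ts"] 2(2) st_mono[OF 1(2) 2(1)] by simp
    next
      fix w2 F assume 2: "w1 \<sqsubseteq> w2" "st w2 F (funs \<sigma>s \<tau>)"
        "\<And>w3 ts. w2 \<sqsubseteq> w3 \<Longrightarrow> sts w3 ts \<sigma>s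
          \<Longrightarrow> w3 \<tturnstile> fsub \<phi> (case_nat (apps F ts) (push (case_nat t e) ts))"
      show "w2 \<tturnstile> fsub (ExSt (funs \<sigma>s \<tau>) ?\<psi>) (case_nat t e)"
        by (rule forces_ExStI'[OF 2(2)], rule forces_AllStsI[OF st_world[OF 2(2)]])
          (simp add: fsub_app_sub list_all2_lengthD 2(3))
    qed
  qed
  then show ?case
  proof (rule forces_AC)
    fix w1 F assume 1: "w \<sqsubseteq> w1" "st w1 F (\<sigma> \<rightarrow> funs \<sigma>s \<tau>)"
      "\<And>w2 t. w1 \<sqsubseteq> w2 \<Longrightarrow> st w2 t \<sigma> \<Longrightarrow> w2 \<tturnstile> fsub ?\<psi> (case_nat (F \<cdot> t) (case_nat t e))"
    show "w1 \<tturnstile> \<chi>"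
    proof (rule Cons.prems(3)[OF 1(1)])
      fix w2 ts assume 2: "w1 \<sqsubseteq> w2" "sts w2 ts (\<sigma> # \<sigma>s)"
      then obtain t ts' where ts: "ts = t # ts'" "st w2 t \<sigma>" "sts w2 ts' \<sigma>s"
        by (auto simp: list_all2_Cons2)
      show "w2 \<tturnstile> fsub \<phi> (case_nat (apps F ts) (push e ts))"
        using forces_AllStsE[OF 1(3)[OF 2(1) ts(2)] ts(3)] ts
        by (simp add: fsub_app_sub list_all2_lengthD)
    qed (use 1(2) in simp)
  qed
qed

text \<open>The functions are chosen one by one. Once the first is fixed it is a parameter, and its
  values replace the first bound variable in what remains to be chosen.\<close>

lemma forces_ACs:
  assumes "world w"
    and "\<And>w' ts. w \<sqsubseteq> w' \<Longrightarrow> sts w' ts \<sigma>s \<Longrightarrow> w' \<tturnstile> fsub (foldr ExSt \<tau>s \<phi>) (push e ts)"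
    and "\<And>w' Fs. w \<sqsubseteq> w' \<Longrightarrow> sts w' Fs (map (funs \<sigma>s) \<tau>s)
      \<Longrightarrow> (\<And>w'' ts. w' \<sqsubseteq> w'' \<Longrightarrow> sts w'' ts \<sigma>s
        \<Longrightarrow> w'' \<tturnstile> fsub \<phi> (push (push e ts) (map (\<lambda>F. apps F ts) Fs)))
      \<Longrightarrow> w' \<tturnstile> \<chi>"
  shows "w \<tturnstile> \<chi>"
  using assms
proof (induction \<tau>s arbitrary: w e \<phi>)
  case Nil
  show ?case
    by (rule Nil(3)[OF later_refl[OF Nil(1)], of "[]"]) (use Nil(2) in simp_all)
next
  case (Cons \<tau> \<tau>s)
  \<comment> \<open>The replacement has to act below the remaining quantifiers, whence the iterated
    \<open>up\<close>.\<close>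
  let ?\<phi> = "fsub \<phi> ((up ^^ length \<tau>s) (app_sub (length \<sigma>s)))"
  show ?case
  proof (rule forces_AC_args[OF Cons.prems(1), of \<sigma>s \<tau> "foldr ExSt \<tau>s \<phi>" e])
    fix w1 F assume 1: "w \<sqsubseteq> w1" "st w1 F (funs \<sigma>s \<tau>)"
      "\<And>w2 ts. w1 \<sqsubseteq> w2 \<Longrightarrow> sts w2 ts \<sigma>s
        \<Longrightarrow> w2 \<tturnstile> fsub (foldr ExSt \<tau>s \<phi>) (case_nat (apps F ts) (push e ts))"
    show "w1 \<tturnstile> \<chi>"
    proof (rule Cons.IH[OF st_world[OF 1(2)], of ?\<phi> "case_nat F e"])
      fix w2 ts assume 2: "w1 \<sqsubseteq> w2" "sts w2 ts \<sigma>s"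
      have "fsub (foldr ExSt \<tau>s ?\<phi>) (push (case_nat F e) ts)
          = fsub (fsub (foldr ExSt \<tau>s \<phi>) (app_sub (length \<sigma>s))) (push (case_nat F e) ts)"
        by (simp only: fsub_foldr)
      then show "w2 \<tturnstile> fsub (foldr ExSt \<tau>s ?\<phi>) (push (case_nat F e) ts)"
        using 1(3)[OF 2] list_all2_lengthD[OF 2(2)] by (simp only: fsub_app_sub)
    next
      fix w2 Fs assume 2: "w1 \<sqsubseteq> w2" "sts w2 Fs (map (funs \<sigma>s) \<tau>s)"
        "\<And>w3 ts. w2 \<sqsubseteq> w3 \<Longrightarrow> sts w3 ts \<sigma>s
          \<Longrightarrow> w3 \<tturnstile> fsub ?\<phi> (push (push (case_nat F e) ts) (map (\<lambda>F. apps F ts) Fs))"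
      show "w2 \<tturnstile> \<chi>"
      proof (rule Cons.prems(3)[OF later_trans[OF 1(1) 2(1)], of "F # Fs"])
        show "sts w2 (F # Fs) (map (funs \<sigma>s) (\<tau> # \<tau>s))" using 2(2) st_mono[OF 1(2) 2(1)] by simp
        fix w3 ts assume 3: "w2 \<sqsubseteq> w3" "sts w3 ts \<sigma>s"
        have "(\<lambda>i. tsub (push (case_nat F e) ts) (app_sub (length \<sigma>s) i)) = case_nat (apps F ts) (push e ts)"
          by (rule ext) (rule tsub_app_sub[OF list_all2_lengthD[OF 3(2)]])
        then show "w3 \<tturnstile> fsub \<phi> (push (push e ts) (map (\<lambda>F. apps F ts) (F # Fs)))"
          using 2(3)[OF 3] list_all2_lengthD[OF 2(2)] by (simp add: fsub_push_up)
      qed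
    qed
  next
    fix w1 ts assume "w \<sqsubseteq> w1" "sts w1 ts \<sigma>s"
    from Cons.prems(2)[OF this] show "w1 \<tturnstile> fsub (ExSt \<tau> (foldr ExSt \<tau>s \<phi>)) (push e ts)" by simp
  qed
qed

lemma forces_NU:
  assumes a: "w \<tturnstile> fsub (All \<tau> (ExSt \<sigma> \<phi>)) e"
    and elim: "\<And>w' x. w \<sqsubseteq> w' \<Longrightarrow> st w' x \<sigma>
      \<Longrightarrow> (\<And>y. typed y \<tau> \<Longrightarrow> w' \<tturnstile> fsub \<phi> (case_nat x (case_nat y e))) \<Longrightarrow> w' \<tturnstile> \<chi>"
  shows "w \<tturnstile> \<chi>"
proof -
  let ?\<phi> = "fsub \<phi> (up (up e))" and ?r = "Var(0 := Var 1, 1 := Var 0)"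
  have a': "w \<tturnstile> All \<tau> (ExSt \<sigma> ?\<phi>)" using a by simp
  then obtain n where "wff ?\<phi> (\<sigma> # \<tau> # Ctx n)" using forces_wfm by (fastforce simp: wfm_def)
  from forces_axiom_Ctx[of NU, OF NU.intros[OF this] _ forces_world[OF a']]
  have "w \<tturnstile> ExSt \<sigma> (All \<tau> (fsub ?\<phi> ?r))" using a' forces_mp by (simp del: One_nat_def)
  then show ?thesis
  proof (rule forces_ExStE)
    fix x w' assume x: "w \<sqsubseteq> w'" "st w' x \<sigma>" "w' \<tturnstile> inst x (All \<tau> (fsub ?\<phi> ?r))"
    show "w' \<tturnstile> \<chi>"
    proof (rule elim[OF x(1,2)])
      fix y assume y: "typed y \<tau>"
      have "fsub (fsub ?\<phi> ?r) (case_nat y (case_nat x Var)) = fsub ?\<phi> (case_nat x (case_nat y Var))"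
        by (rule fsub_fsub_eq) (simp split: nat.split)
      then show "w' \<tturnstile> fsub \<phi> (case_nat x (case_nat y e))"
        using forces_allE'[OF x(3)[unfolded inst_def] y] by (simp only: fsub_up_up_case)
    qed
  qed
qed

definition swap_sub :: "nat \<Rightarrow> tm" where
  "swap_sub = Var(0 := Var 1, 1 := Var 0)"

lemma tsub_swap_sub: "tsub (case_nat y (case_nat x e)) (swap_sub i) = case_nat x (case_nat y e) i"
  by (simp add: swap_sub_def split: nat.split)

text \<open>Each use of \<open>NU\<close> yields one \<open>x\<close> that serves every
  \<open>y\<close>. It is moved past \<open>y\<close> by \<open>swap_sub\<close> and is a parameter
  from then on.\<close>

lemma forces_NUs:
  assumes "\<And>y. typed y \<tau> \<Longrightarrow> w \<tturnstile> fsub (foldr ExSt \<sigma>s \<phi>) (case_nat y e)"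
    and "\<And>w' xs. w \<sqsubseteq> w' \<Longrightarrow> sts w' xs \<sigma>s
      \<Longrightarrow> (\<And>y. typed y \<tau> \<Longrightarrow> w' \<tturnstile> fsub \<phi> (push (case_nat y e) xs)) \<Longrightarrow> w' \<tturnstile> \<chi>"
  shows "w \<tturnstile> \<chi>"
  using assms
proof (induction \<sigma>s arbitrary: w e \<phi>)
  case Nil
  have "world w" by (rule forces_world[OF Nil(1)[OF typed_default]])
  then show ?case by (intro Nil(2)[OF later_refl, of "[]"]) (use Nil(1) in simp_all)
next
  case (Cons \<sigma> \<sigma>s)
  let ?\<phi> = "fsub \<phi> ((up ^^ length \<sigma>s) swap_sub)"
  have "w \<tturnstile> fsub (All \<tau> (ExSt \<sigma> (foldr ExSt \<sigma>s \<phi>))) e"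
    by (rule forces_allI') (use Cons.prems(1) in simp)
  then show ?case
  proof (rule forces_NU)
    fix w1 x assume 1: "w \<sqsubseteq> w1" "st w1 x \<sigma>"
      "\<And>y. typed y \<tau> \<Longrightarrow> w1 \<tturnstile> fsub (foldr ExSt \<sigma>s \<phi>) (case_nat x (case_nat y e))"
    have sw: "(\<lambda>i. tsub (case_nat y (case_nat x e)) (swap_sub i)) = case_nat x (case_nat y e)" for y
      by (rule ext) (rule tsub_swap_sub)
    show "w1 \<tturnstile> \<chi>"
    proof (rule Cons.IH[of w1 ?\<phi> "case_nat x e"])
      fix y assume y: "typed y \<tau>"
      have "fsub (foldr ExSt \<sigma>s ?\<phi>) (case_nat y (case_nat x e))
          = fsub (fsub (foldr ExSt \<sigma>s \<phi>) swap_sub) (case_nat y (case_nat x e))"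
        by (simp only: fsub_foldr)
      then show "w1 \<tturnstile> fsub (foldr ExSt \<sigma>s ?\<phi>) (case_nat y (case_nat x e))"
        using 1(3)[OF y] by (simp only: fsub_fsub sw)
    next
      fix w2 xs assume 2: "w1 \<sqsubseteq> w2" "sts w2 xs \<sigma>s"
        "\<And>y. typed y \<tau> \<Longrightarrow> w2 \<tturnstile> fsub ?\<phi> (push (case_nat y (case_nat x e)) xs)"
      show "w2 \<tturnstile> \<chi>"
        by (rule Cons.prems(2)[OF later_trans[OF 1(1) 2(1)], of "x # xs"])
          (use 2(2,3) st_mono[OF 1(2) 2(1)] list_all2_lengthD[OF 2(2)] in \<open>simp_all add: fsub_push_up sw\<close>)
    qed
  qed
qed

lemma forces_IP:
  assumes \<phi>: "wfm (AllSt \<sigma> \<phi>)" "internal \<phi>" "or_free \<phi>" and w: "world w"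
    and imp: "\<And>w'. w \<sqsubseteq> w' \<Longrightarrow> w' \<tturnstile> AllSt \<sigma> \<phi> \<Longrightarrow> w' \<tturnstile> fsub (ExSt \<tau> \<psi>) e"
    and elim: "\<And>w' u. w \<sqsubseteq> w' \<Longrightarrow> st w' u \<tau>
      \<Longrightarrow> (\<And>w''. w' \<sqsubseteq> w'' \<Longrightarrow> w'' \<tturnstile> AllSt \<sigma> \<phi> \<Longrightarrow> w'' \<tturnstile> fsub \<psi> (case_nat u e)) \<Longrightarrow> w' \<tturnstile> \<chi>"
  shows "w \<tturnstile> \<chi>"
proof -
  let ?\<psi> = "fsub \<psi> (up e)"
  have a: "w \<tturnstile> (AllSt \<sigma> \<phi> \<^bold>\<longrightarrow> ExSt \<tau> ?\<psi>)"
    by (rule forces_impI[OF \<phi>(1) w]) (use imp in simp)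
  then obtain n where n: "wff \<phi> (\<sigma> # Ctx n)" "wff ?\<psi> (\<tau> # Ctx n)"
    using forces_wfm[OF a] unfolding wfm_def by fastforce
  have "w \<tturnstile> ExSt \<tau> (lift (AllSt \<sigma> \<phi>) \<^bold>\<longrightarrow> ?\<psi>)"
    by (rule forces_mp[OF forces_axiom_Ctx[of IP, OF IP.intros[OF n(1) \<phi>(2,3) n(2)] _ w] a]) simp
  then show ?thesis
  proof (rule forces_ExStE)
    fix u w' assume u: "w \<sqsubseteq> w'" "st w' u \<tau>" "w' \<tturnstile> inst u (lift (AllSt \<sigma> \<phi>) \<^bold>\<longrightarrow> ?\<psi>)"
    have "inst u (lift (AllSt \<sigma> \<phi>) \<^bold>\<longrightarrow> ?\<psi>) = (AllSt \<sigma> \<phi> \<^bold>\<longrightarrow> fsub \<psi> (case_nat u e))"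
      unfolding inst_def fsub.simps(6) fsub_lift_case fsub_up_case by simp
    with u(3) have u': "w' \<tturnstile> (AllSt \<sigma> \<phi> \<^bold>\<longrightarrow> fsub \<psi> (case_nat u e))" by simp
    show "w' \<tturnstile> \<chi>" by (rule elim[OF u(1,2)]) (blast intro: forces_mp forces_mono[OF u'])
  qed
qed

text \<open>The conclusion of \<open>IP\<close> is an arbitrary formula, so its quantifiers come out
  one after another; only the premise is tied to a single variable.\<close>

lemma forces_IPs1:
  assumes "wfm (AllSt \<sigma> \<phi>)" "internal \<phi>" "or_free \<phi>" and "world w"
    and "\<And>w'. w \<sqsubseteq> w' \<Longrightarrow> w' \<tturnstile> AllSt \<sigma> \<phi> \<Longrightarrow> w' \<tturnstile> fsub (foldr ExSt \<tau>s \<psi>) e"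
    and "\<And>w' us. w \<sqsubseteq> w' \<Longrightarrow> sts w' us \<tau>s
      \<Longrightarrow> (\<And>w''. w' \<sqsubseteq> w'' \<Longrightarrow> w'' \<tturnstile> AllSt \<sigma> \<phi> \<Longrightarrow> w'' \<tturnstile> fsub \<psi> (push e us)) \<Longrightarrow> w' \<tturnstile> \<chi>"
  shows "w \<tturnstile> \<chi>"
  using assms(4-)
proof (induction \<tau>s arbitrary: w e)
  case Nil
  show ?case by (rule Nil(3)[OF later_refl[OF Nil(1)], of "[]"]) (use Nil(2) in simp_all)
next
  case (Cons \<tau> \<tau>s)
  show ?case
  proof (rule forces_IP[OF assms(1-3) Cons.prems(1), of \<tau> "foldr ExSt \<tau>s \<psi>" e])
    fix w1 u assume 1: "w \<sqsubseteq> w1" "st w1 u \<tau>"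
      "\<And>w2. w1 \<sqsubseteq> w2 \<Longrightarrow> w2 \<tturnstile> AllSt \<sigma> \<phi> \<Longrightarrow> w2 \<tturnstile> fsub (foldr ExSt \<tau>s \<psi>) (case_nat u e)"
    show "w1 \<tturnstile> \<chi>"
    proof (rule Cons.IH[OF st_world[OF 1(2)] 1(3)])
      fix w2 us assume 2: "w1 \<sqsubseteq> w2" "sts w2 us \<tau>s"
        "\<And>w3. w2 \<sqsubseteq> w3 \<Longrightarrow> w3 \<tturnstile> AllSt \<sigma> \<phi> \<Longrightarrow> w3 \<tturnstile> fsub \<psi> (push (case_nat u e) us)"
      show "w2 \<tturnstile> \<chi>"
        by (rule Cons.prems(3)[OF later_trans[OF 1(1) 2(1)], of "u # us"])
          (use 2(2,3) st_mono[OF 1(2) 2(1)] in simp_all)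
    qed
  next
    fix w1 assume "w \<sqsubseteq> w1" "w1 \<tturnstile> AllSt \<sigma> \<phi>"
    from Cons.prems(2)[OF this] show "w1 \<tturnstile> fsub (ExSt \<tau> (foldr ExSt \<tau>s \<psi>)) e" by simp
  qed
qed

text \<open>The formula \<open>hyper\<close> is unfolded into its forcing meaning: \<open>s\<close>
  contains whatever is standard at some later world.\<close>

lemma forces_US:
  assumes \<phi>: "internal \<phi>" "or_free \<phi>" and w: "world w"
    and hyp: "\<And>w' s. w \<sqsubseteq> w' \<Longrightarrow> typed s (Seq \<sigma>)
      \<Longrightarrow> (\<And>w'' x. w' \<sqsubseteq> w'' \<Longrightarrow> st w'' x \<sigma> \<Longrightarrow> w'' \<tturnstile> mem \<sigma> x s) \<Longrightarrow> w' \<tturnstile> fsub \<phi> (case_nat s e)"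
    and elim: "\<And>w' s. w \<sqsubseteq> w' \<Longrightarrow> st w' s (Seq \<sigma>) \<Longrightarrow> w' \<tturnstile> fsub \<phi> (case_nat s e) \<Longrightarrow> w' \<tturnstile> \<chi>"
  shows "w \<tturnstile> \<chi>"
proof -
  let ?\<phi> = "fsub \<phi> (up e)"
  have a: "w \<tturnstile> All (Seq \<sigma>) (hyper \<sigma> (Var 0) \<^bold>\<longrightarrow> ?\<phi>)"
  proof (rule forces_allI)
    fix s assume s: "typed s (Seq \<sigma>)"
    have "w \<tturnstile> (hyper \<sigma> s \<^bold>\<longrightarrow> fsub \<phi> (case_nat s e))"
    proof (rule forces_impI)
      show "wfm (hyper \<sigma> s)"
        using wfm_fsub[of "hyper \<sigma> (Var 0)" "[Seq \<sigma>]" "case_nat s Var"] s by (simp add: wff_hyper)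
      fix w' assume 1: "w \<sqsubseteq> w'" "w' \<tturnstile> hyper \<sigma> s"
      show "w' \<tturnstile> fsub \<phi> (case_nat s e)"
      proof (rule hyp[OF 1(1) s])
        fix w'' x assume x: "w' \<sqsubseteq> w''" "st w'' x \<sigma>"
        from forces_AllStE[OF forces_mono[OF 1(2) x(1), unfolded hyper_def] x(2)]
        show "w'' \<tturnstile> mem \<sigma> x s" by (simp add: inst_def)
      qed
    qed (rule w)
    then show "w \<tturnstile> inst s (hyper \<sigma> (Var 0) \<^bold>\<longrightarrow> ?\<phi>)"
      by (simp add: inst_def fsub_up_case)
  qed
  obtain n where n: "wff ?\<phi> (Seq \<sigma> # Ctx n)" using forces_wfm[OF a] unfolding wfm_def by fastforce
  have "w \<tturnstile> ExSt (Seq \<sigma>) ?\<phi>"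
    by (rule forces_mp[OF forces_axiom_Ctx[of US, OF US.intros[OF n] _ w] a]) (use \<phi> in simp_all)
  then show ?thesis by (rule forces_ExStE) (use elim in \<open>simp add: inst_up\<close>)
qed

lemma forces_OS:
  assumes \<phi>: "internal \<phi>" "or_free \<phi>" and all: "w \<tturnstile> fsub (AllSt (Seq \<sigma>) \<phi>) e"
    and elim: "\<And>w' s. w \<sqsubseteq> w' \<Longrightarrow> typed s (Seq \<sigma>)
      \<Longrightarrow> (\<And>w'' x. w' \<sqsubseteq> w'' \<Longrightarrow> st w'' x \<sigma> \<Longrightarrow> w'' \<tturnstile> mem \<sigma> x s)
      \<Longrightarrow> w' \<tturnstile> fsub \<phi> (case_nat s e) \<Longrightarrow> w' \<tturnstile> \<chi>"
  shows "w \<tturnstile> \<chi>"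
proof -
  let ?\<phi> = "fsub \<phi> (up e)"
  have a: "w \<tturnstile> AllSt (Seq \<sigma>) ?\<phi>" using all by simp
  obtain n where n: "wff ?\<phi> (Seq \<sigma> # Ctx n)" using forces_wfm[OF a] unfolding wfm_def by fastforce
  have "w \<tturnstile> Ex (Seq \<sigma>) (hyper \<sigma> (Var 0) \<^bold>\<and> ?\<phi>)"
    by (rule forces_mp[OF forces_axiom_Ctx[of OS, OF OS.intros[OF n] _ forces_world[OF a]] a])
      (use \<phi> in simp_all)
  then show ?thesis
  proof (rule forces_exE)
    fix s w' assume s: "w \<sqsubseteq> w'" "typed s (Seq \<sigma>)" "w' \<tturnstile> inst s (hyper \<sigma> (Var 0) \<^bold>\<and> ?\<phi>)"
    then have h: "w' \<tturnstile> hyper \<sigma> s" "w' \<tturnstile> fsub \<phi> (case_nat s e)" by (simp_all add: inst_def fsub_up_case)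
    show "w' \<tturnstile> \<chi>"
    proof (rule elim[OF s(1,2) _ h(2)])
      fix w'' x assume x: "w' \<sqsubseteq> w''" "st w'' x \<sigma>"
      from forces_AllStE[OF forces_mono[OF h(1) x(1), unfolded hyper_def] x(2)]
      show "w'' \<tturnstile> mem \<sigma> x s" by (simp add: inst_def)
    qed
  qed
qed

lemma eqs_push:
  "eqs w \<sigma>s ts us \<Longrightarrow> (\<And>i. i < length \<Gamma> \<Longrightarrow> w \<tturnstile> Eq (\<Gamma> ! i) (e i) (e' i)) \<Longrightarrow> i < length (rev \<sigma>s @ \<Gamma>)
    \<Longrightarrow> w \<tturnstile> Eq ((rev \<sigma>s @ \<Gamma>) ! i) (push e ts i) (push e' us i)"
proof (induction w \<sigma>s ts us arbitrary: \<Gamma> e e' rule: eqs.induct)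
  case (2 w \<sigma> \<sigma>s t ts u us)
  have "w \<tturnstile> Eq ((\<sigma> # \<Gamma>) ! i) (case_nat t e i) (case_nat u e' i)" if "i < length (\<sigma> # \<Gamma>)" for i
    using 2(2,3) that by (cases i) auto
  with 2(1)[of "\<sigma> # \<Gamma>" "case_nat t e" "case_nat u e'"] 2(2,4) show ?case by simp
qed simp_all

lemma eqs_typed: "eqs w \<sigma>s ts us \<Longrightarrow> list_all2 typed ts \<sigma>s \<and> list_all2 typed us \<sigma>s"
  by (induction w \<sigma>s ts us rule: eqs.induct) (auto dest: eq_typed)

lemma forces_eqs_subst:
  assumes "wff \<phi> (rev \<sigma>s @ \<Gamma>)" "env e \<Gamma>" "eqs w \<sigma>s ts us" and a: "w \<tturnstile> fsub \<phi> (push e ts)"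
  shows "w \<tturnstile> fsub \<phi> (push e us)"
proof (rule forces_fsub_cong[OF assms(1) _ _ eqs_push[OF assms(3)] a])
  show "w \<tturnstile> Eq (\<Gamma> ! i) (e i) (e i)" if "i < length \<Gamma>" for i
    using that assms(2) forces_world[OF a] by (auto simp: env_def intro: eq_refl)
qed (use eqs_typed[OF assms(3)] assms(2) in \<open>auto intro: env_push\<close>)

definition coding :: "ty \<Rightarrow> tm list \<Rightarrow> ty list \<Rightarrow> bool" where
  "coding \<tau> \<pi>s \<rho>s \<longleftrightarrow> list_all2 (\<lambda>\<pi> \<rho>. closed_tm \<pi> (\<tau> \<rightarrow> \<rho>)) \<pi>s \<rho>s \<and>
    (\<forall>w ys. world w \<longrightarrow> sts w ys \<rho>s \<longrightarrow>
      (\<exists>q. st w q \<tau> \<and> eqs w \<rho>s (map (\<lambda>\<pi>. \<pi> \<cdot> q) \<pi>s) ys))"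

lemma coding_exists: "\<exists>\<tau> \<pi>s. coding \<tau> \<pi>s \<rho>s"
  using tuple_coding unfolding coding_def .

lemma coding_projections:
  assumes "coding \<tau> \<pi>s \<rho>s"
  shows "length \<pi>s = length \<rho>s" "map (\<lambda>\<pi>. tsub e \<pi> \<cdot> q) \<pi>s = map (\<lambda>\<pi>. \<pi> \<cdot> q) \<pi>s"
    and "has_ty \<Gamma> t \<tau> \<Longrightarrow> list_all2 (has_ty \<Gamma>) (map (\<lambda>\<pi>. \<pi> \<cdot> t) \<pi>s) \<rho>s"
    and "typed t \<tau> \<Longrightarrow> list_all2 typed (map (\<lambda>\<pi>. \<pi> \<cdot> t) \<pi>s) \<rho>s"
    and "st w t \<tau> \<Longrightarrow> sts w (map (\<lambda>\<pi>. \<pi> \<cdot> t) \<pi>s) \<rho>s"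
proof -
  have *: "list_all2 (\<lambda>\<pi> \<rho>. closed_tm \<pi> (\<tau> \<rightarrow> \<rho>)) \<pi>s \<rho>s" using assms by (simp add: coding_def)
  show "length \<pi>s = length \<rho>s" by (rule list_all2_lengthD[OF *])
  show "map (\<lambda>\<pi>. tsub e \<pi> \<cdot> q) \<pi>s = map (\<lambda>\<pi>. \<pi> \<cdot> q) \<pi>s"
    using * by (induction rule: list_all2_induct) (auto intro: tsub_closed)
  show "has_ty \<Gamma> t \<tau> \<Longrightarrow> list_all2 (has_ty \<Gamma>) (map (\<lambda>\<pi>. \<pi> \<cdot> t) \<pi>s) \<rho>s"
    using * by (induction rule: list_all2_induct) (auto intro: has_ty_AppI[OF has_ty_closed])
  show "typed t \<tau> \<Longrightarrow> list_all2 typed (map (\<lambda>\<pi>. \<pi> \<cdot> t) \<pi>s) \<rho>s"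
    using * by (induction rule: list_all2_induct) (auto intro: typed_App[OF typed_closed])
  show "st w t \<tau> \<Longrightarrow> sts w (map (\<lambda>\<pi>. \<pi> \<cdot> t) \<pi>s) \<rho>s"
    using * by (induction rule: list_all2_induct) (auto intro: st_App[OF st_closed] st_world)
qed

text \<open>Makes a quantifier over codes out of a block of quantifiers: the variables of the block
  become projections of a single variable.\<close>

definition decode :: "tm list \<Rightarrow> fm \<Rightarrow> fm" where
  "decode \<pi>s \<phi> = fsub \<phi> (push (\<lambda>i. Var (Suc i)) (map (\<lambda>\<pi>. \<pi> \<cdot> Var 0) \<pi>s))"

lemma fsub_decode:
  assumes "coding \<tau> \<pi>s \<rho>s"
  shows "fsub (decode \<pi>s \<phi>) (case_nat q e) = fsub \<phi> (push e (map (\<lambda>\<pi>. \<pi> \<cdot> q) \<pi>s))"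
  unfolding decode_def
  by (rule fsub_fsub_eq) (simp add: tsub_push comp_def coding_projections(2)[OF assms])

lemma push_typed:
  "list_all2 (has_ty \<Gamma>') ts \<sigma>s \<Longrightarrow> (\<And>i. i < length \<Gamma> \<Longrightarrow> has_ty \<Gamma>' (e i) (\<Gamma> ! i))
    \<Longrightarrow> i < length (rev \<sigma>s @ \<Gamma>) \<Longrightarrow> has_ty \<Gamma>' (push e ts i) ((rev \<sigma>s @ \<Gamma>) ! i)"
proof (induction ts \<sigma>s arbitrary: e \<Gamma> rule: list_all2_induct)
  case (Cons t ts \<sigma> \<sigma>s)
  have "has_ty \<Gamma>' (case_nat t e i) ((\<sigma> # \<Gamma>) ! i)" if "i < length (\<sigma> # \<Gamma>)" for i
    using Cons(1,4) that by (cases i) auto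
  with Cons(3)[of "\<sigma> # \<Gamma>" "case_nat t e"] Cons(5) show ?case by simp
qed simp

lemma wff_decode:
  assumes "coding \<tau> \<pi>s \<rho>s" "wff \<phi> (rev \<rho>s @ \<Gamma>)"
  shows "wff (decode \<pi>s \<phi>) (\<tau> # \<Gamma>)"
  unfolding decode_def
  by (rule wff_fsub[OF assms(2)], rule push_typed[OF coding_projections(3)[OF assms(1)]]) simp_all

lemma internal_decode [simp]: "internal (decode \<pi>s \<phi>) = internal \<phi>" "or_free (decode \<pi>s \<phi>) = or_free \<phi>"
  by (simp_all add: decode_def)

text \<open>Every standard tuple has a standard code, and a standard code has standard projections.
  The projections agree with the original components only up to provable equality, so equals have to
  be substituted.\<close>

lemma forces_AllSt_decode:
  assumes c: "coding \<tau> \<pi>s \<rho>s" and wf: "wff \<phi> (rev \<rho>s @ \<Gamma>)" "env e \<Gamma>"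
  shows "w \<tturnstile> fsub (AllSt \<tau> (decode \<pi>s \<phi>)) e \<longleftrightarrow> w \<tturnstile> fsub (foldr AllSt \<rho>s \<phi>) e"
proof
  assume a: "w \<tturnstile> fsub (AllSt \<tau> (decode \<pi>s \<phi>)) e"
  show "w \<tturnstile> fsub (foldr AllSt \<rho>s \<phi>) e"
  proof (rule forces_AllStsI[OF forces_world[OF a]])
    fix w' ys assume *: "w \<sqsubseteq> w'" "sts w' ys \<rho>s"
    then obtain q where q: "st w' q \<tau>" "eqs w' \<rho>s (map (\<lambda>\<pi>. \<pi> \<cdot> q) \<pi>s) ys"
      using c later_world unfolding coding_def by blast
    from forces_AllStE'[OF forces_mono[OF a *(1)] q(1)]
    show "w' \<tturnstile> fsub \<phi> (push e ys)"
      unfolding fsub_decode[OF c] by (rule forces_eqs_subst[OF wf q(2)])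
  qed
next
  assume a: "w \<tturnstile> fsub (foldr AllSt \<rho>s \<phi>) e"
  show "w \<tturnstile> fsub (AllSt \<tau> (decode \<pi>s \<phi>)) e"
  proof (rule forces_AllStI'[OF forces_world[OF a]])
    fix w' q assume *: "w \<sqsubseteq> w'" "st w' q \<tau>"
    show "w' \<tturnstile> fsub (decode \<pi>s \<phi>) (case_nat q e)"
      unfolding fsub_decode[OF c]
      by (rule forces_AllStsE[OF forces_mono[OF a *(1)] coding_projections(5)[OF c *(2)]])
  qed
qed

text \<open>Decoding gives the premise the shape that \<open>IP\<close> demands, a single external
  quantifier in front of an internal formula.\<close>

lemma forces_IPs:
  assumes \<phi>: "wff \<phi> (rev \<rho>s @ Ctx n)" "internal \<phi>" "or_free \<phi>" and w: "world w"
    and imp: "\<And>w'. w \<sqsubseteq> w' \<Longrightarrow> w' \<tturnstile> foldr AllSt \<rho>s \<phi> \<Longrightarrow> w' \<tturnstile> fsub (foldr ExSt \<tau>s \<psi>) e"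
    and elim: "\<And>w' us. w \<sqsubseteq> w' \<Longrightarrow> sts w' us \<tau>s
      \<Longrightarrow> (\<And>w''. w' \<sqsubseteq> w'' \<Longrightarrow> w'' \<tturnstile> foldr AllSt \<rho>s \<phi> \<Longrightarrow> w'' \<tturnstile> fsub \<psi> (push e us)) \<Longrightarrow> w' \<tturnstile> \<chi>"
  shows "w \<tturnstile> \<chi>"
proof -
  obtain \<tau> \<pi>s where c: "coding \<tau> \<pi>s \<rho>s" using coding_exists by blast
  have iff: "w \<tturnstile> AllSt \<tau> (decode \<pi>s \<phi>) \<longleftrightarrow> w \<tturnstile> foldr AllSt \<rho>s \<phi>" for w
    using forces_AllSt_decode[OF c \<phi>(1) env_Ctx, of w] by simp
  have "wfm (AllSt \<tau> (decode \<pi>s \<phi>))" using wff_decode[OF c \<phi>(1)] by (auto simp: wfm_def)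
  then show ?thesis
    by (rule forces_IPs1[of \<tau> "decode \<pi>s \<phi>" w \<tau>s \<psi> e]) (use \<phi> w imp elim in \<open>simp_all add: iff\<close>)
qed

section \<open>Bounded quantifiers, and tuples for \<open>US\<close> and \<open>OS\<close>\<close>

fun mems :: "fm set \<Rightarrow> ty list \<Rightarrow> tm list \<Rightarrow> tm list \<Rightarrow> bool" where
  "mems w [] [] [] = True"
| "mems w (\<sigma> # \<sigma>s) (t # ts) (s # ss) = (typed t \<sigma> \<and> w \<tturnstile> mem \<sigma> t s \<and> mems w \<sigma>s ts ss)"
| "mems w _ _ _ = False"

lemma mems_length: "mems w \<sigma>s ts ss \<Longrightarrow> length ts = length \<sigma>s \<and> length ss = length \<sigma>s"
  by (induction w \<sigma>s ts ss rule: mems.induct) auto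

lemma fsub_ball:
  "length ss = length \<sigma>s
    \<Longrightarrow> fsub (ball \<sigma>s ss \<phi>) e = ball \<sigma>s (map (tsub e) ss) (fsub \<phi> ((up ^^ length \<sigma>s) e))"
proof (induction \<sigma>s ss \<phi> arbitrary: e rule: ball.induct)
  case (1 \<sigma> \<sigma>s s ss \<phi>)
  then show ?case by (simp add: comp_def funpow_swap1)
qed simp_all

lemma wff_ball:
  "list_all2 (has_ty \<Gamma>) ss (map Seq \<sigma>s) \<Longrightarrow> wff \<phi> (rev \<sigma>s @ \<Gamma>) \<Longrightarrow> wff (ball \<sigma>s ss \<phi>) \<Gamma>"
proof (induction \<sigma>s ss \<phi> arbitrary: \<Gamma> rule: ball.induct)
  case (1 \<sigma> \<sigma>s s ss \<phi>)
  have "list_all2 (has_ty (\<sigma> # \<Gamma>)) (map (shift 1) ss) (map Seq \<sigma>s)"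
    using 1(2) by (auto simp: list_all2_map1 intro: has_ty_shift1 elim!: list_all2_mono)
  with 1 show ?case by (auto intro!: wff_mem has_ty_shift1)
qed simp_all

lemma internal_ball [simp]: "internal (ball \<sigma>s ss \<phi>) = internal \<phi>" "or_free (ball \<sigma>s ss \<phi>) = or_free \<phi>"
  by (induction \<sigma>s ss \<phi> rule: ball.induct) simp_all

lemma forces_ballE:
  "w \<tturnstile> fsub (ball \<sigma>s ss \<phi>) e \<Longrightarrow> mems w \<sigma>s ts (map (tsub e) ss) \<Longrightarrow> w \<tturnstile> fsub \<phi> (push e ts)"
proof (induction \<sigma>s ss \<phi> arbitrary: e ts rule: ball.induct)
  case (1 \<sigma> \<sigma>s s ss \<phi>)
  then obtain t ts' where t: "ts = t # ts'" "typed t \<sigma>" "w \<tturnstile> mem \<sigma> t (tsub e s)" "mems w \<sigma>s ts' (map (tsub e) ss)"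
    by (cases ts) auto
  have "w \<tturnstile> (mem \<sigma> t (tsub e s) \<^bold>\<longrightarrow> fsub (ball \<sigma>s (map (shift 1) ss) \<phi>) (case_nat t e))"
    using forces_allE'[OF 1(2)[unfolded ball.simps] t(2)] by simp
  from 1(1)[OF forces_mp[OF this t(3)], of ts'] t show ?case by (simp add: comp_def)
next
  case ("2_1" ss \<phi>)
  then show ?case by (cases ts; cases ss) simp_all
next
  case ("2_2" \<sigma>s \<phi>)
  then show ?case by (cases ts; cases \<sigma>s) simp_all
qed

lemma forces_ballI:
  "world w \<Longrightarrow> list_all2 typed (map (tsub e) ss) (map Seq \<sigma>s)
    \<Longrightarrow> (\<And>w' ts. w \<sqsubseteq> w' \<Longrightarrow> mems w' \<sigma>s ts (map (tsub e) ss) \<Longrightarrow> w' \<tturnstile> fsub \<phi> (push e ts))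
    \<Longrightarrow> w \<tturnstile> fsub (ball \<sigma>s ss \<phi>) e"
proof (induction \<sigma>s ss \<phi> arbitrary: e w rule: ball.induct)
  case (1 \<sigma> \<sigma>s s ss \<phi>)
  show ?case unfolding ball.simps
  proof (rule forces_allI')
    fix t assume t: "typed t \<sigma>"
    have "w \<tturnstile> (mem \<sigma> t (tsub e s) \<^bold>\<longrightarrow> fsub (ball \<sigma>s (map (shift 1) ss) \<phi>) (case_nat t e))"
    proof (rule forces_impI)
      show "wfm (mem \<sigma> t (tsub e s))" using t 1(3) by (auto intro: wfm_mem)
      fix w1 assume *: "w \<sqsubseteq> w1" "w1 \<tturnstile> mem \<sigma> t (tsub e s)"
      show "w1 \<tturnstile> fsub (ball \<sigma>s (map (shift 1) ss) \<phi>) (case_nat t e)"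
      proof (rule 1(1)[OF forces_world[OF *(2)]])
        show "list_all2 typed (map (tsub (case_nat t e)) (map (shift 1) ss)) (map Seq \<sigma>s)"
          using 1(3) by (simp add: comp_def)
        fix w2 ts assume 2: "w1 \<sqsubseteq> w2" "mems w2 \<sigma>s ts (map (tsub (case_nat t e)) (map (shift 1) ss))"
        show "w2 \<tturnstile> fsub \<phi> (push (case_nat t e) ts)"
          using 1(4)[OF later_trans[OF *(1) 2(1)], of "t # ts"] 2(2) t forces_mono[OF *(2) 2(1)]
          by (simp add: comp_def)
      qed
    qed (rule 1(2))
    then show "w \<tturnstile> fsub (mem \<sigma> (Var 0) (shift 1 s) \<^bold>\<longrightarrow> ball \<sigma>s (map (shift 1) ss) \<phi>) (case_nat t e)"
      by simp
  qed
next
  case ("2_1" ss \<phi>)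
  then show ?case using "2_1"(3)[OF later_refl[OF "2_1"(1)], of "[]"] by (cases ss) auto
next
  case ("2_2" \<sigma>s \<phi>)
  then show ?case using "2_2"(3)[OF later_refl[OF "2_2"(1)], of "[]"] by (cases \<sigma>s) auto
qed

text \<open>Transfer of a single variable needs an internal matrix. Therefore the induction
  hypothesis first replaces the later external quantifiers by bounded ones, after which the first
  variable can be transferred.\<close>

lemma forces_st_balls:
  assumes "internal \<phi>" "or_free \<phi>" "sts w ss (map Seq \<rho>s)" "w \<tturnstile> foldr AllSt \<rho>s \<phi>" "mems w \<rho>s ys ss"
  shows "w \<tturnstile> fsub \<phi> (push Var ys)"
  using assms
proof (induction \<rho>s arbitrary: \<phi> ss ys w)
  case Nil
  then show ?case by (cases ys) auto
next
  case (Cons \<rho> \<rho>s)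
  obtain s ss' where s: "ss = s # ss'" "st w s (Seq \<rho>)" "sts w ss' (map Seq \<rho>s)"
    using Cons.prems(3) by (auto simp: list_all2_Cons2)
  obtain y ys' where y: "ys = y # ys'" "typed y \<rho>" "w \<tturnstile> mem \<rho> y s" "mems w \<rho>s ys' ss'"
    using Cons.prems(5) s(1) by (cases ys) auto
  let ?\<beta> = "ball \<rho>s (map (shift 1) ss') \<phi>"
  have ss: "map (tsub (case_nat x Var)) (map (shift 1) ss') = ss'" for x by (simp add: comp_def)
  have all: "w \<tturnstile> fsub (AllSt \<rho> ?\<beta>) Var"
  proof (rule forces_AllStI'[OF st_world[OF s(2)]])
    fix w1 x assume 1: "w \<sqsubseteq> w1" "st w1 x \<rho>"
    show "w1 \<tturnstile> fsub ?\<beta> (case_nat x Var)"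
    proof (rule forces_ballI[OF st_world[OF 1(2)]])
      show "list_all2 typed (map (tsub (case_nat x Var)) (map (shift 1) ss')) (map Seq \<rho>s)"
        using sts_typed[OF s(3)] unfolding ss .
      fix w2 ts assume 2: "w1 \<sqsubseteq> w2" "mems w2 \<rho>s ts (map (tsub (case_nat x Var)) (map (shift 1) ss'))"
      let ?\<phi> = "fsub \<phi> ((up ^^ length \<rho>s) (case_nat x Var))"
      have 12: "w \<sqsubseteq> w2" by (rule later_trans[OF 1(1) 2(1)])
      have "w2 \<tturnstile> fsub ?\<phi> (push Var ts)"
      proof (rule Cons.IH[OF _ _ sts_mono[OF s(3) 12] _ 2(2)[unfolded ss]])
        have "w \<tturnstile> fsub (AllSt \<rho> (foldr AllSt \<rho>s \<phi>)) Var" using Cons.prems(4) by simp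
        from forces_AllStE'[OF forces_mono[OF this 12] st_mono[OF 1(2) 2(1)]]
        show "w2 \<tturnstile> foldr AllSt \<rho>s ?\<phi>" by (simp only: fsub_foldr)
      qed (use Cons.prems(1,2) in simp_all)
      then show "w2 \<tturnstile> fsub \<phi> (push (case_nat x Var) ts)"
        using mems_length[OF 2(2)] by (simp add: fsub_push_up)
    qed
  qed
  then obtain n where "wff ?\<beta> (\<rho> # Ctx n)" using forces_wfm[of w] by (fastforce simp: wfm_def)
  then have "w \<tturnstile> fsub ?\<beta> (case_nat y Var)"
    by (rule forces_st_ball[OF _ _ _ env_Ctx s(2) all y(3)]) (use Cons.prems(1,2) in simp_all)
  from forces_ballE[OF this, of ys'] y show ?case unfolding ss by simp
qed

text \<open>A sequence containing all standard elements contains the projections of the elements of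
  \<open>t\<close>; \<open>US\<close> then replaces it by a standard one.\<close>

lemma forces_boxes:
  assumes "list_all2 (\<lambda>\<pi> \<rho>. closed_tm \<pi> (\<tau> \<rightarrow> \<rho>)) \<pi>s \<rho>s" "st w t (Seq \<tau>)"
    and "\<And>w' ss. w \<sqsubseteq> w' \<Longrightarrow> sts w' ss (map Seq \<rho>s)
      \<Longrightarrow> (\<And>w'' q. w' \<sqsubseteq> w'' \<Longrightarrow> typed q \<tau> \<Longrightarrow> w'' \<tturnstile> mem \<tau> q t \<Longrightarrow> mems w'' \<rho>s (map (\<lambda>\<pi>. \<pi> \<cdot> q) \<pi>s) ss)
      \<Longrightarrow> w' \<tturnstile> \<chi>"
  shows "w \<tturnstile> \<chi>"
  using assms
proof (induction \<pi>s \<rho>s arbitrary: w rule: list_all2_induct)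
  case Nil
  show ?case by (rule Nil(2)[OF later_refl[OF st_world[OF Nil(1)]], of "[]"]) simp_all
next
  case (Cons \<pi> \<pi>s \<rho> \<rho>s)
  let ?\<phi> = "All \<tau> (mem \<tau> (Var 0) (Var (Suc (Suc 0))) \<^bold>\<longrightarrow> mem \<rho> (\<pi> \<cdot> Var 0) (Var (Suc 0)))"
  note cl = tsub_closed[OF Cons(1)]
  have tt: "typed t (Seq \<tau>)" by (rule st_typed[OF Cons(4)])
  show ?case
  proof (rule forces_US[of ?\<phi> w \<rho> "case_nat t Var"])
    fix w1 s assume 1: "w \<sqsubseteq> w1" "typed s (Seq \<rho>)"
      "\<And>w2 x. w1 \<sqsubseteq> w2 \<Longrightarrow> st w2 x \<rho> \<Longrightarrow> w2 \<tturnstile> mem \<rho> x s"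
    show "w1 \<tturnstile> fsub ?\<phi> (case_nat s (case_nat t Var))"
    proof (rule forces_allI')
      fix q assume q: "typed q \<tau>"
      have "w1 \<tturnstile> (mem \<tau> q t \<^bold>\<longrightarrow> mem \<rho> (\<pi> \<cdot> q) s)"
      proof (rule forces_impI[OF wfm_mem[OF q tt] later_world[OF 1(1)]])
        fix w2 assume 2: "w1 \<sqsubseteq> w2" "w2 \<tturnstile> mem \<tau> q t"
        let ?m = "mem \<rho> (\<pi> \<cdot> Var 0) (Var (Suc 0))"
        \<comment> \<open>The entry \<open>q\<close> of \<open>t\<close> need not be standard. But
          \<open>\<pi> \<cdot> x\<close> lies in \<open>s\<close> for every standard
          \<open>x\<close>, and this internal property transfers to the entries of the standard
          sequence \<open>t\<close>.\<close>
        have "w2 \<tturnstile> fsub ?m (case_nat q (case_nat s Var))"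
        proof (rule forces_st_ball[of ?m \<tau> "[Seq \<rho>]" _ w2 t q])
          show "wff ?m [\<tau>, Seq \<rho>]"
            by (rule wff_mem) (use has_ty_closed[OF Cons(1)] in \<open>simp_all add: has_ty_App\<close>)
          show "w2 \<tturnstile> fsub (AllSt \<tau> ?m) (case_nat s Var)"
          proof (rule forces_AllStI'[OF forces_world[OF 2(2)]])
            fix w3 x assume 3: "w2 \<sqsubseteq> w3" "st w3 x \<tau>"
            show "w3 \<tturnstile> fsub ?m (case_nat x (case_nat s Var))"
              using 1(3)[OF later_trans[OF 2(1) 3(1)] st_App[OF st_closed[OF Cons(1) st_world[OF 3(2)]] 3(2)]]
              by (simp add: cl)
          qed
        qed (use 1 2 Cons(4) in \<open>auto intro: st_mono later_trans\<close>)
        then show "w2 \<tturnstile> mem \<rho> (\<pi> \<cdot> q) s" by (simp add: cl)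
      qed
      then show "w1 \<tturnstile> fsub (mem \<tau> (Var 0) (Var (Suc (Suc 0))) \<^bold>\<longrightarrow> mem \<rho> (\<pi> \<cdot> Var 0) (Var (Suc 0)))
          (case_nat q (case_nat s (case_nat t Var)))"
        by (simp add: cl)
    qed
  next
    fix w1 s assume 1: "w \<sqsubseteq> w1" "st w1 s (Seq \<rho>)" "w1 \<tturnstile> fsub ?\<phi> (case_nat s (case_nat t Var))"
    show "w1 \<tturnstile> \<chi>"
    proof (rule Cons.IH[OF st_mono[OF Cons(4) 1(1)]])
      fix w2 ss assume 2: "w1 \<sqsubseteq> w2" "sts w2 ss (map Seq \<rho>s)"
        "\<And>w3 q. w2 \<sqsubseteq> w3 \<Longrightarrow> typed q \<tau> \<Longrightarrow> w3 \<tturnstile> mem \<tau> q t \<Longrightarrow> mems w3 \<rho>s (map (\<lambda>\<pi>. \<pi> \<cdot> q) \<pi>s) ss"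
      show "w2 \<tturnstile> \<chi>"
      proof (rule Cons.prems(2)[OF later_trans[OF 1(1) 2(1)], of "s # ss"])
        show "sts w2 (s # ss) (map Seq (\<rho> # \<rho>s))" using 2(2) st_mono[OF 1(2) 2(1)] by simp
        fix w3 q assume 3: "w2 \<sqsubseteq> w3" "typed q \<tau>" "w3 \<tturnstile> mem \<tau> q t"
        have "w3 \<tturnstile> (mem \<tau> q t \<^bold>\<longrightarrow> mem \<rho> (\<pi> \<cdot> q) s)"
          using forces_allE'[OF forces_mono[OF 1(3) later_trans[OF 2(1) 3(1)]] 3(2)] by (simp add: cl)
        from forces_mp[OF this 3(3)] 2(3)[OF 3] typed_App[OF typed_closed[OF Cons(1)] 3(2)]
        show "mems w3 (\<rho> # \<rho>s) (map (\<lambda>\<pi>. \<pi> \<cdot> q) (\<pi> # \<pi>s)) (s # ss)" by simp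
      qed
    qed
  qed (use st_world[OF Cons(4)] in simp_all)
qed

text \<open>\<open>US\<close> for the type of codes gives a standard sequence such that the decoded
  matrix at all its entries entails \<open>\<psi>\<close>. The component sequences from
  \<open>forces_boxes\<close> contain all projections of these entries, so the matrix bounded by
  them is a stronger premise and entails \<open>\<psi>\<close> as well.\<close>

lemma forces_USs:
  assumes \<phi>: "wff \<phi> (rev \<rho>s @ Ctx n)" "internal \<phi>" "or_free \<phi>" and \<psi>: "internal \<psi>" "or_free \<psi>"
    and w: "world w"
    and imp: "\<And>w'. w \<sqsubseteq> w' \<Longrightarrow> w' \<tturnstile> foldr AllSt \<rho>s \<phi> \<Longrightarrow> w' \<tturnstile> \<psi>"
    and elim: "\<And>w' ss. w \<sqsubseteq> w' \<Longrightarrow> sts w' ss (map Seq \<rho>s)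
      \<Longrightarrow> (\<And>w''. w' \<sqsubseteq> w''
        \<Longrightarrow> (\<And>w3 ys. w'' \<sqsubseteq> w3 \<Longrightarrow> mems w3 \<rho>s ys ss \<Longrightarrow> w3 \<tturnstile> fsub \<phi> (push Var ys)) \<Longrightarrow> w'' \<tturnstile> \<psi>)
      \<Longrightarrow> w' \<tturnstile> \<chi>"
  shows "w \<tturnstile> \<chi>"
proof -
  obtain \<tau> \<pi>s where c: "coding \<tau> \<pi>s \<rho>s" using coding_exists by blast
  let ?d = "fsub (decode \<pi>s \<phi>) (case_nat (Var 0) (\<lambda>i. Var (Suc (Suc i))))"
  \<comment> \<open>\<open>US\<close> is applied to the implication from this bounded statement to
    \<open>\<psi>\<close>, which is internal. For a sequence containing all standard codes,
    \<open>?a\<close> gives the matrix at all standard tuples, and \<open>imp\<close>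
    applies.\<close>
  let ?a = "All \<tau> (mem \<tau> (Var 0) (Var (Suc 0)) \<^bold>\<longrightarrow> ?d)"
  let ?\<xi> = "?a \<^bold>\<longrightarrow> lift \<psi>"
  have d: "fsub ?d (case_nat q (case_nat s Var)) = fsub \<phi> (push Var (map (\<lambda>\<pi>. \<pi> \<cdot> q) \<pi>s))" for q s
    unfolding fsub_decode[OF c, symmetric] by (rule fsub_fsub_eq) (simp split: nat.split)
  have "wff ?d (\<tau> # Seq \<tau> # Ctx n)"
    by (rule wff_fsub[OF wff_decode[OF c \<phi>(1)]]) (simp add: nth_Cons split: nat.split)
  then have wfa: "wff ?a (Seq \<tau> # Ctx n)" by (simp add: wff_mem)
  have wfa': "wfm (fsub ?a (case_nat s Var))" if "typed s (Seq \<tau>)" for s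
    by (rule wfm_fsub[OF wfa]) (use that env_Ctx in simp)
  have aI: "w' \<tturnstile> fsub ?a (case_nat s Var)"
    if "world w'" "typed s (Seq \<tau>)" and "\<And>w'' q. w' \<sqsubseteq> w'' \<Longrightarrow> typed q \<tau> \<Longrightarrow> w'' \<tturnstile> mem \<tau> q s
      \<Longrightarrow> w'' \<tturnstile> fsub \<phi> (push Var (map (\<lambda>\<pi>. \<pi> \<cdot> q) \<pi>s))" for w' s
  proof (rule forces_allI')
    fix q assume q: "typed q \<tau>"
    have "w' \<tturnstile> (mem \<tau> q s \<^bold>\<longrightarrow> fsub \<phi> (push Var (map (\<lambda>\<pi>. \<pi> \<cdot> q) \<pi>s)))"
      by (rule forces_impI[OF wfm_mem[OF q that(2)] that(1)]) (rule that(3)[OF _ q])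
    then show "w' \<tturnstile> fsub (mem \<tau> (Var 0) (Var (Suc 0)) \<^bold>\<longrightarrow> ?d) (case_nat q (case_nat s Var))" by (simp add: d)
  qed
  have aE: "w' \<tturnstile> fsub \<phi> (push Var (map (\<lambda>\<pi>. \<pi> \<cdot> q) \<pi>s))"
    if "w' \<tturnstile> fsub ?a (case_nat s Var)" "typed q \<tau>" "w' \<tturnstile> mem \<tau> q s" for w' s q
  proof -
    have "w' \<tturnstile> (mem \<tau> q s \<^bold>\<longrightarrow> fsub \<phi> (push Var (map (\<lambda>\<pi>. \<pi> \<cdot> q) \<pi>s)))"
      using forces_allE'[OF that(1,2)] by (simp add: d)
    then show ?thesis using that(3) by (rule forces_mp)
  qed
  show ?thesis
  proof (rule forces_US[of ?\<xi> w \<tau> Var])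
    fix w1 s assume 1: "w \<sqsubseteq> w1" "typed s (Seq \<tau>)"
      "\<And>w2 x. w1 \<sqsubseteq> w2 \<Longrightarrow> st w2 x \<tau> \<Longrightarrow> w2 \<tturnstile> mem \<tau> x s"
    have "w1 \<tturnstile> (fsub ?a (case_nat s Var) \<^bold>\<longrightarrow> \<psi>)"
    proof (rule forces_impI[OF wfa'[OF 1(2)] later_world[OF 1(1)]])
      fix w2 assume 2: "w1 \<sqsubseteq> w2" "w2 \<tturnstile> fsub ?a (case_nat s Var)"
      have "w2 \<tturnstile> fsub (AllSt \<tau> (decode \<pi>s \<phi>)) Var"
      proof (rule forces_AllStI'[OF forces_world[OF 2(2)]])
        fix w3 q assume 3: "w2 \<sqsubseteq> w3" "st w3 q \<tau>"
        show "w3 \<tturnstile> fsub (decode \<pi>s \<phi>) (case_nat q Var)" unfolding fsub_decode[OF c]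
          by (rule aE[OF forces_mono[OF 2(2) 3(1)] st_typed[OF 3(2)] 1(3)[OF later_trans[OF 2(1) 3(1)] 3(2)]])
      qed
      then have "w2 \<tturnstile> foldr AllSt \<rho>s \<phi>"
        unfolding forces_AllSt_decode[OF c \<phi>(1) env_Ctx] by simp
      then show "w2 \<tturnstile> \<psi>" by (rule imp[OF later_trans[OF 1(1) 2(1)]])
    qed
    then show "w1 \<tturnstile> fsub ?\<xi> (case_nat s Var)" by simp
  next
    fix w1 s assume 1: "w \<sqsubseteq> w1" "st w1 s (Seq \<tau>)" "w1 \<tturnstile> fsub ?\<xi> (case_nat s Var)"
    then have \<xi>: "w1 \<tturnstile> (fsub ?a (case_nat s Var) \<^bold>\<longrightarrow> \<psi>)" by simp
    have "list_all2 (\<lambda>\<pi> \<rho>. closed_tm \<pi> (\<tau> \<rightarrow> \<rho>)) \<pi>s \<rho>s" using c by (simp add: coding_def)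
    then show "w1 \<tturnstile> \<chi>"
    proof (rule forces_boxes[OF _ 1(2)])
      fix w2 ss assume 2: "w1 \<sqsubseteq> w2" "sts w2 ss (map Seq \<rho>s)"
        "\<And>w3 q. w2 \<sqsubseteq> w3 \<Longrightarrow> typed q \<tau> \<Longrightarrow> w3 \<tturnstile> mem \<tau> q s \<Longrightarrow> mems w3 \<rho>s (map (\<lambda>\<pi>. \<pi> \<cdot> q) \<pi>s) ss"
      show "w2 \<tturnstile> \<chi>"
      proof (rule elim[OF later_trans[OF 1(1) 2(1)] 2(2)])
        fix w3 assume 3: "w2 \<sqsubseteq> w3"
          "\<And>w4 ys. w3 \<sqsubseteq> w4 \<Longrightarrow> mems w4 \<rho>s ys ss \<Longrightarrow> w4 \<tturnstile> fsub \<phi> (push Var ys)"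
        have "w3 \<tturnstile> fsub ?a (case_nat s Var)"
        proof (rule aI[OF later_world[OF 3(1)] st_typed[OF 1(2)]])
          fix w4 q assume 4: "w3 \<sqsubseteq> w4" "typed q \<tau>" "w4 \<tturnstile> mem \<tau> q s"
          show "w4 \<tturnstile> fsub \<phi> (push Var (map (\<lambda>\<pi>. \<pi> \<cdot> q) \<pi>s))"
            by (rule 3(2)[OF 4(1) 2(3)[OF later_trans[OF 3(1) 4(1)] 4(2,3)]])
        qed
        with forces_mono[OF \<xi> later_trans[OF 2(1) 3(1)]] show "w3 \<tturnstile> \<psi>" by (rule forces_mp)
      qed
    qed
  qed (use \<phi> \<psi> w in simp_all)
qed

text \<open>Given a standard sequence of codes, \<open>all\<close> is used for component sequences
  containing the projections of its entries, and the witness found there serves all those entries.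
  \<open>OS\<close> then yields a sequence with all standard codes among its entries and a single
  \<open>z\<close> that works for them.\<close>

lemma forces_OSs:
  assumes \<phi>: "wff \<phi> (rev \<rho>s @ \<sigma> # Ctx n)" "internal \<phi>" "or_free \<phi>" and w: "world w"
    and all: "\<And>w' ss. w \<sqsubseteq> w' \<Longrightarrow> sts w' ss (map Seq \<rho>s) \<Longrightarrow> w' \<tturnstile> Ex \<sigma> (ball \<rho>s (map (shift 1) ss) \<phi>)"
    and elim: "\<And>w' z. w \<sqsubseteq> w' \<Longrightarrow> typed z \<sigma>
      \<Longrightarrow> (\<And>w'' ys. w' \<sqsubseteq> w'' \<Longrightarrow> sts w'' ys \<rho>s \<Longrightarrow> w'' \<tturnstile> fsub \<phi> (push (case_nat z Var) ys)) \<Longrightarrow> w' \<tturnstile> \<chi>"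
  shows "w \<tturnstile> \<chi>"
proof -
  obtain \<tau> \<pi>s where c: "coding \<tau> \<pi>s \<rho>s" using coding_exists by blast
  let ?d = "fsub (decode \<pi>s \<phi>) (case_nat (Var 0) (case_nat (Var (Suc 0)) (\<lambda>i. Var (Suc (Suc (Suc i))))))"
  let ?a = "All \<tau> (mem \<tau> (Var 0) (Var (Suc (Suc 0))) \<^bold>\<longrightarrow> ?d)"
  have d: "fsub ?d (case_nat q (case_nat z (case_nat s Var))) = fsub \<phi> (push (case_nat z Var) (map (\<lambda>\<pi>. \<pi> \<cdot> q) \<pi>s))" for q s z
    unfolding fsub_decode[OF c, symmetric] by (rule fsub_fsub_eq) (simp split: nat.split)
  have "w \<tturnstile> fsub (AllSt (Seq \<tau>) (Ex \<sigma> ?a)) Var"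
  proof (rule forces_AllStI'[OF w])
    fix w1 s assume 1: "w \<sqsubseteq> w1" "st w1 s (Seq \<tau>)"
    have "list_all2 (\<lambda>\<pi> \<rho>. closed_tm \<pi> (\<tau> \<rightarrow> \<rho>)) \<pi>s \<rho>s" using c by (simp add: coding_def)
    then show "w1 \<tturnstile> fsub (Ex \<sigma> ?a) (case_nat s Var)"
    proof (rule forces_boxes[OF _ 1(2)])
      fix w2 ss assume 2: "w1 \<sqsubseteq> w2" "sts w2 ss (map Seq \<rho>s)"
        "\<And>w3 q. w2 \<sqsubseteq> w3 \<Longrightarrow> typed q \<tau> \<Longrightarrow> w3 \<tturnstile> mem \<tau> q s \<Longrightarrow> mems w3 \<rho>s (map (\<lambda>\<pi>. \<pi> \<cdot> q) \<pi>s) ss"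
      from all[OF later_trans[OF 1(1) 2(1)] 2(2)]
      show "w2 \<tturnstile> fsub (Ex \<sigma> ?a) (case_nat s Var)"
      proof (rule forces_exE)
        fix z w3 assume 3: "w2 \<sqsubseteq> w3" "typed z \<sigma>" "w3 \<tturnstile> inst z (ball \<rho>s (map (shift 1) ss) \<phi>)"
        have "w3 \<tturnstile> fsub ?a (case_nat z (case_nat s Var))"
        proof (rule forces_allI')
          fix q assume q: "typed q \<tau>"
          have "w3 \<tturnstile> (mem \<tau> q s \<^bold>\<longrightarrow> fsub \<phi> (push (case_nat z Var) (map (\<lambda>\<pi>. \<pi> \<cdot> q) \<pi>s)))"
          proof (rule forces_impI[OF wfm_mem[OF q st_typed[OF 1(2)]] later_world[OF 3(1)]])
            fix w4 assume 4: "w3 \<sqsubseteq> w4" "w4 \<tturnstile> mem \<tau> q s"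
            show "w4 \<tturnstile> fsub \<phi> (push (case_nat z Var) (map (\<lambda>\<pi>. \<pi> \<cdot> q) \<pi>s))"
              by (rule forces_ballE[OF forces_mono[OF 3(3)[unfolded inst_def] 4(1)]])
                (use 2(3)[OF later_trans[OF 3(1) 4(1)] q 4(2)] in \<open>simp add: comp_def\<close>)
          qed
          then show "w3 \<tturnstile> fsub (mem \<tau> (Var 0) (Var (Suc (Suc 0))) \<^bold>\<longrightarrow> ?d) (case_nat q (case_nat z (case_nat s Var)))"
            by (simp add: d)
        qed
        then show "w3 \<tturnstile> fsub (Ex \<sigma> ?a) (case_nat s Var)"
          using forces_exI[OF _ 3(2), of w3 "fsub ?a (up (case_nat s Var))"]
          unfolding inst_up fsub.simps(8) by blast
      qed
    qed
  qed
  then show ?thesis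
  proof (rule forces_OS[rotated 2])
    fix w1 s assume 1: "w \<sqsubseteq> w1" "typed s (Seq \<tau>)"
      "\<And>w2 x. w1 \<sqsubseteq> w2 \<Longrightarrow> st w2 x \<tau> \<Longrightarrow> w2 \<tturnstile> mem \<tau> x s" "w1 \<tturnstile> fsub (Ex \<sigma> ?a) (case_nat s Var)"
    from 1(4)[unfolded fsub.simps(8)] show "w1 \<tturnstile> \<chi>"
    proof (rule forces_exE)
      fix z w2 assume 2: "w1 \<sqsubseteq> w2" "typed z \<sigma>" "w2 \<tturnstile> inst z (fsub ?a (up (case_nat s Var)))"
      show "w2 \<tturnstile> \<chi>"
      proof (rule elim[OF later_trans[OF 1(1) 2(1)] 2(2)])
        fix w3 ys assume 3: "w2 \<sqsubseteq> w3" "sts w3 ys \<rho>s"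
        then obtain q where q: "st w3 q \<tau>" "eqs w3 \<rho>s (map (\<lambda>\<pi>. \<pi> \<cdot> q) \<pi>s) ys"
          using c later_world unfolding coding_def by blast
        have "w3 \<tturnstile> (mem \<tau> q s \<^bold>\<longrightarrow> fsub \<phi> (push (case_nat z Var) (map (\<lambda>\<pi>. \<pi> \<cdot> q) \<pi>s)))"
          using forces_allE'[OF forces_mono[OF 2(3)[unfolded inst_up] 3(1)] st_typed[OF q(1)]] by (simp add: d)
        note q' = forces_mp[OF this 1(3)[OF later_trans[OF 2(1) 3(1)] q(1)]]
        show "w3 \<tturnstile> fsub \<phi> (push (case_nat z Var) ys)"
          by (rule forces_eqs_subst[OF \<phi>(1) _ q(2) q']) (use 2(2) env_Ctx in simp)
      qed
    qed
  qed (use \<phi> in simp_all)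
qed

section \<open>The translation\<close>

lemma tsub_up_funpow_shift [simp]: "tsub ((up ^^ m) s) (shift (m + k) t) = shift m (tsub s (shift k t))"
  by (simp add: shift_def tsub_tsub up_funpow)

lemma tsub_up_funpow_shift0 [simp]: "tsub ((up ^^ m) s) (shift m t) = shift m (tsub s t)"
  using tsub_up_funpow_shift[of m s 0 t] by simp

lemma map_tsub_Var [simp]: "map (tsub Var) ts = ts"
  by (simp add: map_idI)

lemma map_tsub_up_vars [simp]: "map (tsub ((up ^^ m) s)) (vars m) = vars m"
  by (simp add: vars_def rev_map[symmetric] up_funpow)

text \<open>The length conditions make \<open>hd\<close>, \<open>last\<close> and the bounded block
  of \<open>ball\<close> commute with the substitution.\<close>

lemma fsub_Um:
  "length xs = length (Ux \<Phi>) \<Longrightarrow> length ys = length (Uy \<Phi>)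
    \<Longrightarrow> fsub (Um \<Phi> a xs ys) s = Um \<Phi> (\<lambda>i. tsub s (a i)) (map (tsub s) xs) (map (tsub s) ys)"
proof (induction \<Phi> arbitrary: a xs ys s)
  case (St \<sigma> t)
  then show ?case by (cases xs) (auto simp: tsub_tsub)
next
  case (Or \<Phi> \<Psi>)
  then show ?case by (cases xs) (auto simp: Let_def take_map drop_map)
next
  case (Imp \<Phi> \<Psi>)
  then show ?case by (simp add: Let_def take_map drop_map fsub_ball comp_def)
next
  case (All \<sigma> \<Phi>)
  then show ?case by (simp add: comp_def up_comp)
next
  case (Ex \<sigma> \<Phi>)
  have "tsub (up s) (up a i) = up (\<lambda>i. tsub s (a i)) i" for i using fun_cong[OF up_comp] .
  with Ex show ?case
    using tsub_up_funpow_shift[of "length (Uy \<Phi>)" "up s" 1]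
    by (simp add: Let_def fsub_ball comp_def)
next
  case (AllSt \<sigma> \<Phi>)
  then have "ys \<noteq> []" by auto
  with AllSt show ?case by (simp add: Let_def last_map map_butlast comp_def tsub_case_nat)
next
  case (ExSt \<sigma> \<Phi>)
  then show ?case by (cases xs) (auto simp: tsub_case_nat)
qed (auto simp: Let_def take_map drop_map tsub_tsub)

text \<open>This is what admits the matrix in \<open>IP\<close>, \<open>US\<close>,
  \<open>OS\<close> and in the transfer to entries of standard sequences, whatever the formula
  \<open>\<Phi>\<close> is.\<close>

lemma internal_Um [simp]: "internal (Um \<Phi> a xs ys)"
  and or_free_Um [simp]: "or_free (Um \<Phi> a xs ys)"
  by (induction \<Phi> arbitrary: a xs ys) (simp_all add: Let_def)

lemma list_all2_take_drop:
  "list_all2 Q xs (A @ B) \<Longrightarrow> list_all2 Q (take (length A) xs) A \<and> list_all2 Q (drop (length A) xs) B"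
  by (auto simp: list_all2_append2)

lemma has_ty_apps:
  "has_ty \<Gamma> f (funs \<sigma>s \<tau>) \<Longrightarrow> list_all2 (has_ty \<Gamma>) ts \<sigma>s \<Longrightarrow> has_ty \<Gamma> (apps f ts) \<tau>"
proof (induction \<sigma>s arbitrary: f ts)
  case (Cons \<sigma> \<sigma>s)
  then obtain t ts' where ts: "ts = t # ts'" "has_ty \<Gamma> t \<sigma>" "list_all2 (has_ty \<Gamma>) ts' \<sigma>s"
    by (auto simp: list_all2_Cons2)
  with Cons.IH[OF has_ty_AppI[OF _ ts(2)] ts(3)] Cons.prems(1) show ?case by simp
qed simp

lemma vars_typed: "length \<sigma>s = n \<Longrightarrow> list_all2 (has_ty (rev \<sigma>s @ \<Gamma>)) (vars n) \<sigma>s"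
  by (auto simp: list_all2_conv_all_nth vars_def rev_nth nth_append)

lemma shift_typed:
  "list_all2 (has_ty \<Gamma>) ts \<sigma>s \<Longrightarrow> length \<Theta> = n \<Longrightarrow> list_all2 (has_ty (\<Theta> @ \<Gamma>)) (map (shift n) ts) \<sigma>s"
  by (auto simp: list_all2_map1 has_ty_shift elim!: list_all2_mono)

lemma shift_typed1:
  "list_all2 (has_ty \<Gamma>) ts \<sigma>s \<Longrightarrow> list_all2 (has_ty (\<sigma> # \<Gamma>)) (map (shift (Suc 0)) ts) \<sigma>s"
  using shift_typed[of \<Gamma> ts \<sigma>s "[\<sigma>]"] by simp

lemma wff_Um:
  "wff \<Phi> \<Gamma> \<Longrightarrow> (\<And>i. i < length \<Gamma> \<Longrightarrow> has_ty \<Gamma>' (a i) (\<Gamma> ! i)) \<Longrightarrow> list_all2 (has_ty \<Gamma>') xs (Ux \<Phi>)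
    \<Longrightarrow> list_all2 (has_ty \<Gamma>') ys (Uy \<Phi>) \<Longrightarrow> wff (Um \<Phi> a xs ys) \<Gamma>'"
proof (induction \<Phi> arbitrary: \<Gamma> \<Gamma>' a xs ys)
  case (Eq \<sigma> t u)
  then show ?case using has_ty_tsub[OF _ Eq.prems(2)] by simp
next
  case (St \<sigma> t)
  then show ?case using has_ty_tsub[OF _ St.prems(2)] by (auto simp: list_all2_Cons2)
next
  case (And \<Phi> \<Psi>)
  have "wff \<Phi> \<Gamma>" "wff \<Psi> \<Gamma>" using And.prems(1) by simp_all
  from And.IH(1)[OF this(1) And.prems(2)] And.IH(2)[OF this(2) And.prems(2)]
  show ?case
    using list_all2_take_drop[of "has_ty \<Gamma>'" xs "Ux \<Phi>" "Ux \<Psi>"] And.prems(3)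
      list_all2_take_drop[of "has_ty \<Gamma>'" ys "Uy \<Phi>" "Uy \<Psi>"] And.prems(4)
    by (simp add: Let_def)
next
  case (Or \<Phi> \<Psi>)
  have wf: "wff \<Phi> \<Gamma>" "wff \<Psi> \<Gamma>" using Or.prems(1) by simp_all
  obtain z xs' where xs: "xs = z # xs'" "has_ty \<Gamma>' z N" "list_all2 (has_ty \<Gamma>') xs' (Ux \<Phi> @ Ux \<Psi>)"
    using Or.prems(3) by (auto simp: list_all2_Cons2)
  from Or.IH(1)[OF wf(1) Or.prems(2)] Or.IH(2)[OF wf(2) Or.prems(2)]
  show ?case
    using list_all2_take_drop[OF xs(3)] xs(1,2)
      list_all2_take_drop[of "has_ty \<Gamma>'" ys "Uy \<Phi>" "Uy \<Psi>"] Or.prems(4)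
    by (simp add: Let_def)
next
  case (Imp \<Phi> \<Psi>)
  let ?m = "length (Uy \<Phi>)"
  define Us where "Us = take (length (Ux \<Psi>)) xs"
  define Ys where "Ys = drop (length (Ux \<Psi>)) xs"
  define xs' where "xs' = take (length (Ux \<Phi>)) ys"
  define vs where "vs = drop (length (Ux \<Phi>)) ys"
  have wf: "wff \<Phi> \<Gamma>" "wff \<Psi> \<Gamma>" using Imp.prems(1) by simp_all
  have UY: "list_all2 (has_ty \<Gamma>') Us (map (funs (Ux \<Phi>)) (Ux \<Psi>))"
    "list_all2 (has_ty \<Gamma>') Ys (map (\<lambda>\<sigma>. funs (Ux \<Phi> @ Uy \<Psi>) (Seq \<sigma>)) (Uy \<Phi>))"
    using list_all2_take_drop[of _ xs "map (funs (Ux \<Phi>)) (Ux \<Psi>)"] Imp.prems(3)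
    by (auto simp: Us_def Ys_def)
  have xv: "list_all2 (has_ty \<Gamma>') xs' (Ux \<Phi>)" "list_all2 (has_ty \<Gamma>') vs (Uy \<Psi>)"
    using list_all2_take_drop Imp.prems(4) by (auto simp: xs'_def vs_def)
  have "list_all2 (has_ty \<Gamma>') (map (\<lambda>Y. apps Y (xs' @ vs)) Ys) (map Seq (Uy \<Phi>))"
    using UY(2) list_all2_appendI[OF xv] unfolding list_all2_map1 list_all2_map2
    by (auto intro: has_ty_apps elim!: list_all2_mono simp del: foldl_append foldr_append)
  moreover have "wff (Um \<Phi> (\<lambda>i. shift ?m (a i)) (map (shift ?m) xs') (vars ?m)) (rev (Uy \<Phi>) @ \<Gamma>')"
    by (rule Imp.IH(1)[OF wf(1)])
      (use Imp.prems(2) xv(1) in \<open>auto intro: has_ty_shift shift_typed vars_typed\<close>)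
  moreover have "list_all2 (has_ty \<Gamma>') (map (\<lambda>U. apps U xs') Us) (Ux \<Psi>)"
    using UY(1) xv(1) unfolding list_all2_map1 list_all2_map2
    by (auto intro: has_ty_apps elim!: list_all2_mono)
  ultimately show ?case using Imp.IH(2)[OF wf(2) Imp.prems(2) _ xv(2)]
    by (auto simp: Let_def Us_def[symmetric] Ys_def[symmetric] xs'_def[symmetric] vs_def[symmetric]
        intro!: wff_ball)
next
  case (All \<sigma> \<Phi>)
  have "wff (Um \<Phi> (up a) (map (shift 1) xs) (map (shift 1) ys)) (\<sigma> # \<Gamma>')"
    by (rule All.IH[of "\<sigma> # \<Gamma>"])
      (use All.prems up_typed[OF All.prems(2)] in \<open>auto intro: shift_typed1\<close>)
  then show ?case by simp
next
  case (Ex \<sigma> \<Phi>)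
  let ?m = "length (Uy \<Phi>)"
  have "wff (Um \<Phi> (\<lambda>i. shift ?m (up a i)) (map (shift (?m + 1)) xs) (vars ?m)) (rev (Uy \<Phi>) @ \<sigma> # \<Gamma>')"
  proof (rule Ex.IH[of "\<sigma> # \<Gamma>"])
    show "has_ty (rev (Uy \<Phi>) @ \<sigma> # \<Gamma>') (shift ?m (up a i)) ((\<sigma> # \<Gamma>) ! i)" if "i < length (\<sigma> # \<Gamma>)" for i
      by (rule has_ty_shift[OF up_typed[OF Ex.prems(2)]]) (use that in auto)
    show "list_all2 (has_ty (rev (Uy \<Phi>) @ \<sigma> # \<Gamma>')) (map (shift (?m + 1)) xs) (Ux \<Phi>)"
      using shift_typed[of \<Gamma>' xs "Ux \<Phi>" "rev (Uy \<Phi>) @ [\<sigma>]"] Ex.prems(3) by simp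
  qed (use Ex.prems(1) vars_typed in auto)
  moreover have "list_all2 (has_ty (\<sigma> # \<Gamma>')) (map (shift 1) ys) (map Seq (Uy \<Phi>))"
    using Ex.prems(4) by (auto intro: shift_typed1)
  ultimately show ?case by (simp add: Let_def wff_ball)
next
  case (AllSt \<sigma> \<Phi>)
  obtain ys' z where ys: "ys = ys' @ [z]" "list_all2 (has_ty \<Gamma>') ys' (Uy \<Phi>)" "has_ty \<Gamma>' z \<sigma>"
    using AllSt.prems(4) by (auto simp: list_all2_append2 list_all2_Cons2)
  have "wff (Um \<Phi> (case_nat z a) (map (\<lambda>X. X \<cdot> z) xs) ys') \<Gamma>'"
  proof (rule AllSt.IH[of "\<sigma> # \<Gamma>"])
    show "has_ty \<Gamma>' (case_nat z a i) ((\<sigma> # \<Gamma>) ! i)" if "i < length (\<sigma> # \<Gamma>)" for i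
      using that AllSt.prems(2) ys(3) by (cases i) auto
    show "list_all2 (has_ty \<Gamma>') (map (\<lambda>X. X \<cdot> z) xs) (Ux \<Phi>)"
      using AllSt.prems(3) ys(3) by (auto simp: list_all2_map1 list_all2_map2 intro: has_ty_AppI elim!: list_all2_mono)
  qed (use AllSt.prems(1) ys(2) in auto)
  then show ?case by (simp add: Let_def ys(1))
next
  case (ExSt \<sigma> \<Phi>)
  obtain z xs' where xs: "xs = z # xs'" "has_ty \<Gamma>' z \<sigma>" "list_all2 (has_ty \<Gamma>') xs' (Ux \<Phi>)"
    using ExSt.prems(3) by (auto simp: list_all2_Cons2)
  have "wff (Um \<Phi> (case_nat z a) xs' ys) \<Gamma>'"
  proof (rule ExSt.IH[of "\<sigma> # \<Gamma>"])
    show "has_ty \<Gamma>' (case_nat z a i) ((\<sigma> # \<Gamma>) ! i)" if "i < length (\<sigma> # \<Gamma>)" for i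
      using that ExSt.prems(2) xs(2) by (cases i) auto
  qed (use ExSt.prems xs in auto)
  then show ?case by (simp add: xs(1))
qed simp

text \<open>The matrix with the tuple \<open>ys\<close> turned into innermost bound variables. The
  external block of \<open>U_all\<close>, the bounded blocks of \<open>Um\<close> and the internal
  block of \<open>U_at\<close> are all put in front of this one formula.\<close>

definition Um_body :: "fm \<Rightarrow> (nat \<Rightarrow> tm) \<Rightarrow> tm list \<Rightarrow> fm" where
  "Um_body \<Phi> a xs = (let m = length (Uy \<Phi>) in Um \<Phi> (\<lambda>i. shift m (a i)) (map (shift m) xs) (vars m))"

definition U_all :: "fm \<Rightarrow> (nat \<Rightarrow> tm) \<Rightarrow> tm list \<Rightarrow> fm" where
  "U_all \<Phi> a xs = foldr AllSt (Uy \<Phi>) (Um_body \<Phi> a xs)"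

text \<open>Keeping \<open>a\<close> explicit lets the induction hypothesis be used at instances of
  the variables bound in the surrounding formula; \<open>U \<Phi>\<close> is the case
  \<open>a = Var\<close>.\<close>

definition U_ex :: "fm \<Rightarrow> (nat \<Rightarrow> tm) \<Rightarrow> fm" where
  "U_ex \<Phi> a = (let n = length (Ux \<Phi>) in foldr ExSt (Ux \<Phi>) (U_all \<Phi> (\<lambda>i. shift n (a i)) (vars n)))"

lemma internal_Um_body [simp]: "internal (Um_body \<Phi> a xs)" "or_free (Um_body \<Phi> a xs)"
  by (simp_all add: Um_body_def Let_def)

lemma fsub_Um_body:
  "length xs = length (Ux \<Phi>) \<Longrightarrow> length ys = length (Uy \<Phi>)
    \<Longrightarrow> fsub (Um_body \<Phi> a xs) (push e ys) = Um \<Phi> (\<lambda>i. tsub e (a i)) (map (tsub e) xs) ys"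
  by (simp add: Um_body_def Let_def fsub_Um comp_def)

lemma fsub_Um_body_Var:
  "length xs = length (Ux \<Phi>) \<Longrightarrow> length ys = length (Uy \<Phi>)
    \<Longrightarrow> fsub (Um_body \<Phi> a xs) (push Var ys) = Um \<Phi> a xs ys"
  by (simp add: fsub_Um_body)

lemma fsub_up_Um_body:
  "length xs = length (Ux \<Phi>) \<Longrightarrow> fsub (Um_body \<Phi> a xs) ((up ^^ length (Uy \<Phi>)) s)
    = Um_body \<Phi> (\<lambda>i. tsub s (a i)) (map (tsub s) xs)"
  by (simp add: Um_body_def Let_def fsub_Um comp_def)

lemma fsub_U_all:
  "length xs = length (Ux \<Phi>) \<Longrightarrow> fsub (U_all \<Phi> a xs) s = U_all \<Phi> (\<lambda>i. tsub s (a i)) (map (tsub s) xs)"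
  by (simp add: U_all_def fsub_foldr fsub_up_Um_body)

lemma fsub_U_ex: "fsub (U_ex \<Phi> a) s = U_ex \<Phi> (\<lambda>i. tsub s (a i))"
  by (simp add: U_ex_def Let_def fsub_foldr fsub_U_all)

lemma U_eq: "U \<Phi> = U_ex \<Phi> Var"
  by (simp add: U_def U_ex_def U_all_def Um_body_def Let_def)

lemma forces_U_allE:
  "w \<tturnstile> U_all \<Phi> a xs \<Longrightarrow> length xs = length (Ux \<Phi>) \<Longrightarrow> sts w ys (Uy \<Phi>) \<Longrightarrow> w \<tturnstile> Um \<Phi> a xs ys"
  using forces_AllStsE[of w "Uy \<Phi>" "Um_body \<Phi> a xs" Var ys]
  by (simp add: U_all_def fsub_Um_body_Var list_all2_lengthD)

lemma forces_U_allI: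
  assumes "world w" "length xs = length (Ux \<Phi>)"
    and "\<And>w' ys. w \<sqsubseteq> w' \<Longrightarrow> sts w' ys (Uy \<Phi>) \<Longrightarrow> w' \<tturnstile> Um \<Phi> a xs ys"
  shows "w \<tturnstile> U_all \<Phi> a xs"
proof -
  have "w \<tturnstile> fsub (foldr AllSt (Uy \<Phi>) (Um_body \<Phi> a xs)) Var"
    by (rule forces_AllStsI[OF assms(1)]) (use assms(2,3) in \<open>simp add: fsub_Um_body_Var list_all2_lengthD\<close>)
  then show ?thesis by (simp add: U_all_def)
qed

lemma fsub_U_all_push:
  "length xs = length (Ux \<Phi>)
    \<Longrightarrow> fsub (U_all \<Phi> (\<lambda>i. shift (length (Ux \<Phi>)) (a i)) (vars (length (Ux \<Phi>)))) (push e xs)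
      = U_all \<Phi> (\<lambda>i. tsub e (a i)) xs"
  by (simp add: fsub_U_all)

lemma forces_U_exI: "sts w xs (Ux \<Phi>) \<Longrightarrow> w \<tturnstile> U_all \<Phi> a xs \<Longrightarrow> w \<tturnstile> U_ex \<Phi> a"
  using forces_ExStsI[of w xs "Ux \<Phi>" "U_all \<Phi> (\<lambda>i. shift (length (Ux \<Phi>)) (a i)) (vars (length (Ux \<Phi>)))" Var]
  by (simp add: U_ex_def Let_def fsub_U_all_push list_all2_lengthD)

lemma forces_U_exE:
  assumes "w \<tturnstile> U_ex \<Phi> a"
    and "\<And>w' xs. w \<sqsubseteq> w' \<Longrightarrow> sts w' xs (Ux \<Phi>) \<Longrightarrow> w' \<tturnstile> U_all \<Phi> a xs \<Longrightarrow> w' \<tturnstile> \<chi>"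
  shows "w \<tturnstile> \<chi>"
proof (rule forces_ExStsE[of w "Ux \<Phi>" "U_all \<Phi> (\<lambda>i. shift (length (Ux \<Phi>)) (a i)) (vars (length (Ux \<Phi>)))" Var])
  show "w \<tturnstile> fsub (foldr ExSt (Ux \<Phi>) (U_all \<Phi> (\<lambda>i. shift (length (Ux \<Phi>)) (a i)) (vars (length (Ux \<Phi>))))) Var"
    using assms(1) by (simp add: U_ex_def Let_def)
qed (use assms(2) in \<open>simp add: fsub_U_all_push list_all2_lengthD\<close>)

lemma typed_list_has_ty: "list_all2 typed ts \<sigma>s \<Longrightarrow> \<exists>n. \<forall>m\<ge>n. list_all2 (has_ty (Ctx m)) ts \<sigma>s"
proof (induction rule: list_all2_induct)
  case (Cons t ts \<sigma> \<sigma>s)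
  then obtain n n' where n: "\<And>m. m \<ge> n \<Longrightarrow> list_all2 (has_ty (Ctx m)) ts \<sigma>s" "\<And>m. m \<ge> n' \<Longrightarrow> has_ty (Ctx m) t \<sigma>"
    using typedD by metis
  then show ?case by (intro exI[of _ "n + n'"]) simp
qed simp

lemma wff_Um_body:
  assumes "wff \<Phi> \<Gamma>" "\<And>i. i < length \<Gamma> \<Longrightarrow> has_ty \<Gamma>' (a i) (\<Gamma> ! i)" "list_all2 (has_ty \<Gamma>') xs (Ux \<Phi>)"
  shows "wff (Um_body \<Phi> a xs) (rev (Uy \<Phi>) @ \<Gamma>')"
  unfolding Um_body_def Let_def
  by (rule wff_Um[OF assms(1)]) (use assms(2,3) in \<open>auto intro: has_ty_shift shift_typed vars_typed\<close>)

lemma wff_Um_body_Ctx: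
  assumes "wff \<Phi> \<Gamma>" "env a \<Gamma>" "list_all2 typed xs (Ux \<Phi>)"
  shows "\<exists>n. wff (Um_body \<Phi> a xs) (rev (Uy \<Phi>) @ Ctx n)"
proof -
  obtain n1 n2 where n: "\<And>m. m \<ge> n1 \<Longrightarrow> \<forall>i<length \<Gamma>. has_ty (Ctx m) (a i) (\<Gamma> ! i)"
    "\<And>m. m \<ge> n2 \<Longrightarrow> list_all2 (has_ty (Ctx m)) xs (Ux \<Phi>)"
    using env_has_ty[OF assms(2)] typed_list_has_ty[OF assms(3)] by blast
  show ?thesis
    by (rule exI[of _ "n1 + n2"], rule wff_Um_body[OF assms(1)]) (use n[of "n1 + n2"] in auto)
qed

lemma wfm_U_all: "wff \<Phi> \<Gamma> \<Longrightarrow> env a \<Gamma> \<Longrightarrow> list_all2 typed xs (Ux \<Phi>) \<Longrightarrow> wfm (U_all \<Phi> a xs)"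
  using wff_Um_body_Ctx[of \<Phi> \<Gamma> a xs] by (simp add: U_all_def wfm_def)

lemma wfm_Um:
  assumes "wff \<Phi> \<Gamma>" "env a \<Gamma>" "list_all2 typed xs (Ux \<Phi>)" "list_all2 typed ys (Uy \<Phi>)"
  shows "wfm (Um \<Phi> a xs ys)"
proof -
  obtain n where n: "wff (Um_body \<Phi> a xs) (rev (Uy \<Phi>) @ Ctx n)" using wff_Um_body_Ctx[OF assms(1-3)] by blast
  have "wfm (fsub (Um_body \<Phi> a xs) (push Var ys))"
    by (rule wfm_fsub[OF n env_push[OF assms(4) env_Ctx]])
  then show ?thesis using assms(3,4) by (simp add: fsub_Um_body_Var list_all2_lengthD)
qed

lemma wfm_ball:
  assumes "list_all2 typed ss (map Seq \<sigma>s)" "wff \<phi> (rev \<sigma>s @ Ctx n)"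
  shows "wfm (ball \<sigma>s ss \<phi>)"
proof -
  obtain n' where n': "\<And>m. m \<ge> n' \<Longrightarrow> list_all2 (has_ty (Ctx m)) ss (map Seq \<sigma>s)"
    using typed_list_has_ty[OF assms(1)] by blast
  \<comment> \<open>Binding the block leaves a context of the form \<open>Ctx n\<close>, which can
    be enlarged; afterwards the block is opened again.\<close>
  have "wff (foldr All \<sigma>s \<phi>) (Ctx n)" using assms(2) by simp
  then have "wff (foldr All \<sigma>s \<phi>) (Ctx (n + n'))" by (rule wff_Ctx_mono) simp
  then have "wff (ball \<sigma>s ss \<phi>) (Ctx (n + n'))" using n'[of "n + n'"] by (intro wff_ball) auto
  then show ?thesis unfolding wfm_def by blast
qed

lemma sts_apps: "sts w Fs (map (funs \<sigma>s) \<tau>s) \<Longrightarrow> sts w ts \<sigma>s \<Longrightarrow> sts w (map (\<lambda>F. apps F ts) Fs) \<tau>s"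
  by (auto simp: list_all2_map1 list_all2_map2 intro: st_apps elim!: list_all2_mono)

text \<open>Fillers for the part of a tuple that belongs to the other subformula of a conjunction or
  disjunction.\<close>

lemma sts_default: "world w \<Longrightarrow> sts w (map default_tm \<sigma>s) \<sigma>s"
  by (induction \<sigma>s) (auto intro: st_closed)

text \<open>The induction formula contains a primitive disjunction, which only external induction
  permits. The result decides the flag in the translation of a disjunction.\<close>

lemma forces_st_zero_dec:
  assumes "st w z N"
  shows "w \<tturnstile> (Eq N z zero \<^bold>\<or> (\<^bold>\<not> Eq N z zero))"
proof -
  let ?\<phi> = "Eq N (Var 0) zero \<^bold>\<or> (\<^bold>\<not> Eq N (Var 0) zero)"
  have w: "world w" by (rule st_world[OF assms])
  have "w \<tturnstile> fsub ?\<phi> (case_nat z Var)"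
  proof (rule forces_st_induct[of _ "[]"])
    have "w \<tturnstile> (Eq N zero zero \<^bold>\<or> (\<^bold>\<not> Eq N zero zero))"
      by (rule forces_orI) (use w in \<open>auto intro: eq_refl\<close>)
    then show "w \<tturnstile> fsub ?\<phi> (case_nat zero Var)" by simp
    fix w' t assume t: "st w' t N"
    have "w' \<tturnstile> (\<^bold>\<not> Eq N (suc t) zero)"
      by (rule forces_impI) (use t in \<open>auto intro: suc_not_zero typed_suc st_typed st_world\<close>)
    then have "w' \<tturnstile> (Eq N (suc t) zero \<^bold>\<or> (\<^bold>\<not> Eq N (suc t) zero))"
      by (intro forces_orI) (use t in \<open>auto intro: typed_suc st_typed\<close>)
    then show "w' \<tturnstile> fsub ?\<phi> (case_nat (suc t) Var)" by simp
  qed (use assms in simp_all)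
  then show ?thesis by simp
qed

text \<open>The quantification over environments and worlds strengthens the induction: subformulae
  are met at instances of bound variables and at the later worlds opened by implications.\<close>

definition U_equiv :: "fm \<Rightarrow> bool" where
  "U_equiv \<Phi> \<longleftrightarrow> (\<forall>\<Gamma> e w. wff \<Phi> \<Gamma> \<longrightarrow> env e \<Gamma> \<longrightarrow> (w \<tturnstile> fsub \<Phi> e \<longleftrightarrow> w \<tturnstile> U_ex \<Phi> e))"

lemma U_equivI:
  assumes "\<And>\<Gamma> e w. wff \<Phi> \<Gamma> \<Longrightarrow> env e \<Gamma> \<Longrightarrow> w \<tturnstile> fsub \<Phi> e \<Longrightarrow> w \<tturnstile> U_ex \<Phi> e"
    and "\<And>\<Gamma> e w xs. wff \<Phi> \<Gamma> \<Longrightarrow> env e \<Gamma> \<Longrightarrow> world w \<Longrightarrow> sts w xs (Ux \<Phi>) \<Longrightarrow> w \<tturnstile> U_all \<Phi> e xs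
      \<Longrightarrow> w \<tturnstile> fsub \<Phi> e"
  shows "U_equiv \<Phi>"
  unfolding U_equiv_def
proof (intro allI impI iffI)
  fix \<Gamma> e w assume *: "wff \<Phi> \<Gamma>" "env e \<Gamma>" "w \<tturnstile> U_ex \<Phi> e"
  from *(3) show "w \<tturnstile> fsub \<Phi> e"
    by (rule forces_U_exE) (use assms(2)[OF *(1,2)] forces_world in blast)
qed (rule assms(1))

lemma U_equivD:
  assumes "U_equiv \<Phi>" "wff \<Phi> \<Gamma>" "env e \<Gamma>"
  shows "w \<tturnstile> fsub \<Phi> e \<Longrightarrow> w \<tturnstile> U_ex \<Phi> e"
    and "sts w xs (Ux \<Phi>) \<Longrightarrow> w \<tturnstile> U_all \<Phi> e xs \<Longrightarrow> w \<tturnstile> fsub \<Phi> e"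
  using assms forces_U_exI[of w xs \<Phi> e] unfolding U_equiv_def by blast+

section \<open>The equivalence for each formula constructor\<close>

lemma U_equiv_St: "U_equiv (St \<sigma> t)"
proof (rule U_equivI)
  fix \<Gamma> e w assume *: "wff (St \<sigma> t) \<Gamma>" "env e \<Gamma>" "w \<tturnstile> fsub (St \<sigma> t) e"
  then have t: "st w (tsub e t) \<sigma>" by (simp add: st_def)
  show "w \<tturnstile> U_ex (St \<sigma> t) e"
  \<comment> \<open>A standard object is its own witness.\<close>
  proof (rule forces_U_exI[of _ "[tsub e t]"])
    show "w \<tturnstile> U_all (St \<sigma> t) e [tsub e t]"
      by (rule forces_U_allI) (use t in \<open>auto intro: eq_refl st_typed st_world later_world\<close>)
  qed (use t in simp)
next
  fix \<Gamma> e w xs assume *: "world w" "sts w xs (Ux (St \<sigma> t))" "w \<tturnstile> U_all (St \<sigma> t) e xs"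
  then obtain x where x: "xs = [x]" "st w x \<sigma>" by (auto simp: list_all2_Cons2)
  have "w \<tturnstile> Eq \<sigma> x (tsub e t)" using forces_U_allE[OF *(3), of "[]"] x by simp
  from st_eq[OF this x(2)] show "w \<tturnstile> fsub (St \<sigma> t) e" by (simp add: st_def)
qed

lemma U_equiv_And:
  assumes "U_equiv \<Phi>" "U_equiv \<Psi>"
  shows "U_equiv (\<Phi> \<^bold>\<and> \<Psi>)"
proof (rule U_equivI)
  fix \<Gamma> e w assume *: "wff (\<Phi> \<^bold>\<and> \<Psi>) \<Gamma>" "env e \<Gamma>" "w \<tturnstile> fsub (\<Phi> \<^bold>\<and> \<Psi>) e"
  then have ex: "w \<tturnstile> U_ex \<Phi> e" "w \<tturnstile> U_ex \<Psi> e"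
    using U_equivD(1)[OF assms(1) _ *(2)] U_equivD(1)[OF assms(2) _ *(2)] by simp_all
  from ex(1) show "w \<tturnstile> U_ex (\<Phi> \<^bold>\<and> \<Psi>) e"
  proof (rule forces_U_exE)
    fix w1 xs assume 1: "w \<sqsubseteq> w1" "sts w1 xs (Ux \<Phi>)" "w1 \<tturnstile> U_all \<Phi> e xs"
    from forces_mono[OF ex(2) 1(1)] show "w1 \<tturnstile> U_ex (\<Phi> \<^bold>\<and> \<Psi>) e"
    proof (rule forces_U_exE)
      fix w2 us assume 2: "w1 \<sqsubseteq> w2" "sts w2 us (Ux \<Psi>)" "w2 \<tturnstile> U_all \<Psi> e us"
      note len = list_all2_lengthD[OF 1(2)] list_all2_lengthD[OF 2(2)]
      show "w2 \<tturnstile> U_ex (\<Phi> \<^bold>\<and> \<Psi>) e"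
      proof (rule forces_U_exI[of _ "xs @ us"])
        show "sts w2 (xs @ us) (Ux (\<Phi> \<^bold>\<and> \<Psi>))" using sts_mono[OF 1(2) 2(1)] 2(2) by (simp add: list_all2_appendI)
        show "w2 \<tturnstile> U_all (\<Phi> \<^bold>\<and> \<Psi>) e (xs @ us)"
        proof (rule forces_U_allI[OF later_world[OF 2(1)]])
          fix w3 ys assume 3: "w2 \<sqsubseteq> w3" "sts w3 ys (Uy (\<Phi> \<^bold>\<and> \<Psi>))"
          then have "sts w3 (take (length (Uy \<Phi>)) ys) (Uy \<Phi>)" "sts w3 (drop (length (Uy \<Phi>)) ys) (Uy \<Psi>)"
            using list_all2_take_drop by auto
          with forces_U_allE[OF forces_mono[OF 1(3) later_trans[OF 2(1) 3(1)]] len(1)]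
            forces_U_allE[OF forces_mono[OF 2(3) 3(1)] len(2)]
          show "w3 \<tturnstile> Um (\<Phi> \<^bold>\<and> \<Psi>) e (xs @ us) ys" by (simp add: Let_def len)
        qed (simp add: len)
      qed
    qed
  qed
next
  fix \<Gamma> e w xs
  assume *: "wff (\<Phi> \<^bold>\<and> \<Psi>) \<Gamma>" "env e \<Gamma>" "world w" "sts w xs (Ux (\<Phi> \<^bold>\<and> \<Psi>))" "w \<tturnstile> U_all (\<Phi> \<^bold>\<and> \<Psi>) e xs"
  have xs: "sts w (take (length (Ux \<Phi>)) xs) (Ux \<Phi>)" "sts w (drop (length (Ux \<Phi>)) xs) (Ux \<Psi>)"
    using list_all2_take_drop *(4) by auto
  note len = list_all2_lengthD[OF *(4)]
  have "w \<tturnstile> U_all \<Phi> e (take (length (Ux \<Phi>)) xs)"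
  proof (rule forces_U_allI[OF *(3) list_all2_lengthD[OF xs(1)]])
    fix w1 ys assume 1: "w \<sqsubseteq> w1" "sts w1 ys (Uy \<Phi>)"
    \<comment> \<open>The universal block of the conjunction also contains the variables of the
      other conjunct, which have to be instantiated as well.\<close>
    from forces_U_allE[OF forces_mono[OF *(5) 1(1)] len, of "ys @ map default_tm (Uy \<Psi>)"]
    show "w1 \<tturnstile> Um \<Phi> e (take (length (Ux \<Phi>)) xs) ys"
      using 1(2) sts_default[OF later_world[OF 1(1)]] list_all2_lengthD[OF 1(2)]
      by (simp add: Let_def list_all2_appendI)
  qed
  moreover have "w \<tturnstile> U_all \<Psi> e (drop (length (Ux \<Phi>)) xs)"
  proof (rule forces_U_allI[OF *(3) list_all2_lengthD[OF xs(2)]])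
    fix w1 ys assume 1: "w \<sqsubseteq> w1" "sts w1 ys (Uy \<Psi>)"
    from forces_U_allE[OF forces_mono[OF *(5) 1(1)] len, of "map default_tm (Uy \<Phi>) @ ys"]
    show "w1 \<tturnstile> Um \<Psi> e (drop (length (Ux \<Phi>)) xs) ys"
      using 1(2) sts_default[OF later_world[OF 1(1)]] by (simp add: Let_def list_all2_appendI)
  qed
  ultimately show "w \<tturnstile> fsub (\<Phi> \<^bold>\<and> \<Psi>) e"
    using U_equivD(2)[OF assms(1) _ *(2) xs(1)] U_equivD(2)[OF assms(2) _ *(2) xs(2)] *(1) by simp
qed

lemma forces_imp_weaken: "wfm \<phi> \<Longrightarrow> w \<tturnstile> \<psi> \<Longrightarrow> w \<tturnstile> (\<phi> \<^bold>\<longrightarrow> \<psi>)"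
  by (rule forces_impI) (auto intro: forces_world forces_mono)

lemma forces_imp_absurd:
  assumes "wfm \<psi>" "wfm \<phi>" "world w" "\<And>w'. w \<sqsubseteq> w' \<Longrightarrow> w' \<tturnstile> \<phi> \<Longrightarrow> w' \<tturnstile> Fls"
  shows "w \<tturnstile> (\<phi> \<^bold>\<longrightarrow> \<psi>)"
  by (rule forces_impI[OF assms(2,3)]) (rule forces_flsE[OF assms(4) assms(1)])

lemma U_equiv_Or:
  assumes "U_equiv \<Phi>" "U_equiv \<Psi>"
  shows "U_equiv (\<Phi> \<^bold>\<or> \<Psi>)"
proof (rule U_equivI)
  fix \<Gamma> e w assume *: "wff (\<Phi> \<^bold>\<or> \<Psi>) \<Gamma>" "env e \<Gamma>" "w \<tturnstile> fsub (\<Phi> \<^bold>\<or> \<Psi>) e"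
  then have wf: "wff \<Phi> \<Gamma>" "wff \<Psi> \<Gamma>" and or: "w \<tturnstile> (fsub \<Phi> e \<^bold>\<or> fsub \<Psi> e)" by simp_all
  from or show "w \<tturnstile> U_ex (\<Phi> \<^bold>\<or> \<Psi>) e"
  proof (rule forces_orE)
    fix w0 assume 0: "w \<sqsubseteq> w0" "w0 \<tturnstile> fsub \<Phi> e"
    from U_equivD(1)[OF assms(1) wf(1) *(2) 0(2)] show "w0 \<tturnstile> U_ex (\<Phi> \<^bold>\<or> \<Psi>) e"
    proof (rule forces_U_exE)
      fix w1 xs assume 1: "w0 \<sqsubseteq> w1" "sts w1 xs (Ux \<Phi>)" "w1 \<tturnstile> U_all \<Phi> e xs"
      \<comment> \<open>The flag \<open>zero\<close> selects the first disjunct. The witnesses for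
        the second may then be anything standard, as the premise of its clause is refutable.\<close>
      let ?us = "map default_tm (Ux \<Psi>)"
      note len = list_all2_lengthD[OF 1(2)]
      have w1: "world w1" by (rule later_world[OF 1(1)])
      show "w1 \<tturnstile> U_ex (\<Phi> \<^bold>\<or> \<Psi>) e"
      proof (rule forces_U_exI[of _ "zero # xs @ ?us"])
        show "sts w1 (zero # xs @ ?us) (Ux (\<Phi> \<^bold>\<or> \<Psi>))"
          using 1(2) w1 by (auto intro: list_all2_appendI sts_default st_closed)
        show "w1 \<tturnstile> U_all (\<Phi> \<^bold>\<or> \<Psi>) e (zero # xs @ ?us)"
        proof (rule forces_U_allI[OF w1])
          fix w2 ys assume 2: "w1 \<sqsubseteq> w2" "sts w2 ys (Uy (\<Phi> \<^bold>\<or> \<Psi>))"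
          then have ys: "sts w2 (take (length (Uy \<Phi>)) ys) (Uy \<Phi>)" "sts w2 (drop (length (Uy \<Phi>)) ys) (Uy \<Psi>)"
            using list_all2_take_drop by auto
          have w2: "world w2" by (rule later_world[OF 2(1)])
          have "w2 \<tturnstile> (Eq N zero zero \<^bold>\<longrightarrow> Um \<Phi> e xs (take (length (Uy \<Phi>)) ys))"
            by (rule forces_imp_weaken[OF _ forces_U_allE[OF forces_mono[OF 1(3) 2(1)] len ys(1)]]) simp
          moreover have "w2 \<tturnstile> ((\<^bold>\<not> Eq N zero zero) \<^bold>\<longrightarrow> Um \<Psi> e ?us (drop (length (Uy \<Phi>)) ys))"
          proof (rule forces_imp_absurd[OF wfm_Um[OF wf(2) *(2) sts_typed[OF sts_default[OF w2]] sts_typed[OF ys(2)]] _ w2])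
            fix w3 assume 3: "w3 \<tturnstile> (\<^bold>\<not> Eq N zero zero)"
            then show "w3 \<tturnstile> Fls" by (rule forces_mp) (rule eq_refl[OF typed_consts(1) forces_world[OF 3]])
          qed simp
          ultimately show "w2 \<tturnstile> Um (\<Phi> \<^bold>\<or> \<Psi>) e (zero # xs @ ?us) ys" by (simp add: Let_def len)
        qed (simp add: len)
      qed
    qed
  next
    fix w0 assume 0: "w \<sqsubseteq> w0" "w0 \<tturnstile> fsub \<Psi> e"
    from U_equivD(1)[OF assms(2) wf(2) *(2) 0(2)] show "w0 \<tturnstile> U_ex (\<Phi> \<^bold>\<or> \<Psi>) e"
    proof (rule forces_U_exE)
      fix w1 us assume 1: "w0 \<sqsubseteq> w1" "sts w1 us (Ux \<Psi>)" "w1 \<tturnstile> U_all \<Psi> e us"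
      let ?xs = "map default_tm (Ux \<Phi>)"
      note len = list_all2_lengthD[OF 1(2)]
      have w1: "world w1" by (rule later_world[OF 1(1)])
      show "w1 \<tturnstile> U_ex (\<Phi> \<^bold>\<or> \<Psi>) e"
      \<comment> \<open>Any successor would do as the flag for the second disjunct.\<close>
      proof (rule forces_U_exI[of _ "suc zero # ?xs @ us"])
        have "closed_tm (suc zero) N" by (simp add: has_ty_App)
        then show "sts w1 (suc zero # ?xs @ us) (Ux (\<Phi> \<^bold>\<or> \<Psi>))"
          using 1(2) w1 by (auto intro: list_all2_appendI sts_default st_closed)
        show "w1 \<tturnstile> U_all (\<Phi> \<^bold>\<or> \<Psi>) e (suc zero # ?xs @ us)"
        proof (rule forces_U_allI[OF w1])
          fix w2 ys assume 2: "w1 \<sqsubseteq> w2" "sts w2 ys (Uy (\<Phi> \<^bold>\<or> \<Psi>))"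
          then have ys: "sts w2 (take (length (Uy \<Phi>)) ys) (Uy \<Phi>)" "sts w2 (drop (length (Uy \<Phi>)) ys) (Uy \<Psi>)"
            using list_all2_take_drop by auto
          have w2: "world w2" by (rule later_world[OF 2(1)])
          have "w2 \<tturnstile> (Eq N (suc zero) zero \<^bold>\<longrightarrow> Um \<Phi> e ?xs (take (length (Uy \<Phi>)) ys))"
            by (rule forces_imp_absurd[OF wfm_Um[OF wf(1) *(2) sts_typed[OF sts_default[OF w2]] sts_typed[OF ys(1)]] _ w2])
              (auto simp: typed_suc intro: suc_not_zero)
          moreover have "w2 \<tturnstile> ((\<^bold>\<not> Eq N (suc zero) zero) \<^bold>\<longrightarrow> Um \<Psi> e us (drop (length (Uy \<Phi>)) ys))"
            by (rule forces_imp_weaken[OF _ forces_U_allE[OF forces_mono[OF 1(3) 2(1)] len ys(2)]])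
              (simp add: typed_suc)
          ultimately show "w2 \<tturnstile> Um (\<Phi> \<^bold>\<or> \<Psi>) e (suc zero # ?xs @ us) ys" by (simp add: Let_def)
        qed (simp add: len)
      qed
    qed
  qed
next
  fix \<Gamma> e w xs
  assume *: "wff (\<Phi> \<^bold>\<or> \<Psi>) \<Gamma>" "env e \<Gamma>" "world w" "sts w xs (Ux (\<Phi> \<^bold>\<or> \<Psi>))" "w \<tturnstile> U_all (\<Phi> \<^bold>\<or> \<Psi>) e xs"
  have wf: "wff \<Phi> \<Gamma>" "wff \<Psi> \<Gamma>" using *(1) by simp_all
  obtain z us where z: "xs = z # us" "st w z N" and us: "sts w us (Ux \<Phi> @ Ux \<Psi>)"
    using *(4) by (auto simp: list_all2_Cons2)
  note us = list_all2_take_drop[OF us, THEN conjunct1] list_all2_take_drop[OF us, THEN conjunct2]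
  note len = list_all2_lengthD[OF *(4)]
  \<comment> \<open>The flag is among the standard witnesses, so it may be decided even though the
    goal is a primitive disjunction.\<close>
  from forces_st_zero_dec[OF z(2)] have "w \<tturnstile> (fsub \<Phi> e \<^bold>\<or> fsub \<Psi> e)"
  proof (rule forces_orE)
    fix w1 assume 1: "w \<sqsubseteq> w1" "w1 \<tturnstile> Eq N z zero"
    have "w1 \<tturnstile> U_all \<Phi> e (take (length (Ux \<Phi>)) us)"
    proof (rule forces_U_allI[OF later_world[OF 1(1)] list_all2_lengthD[OF us(1)]])
      fix w2 ys assume 2: "w1 \<sqsubseteq> w2" "sts w2 ys (Uy \<Phi>)"
      from forces_U_allE[OF forces_mono[OF *(5) later_trans[OF 1(1) 2(1)]] len, of "ys @ map default_tm (Uy \<Psi>)"]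
      have "w2 \<tturnstile> (Eq N z zero \<^bold>\<longrightarrow> Um \<Phi> e (take (length (Ux \<Phi>)) us) ys)"
        using 2(2) sts_default[OF later_world[OF 2(1)]] list_all2_lengthD[OF 2(2)] z(1)
        by (simp add: Let_def list_all2_appendI)
      then show "w2 \<tturnstile> Um \<Phi> e (take (length (Ux \<Phi>)) us) ys" by (rule forces_mp) (rule forces_mono[OF 1(2) 2(1)])
    qed
    from U_equivD(2)[OF assms(1) wf(1) *(2) sts_mono[OF us(1) 1(1)] this]
    show "w1 \<tturnstile> (fsub \<Phi> e \<^bold>\<or> fsub \<Psi> e)" using wf *(2) by (auto intro!: forces_orI wfm_fsub)
  next
    fix w1 assume 1: "w \<sqsubseteq> w1" "w1 \<tturnstile> (\<^bold>\<not> Eq N z zero)"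
    have "w1 \<tturnstile> U_all \<Psi> e (drop (length (Ux \<Phi>)) us)"
    proof (rule forces_U_allI[OF later_world[OF 1(1)] list_all2_lengthD[OF us(2)]])
      fix w2 ys assume 2: "w1 \<sqsubseteq> w2" "sts w2 ys (Uy \<Psi>)"
      from forces_U_allE[OF forces_mono[OF *(5) later_trans[OF 1(1) 2(1)]] len, of "map default_tm (Uy \<Phi>) @ ys"]
      have "w2 \<tturnstile> ((\<^bold>\<not> Eq N z zero) \<^bold>\<longrightarrow> Um \<Psi> e (drop (length (Ux \<Phi>)) us) ys)"
        using 2(2) sts_default[OF later_world[OF 2(1)]] z(1)
        by (simp add: Let_def list_all2_appendI)
      then show "w2 \<tturnstile> Um \<Psi> e (drop (length (Ux \<Phi>)) us) ys" by (rule forces_mp) (rule forces_mono[OF 1(2) 2(1)])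
    qed
    from U_equivD(2)[OF assms(2) wf(2) *(2) sts_mono[OF us(2) 1(1)] this]
    show "w1 \<tturnstile> (fsub \<Phi> e \<^bold>\<or> fsub \<Psi> e)" using wf *(2) by (auto intro!: forces_orI wfm_fsub)
  qed
  then show "w \<tturnstile> fsub (\<Phi> \<^bold>\<or> \<Psi>) e" by simp
qed

lemma env_case: "env e \<Gamma> \<Longrightarrow> typed t \<sigma> \<Longrightarrow> env (case_nat t e) (\<sigma> # \<Gamma>)"
  by simp

text \<open>In the translation the quantifier over \<open>y\<close> belongs to the matrix, so the
  witnesses must not depend on \<open>y\<close>. \<open>NU\<close> provides such uniform witnesses;
  the converse is mere instantiation.\<close>

lemma U_equiv_All:
  assumes IH: "U_equiv \<Phi>"
  shows "U_equiv (All \<sigma> \<Phi>)"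
proof (rule U_equivI)
  fix \<Gamma> e w assume *: "wff (All \<sigma> \<Phi>) \<Gamma>" "env e \<Gamma>" "w \<tturnstile> fsub (All \<sigma> \<Phi>) e"
  then have wf: "wff \<Phi> (\<sigma> # \<Gamma>)" by simp
  let ?n = "length (Ux \<Phi>)"
  let ?\<phi> = "U_all \<Phi> (\<lambda>i. shift ?n (up e i)) (vars ?n)"
  show "w \<tturnstile> U_ex (All \<sigma> \<Phi>) e"
  proof (rule forces_NUs[of \<sigma> w "Ux \<Phi>" ?\<phi> Var])
    fix y assume y: "typed y \<sigma>"
    have "w \<tturnstile> U_ex \<Phi> (case_nat y e)"
      by (rule U_equivD(1)[OF IH wf env_case[OF *(2) y] forces_allE'[OF *(3) y]])
    moreover have "fsub (foldr ExSt (Ux \<Phi>) ?\<phi>) (case_nat y Var) = fsub (U_ex \<Phi> (up e)) (case_nat y Var)"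
      by (simp add: U_ex_def Let_def)
    ultimately show "w \<tturnstile> fsub (foldr ExSt (Ux \<Phi>) ?\<phi>) (case_nat y Var)"
      by (simp only: fsub_U_ex case_up_comp tsub_Var)
  next
    fix w1 xs assume 1: "w \<sqsubseteq> w1" "sts w1 xs (Ux \<Phi>)"
      "\<And>y. typed y \<sigma> \<Longrightarrow> w1 \<tturnstile> fsub ?\<phi> (push (case_nat y Var) xs)"
    note len = list_all2_lengthD[OF 1(2)]
    have all: "w1 \<tturnstile> U_all \<Phi> (case_nat y e) xs" if "typed y \<sigma>" for y
      using 1(3)[OF that] fsub_U_all_push[OF len, of "up e" "case_nat y Var"]
      by (simp only: case_up_comp tsub_Var)
    show "w1 \<tturnstile> U_ex (All \<sigma> \<Phi>) e"
    proof (rule forces_U_exI[of _ xs])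
      show "sts w1 xs (Ux (All \<sigma> \<Phi>))" using 1(2) by simp
      show "w1 \<tturnstile> U_all (All \<sigma> \<Phi>) e xs"
      proof (rule forces_U_allI[OF later_world[OF 1(1)]])
        fix w2 ys assume 2: "w1 \<sqsubseteq> w2" "sts w2 ys (Uy (All \<sigma> \<Phi>))"
        then have ys: "sts w2 ys (Uy \<Phi>)" by simp
        show "w2 \<tturnstile> Um (All \<sigma> \<Phi>) e xs ys" unfolding Um.simps
        proof (rule forces_allI)
          fix y assume y: "typed y \<sigma>"
          from forces_U_allE[OF forces_mono[OF all[OF y] 2(1)] len ys]
          show "w2 \<tturnstile> inst y (Um \<Phi> (up e) (map (shift 1) xs) (map (shift 1) ys))"
            using len list_all2_lengthD[OF ys] by (simp add: inst_def fsub_Um case_up_comp comp_def)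
        qed
      qed (simp add: len)
    qed
  qed
next
  fix \<Gamma> e w xs
  assume *: "wff (All \<sigma> \<Phi>) \<Gamma>" "env e \<Gamma>" "world w" "sts w xs (Ux (All \<sigma> \<Phi>))" "w \<tturnstile> U_all (All \<sigma> \<Phi>) e xs"
  have wf: "wff \<Phi> (\<sigma> # \<Gamma>)" and xs: "sts w xs (Ux \<Phi>)" using *(1,4) by simp_all
  note len = list_all2_lengthD[OF xs]
  show "w \<tturnstile> fsub (All \<sigma> \<Phi>) e"
  proof (rule forces_allI')
    fix y assume y: "typed y \<sigma>"
    show "w \<tturnstile> fsub \<Phi> (case_nat y e)"
    proof (rule U_equivD(2)[OF IH wf env_case[OF *(2) y] xs], rule forces_U_allI[OF *(3) len])
      fix w1 ys assume 1: "w \<sqsubseteq> w1" "sts w1 ys (Uy \<Phi>)"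
      have "w1 \<tturnstile> All \<sigma> (Um \<Phi> (up e) (map (shift 1) xs) (map (shift 1) ys))"
        using forces_U_allE[OF forces_mono[OF *(5) 1(1)], of ys] 1(2) len by simp
      from forces_allE[OF this y] show "w1 \<tturnstile> Um \<Phi> (case_nat y e) xs ys"
        using len list_all2_lengthD[OF 1(2)] by (simp add: inst_def fsub_Um case_up_comp comp_def)
    qed
  qed
qed

lemma forces_Um_st_balls:
  assumes "sts w ss (map Seq (Uy \<Phi>))" "w \<tturnstile> U_all \<Phi> a xs" "mems w (Uy \<Phi>) ys ss"
    and "length xs = length (Ux \<Phi>)"
  shows "w \<tturnstile> Um \<Phi> a xs ys"
  using forces_st_balls[of "Um_body \<Phi> a xs" w ss "Uy \<Phi>" ys] assms mems_length[OF assms(3)]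
  by (simp add: U_all_def fsub_Um_body_Var)

lemma Um_Ex: "Um (Ex \<sigma> \<Phi>) a xs ss = Ex \<sigma> (ball (Uy \<Phi>) (map (shift 1) ss) (Um_body \<Phi> (up a) (map (shift 1) xs)))"
  by (simp add: Um_body_def Let_def comp_def)

text \<open>The translated formula offers a \<open>z\<close> only relative to standard sequences
  \<open>ss\<close>. A \<open>z\<close> that is good for all standard \<open>ys\<close> is good for
  the entries of \<open>ss\<close> by transfer; conversely \<open>OS\<close> merges the witnesses
  for the various \<open>ss\<close> into one.\<close>

lemma U_equiv_Ex:
  assumes IH: "U_equiv \<Phi>"
  shows "U_equiv (Ex \<sigma> \<Phi>)"
proof (rule U_equivI)
  fix \<Gamma> e w assume *: "wff (Ex \<sigma> \<Phi>) \<Gamma>" "env e \<Gamma>" "w \<tturnstile> fsub (Ex \<sigma> \<Phi>) e"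
  then have wf: "wff \<Phi> (\<sigma> # \<Gamma>)" by simp
  from *(3)[unfolded fsub.simps(8)] show "w \<tturnstile> U_ex (Ex \<sigma> \<Phi>) e"
  proof (rule forces_exE)
    fix z w1 assume 1: "w \<sqsubseteq> w1" "typed z \<sigma>" "w1 \<tturnstile> inst z (fsub \<Phi> (up e))"
    have "w1 \<tturnstile> U_ex \<Phi> (case_nat z e)"
      by (rule U_equivD(1)[OF IH wf env_case[OF *(2) 1(2)] 1(3)[unfolded inst_up]])
    then show "w1 \<tturnstile> U_ex (Ex \<sigma> \<Phi>) e"
    proof (rule forces_U_exE)
      fix w2 xs assume 2: "w1 \<sqsubseteq> w2" "sts w2 xs (Ux \<Phi>)" "w2 \<tturnstile> U_all \<Phi> (case_nat z e) xs"
      note len = list_all2_lengthD[OF 2(2)]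
      show "w2 \<tturnstile> U_ex (Ex \<sigma> \<Phi>) e"
      proof (rule forces_U_exI[of _ xs])
        show "sts w2 xs (Ux (Ex \<sigma> \<Phi>))" using 2(2) by simp
        show "w2 \<tturnstile> U_all (Ex \<sigma> \<Phi>) e xs"
        proof (rule forces_U_allI[OF later_world[OF 2(1)]])
          fix w3 ss assume 3: "w2 \<sqsubseteq> w3" "sts w3 ss (Uy (Ex \<sigma> \<Phi>))"
          then have ss: "sts w3 ss (map Seq (Uy \<Phi>))" by simp
          show "w3 \<tturnstile> Um (Ex \<sigma> \<Phi>) e xs ss" unfolding Um_Ex
          proof (rule forces_exI[OF _ 1(2)], unfold inst_def, rule forces_ballI[OF later_world[OF 3(1)]])
            have s: "map (tsub (case_nat z Var)) (map (shift 1) ss) = ss" by (simp add: comp_def)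
            show "list_all2 typed (map (tsub (case_nat z Var)) (map (shift 1) ss)) (map Seq (Uy \<Phi>))"
              unfolding s by (rule sts_typed[OF ss])
            fix w4 ys assume 4: "w3 \<sqsubseteq> w4" "mems w4 (Uy \<Phi>) ys (map (tsub (case_nat z Var)) (map (shift 1) ss))"
            have "w4 \<tturnstile> Um \<Phi> (case_nat z e) xs ys"
              by (rule forces_Um_st_balls[OF sts_mono[OF ss 4(1)] forces_mono[OF 2(3) later_trans[OF 3(1) 4(1)]]
                    4(2)[unfolded s] len])
            then show "w4 \<tturnstile> fsub (Um_body \<Phi> (up e) (map (shift 1) xs)) (push (case_nat z Var) ys)"
              using mems_length[OF 4(2)] len by (simp add: fsub_Um_body case_up_comp comp_def)
          qed
        qed (simp add: len)
      qed
    qed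
  qed
next
  fix \<Gamma> e w xs
  assume *: "wff (Ex \<sigma> \<Phi>) \<Gamma>" "env e \<Gamma>" "world w" "sts w xs (Ux (Ex \<sigma> \<Phi>))" "w \<tturnstile> U_all (Ex \<sigma> \<Phi>) e xs"
  have wf: "wff \<Phi> (\<sigma> # \<Gamma>)" and xs: "sts w xs (Ux \<Phi>)" using *(1,4) by simp_all
  note len = list_all2_lengthD[OF xs]
  let ?\<phi> = "Um_body \<Phi> (up e) (map (shift 1) xs)"
  obtain n1 n2 where n: "\<And>m. m \<ge> n1 \<Longrightarrow> \<forall>i<length \<Gamma>. has_ty (Ctx m) (e i) (\<Gamma> ! i)"
    "\<And>m. m \<ge> n2 \<Longrightarrow> list_all2 (has_ty (Ctx m)) xs (Ux \<Phi>)"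
    using env_has_ty[OF *(2)] typed_list_has_ty[OF sts_typed[OF xs]] by blast
  have wf\<phi>: "wff ?\<phi> (rev (Uy \<Phi>) @ \<sigma> # Ctx (n1 + n2))"
  proof (rule wff_Um_body[OF wf])
    show "has_ty (\<sigma> # Ctx (n1 + n2)) (up e i) ((\<sigma> # \<Gamma>) ! i)" if "i < length (\<sigma> # \<Gamma>)" for i
      by (rule up_typed) (use that n(1)[of "n1 + n2"] in auto)
  qed (use n(2)[of "n1 + n2"] in \<open>auto intro: shift_typed1\<close>)
  have "w \<tturnstile> Ex \<sigma> (fsub \<Phi> (up e))"
  proof (rule forces_OSs[OF wf\<phi> _ _ *(3)])
    fix w1 ss assume "w \<sqsubseteq> w1" "sts w1 ss (map Seq (Uy \<Phi>))"
    with forces_U_allE[OF forces_mono[OF *(5)], of w1 ss] len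
    show "w1 \<tturnstile> Ex \<sigma> (ball (Uy \<Phi>) (map (shift 1) ss) ?\<phi>)" by (simp only: Um_Ex Ux.simps Uy.simps)
  next
    fix w1 z assume 1: "w \<sqsubseteq> w1" "typed z \<sigma>"
      "\<And>w2 ys. w1 \<sqsubseteq> w2 \<Longrightarrow> sts w2 ys (Uy \<Phi>) \<Longrightarrow> w2 \<tturnstile> fsub ?\<phi> (push (case_nat z Var) ys)"
    have "w1 \<tturnstile> U_all \<Phi> (case_nat z e) xs"
      by (rule forces_U_allI[OF later_world[OF 1(1)] len])
        (use 1(3) len in \<open>simp add: fsub_Um_body list_all2_lengthD case_up_comp comp_def\<close>)
    from U_equivD(2)[OF IH wf env_case[OF *(2) 1(2)] sts_mono[OF xs 1(1)] this]
    show "w1 \<tturnstile> Ex \<sigma> (fsub \<Phi> (up e))" by (intro forces_exI[OF _ 1(2)]) (simp add: inst_up)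
  qed simp_all
  then show "w \<tturnstile> fsub (Ex \<sigma> \<Phi>) e" by simp
qed

lemma U_equiv_ExSt:
  assumes IH: "U_equiv \<Phi>"
  shows "U_equiv (ExSt \<sigma> \<Phi>)"
proof (rule U_equivI)
  fix \<Gamma> e w assume *: "wff (ExSt \<sigma> \<Phi>) \<Gamma>" "env e \<Gamma>" "w \<tturnstile> fsub (ExSt \<sigma> \<Phi>) e"
  then have wf: "wff \<Phi> (\<sigma> # \<Gamma>)" by simp
  from *(3)[unfolded fsub.simps(10)] show "w \<tturnstile> U_ex (ExSt \<sigma> \<Phi>) e"
  proof (rule forces_ExStE)
    fix z w1 assume 1: "w \<sqsubseteq> w1" "st w1 z \<sigma>" "w1 \<tturnstile> inst z (fsub \<Phi> (up e))"
    have "w1 \<tturnstile> U_ex \<Phi> (case_nat z e)"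
      by (rule U_equivD(1)[OF IH wf env_case[OF *(2) st_typed[OF 1(2)]] 1(3)[unfolded inst_up]])
    then show "w1 \<tturnstile> U_ex (ExSt \<sigma> \<Phi>) e"
    proof (rule forces_U_exE)
      fix w2 xs assume 2: "w1 \<sqsubseteq> w2" "sts w2 xs (Ux \<Phi>)" "w2 \<tturnstile> U_all \<Phi> (case_nat z e) xs"
      note len = list_all2_lengthD[OF 2(2)]
      show "w2 \<tturnstile> U_ex (ExSt \<sigma> \<Phi>) e"
      proof (rule forces_U_exI[of _ "z # xs"])
        show "sts w2 (z # xs) (Ux (ExSt \<sigma> \<Phi>))" using 2(2) st_mono[OF 1(2) 2(1)] by simp
        show "w2 \<tturnstile> U_all (ExSt \<sigma> \<Phi>) e (z # xs)"
          by (rule forces_U_allI[OF later_world[OF 2(1)]])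
            (use forces_U_allE[OF forces_mono[OF 2(3)] len] in \<open>simp_all add: len\<close>)
      qed
    qed
  qed
next
  fix \<Gamma> e w xs
  assume *: "wff (ExSt \<sigma> \<Phi>) \<Gamma>" "env e \<Gamma>" "world w" "sts w xs (Ux (ExSt \<sigma> \<Phi>))" "w \<tturnstile> U_all (ExSt \<sigma> \<Phi>) e xs"
  have wf: "wff \<Phi> (\<sigma> # \<Gamma>)" using *(1) by simp
  obtain z us where z: "xs = z # us" "st w z \<sigma>" and us: "sts w us (Ux \<Phi>)"
    using *(4) by (auto simp: list_all2_Cons2)
  have "w \<tturnstile> U_all \<Phi> (case_nat z e) us"
  proof (rule forces_U_allI[OF *(3) list_all2_lengthD[OF us]])
    fix w1 ys assume 1: "w \<sqsubseteq> w1" "sts w1 ys (Uy \<Phi>)"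
    from forces_U_allE[OF forces_mono[OF *(5) 1(1)] list_all2_lengthD[OF *(4)], of ys] 1(2) z(1)
    show "w1 \<tturnstile> Um \<Phi> (case_nat z e) us ys" by simp
  qed
  from U_equivD(2)[OF IH wf env_case[OF *(2) st_typed[OF z(2)]] us this]
  show "w \<tturnstile> fsub (ExSt \<sigma> \<Phi>) e" by (rule forces_ExStI'[OF z(2)])
qed

text \<open>Here the witnesses may depend on \<open>z\<close>, and \<open>AC\<close> with the single
  argument \<open>z\<close> collects them into functions.\<close>

lemma U_equiv_AllSt:
  assumes IH: "U_equiv \<Phi>"
  shows "U_equiv (AllSt \<sigma> \<Phi>)"
proof (rule U_equivI)
  fix \<Gamma> e w assume *: "wff (AllSt \<sigma> \<Phi>) \<Gamma>" "env e \<Gamma>" "w \<tturnstile> fsub (AllSt \<sigma> \<Phi>) e"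
  then have wf: "wff \<Phi> (\<sigma> # \<Gamma>)" by simp
  let ?n = "length (Ux \<Phi>)"
  let ?\<phi> = "U_all \<Phi> (\<lambda>i. shift ?n (up e i)) (vars ?n)"
  show "w \<tturnstile> U_ex (AllSt \<sigma> \<Phi>) e"
  proof (rule forces_ACs[OF forces_world[OF *(3)], of "[\<sigma>]" "Ux \<Phi>" ?\<phi> Var])
    fix w1 zs assume 1: "w \<sqsubseteq> w1" "sts w1 zs [\<sigma>]"
    then obtain z where z: "zs = [z]" "st w1 z \<sigma>" by (auto simp: list_all2_Cons2)
    have "w1 \<tturnstile> U_ex \<Phi> (case_nat z e)"
      by (rule U_equivD(1)[OF IH wf env_case[OF *(2) st_typed[OF z(2)]]
            forces_AllStE'[OF forces_mono[OF *(3) 1(1)] z(2)]])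
    moreover have "fsub (foldr ExSt (Ux \<Phi>) ?\<phi>) (case_nat z Var) = fsub (U_ex \<Phi> (up e)) (case_nat z Var)"
      by (simp add: U_ex_def Let_def)
    ultimately have "w1 \<tturnstile> fsub (foldr ExSt (Ux \<Phi>) ?\<phi>) (case_nat z Var)"
      by (simp only: fsub_U_ex case_up_comp tsub_Var)
    then show "w1 \<tturnstile> fsub (foldr ExSt (Ux \<Phi>) ?\<phi>) (push Var zs)" by (simp add: z(1))
  next
    fix w1 Xs assume 1: "w \<sqsubseteq> w1" "sts w1 Xs (map (funs [\<sigma>]) (Ux \<Phi>))"
      "\<And>w2 zs. w1 \<sqsubseteq> w2 \<Longrightarrow> sts w2 zs [\<sigma>] \<Longrightarrow> w2 \<tturnstile> fsub ?\<phi> (push (push Var zs) (map (\<lambda>X. apps X zs) Xs))"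
    have len: "length Xs = ?n" using list_all2_lengthD[OF 1(2)] by simp
    have all: "w2 \<tturnstile> U_all \<Phi> (case_nat z e) (map (\<lambda>X. X \<cdot> z) Xs)" if "w1 \<sqsubseteq> w2" "st w2 z \<sigma>" for w2 z
      using 1(3)[OF that(1), of "[z]"] that(2) fsub_U_all_push[of "map (\<lambda>X. X \<cdot> z) Xs" \<Phi> "up e" "case_nat z Var"] len
      by (simp add: case_up_comp)
    show "w1 \<tturnstile> U_ex (AllSt \<sigma> \<Phi>) e"
    proof (rule forces_U_exI[of _ Xs])
      show "sts w1 Xs (Ux (AllSt \<sigma> \<Phi>))" using 1(2) by simp
      show "w1 \<tturnstile> U_all (AllSt \<sigma> \<Phi>) e Xs"
      proof (rule forces_U_allI[OF later_world[OF 1(1)]])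
        fix w2 yzs assume 2: "w1 \<sqsubseteq> w2" "sts w2 yzs (Uy (AllSt \<sigma> \<Phi>))"
        then obtain ys z where yz: "yzs = ys @ [z]" "sts w2 ys (Uy \<Phi>)" "st w2 z \<sigma>"
          by (auto simp: list_all2_append2 list_all2_Cons2)
        from forces_U_allE[OF all[OF 2(1) yz(3)] _ yz(2)] len
        show "w2 \<tturnstile> Um (AllSt \<sigma> \<Phi>) e Xs yzs" by (simp add: yz(1) Let_def)
      qed (simp add: len)
    qed
  qed
next
  fix \<Gamma> e w Xs
  assume *: "wff (AllSt \<sigma> \<Phi>) \<Gamma>" "env e \<Gamma>" "world w" "sts w Xs (Ux (AllSt \<sigma> \<Phi>))" "w \<tturnstile> U_all (AllSt \<sigma> \<Phi>) e Xs"
  have wf: "wff \<Phi> (\<sigma> # \<Gamma>)" using *(1) by simp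
  show "w \<tturnstile> fsub (AllSt \<sigma> \<Phi>) e"
  proof (rule forces_AllStI'[OF *(3)])
    fix w1 z assume 1: "w \<sqsubseteq> w1" "st w1 z \<sigma>"
    have xs: "sts w1 (map (\<lambda>X. X \<cdot> z) Xs) (Ux \<Phi>)"
      using sts_apps[of w1 Xs "[\<sigma>]" "Ux \<Phi>" "[z]"] sts_mono[OF *(4) 1(1)] 1(2) by simp
    show "w1 \<tturnstile> fsub \<Phi> (case_nat z e)"
    proof (rule U_equivD(2)[OF IH wf env_case[OF *(2) st_typed[OF 1(2)]] xs],
        rule forces_U_allI[OF later_world[OF 1(1)] list_all2_lengthD[OF xs]])
      fix w2 ys assume 2: "w1 \<sqsubseteq> w2" "sts w2 ys (Uy \<Phi>)"
      from forces_U_allE[OF forces_mono[OF *(5) later_trans[OF 1(1) 2(1)]] list_all2_lengthD[OF *(4)], of "ys @ [z]"]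
      show "w2 \<tturnstile> Um \<Phi> (case_nat z e) (map (\<lambda>X. X \<cdot> z) Xs) ys"
        using 2(2) st_mono[OF 1(2) 2(1)] by (simp add: Let_def list_all2_appendI)
    qed
  qed
qed

text \<open>The matrix of an implication with the bounding sequences as arguments, in place of the
  functions that produce them. This is the form reached after \<open>US\<close> and before the last
  use of \<open>AC\<close>.\<close>

definition imp_body :: "fm \<Rightarrow> fm \<Rightarrow> (nat \<Rightarrow> tm) \<Rightarrow> tm list \<Rightarrow> tm list \<Rightarrow> tm list \<Rightarrow> fm" where
  "imp_body \<Phi> \<Psi> a Us ss xvs =
    (let xs = take (length (Ux \<Phi>)) xvs
     in ball (Uy \<Phi>) ss (Um_body \<Phi> a xs) \<^bold>\<longrightarrow> Um \<Psi> a (map (\<lambda>U. apps U xs) Us) (drop (length (Ux \<Phi>)) xvs))"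

lemma Um_Imp:
  "length Us = length (Ux \<Psi>)
    \<Longrightarrow> Um (\<Phi> \<^bold>\<longrightarrow> \<Psi>) a (Us @ Ys) xvs = imp_body \<Phi> \<Psi> a Us (map (\<lambda>Y. apps Y xvs) Ys) xvs"
  by (simp add: imp_body_def Um_body_def Let_def del: foldl_append)

lemma fsub_imp_body:
  "length Us = length (Ux \<Psi>) \<Longrightarrow> length ss = length (Uy \<Phi>) \<Longrightarrow> length xvs = length (Ux \<Phi>) + length (Uy \<Psi>)
    \<Longrightarrow> fsub (imp_body \<Phi> \<Psi> a Us ss xvs) s
      = imp_body \<Phi> \<Psi> (\<lambda>i. tsub s (a i)) (map (tsub s) Us) (map (tsub s) ss) (map (tsub s) xvs)"
  by (simp add: imp_body_def Let_def fsub_ball fsub_up_Um_body fsub_Um take_map drop_map comp_def)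

text \<open>The order of the principles reflects dependencies: \<open>Us\<close> may depend on
  \<open>xs\<close> alone and is chosen while the conclusion still carries its external quantifiers.
  Only then is \<open>vs\<close> fixed and the premise cut down to sequences, which may depend on
  \<open>xs\<close> and \<open>vs\<close>. For the converse the functions are evaluated, and the
  bounded premise follows by transfer.\<close>

lemma U_equiv_Imp:
  assumes IH: "U_equiv \<Phi>" "U_equiv \<Psi>"
  shows "U_equiv (\<Phi> \<^bold>\<longrightarrow> \<Psi>)"
proof (rule U_equivI)
  fix \<Gamma> e w assume *: "wff (\<Phi> \<^bold>\<longrightarrow> \<Psi>) \<Gamma>" "env e \<Gamma>" "w \<tturnstile> fsub (\<Phi> \<^bold>\<longrightarrow> \<Psi>) e"
  then have wf: "wff \<Phi> \<Gamma>" "wff \<Psi> \<Gamma>" and imp: "w \<tturnstile> (fsub \<Phi> e \<^bold>\<longrightarrow> fsub \<Psi> e)" by simp_all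
  let ?n = "length (Ux \<Phi>)" and ?m = "length (Uy \<Phi>)" and ?k = "length (Ux \<Psi>)" and ?l = "length (Uy \<Psi>)"
  let ?\<psi> = "U_all \<Psi> (\<lambda>i. shift ?k (e i)) (vars ?k)"
  \<comment> \<open>Matrix of the first choice, in which both universal blocks are still external;
    the variables for \<open>us\<close> lie inside those for \<open>xs\<close>.\<close>
  let ?\<phi>1 = "U_all \<Phi> (\<lambda>i. shift ?k (shift ?n (e i))) (map (shift ?k) (vars ?n))
    \<^bold>\<longrightarrow> U_all \<Psi> (\<lambda>i. shift ?k (shift ?n (e i))) (vars ?k)"
  have \<phi>1: "fsub ?\<phi>1 (push (push Var xs) us) = (U_all \<Phi> e xs \<^bold>\<longrightarrow> U_all \<Psi> e us)"
    if "length xs = ?n" "length us = ?k" for xs us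
    using that by (simp add: fsub_U_all comp_def del: shift_shift)
  show "w \<tturnstile> U_ex (\<Phi> \<^bold>\<longrightarrow> \<Psi>) e"
  proof (rule forces_ACs[OF forces_world[OF imp], of "Ux \<Phi>" "Ux \<Psi>" ?\<phi>1 Var])
    fix w1 xs assume 1: "w \<sqsubseteq> w1" "sts w1 xs (Ux \<Phi>)"
    obtain n where n: "wff (Um_body \<Phi> e xs) (rev (Uy \<Phi>) @ Ctx n)"
      using wff_Um_body_Ctx[OF wf(1) *(2) sts_typed[OF 1(2)]] by blast
    show "w1 \<tturnstile> fsub (foldr ExSt (Ux \<Psi>) ?\<phi>1) (push Var xs)"
    \<comment> \<open>Once \<open>xs\<close> is fixed, the premise is a block of external
      quantifiers in front of an internal formula. The original premise \<open>\<Phi>\<close> would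
      not be admissible in \<open>IP\<close>.\<close>
    proof (rule forces_IPs[OF n _ _ later_world[OF 1(1)], of "Ux \<Psi>" ?\<psi> Var])
      fix w2 assume 2: "w1 \<sqsubseteq> w2" "w2 \<tturnstile> foldr AllSt (Uy \<Phi>) (Um_body \<Phi> e xs)"
      have "w2 \<tturnstile> fsub \<Phi> e"
        by (rule U_equivD(2)[OF IH(1) wf(1) *(2) sts_mono[OF 1(2) 2(1)]]) (use 2(2) in \<open>simp add: U_all_def\<close>)
      from U_equivD(1)[OF IH(2) wf(2) *(2) forces_mp[OF forces_mono[OF imp later_trans[OF 1(1) 2(1)]] this]]
      show "w2 \<tturnstile> fsub (foldr ExSt (Ux \<Psi>) ?\<psi>) Var" by (simp add: U_ex_def Let_def)
    next
      fix w2 us assume 2: "w1 \<sqsubseteq> w2" "sts w2 us (Ux \<Psi>)"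
        "\<And>w3. w2 \<sqsubseteq> w3 \<Longrightarrow> w3 \<tturnstile> foldr AllSt (Uy \<Phi>) (Um_body \<Phi> e xs) \<Longrightarrow> w3 \<tturnstile> fsub ?\<psi> (push Var us)"
      show "w2 \<tturnstile> fsub (foldr ExSt (Ux \<Psi>) ?\<phi>1) (push Var xs)"
      proof (rule forces_ExStsI[OF 2(2)], subst \<phi>1[OF list_all2_lengthD[OF 1(2)] list_all2_lengthD[OF 2(2)]],
          rule forces_impI[OF wfm_U_all[OF wf(1) *(2) sts_typed[OF 1(2)]] later_world[OF 2(1)]])
        fix w3 assume 3: "w2 \<sqsubseteq> w3" "w3 \<tturnstile> U_all \<Phi> e xs"
        from 2(3)[OF 3(1) 3(2)[unfolded U_all_def]] list_all2_lengthD[OF 2(2)]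
        show "w3 \<tturnstile> U_all \<Psi> e us" by (simp add: fsub_U_all_push)
      qed
    qed simp_all
  next
    fix w1 Us assume 1: "w \<sqsubseteq> w1" "sts w1 Us (map (funs (Ux \<Phi>)) (Ux \<Psi>))"
      "\<And>w2 xs. w1 \<sqsubseteq> w2 \<Longrightarrow> sts w2 xs (Ux \<Phi>) \<Longrightarrow> w2 \<tturnstile> fsub ?\<phi>1 (push (push Var xs) (map (\<lambda>U. apps U xs) Us))"
    have lU: "length Us = ?k" using list_all2_lengthD[OF 1(2)] by simp
    have Us: "w2 \<tturnstile> U_all \<Psi> e (map (\<lambda>U. apps U xs) Us)"
      if "w1 \<sqsubseteq> w2" "sts w2 xs (Ux \<Phi>)" "w2 \<tturnstile> U_all \<Phi> e xs" for w2 xs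
    proof -
      have "w2 \<tturnstile> (U_all \<Phi> e xs \<^bold>\<longrightarrow> U_all \<Psi> e (map (\<lambda>U. apps U xs) Us))"
        using 1(3)[OF that(1,2)] \<phi>1[OF list_all2_lengthD[OF that(2)], of "map (\<lambda>U. apps U xs) Us"] lU by simp
      then show ?thesis using that(3) by (rule forces_mp)
    qed
    \<comment> \<open>Matrix of the second choice, whose arguments \<open>xs\<close> and
      \<open>vs\<close> are treated as one tuple.\<close>
    let ?\<phi>2 = "imp_body \<Phi> \<Psi> (\<lambda>i. shift ?m (shift (?n + ?l) (e i))) (map (shift ?m) (map (shift (?n + ?l)) Us))
      (vars ?m) (map (shift ?m) (vars (?n + ?l)))"
    have \<phi>2: "fsub ?\<phi>2 (push (push Var xvs) ss) = imp_body \<Phi> \<Psi> e Us ss xvs"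
      if "length xvs = ?n + ?l" "length ss = ?m" for xvs ss
      using that lU by (simp add: fsub_imp_body comp_def del: shift_shift)
    show "w1 \<tturnstile> U_ex (\<Phi> \<^bold>\<longrightarrow> \<Psi>) e"
    proof (rule forces_ACs[OF later_world[OF 1(1)], of "Ux \<Phi> @ Uy \<Psi>" "map Seq (Uy \<Phi>)" ?\<phi>2 Var])
      fix w2 xvs assume 2: "w1 \<sqsubseteq> w2" "sts w2 xvs (Ux \<Phi> @ Uy \<Psi>)"
      define xs vs where "xs = take ?n xvs" and "vs = drop ?n xvs"
      have xv: "sts w2 xs (Ux \<Phi>)" "sts w2 vs (Uy \<Psi>)"
        using list_all2_take_drop[OF 2(2)] by (auto simp: xs_def vs_def)
      obtain n where n: "wff (Um_body \<Phi> e xs) (rev (Uy \<Phi>) @ Ctx n)"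
        using wff_Um_body_Ctx[OF wf(1) *(2) sts_typed[OF xv(1)]] by blast
      let ?us = "map (\<lambda>U. apps U xs) Us"
      show "w2 \<tturnstile> fsub (foldr ExSt (map Seq (Uy \<Phi>)) ?\<phi>2) (push Var xvs)"
      \<comment> \<open>With \<open>vs\<close> fixed the conclusion is internal and
        disjunction-free, as \<open>US\<close> requires.\<close>
      proof (rule forces_USs[OF n _ _ _ _ later_world[OF 2(1)], of "Um \<Psi> e ?us vs"])
        fix w3 assume 3: "w2 \<sqsubseteq> w3" "w3 \<tturnstile> foldr AllSt (Uy \<Phi>) (Um_body \<Phi> e xs)"
        have "w3 \<tturnstile> U_all \<Psi> e ?us"
          by (rule Us[OF later_trans[OF 2(1) 3(1)] sts_mono[OF xv(1) 3(1)]]) (use 3(2) in \<open>simp add: U_all_def\<close>)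
        then show "w3 \<tturnstile> Um \<Psi> e ?us vs" by (rule forces_U_allE) (use lU sts_mono[OF xv(2) 3(1)] in simp_all)
      next
        fix w3 ss assume 3: "w2 \<sqsubseteq> w3" "sts w3 ss (map Seq (Uy \<Phi>))"
          "\<And>w4. w3 \<sqsubseteq> w4
            \<Longrightarrow> (\<And>w5 ys. w4 \<sqsubseteq> w5 \<Longrightarrow> mems w5 (Uy \<Phi>) ys ss \<Longrightarrow> w5 \<tturnstile> fsub (Um_body \<Phi> e xs) (push Var ys))
            \<Longrightarrow> w4 \<tturnstile> Um \<Psi> e ?us vs"
        have ls: "length ss = ?m" and lx: "length xvs = ?n + ?l"
          using list_all2_lengthD[OF 3(2)] list_all2_lengthD[OF 2(2)] by simp_all
        have "w3 \<tturnstile> (ball (Uy \<Phi>) ss (Um_body \<Phi> e xs) \<^bold>\<longrightarrow> Um \<Psi> e ?us vs)"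
        proof (rule forces_impI[OF wfm_ball[OF sts_typed[OF 3(2)] n] later_world[OF 3(1)]])
          fix w4 assume 4: "w3 \<sqsubseteq> w4" "w4 \<tturnstile> ball (Uy \<Phi>) ss (Um_body \<Phi> e xs)"
          show "w4 \<tturnstile> Um \<Psi> e ?us vs"
          proof (rule 3(3)[OF 4(1)])
            fix w5 ys assume 5: "w4 \<sqsubseteq> w5" "mems w5 (Uy \<Phi>) ys ss"
            show "w5 \<tturnstile> fsub (Um_body \<Phi> e xs) (push Var ys)"
              by (rule forces_ballE[of _ _ ss]) (use forces_mono[OF 4(2) 5(1)] 5(2) in simp_all)
          qed
        qed
        then have "w3 \<tturnstile> fsub ?\<phi>2 (push (push Var xvs) ss)"
          unfolding \<phi>2[OF lx ls] by (simp add: imp_body_def Let_def xs_def vs_def)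
        then show "w3 \<tturnstile> fsub (foldr ExSt (map Seq (Uy \<Phi>)) ?\<phi>2) (push Var xvs)"
          by (rule forces_ExStsI[OF 3(2)])
      qed simp_all
    next
      fix w2 Ys assume 2: "w1 \<sqsubseteq> w2" "sts w2 Ys (map (funs (Ux \<Phi> @ Uy \<Psi>)) (map Seq (Uy \<Phi>)))"
        "\<And>w3 xvs. w2 \<sqsubseteq> w3 \<Longrightarrow> sts w3 xvs (Ux \<Phi> @ Uy \<Psi>)
          \<Longrightarrow> w3 \<tturnstile> fsub ?\<phi>2 (push (push Var xvs) (map (\<lambda>Y. apps Y xvs) Ys))"
      have lY: "length Ys = ?m" using list_all2_lengthD[OF 2(2)] by simp
      show "w2 \<tturnstile> U_ex (\<Phi> \<^bold>\<longrightarrow> \<Psi>) e"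
      proof (rule forces_U_exI[of _ "Us @ Ys"])
        show "sts w2 (Us @ Ys) (Ux (\<Phi> \<^bold>\<longrightarrow> \<Psi>))"
          unfolding Ux.simps
          by (rule list_all2_appendI[OF sts_mono[OF 1(2) 2(1)]]) (use 2(2) in \<open>simp add: comp_def\<close>)
        show "w2 \<tturnstile> U_all (\<Phi> \<^bold>\<longrightarrow> \<Psi>) e (Us @ Ys)"
        proof (rule forces_U_allI[OF later_world[OF 2(1)]])
          fix w3 xvs assume 3: "w2 \<sqsubseteq> w3" "sts w3 xvs (Uy (\<Phi> \<^bold>\<longrightarrow> \<Psi>))"
          then have xvs: "sts w3 xvs (Ux \<Phi> @ Uy \<Psi>)" by simp
          from 2(3)[OF 3(1) xvs] \<phi>2[of xvs "map (\<lambda>Y. apps Y xvs) Ys"] list_all2_lengthD[OF xvs] lY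
          show "w3 \<tturnstile> Um (\<Phi> \<^bold>\<longrightarrow> \<Psi>) e (Us @ Ys) xvs" by (simp add: Um_Imp[OF lU] del: Um.simps)
        qed (simp add: lU lY)
      qed
    qed
  qed
next
  fix \<Gamma> e w UYs
  assume *: "wff (\<Phi> \<^bold>\<longrightarrow> \<Psi>) \<Gamma>" "env e \<Gamma>" "world w" "sts w UYs (Ux (\<Phi> \<^bold>\<longrightarrow> \<Psi>))" "w \<tturnstile> U_all (\<Phi> \<^bold>\<longrightarrow> \<Psi>) e UYs"
  have wf: "wff \<Phi> \<Gamma>" "wff \<Psi> \<Gamma>" using *(1) by simp_all
  obtain Us Ys where UYs: "UYs = Us @ Ys" and Us: "sts w Us (map (funs (Ux \<Phi>)) (Ux \<Psi>))"
    and Ys: "sts w Ys (map (funs (Ux \<Phi> @ Uy \<Psi>)) (map Seq (Uy \<Phi>)))"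
    using *(4) by (auto simp: list_all2_append2 comp_def)
  have lU: "length Us = length (Ux \<Psi>)" using list_all2_lengthD[OF Us] by simp
  have "w \<tturnstile> (fsub \<Phi> e \<^bold>\<longrightarrow> fsub \<Psi> e)"
  proof (rule forces_impI[OF wfm_fsub[OF wf(1) *(2)] *(3)])
    fix w1 assume 1: "w \<sqsubseteq> w1" "w1 \<tturnstile> fsub \<Phi> e"
    from U_equivD(1)[OF IH(1) wf(1) *(2) 1(2)] show "w1 \<tturnstile> fsub \<Psi> e"
    proof (rule forces_U_exE)
      fix w2 xs assume 2: "w1 \<sqsubseteq> w2" "sts w2 xs (Ux \<Phi>)" "w2 \<tturnstile> U_all \<Phi> e xs"
      note lx = list_all2_lengthD[OF 2(2)]
      have d2: "w \<sqsubseteq> w2" by (rule later_trans[OF 1(1) 2(1)])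
      have us: "sts w2 (map (\<lambda>U. apps U xs) Us) (Ux \<Psi>)" by (rule sts_apps[OF sts_mono[OF Us d2] 2(2)])
      show "w2 \<tturnstile> fsub \<Psi> e"
      proof (rule U_equivD(2)[OF IH(2) wf(2) *(2) us], rule forces_U_allI[OF later_world[OF 2(1)] list_all2_lengthD[OF us]])
        fix w3 vs assume 3: "w2 \<sqsubseteq> w3" "sts w3 vs (Uy \<Psi>)"
        have xv: "sts w3 (xs @ vs) (Ux \<Phi> @ Uy \<Psi>)" by (rule list_all2_appendI[OF sts_mono[OF 2(2) 3(1)] 3(2)])
        have d3: "w \<sqsubseteq> w3" by (rule later_trans[OF d2 3(1)])
        \<comment> \<open>Standard functions at standard arguments: these sequences are standard, so
          the external premise transfers to their entries.\<close>
        let ?ss = "map (\<lambda>Y. apps Y (xs @ vs)) Ys"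
        have ss: "sts w3 ?ss (map Seq (Uy \<Phi>))" by (rule sts_apps[OF sts_mono[OF Ys d3] xv])
        have "w3 \<tturnstile> Um (\<Phi> \<^bold>\<longrightarrow> \<Psi>) e (Us @ Ys) (xs @ vs)"
          by (rule forces_U_allE[OF forces_mono[OF *(5)[unfolded UYs] d3]])
            (use xv list_all2_lengthD[OF *(4)] UYs in simp_all)
        then have "w3 \<tturnstile> (ball (Uy \<Phi>) ?ss (Um_body \<Phi> e xs) \<^bold>\<longrightarrow> Um \<Psi> e (map (\<lambda>U. apps U xs) Us) vs)"
          unfolding Um_Imp[OF lU] imp_body_def Let_def using lx by simp
        moreover have "w3 \<tturnstile> fsub (ball (Uy \<Phi>) ?ss (Um_body \<Phi> e xs)) Var"
        proof (rule forces_ballI[OF later_world[OF 3(1)]])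
          show "list_all2 typed (map (tsub Var) ?ss) (map Seq (Uy \<Phi>))"
            unfolding map_tsub_Var by (rule sts_typed[OF ss])
          fix w4 ys assume 4: "w3 \<sqsubseteq> w4" "mems w4 (Uy \<Phi>) ys (map (tsub Var) ?ss)"
          have "w4 \<tturnstile> Um \<Phi> e xs ys"
            by (rule forces_Um_st_balls[OF sts_mono[OF ss 4(1)] forces_mono[OF 2(3) later_trans[OF 3(1) 4(1)]]
                  4(2)[unfolded map_tsub_Var] lx])
          then show "w4 \<tturnstile> fsub (Um_body \<Phi> e xs) (push Var ys)"
            using lx mems_length[OF 4(2)] by (simp add: fsub_Um_body_Var)
        qed
        ultimately show "w3 \<tturnstile> Um \<Psi> e (map (\<lambda>U. apps U xs) Us) vs"
          by (auto intro: forces_mp)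
      qed
    qed
  qed
  then show "w \<tturnstile> fsub (\<Phi> \<^bold>\<longrightarrow> \<Psi>) e" by simp
qed

lemma U_equiv: "U_equiv \<Phi>"
proof (induction \<Phi>)
  case Fls
  show ?case by (simp add: U_equiv_def U_ex_def U_all_def Um_body_def)
next
  case (Eq \<sigma> t u)
  show ?case by (simp add: U_equiv_def U_ex_def U_all_def Um_body_def)
qed (simp_all add: U_equiv_St U_equiv_And U_equiv_Or U_equiv_Imp U_equiv_All U_equiv_Ex
    U_equiv_AllSt U_equiv_ExSt)

section \<open>From forcing back to provability\<close>

lemma prv_forces:
  assumes "prv UNIV H \<Gamma> {} \<phi>" "wff \<phi> \<Gamma>" "env e \<Gamma>"
  shows "{} \<tturnstile> fsub \<phi> e"
proof -
  obtain n where n: "\<forall>i<length \<Gamma>. has_ty (Ctx n) (e i) (\<Gamma> ! i)" using env_has_ty[OF assms(3)] by blast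
  have "prv UNIV H (Ctx n) {} (fsub \<phi> e)" using prv_fsub[OF assms(1) wff_H, of "Ctx n" e] n by simp
  moreover have "wff (fsub \<phi> e) (Ctx n)" by (rule wff_fsub[OF assms(2)]) (use n in simp)
  ultimately show ?thesis unfolding forces_def by auto
qed

text \<open>One generic instance is enough, where distinct variables of \<open>\<Gamma>\<close>
  become distinct pool variables of the same types; substituting back recovers the formula over
  \<open>\<Gamma>\<close>.\<close>

lemma forces_prv:
  assumes wf: "wff \<phi> \<Gamma>" and all: "\<And>e. env e \<Gamma> \<Longrightarrow> {} \<tturnstile> fsub \<phi> e"
  shows "prv UNIV H \<Gamma> {} \<phi>"
proof -
  \<comment> \<open>The index \<open>i\<close> serves as serial number. This makes \<open>e\<close>
    injective and lets \<open>r\<close> read off where a pool variable came from.\<close>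
  define e where "e i = Var (prod_encode (to_nat (\<Gamma> ! i), i))" for i
  \<comment> \<open>Every pool variable of the derivation must be sent to a term over
    \<open>\<Gamma>\<close> of the right type; those outside the range of \<open>e\<close> become
    default terms.\<close>
  define r where "r j = (let i = snd (prod_decode j) in
    if i < length \<Gamma> \<and> pty j = \<Gamma> ! i then Var i else default_tm (pty j))" for j
  have "env e \<Gamma>" by (auto simp: env_def e_def intro: typed_Var_pty)
  from all[OF this] obtain n where n: "prv UNIV H (Ctx n) {} (fsub \<phi> e)" unfolding forces_def by blast
  have "has_ty \<Gamma> (r j) (pty j)" for j
    using has_ty_closed[OF closed_default] by (auto simp: r_def Let_def)
  with prv_fsub[OF n wff_H, of \<Gamma> r] have "prv UNIV H \<Gamma> {} (fsub \<phi> (\<lambda>i. tsub r (e i)))"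
    by (simp add: fsub_fsub)
  moreover have "fsub \<phi> (\<lambda>i. tsub r (e i)) = fsub \<phi> Var"
    by (rule fsub_cong[OF wf]) (simp add: e_def r_def Let_def)
  ultimately show ?thesis by simp
qed

lemma wff_U: "wff \<Phi> \<Gamma> \<Longrightarrow> wff (U \<Phi>) \<Gamma>"
  unfolding U_eq U_ex_def U_all_def Let_def wff_foldr
  by (rule wff_Um_body) (auto simp: nth_append intro: vars_typed)

lemma forces_AllsE:
  "w \<tturnstile> fsub (foldr All \<sigma>s \<phi>) e \<Longrightarrow> list_all2 typed ts \<sigma>s \<Longrightarrow> w \<tturnstile> fsub \<phi> (push e ts)"
proof (induction \<sigma>s arbitrary: ts e)
  case (Cons \<sigma> \<sigma>s)
  then obtain t ts' where t: "ts = t # ts'" "typed t \<sigma>" "list_all2 typed ts' \<sigma>s"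
    by (auto simp: list_all2_Cons2)
  have "w \<tturnstile> fsub (All \<sigma> (foldr All \<sigma>s \<phi>)) e" using Cons.prems(1) by simp
  from Cons.IH[OF forces_allE'[OF this t(2)] t(3)] show ?case by (simp add: t(1))
qed simp

lemma U_at_eq: "U_at \<Phi> ts = foldr All (Uy \<Phi>) (Um_body \<Phi> Var ts)"
  by (simp add: U_at_def Um_body_def Let_def)

theorem mainTheorem14:
  fixes \<Gamma> :: "ty list" and \<Phi> :: fm
  assumes "wff \<Phi> \<Gamma>"
  shows "prv_st H \<Gamma> (\<Phi> \<^bold>\<longleftrightarrow> U \<Phi>) \<and>
    ((\<forall>\<Gamma>' \<Psi>. wff \<Psi> \<Gamma>' \<longrightarrow> prv_st (insert (closure \<Gamma> \<Phi>) H) \<Gamma>' \<Psi> \<longrightarrow>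
        (\<exists>ts. list_all2 closed_tm ts (Ux \<Psi>) \<and> prv_int EHA_or \<Gamma>' (U_at \<Psi> ts)))
      \<longrightarrow> prv_st H \<Gamma> \<Phi>)"
proof (intro conjI impI)
  show "prv_st H \<Gamma> (\<Phi> \<^bold>\<longleftrightarrow> U \<Phi>)"
    unfolding prv_st_def
  proof (rule forces_prv)
    show "wff (\<Phi> \<^bold>\<longleftrightarrow> U \<Phi>) \<Gamma>" using assms wff_U by simp
    fix e assume e: "env e \<Gamma>"
    have U: "fsub (U \<Phi>) e = U_ex \<Phi> e" by (simp add: U_eq fsub_U_ex)
    have "wfm (fsub (U \<Phi>) e)" by (rule wfm_fsub[OF wff_U[OF assms] e])
    then have "{} \<tturnstile> (fsub \<Phi> e \<^bold>\<longrightarrow> U_ex \<Phi> e)" "{} \<tturnstile> (U_ex \<Phi> e \<^bold>\<longrightarrow> fsub \<Phi> e)"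
      using U_equiv[of \<Phi>] assms e
      by (auto intro!: forces_impI wfm_fsub[OF assms e] simp: U U_equiv_def world_def)
    then show "{} \<tturnstile> fsub (\<Phi> \<^bold>\<longleftrightarrow> U \<Phi>) e" by (simp add: U)
  qed
next
  assume b: "\<forall>\<Gamma>' \<Psi>. wff \<Psi> \<Gamma>' \<longrightarrow> prv_st (insert (closure \<Gamma> \<Phi>) H) \<Gamma>' \<Psi> \<longrightarrow>
    (\<exists>ts. list_all2 closed_tm ts (Ux \<Psi>) \<and> prv_int EHA_or \<Gamma>' (U_at \<Psi> ts))"
  \<comment> \<open>Instantiating the closure of \<open>\<Phi>\<close> at the variables themselves
    gives \<open>\<Phi>\<close> back, so the assumption may be used for
    \<open>\<Phi>\<close>.\<close>
  have "prv UNIV (insert (closure \<Gamma> \<Phi>) H) \<Gamma> {} (fsub \<Phi> Var)"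
    by (rule prv_closure[OF prv.ax]) (use assms in auto)
  with b assms obtain ts where ts: "list_all2 closed_tm ts (Ux \<Phi>)" and "prv_int EHA_or \<Gamma> (U_at \<Phi> ts)"
    unfolding prv_st_def by auto
  \<comment> \<open>A derivation in the internal language is also one in the full language, and the
    axioms of \<open>EHA_or\<close> are among those of \<open>H\<close>.\<close>
  then have at: "prv UNIV H \<Gamma> {} (U_at \<Phi> ts)"
    unfolding prv_int_def by (auto elim!: prv_mono simp: H_def EHA_st_or_def)
  have "list_all2 (has_ty \<Gamma>) ts (Ux \<Phi>)" using ts has_ty_closed by (rule list_all2_mono)
  with assms have wf: "wff (U_at \<Phi> ts) \<Gamma>" unfolding U_at_eq wff_foldr by (intro wff_Um_body) auto
  have w: "world {}" by (simp add: world_def)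
  \<comment> \<open>Closed terms are standard, which makes \<open>ts\<close> admissible witnesses
    for the external existential block.\<close>
  have st: "sts {} ts (Ux \<Phi>)" using ts st_closed[OF _ w] by (rule list_all2_mono)
  note len = list_all2_lengthD[OF st]
  show "prv_st H \<Gamma> \<Phi>"
    unfolding prv_st_def
  proof (rule forces_prv[OF assms])
    fix e assume e: "env e \<Gamma>"
    have "map (tsub e) ts = ts" using ts by (induction rule: list_all2_induct) (auto intro: tsub_closed)
    then have Um: "fsub (Um_body \<Phi> Var ts) (push e ys) = Um \<Phi> e ts ys" if "length ys = length (Uy \<Phi>)" for ys
      using that by (simp add: fsub_Um_body[OF len])
    show "{} \<tturnstile> fsub \<Phi> e"
    proof (rule U_equivD(2)[OF U_equiv assms e st], rule forces_U_allI[OF w len])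
      fix w ys assume 1: "{} \<sqsubseteq> w" "sts w ys (Uy \<Phi>)"
      \<comment> \<open>The internal quantifiers range over all objects, in particular over the
        standard \<open>ys\<close>.\<close>
      have "w \<tturnstile> fsub (Um_body \<Phi> Var ts) (push e ys)"
        by (rule forces_AllsE[OF forces_mono[OF prv_forces[OF at wf e, unfolded U_at_eq] 1(1)] sts_typed[OF 1(2)]])
      then show "w \<tturnstile> Um \<Phi> e ts ys" unfolding Um[OF list_all2_lengthD[OF 1(2)]] .
    qed
  qed
qed

end
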